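(* Let $P\in\mathcal W$ and let $\Gamma$ be a $\pi_{\mathsf S}$ context and $l$ a level function such that $\Gamma\vdash_{\mathsf s}P$ and $[\![\Gamma]\!]^l\vdash_{\mathsf w}[\![P]\!]$. Then for every $Q$ with $P\longrightarrow Q$ there exists $R\in\mathcal W$ such that $[\![P]\!]\xrightarrow{\tau}[\![R]\!]$ and $R\equiv Q$.
   Context: Session calculus $\pi_{\mathsf S}$. Names (variables) $x,y,z,\dots$; values are names. Processes: $P,Q ::= \overline x\langle v\rangle.P \mid q\,x(y).P$ with $q\in\{\mathsf{lin},\mathsf{un}\}$ (linear/unrestricted input, $y$ bound) $\mid P\mid Q\mid (\nu xy)P$ (restriction binding co-variables $x,y$) $\mid\mathbf 0$. Structural congruence $\equiv$: $\mid$ commutative, associative, unit $\mathbf 0$; $(\nu xy)\mathbf 0\equiv\mathbf 0$; $(\nu xy)(\nu zw)P\equiv(\nu zw)(\nu xy)P$; $(\nu xy)P\equiv(\nu yx)P$; $((\nu xy)P)\mid Q\equiv(\nu xy)(P\mid Q)$ if $x,y\notin\mathrm{fv}(Q)$. Reduction: $(\nu xy)(\overline x\langle v\rangle.P\mid \mathsf{lin}\,y(z).Q\mid R)\longrightarrow(\nu xy)(P\mid Q\{v/z\}\mid R)$; $(\nu xy)(\overline x\langle v\rangle.P\mid\mathsf{un}\,y(z).Q\mid R)\longrightarrow(\nu xy)(P\mid Q\{v/z\}\mid \mathsf{un}\,y(z).Q\mid R)$; closed under $\mid$, restriction and $\equiv$. Session types: $T,S ::= \mathbf{end}\mid q\,p\mid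 a\mid \mu a.T$, $p::= ?T.S\mid !T.S$ (receive/send); recursive types contractive and equi-recursive; only tail-recursive ones are used: server type $\ast?T:=\mu a.\mathsf{un}\,?T.a$ and client type $\ast!T:=\mu a.\mathsf{un}\,!T.a$ ($a$ not in $T$). Duality: $\overline{\mathbf{end}}=\mathbf{end}$, $\overline{q\,p}=q\,\overline p$, $\overline{!T.S}=?T.\overline S$, $\overline{?T.S}=!T.\overline S$, $\overline{\ast?T}=\ast!T$, $\overline{\ast!T}=\ast?T$. $\mathrm{un}(T)$ iff $T=\mathbf{end}$ or $T=\mathsf{un}\,p$; $\mathrm{lin}(T)$ always; $q(\Gamma)$ iff $q(T)$ for every $x:T\in\Gamma$. Split: $\emptyset=\emptyset\circ\emptyset$; given $\Gamma=\Gamma_1\circ\Gamma_2$: if $\mathrm{un}(T)$, $\Gamma,x:T=(\Gamma_1,x:T)\circ(\Gamma_2,x:T)$; $\Gamma,x:\mathsf{lin}\,p=(\Gamma_1,x:\mathsf{lin}\,p)\circ\Gamma_2=\Gamma_1\circ(\Gamma_2,x:\mathsf{lin}\,p)$. Update: $\Gamma+x:T=\Gamma,x:T$ if $x\notin\mathrm{dom}(\Gamma)$; $(\Gamma,x:T)+x:T=\Gamma,x:T$ if $\mathrm{un}(T)$. Typing rules: Var: $\mathrm{un}(\Gamma)\Rightarrow\Gamma,x:T\vdash_{\mathsf s}x:T$; Nil: $\mathrm{un}(\Gamma)\Rightarrow\Gamma\vdash_{\mathsf s}\mathbf 0$; Par: $\Gamma_1\vdash_{\mathsf s}P,\Gamma_2\vdash_{\mathsf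 s}Q\Rightarrow\Gamma_1\circ\Gamma_2\vdash_{\mathsf s}P\mid Q$; Res: $\Gamma,x:T,y:\overline T\vdash_{\mathsf s}P\Rightarrow\Gamma\vdash_{\mathsf s}(\nu xy)P$; In: $q_1(\Gamma_1\circ\Gamma_2)$, $\Gamma_1\vdash_{\mathsf s}x:q_2\,?T.S$, $(\Gamma_2+x:S),y:T\vdash_{\mathsf s}P\Rightarrow\Gamma_1\circ\Gamma_2\vdash_{\mathsf s}q_1\,x(y).P$; Out: $\Gamma_1\vdash_{\mathsf s}x:q\,!T.S$, $\Gamma_2\vdash_{\mathsf s}v:T$, $\Gamma_3+x:S\vdash_{\mathsf s}P\Rightarrow\Gamma_1\circ\Gamma_2\circ\Gamma_3\vdash_{\mathsf s}\overline x\langle v\rangle.P$. The calculus $\pi_{\mathsf W}$: processes $P ::= \overline{x}\langle y_1,y_2\rangle.P\mid x(y_1,y_2).P\mid\ !x(y_1,y_2).P\mid P\mid Q\mid(\nu x)P\mid\mathbf 0$; standard early LTS with $\tau$-transitions arising from an output (possibly bound, with scope extrusion) synchronizing with a linear input $x(\tilde y).P\xrightarrow{x(\tilde v)}P\{\tilde v/\tilde y\}$ or a replicated input $!x(\tilde y).P\xrightarrow{x(\tilde v)}!x(\tilde y).P\mid P\{\tilde v/\tilde y\}$, closed under parallel composition and restriction. Types: $V::=\mathsf i^n[V_1,V_2]\mid\mathsf o^n[V_1,V_2]\mid\mathsf S^n[V]\mid\mathsf C^n[V]\mid\mathbf{unit}$ (linear input, linear output, server, client, unit; $n\ge1$ a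 weight); duality swaps $\mathsf i/\mathsf o$ and $\mathsf S/\mathsf C$ componentwise, $\overline{\mathbf{unit}}=\mathbf{unit}$. Contexts contain $x:V$ or $x::V$ (the latter meaning $x:(V,\overline V)$). $\mathrm{un}$ holds for $\mathsf S^n,\mathsf C^n,\mathbf{unit}$ and for $x::V$ with $\mathrm{un}(V)$. Split: unrestricted entries are copied to both sides; a linear $x:T$ goes to exactly one side; a linear $x::V$ goes entirely to one side or is split as $x:V$ and $x:\overline V$. Level function $l$: names $\to\mathbb N$, $l(x)$ is the weight of $x$'s type (arbitrary for $\mathbf{unit}$). $\mathrm{os}(P)$: names in output-subject position not under an input or replicated-input prefix... precisely $\mathrm{os}(\overline x\langle\tilde y\rangle.P)=\{x\}\cup\mathrm{os}(P)$, $\mathrm{os}(x(\tilde y).P)=\mathrm{os}(P)$, $\mathrm{os}(P\mid Q)=\mathrm{os}(P)\cup\mathrm{os}(Q)$, $\mathrm{os}((\nu x)P)=\mathrm{os}(P)$, $\mathrm{os}(\mathbf 0)=\mathrm{os}(!x(\tilde y).P)=\emptyset$. Typing rules: Var$_{1,2}$: $\mathrm{un}(\Gamma)\Rightarrow\Gamma,x:V\vdash x:V$ and $\Gamma,x::V\vdash x:V$; Nil: $\mathrm{un}(\Gamma)\Rightarrow\Gamma\vdash\mathbf 0$; Par: $\Gamma_1\vdash P,\Gamma_2\vdash Q\Rightarrow\Gamma_1\circ\Gamma_2\vdash P\mid Q$; Res: $\Gamma,x::V\vdash P\Rightarrow\Gamma\vdash(\nu x)P$; Lin-In$_1$: $\Gamma_1,x:\mathsf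 i^n[V_1,V_2]\vdash x:\mathsf i^n[V_1,V_2]$, $\Gamma_2,y_1:V_1,y_2:V_2\vdash P$, $l(x)=l(y_2)\Rightarrow(\Gamma_1,x:\mathsf i^n[V_1,V_2])\circ\Gamma_2\vdash x(y_1,y_2).P$; Lin-In$_2$: $\Gamma_1,x:\mathsf S^n[V]\vdash x:\mathsf S^n[V]$, $\Gamma_2,x:\mathsf S^n[V],y_1:V,y_2:\mathbf{unit}\vdash P\Rightarrow(\Gamma_1,x:\mathsf S^n[V])\circ(\Gamma_2,x:\mathsf S^n[V])\vdash x(y_1,y_2).P$; Lin-In$_3$: as Lin-In$_2$ with $x::\mathsf S^n[V]$ in a single shared $\Gamma$; Lin-Out: $\Gamma_1,x:\mathsf o^n[V_1,V_2]\vdash x:\mathsf o^n[V_1,V_2]$, $\Gamma_2,y_1:V_1\vdash y_1:V_1$, $\Gamma_3,y_2:V_2\vdash P$, $l(x)=l(y_2)\Rightarrow(\Gamma_1,x:\mathsf o^n[V_1,V_2])\circ(\Gamma_2,y_1:V_1)\circ(\Gamma_3,y_2::V_2)\vdash\overline x\langle y_1,y_2\rangle.P$; Un-Out$_{1,2}$: $\Gamma_1,x\diamond\mathsf C^n[V]\vdash x:\mathsf C^n[V]$, $\Gamma_2,x\diamond\mathsf C^n[V],y_1:V\vdash y_1:V$, $\Gamma_3,x\diamond\mathsf C^n[V],y_2:\mathbf{unit}\vdash P\Rightarrow(\Gamma_1,x\diamond\mathsf C^n[V])\circ(\Gamma_2,x\diamond\mathsf C^n[V],y_1:V)\circ(\Gamma_3,x\diamond\mathsf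 C^n[V])\vdash\overline x\langle y_1,y_2\rangle.P$ with $\diamond\in\{:,::\}$; Un-In$_{1,2}$: $\Gamma,x\diamond\mathsf S^n[V]\vdash x:\mathsf S^n[V]$, $\Gamma,x\diamond\mathsf S^n[V],y_1:V,y_2:\mathbf{unit}\vdash P$, $l(b)<n$ for all $b\in\mathrm{os}(P)\Rightarrow\Gamma,x\diamond\mathsf S^n[V]\vdash\ !x(y_1,y_2).P$. Translation $[\![\cdot]\!]:\pi_{\mathsf S}\to\pi_{\mathsf W}$, relative to the $\pi_{\mathsf S}$ typing (cases by the type of $x$; $z$ fresh): $[\![\mathbf 0]\!]=\mathbf 0$; $[\![P\mid Q]\!]=[\![P]\!]\mid[\![Q]\!]$; $[\![(\nu xy)P]\!]=(\nu z)[\![P\{z/x\}\{z/y\}]\!]$; $[\![\mathsf{lin}\,x(y).P]\!]=x(y,z).[\![P\{z/x\}]\!]$ if $x:\mathsf{lin}\,?T.S$, and $x(y,z).[\![P]\!]$ if $x:\ast?T$; $[\![\mathsf{un}\,x(y).P]\!]=\ !x(y,z).[\![P]\!]$; $[\![\overline x\langle y\rangle.P]\!]=(\nu z)\overline x\langle y,z\rangle.[\![P\{z/x\}]\!]$ if $x:\mathsf{lin}\,!T.S$, and $\overline x\langle y,z\rangle.[\![P]\!]$ if $x:\ast!T$. Types, relative to $l$: $[\![\mathbf{end}]\!]^l_x=\mathbf{unit}$; $[\![\mathsf{lin}\,?T.S]\!]^l_x=\mathsf i^{l(x)}[[\![T]\!]^l_\alpha,[\![S]\!]^l_x]$; $[\![\mathsf{lin}\,!T.S]\!]^l_x=\mathsf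 o^{l(x)}[[\![T]\!]^l_\beta,[\![S]\!]^l_x]$; $[\![\ast?T]\!]^l_x=\mathsf S^{l(x)}[[\![T]\!]^l_\gamma]$; $[\![\ast!T]\!]^l_x=\mathsf C^{l(x)}[[\![T]\!]^l_\gamma]$, with $\alpha,\beta,\gamma$ auxiliary names (the names that occupy the corresponding positions). $[\![x_1:T_1,\dots,x_n:T_n]\!]^l=x_1:[\![T_1]\!]^l_{x_1},\dots,x_n:[\![T_n]\!]^l_{x_n}$. $[\![\Gamma]\!]^l\vdash_{\mathsf w}[\![P]\!]$ means this judgment is derivable in $\pi_{\mathsf W}$ with level function $l$. $\mathcal W:=\{P\in\pi_{\mathsf S}:\exists\Gamma,l.\ \Gamma\vdash_{\mathsf s}P\text{ and }[\![\Gamma]\!]^l\vdash_{\mathsf w}[\![P]\!]\}$.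
   Formalization: x::V is read as two assumptions x:V and x:V̄, so Γ,y:V accepts y::V for unrestricted V and Lin-In3 may split Γ; duality keeps payload types; in [[(νxy)P]] the names x,y are identified after translating. With the literal rules the claim fails. *)

theory Defs
  imports Main
begin

text \<open>
  Both calculi are represented with de Bruijn indices, so that processes are identified up to
  renaming of bound names: a name is a natural number, and an index that points beyond all
  enclosing binders is a free name. Substitutions of names for names are renamings.
\<close>

type_synonym name = nat

definition ext :: "'a \<Rightarrow> (nat \<Rightarrow> 'a) \<Rightarrow> nat \<Rightarrow> 'a" where
  "ext a f = (\<lambda>i. case i of 0 \<Rightarrow> a | Suc j \<Rightarrow> f j)"

definition lift :: "(name \<Rightarrow> name) \<Rightarrow> name \<Rightarrow> name" where
  "lift f = ext 0 (\<lambda>j. Suc (f j))"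


section \<open>The session calculus\<close>

datatype qual = Lin | Unr

text \<open>
  \<open>SIn q x P\<close> binds index 0 in \<open>P\<close>. \<open>SRes P\<close> is $(\nu xy)P$; it binds the co-variables
  $x$ (index 0) and $y$ (index 1).
\<close>

datatype sproc =
    SNil
  | SOut name name sproc
  | SIn qual name sproc
  | SPar sproc sproc
  | SRes sproc

primrec sren :: "(name \<Rightarrow> name) \<Rightarrow> sproc \<Rightarrow> sproc" where
  "sren f SNil = SNil"
| "sren f (SOut x v P) = SOut (f x) (f v) (sren f P)"
| "sren f (SIn q x P) = SIn q (f x) (sren (lift f) P)"
| "sren f (SPar P Q) = SPar (sren f P) (sren f Q)"
| "sren f (SRes P) = SRes (sren (lift (lift f)) P)"

text \<open>$P\{v/z\}$, where $z$ is index 0 of \<open>P\<close> and its binder disappears.\<close>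

definition ssubst :: "name \<Rightarrow> sproc \<Rightarrow> sproc" where
  "ssubst v P = sren (ext v id) P"

definition swap_co :: "name \<Rightarrow> name" where
  "swap_co i = (if i = 0 then 1 else if i = 1 then 0 else i)"

definition swap_res :: "name \<Rightarrow> name" where
  "swap_res i = (if i < 2 then i + 2 else if i < 4 then i - 2 else i)"

inductive scong :: "sproc \<Rightarrow> sproc \<Rightarrow> bool" (infix "\<equiv>\<^sub>s" 50) where
  sc_refl: "P \<equiv>\<^sub>s P"
| sc_sym: "P \<equiv>\<^sub>s Q \<Longrightarrow> Q \<equiv>\<^sub>s P"
| sc_trans: "P \<equiv>\<^sub>s Q \<Longrightarrow> Q \<equiv>\<^sub>s R \<Longrightarrow> P \<equiv>\<^sub>s R"
| sc_out: "P \<equiv>\<^sub>s Q \<Longrightarrow> SOut x v P \<equiv>\<^sub>s SOut x v Q"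
| sc_in: "P \<equiv>\<^sub>s Q \<Longrightarrow> SIn q x P \<equiv>\<^sub>s SIn q x Q"
| sc_par: "P \<equiv>\<^sub>s P' \<Longrightarrow> Q \<equiv>\<^sub>s Q' \<Longrightarrow> SPar P Q \<equiv>\<^sub>s SPar P' Q'"
| sc_res: "P \<equiv>\<^sub>s Q \<Longrightarrow> SRes P \<equiv>\<^sub>s SRes Q"
| sc_par_comm: "SPar P Q \<equiv>\<^sub>s SPar Q P"
| sc_par_assoc: "SPar (SPar P Q) R \<equiv>\<^sub>s SPar P (SPar Q R)"
| sc_par_nil: "SPar P SNil \<equiv>\<^sub>s P"
| sc_res_nil: "SRes SNil \<equiv>\<^sub>s SNil"
| sc_res_res: "SRes (SRes P) \<equiv>\<^sub>s SRes (SRes (sren swap_res P))"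
| sc_res_co: "SRes P \<equiv>\<^sub>s SRes (sren swap_co P)"
| sc_extrude: "SPar (SRes P) Q \<equiv>\<^sub>s SRes (SPar P (sren (\<lambda>i. i + 2) Q))"

inductive sred :: "sproc \<Rightarrow> sproc \<Rightarrow> bool" (infix "\<longrightarrow>\<^sub>s" 50) where
  sr_lin: "SRes (SPar (SOut 0 v P) (SPar (SIn Lin 1 Q) R))
             \<longrightarrow>\<^sub>s SRes (SPar P (SPar (ssubst v Q) R))"
| sr_un: "SRes (SPar (SOut 0 v P) (SPar (SIn Unr 1 Q) R))
             \<longrightarrow>\<^sub>s SRes (SPar P (SPar (ssubst v Q) (SPar (SIn Unr 1 Q) R)))"
| sr_par: "P \<longrightarrow>\<^sub>s P' \<Longrightarrow> SPar P Q \<longrightarrow>\<^sub>s SPar P' Q"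
| sr_res: "P \<longrightarrow>\<^sub>s P' \<Longrightarrow> SRes P \<longrightarrow>\<^sub>s SRes P'"
| sr_cong: "P \<equiv>\<^sub>s P' \<Longrightarrow> P' \<longrightarrow>\<^sub>s Q' \<Longrightarrow> Q' \<equiv>\<^sub>s Q \<Longrightarrow> P \<longrightarrow>\<^sub>s Q"


subsection \<open>Session types\<close>

text \<open>
  The only recursive types in use are $\ast?T = \mu a.\mathsf{un}\,?T.a$ (\<open>TSrv T\<close>) and
  $\ast!T = \mu a.\mathsf{un}\,!T.a$ (\<open>TCli T\<close>), and these are also the only types of the form
  $\mathsf{un}\,p$. Equi-recursion then amounts to the unfolding built into \<open>as_recv\<close> and \<open>as_send\<close>.
\<close>

datatype sty =
    TEnd
  | TLIn sty sty
  | TLOut sty sty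
  | TSrv sty
  | TCli sty

primrec sdual :: "sty \<Rightarrow> sty" where
  "sdual TEnd = TEnd"
| "sdual (TLIn T S) = TLOut T (sdual S)"
| "sdual (TLOut T S) = TLIn T (sdual S)"
| "sdual (TSrv T) = TCli T"
| "sdual (TCli T) = TSrv T"

primrec sun :: "sty \<Rightarrow> bool" where
  "sun TEnd = True"
| "sun (TLIn T S) = False"
| "sun (TLOut T S) = False"
| "sun (TSrv T) = True"
| "sun (TCli T) = True"

text \<open>\<open>as_recv U = Some (T, S)\<close> iff $U = q\,?T.S$ for some $q$, and dually for \<open>as_send\<close>.\<close>

primrec as_recv :: "sty \<Rightarrow> (sty \<times> sty) option" where
  "as_recv TEnd = None"
| "as_recv (TLIn T S) = Some (T, S)"
| "as_recv (TLOut T S) = None"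
| "as_recv (TSrv T) = Some (T, TSrv T)"
| "as_recv (TCli T) = None"

primrec as_send :: "sty \<Rightarrow> (sty \<times> sty) option" where
  "as_send TEnd = None"
| "as_send (TLIn T S) = None"
| "as_send (TLOut T S) = Some (T, S)"
| "as_send (TSrv T) = None"
| "as_send (TCli T) = Some (T, TCli T)"

type_synonym sctx = "name \<Rightarrow> sty option"

definition sun_ctx :: "sctx \<Rightarrow> bool" where
  "sun_ctx \<Gamma> \<longleftrightarrow> (\<forall>x T. \<Gamma> x = Some T \<longrightarrow> sun T)"

definition qual_ctx :: "qual \<Rightarrow> sctx \<Rightarrow> bool" where
  "qual_ctx q \<Gamma> \<longleftrightarrow> (q = Unr \<longrightarrow> sun_ctx \<Gamma>)"

text \<open>\<open>ssplit \<Gamma> \<Gamma>\<^sub>1 \<Gamma>\<^sub>2\<close> is $\Gamma = \Gamma_1 \circ \Gamma_2$.\<close>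

definition ssplit :: "sctx \<Rightarrow> sctx \<Rightarrow> sctx \<Rightarrow> bool" where
  "ssplit \<Gamma> \<Gamma>\<^sub>1 \<Gamma>\<^sub>2 \<longleftrightarrow>
     (\<forall>x. case \<Gamma> x of
            None \<Rightarrow> \<Gamma>\<^sub>1 x = None \<and> \<Gamma>\<^sub>2 x = None
          | Some T \<Rightarrow>
              if sun T then \<Gamma>\<^sub>1 x = Some T \<and> \<Gamma>\<^sub>2 x = Some T
              else (\<Gamma>\<^sub>1 x = Some T \<and> \<Gamma>\<^sub>2 x = None) \<or> (\<Gamma>\<^sub>1 x = None \<and> \<Gamma>\<^sub>2 x = Some T))"

definition ssplit3 :: "sctx \<Rightarrow> sctx \<Rightarrow> sctx \<Rightarrow> sctx \<Rightarrow> bool" where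
  "ssplit3 \<Gamma> \<Gamma>\<^sub>1 \<Gamma>\<^sub>2 \<Gamma>\<^sub>3 \<longleftrightarrow> (\<exists>\<Delta>. ssplit \<Gamma> \<Gamma>\<^sub>1 \<Delta> \<and> ssplit \<Delta> \<Gamma>\<^sub>2 \<Gamma>\<^sub>3)"

text \<open>
  $\Gamma + x:T$ is the partial operation whose domain of definition is \<open>supd_ok\<close>; where it is defined,
  its value is \<open>\<Gamma>(x \<mapsto> T)\<close>.
\<close>

definition supd_ok :: "sctx \<Rightarrow> name \<Rightarrow> sty \<Rightarrow> bool" where
  "supd_ok \<Gamma> x T \<longleftrightarrow> \<Gamma> x = None \<or> (\<Gamma> x = Some T \<and> sun T)"

definition svar :: "sctx \<Rightarrow> name \<Rightarrow> sty \<Rightarrow> bool" where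
  "svar \<Gamma> x T \<longleftrightarrow> \<Gamma> x = Some T \<and> sun_ctx (\<Gamma>(x := None))"

inductive styped :: "sctx \<Rightarrow> sproc \<Rightarrow> bool" (infix "\<turnstile>\<^sub>s" 50) where
  st_nil: "sun_ctx \<Gamma> \<Longrightarrow> \<Gamma> \<turnstile>\<^sub>s SNil"
| st_par: "ssplit \<Gamma> \<Gamma>\<^sub>1 \<Gamma>\<^sub>2 \<Longrightarrow> \<Gamma>\<^sub>1 \<turnstile>\<^sub>s P \<Longrightarrow> \<Gamma>\<^sub>2 \<turnstile>\<^sub>s Q \<Longrightarrow> \<Gamma> \<turnstile>\<^sub>s SPar P Q"
| st_res: "ext (Some T) (ext (Some (sdual T)) \<Gamma>) \<turnstile>\<^sub>s P \<Longrightarrow> \<Gamma> \<turnstile>\<^sub>s SRes P"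
| st_in: "ssplit \<Gamma> \<Gamma>\<^sub>1 \<Gamma>\<^sub>2 \<Longrightarrow> qual_ctx q \<Gamma> \<Longrightarrow> svar \<Gamma>\<^sub>1 x U \<Longrightarrow> as_recv U = Some (T, S)
           \<Longrightarrow> supd_ok \<Gamma>\<^sub>2 x S \<Longrightarrow> ext (Some T) (\<Gamma>\<^sub>2(x \<mapsto> S)) \<turnstile>\<^sub>s P \<Longrightarrow> \<Gamma> \<turnstile>\<^sub>s SIn q x P"
| st_out: "ssplit3 \<Gamma> \<Gamma>\<^sub>1 \<Gamma>\<^sub>2 \<Gamma>\<^sub>3 \<Longrightarrow> svar \<Gamma>\<^sub>1 x U \<Longrightarrow> as_send U = Some (T, S) \<Longrightarrow> svar \<Gamma>\<^sub>2 v T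
           \<Longrightarrow> supd_ok \<Gamma>\<^sub>3 x S \<Longrightarrow> \<Gamma>\<^sub>3(x \<mapsto> S) \<turnstile>\<^sub>s P \<Longrightarrow> \<Gamma> \<turnstile>\<^sub>s SOut x v P"


section \<open>The weighted calculus\<close>

text \<open>
  \<open>WIn x P\<close> is $x(y_1,y_2).P$ and \<open>WRep x P\<close> is $!x(y_1,y_2).P$; both bind $y_1$ (index 0) and $y_2$
  (index 1) in \<open>P\<close>. \<open>WRes P\<close> binds index 0.
\<close>

datatype wproc =
    WNil
  | WOut name name name wproc
  | WIn name wproc
  | WRep name wproc
  | WPar wproc wproc
  | WRes wproc

primrec wren :: "(name \<Rightarrow> name) \<Rightarrow> wproc \<Rightarrow> wproc" where
  "wren f WNil = WNil"
| "wren f (WOut x y z P) = WOut (f x) (f y) (f z) (wren f P)"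
| "wren f (WIn x P) = WIn (f x) (wren (lift (lift f)) P)"
| "wren f (WRep x P) = WRep (f x) (wren (lift (lift f)) P)"
| "wren f (WPar P Q) = WPar (wren f P) (wren f Q)"
| "wren f (WRes P) = WRes (wren (lift f) P)"

primrec wfn :: "wproc \<Rightarrow> name set" where
  "wfn WNil = {}"
| "wfn (WOut x y z P) = {x, y, z} \<union> wfn P"
| "wfn (WIn x P) = {x} \<union> {i. Suc (Suc i) \<in> wfn P}"
| "wfn (WRep x P) = {x} \<union> {i. Suc (Suc i) \<in> wfn P}"
| "wfn (WPar P Q) = wfn P \<union> wfn Q"
| "wfn (WRes P) = {i. Suc i \<in> wfn P}"

definition wsubst :: "name \<Rightarrow> name \<Rightarrow> wproc \<Rightarrow> wproc" where
  "wsubst b c P = wren (ext b (ext c id)) P"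

text \<open>
  In the output action \<open>AOut k x b c\<close>, \<open>k\<close> is the number of extruded names. The objects \<open>b\<close>, \<open>c\<close> and
  the residual process live below the \<open>k\<close> extruded binders, which are the indices \<open>< k\<close> there; the
  subject \<open>x\<close> lives outside of them. The output is free iff \<open>k = 0\<close>.
\<close>

datatype act = ATau | AIn name name name | AOut nat name name name

text \<open>
  \<open>wrot k\<close> moves a restriction that is not extruded inside the \<open>k\<close> extruded binders, and \<open>wdrop k\<close>
  removes it from the scope of an object.
\<close>

definition wrot :: "nat \<Rightarrow> name \<Rightarrow> name" where
  "wrot k i = (if i < k then Suc i else if i = k then 0 else i)"

definition wdrop :: "nat \<Rightarrow> name \<Rightarrow> name" where
  "wdrop k i = (if i < k then i else i - 1)"

inductive wlts :: "wproc \<Rightarrow> act \<Rightarrow> wproc \<Rightarrow> bool" where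
  wl_out: "wlts (WOut x y z P) (AOut 0 x y z) P"
| wl_in: "wlts (WIn x P) (AIn x b c) (wsubst b c P)"
| wl_rep: "wlts (WRep x P) (AIn x b c) (WPar (WRep x P) (wsubst b c P))"
| wl_open: "wlts P (AOut k (Suc x) b c) P' \<Longrightarrow> k \<in> {b, c}
            \<Longrightarrow> wlts (WRes P) (AOut (Suc k) x b c) P'"
| wl_res_out: "wlts P (AOut k (Suc x) b c) P' \<Longrightarrow> k \<notin> {b, c}
            \<Longrightarrow> wlts (WRes P) (AOut k x (wdrop k b) (wdrop k c)) (WRes (wren (wrot k) P'))"
| wl_res_in: "wlts P (AIn (Suc x) (Suc b) (Suc c)) P' \<Longrightarrow> wlts (WRes P) (AIn x b c) (WRes P')"
| wl_res_tau: "wlts P ATau P' \<Longrightarrow> wlts (WRes P) ATau (WRes P')"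
| wl_par_out1: "wlts P (AOut k x b c) P'
            \<Longrightarrow> wlts (WPar P Q) (AOut k x b c) (WPar P' (wren (\<lambda>i. i + k) Q))"
| wl_par_out2: "wlts Q (AOut k x b c) Q'
            \<Longrightarrow> wlts (WPar P Q) (AOut k x b c) (WPar (wren (\<lambda>i. i + k) P) Q')"
| wl_par_in1: "wlts P (AIn x b c) P' \<Longrightarrow> wlts (WPar P Q) (AIn x b c) (WPar P' Q)"
| wl_par_in2: "wlts Q (AIn x b c) Q' \<Longrightarrow> wlts (WPar P Q) (AIn x b c) (WPar P Q')"
| wl_par_tau1: "wlts P ATau P' \<Longrightarrow> wlts (WPar P Q) ATau (WPar P' Q)"
| wl_par_tau2: "wlts Q ATau Q' \<Longrightarrow> wlts (WPar P Q) ATau (WPar P Q')"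
| wl_com1: "wlts P (AOut k x b c) P' \<Longrightarrow> wlts (wren (\<lambda>i. i + k) Q) (AIn (x + k) b c) Q'
            \<Longrightarrow> wlts (WPar P Q) ATau ((WRes ^^ k) (WPar P' Q'))"
| wl_com2: "wlts Q (AOut k x b c) Q' \<Longrightarrow> wlts (wren (\<lambda>i. i + k) P) (AIn (x + k) b c) P'
            \<Longrightarrow> wlts (WPar P Q) ATau ((WRes ^^ k) (WPar P' Q'))"

abbreviation wtau :: "wproc \<Rightarrow> wproc \<Rightarrow> bool" (infix "\<longrightarrow>\<^sub>\<tau>" 50) where
  "P \<longrightarrow>\<^sub>\<tau> Q \<equiv> wlts P ATau Q"


subsection \<open>Weighted types\<close>

datatype wty =
    VUnit
  | VIn nat wty wty
  | VOut nat wty wty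
  | VSrv nat wty
  | VCli nat wty

text \<open>
  Duality exchanges the two capabilities along the protocol of a name. Types of first objects
  (payloads) are unchanged, as sender and receiver agree on them; the second object is the
  continuation of the protocol.
\<close>

primrec wdual :: "wty \<Rightarrow> wty" where
  "wdual VUnit = VUnit"
| "wdual (VIn n V\<^sub>1 V\<^sub>2) = VOut n V\<^sub>1 (wdual V\<^sub>2)"
| "wdual (VOut n V\<^sub>1 V\<^sub>2) = VIn n V\<^sub>1 (wdual V\<^sub>2)"
| "wdual (VSrv n V) = VCli n V"
| "wdual (VCli n V) = VSrv n V"

primrec wun :: "wty \<Rightarrow> bool" where
  "wun VUnit = True"
| "wun (VIn n V\<^sub>1 V\<^sub>2) = False"
| "wun (VOut n V\<^sub>1 V\<^sub>2) = False"
| "wun (VSrv n V) = True"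
| "wun (VCli n V) = True"

text \<open>All weights are at least 1.\<close>

primrec weights_pos :: "wty \<Rightarrow> bool" where
  "weights_pos VUnit = True"
| "weights_pos (VIn n V\<^sub>1 V\<^sub>2) = (n \<ge> 1 \<and> weights_pos V\<^sub>1 \<and> weights_pos V\<^sub>2)"
| "weights_pos (VOut n V\<^sub>1 V\<^sub>2) = (n \<ge> 1 \<and> weights_pos V\<^sub>1 \<and> weights_pos V\<^sub>2)"
| "weights_pos (VSrv n V) = (n \<ge> 1 \<and> weights_pos V)"
| "weights_pos (VCli n V) = (n \<ge> 1 \<and> weights_pos V)"

text \<open>\<open>has_level V n\<close>: a name of type \<open>V\<close> may have level \<open>n\<close>.\<close>

primrec has_level :: "wty \<Rightarrow> nat \<Rightarrow> bool" where
  "has_level VUnit m = True"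
| "has_level (VIn n V\<^sub>1 V\<^sub>2) m = (m = n)"
| "has_level (VOut n V\<^sub>1 V\<^sub>2) m = (m = n)"
| "has_level (VSrv n V) m = (m = n)"
| "has_level (VCli n V) m = (m = n)"

text \<open>
  A context gives each name the set of types assumed for it: \<open>{}\<close> for a name outside the domain,
  \<open>{V}\<close> for $x:V$, and \<open>{V, wdual V}\<close> for $x::V$, that is $x:(V,\overline V)$. Accordingly $x::V$ and
  $x::\overline V$ are the same entry, as is needed for the server and the client of one restricted
  name to be typed together, and the $\Gamma$ of a context $\Gamma,x:V$ may hold the assumption
  $x:\overline V$.
\<close>

type_synonym wctx = "name \<Rightarrow> wty set"

definition wun_ctx :: "wctx \<Rightarrow> bool" where
  "wun_ctx \<Gamma> \<longleftrightarrow> (\<forall>x. \<forall>V\<in>\<Gamma> x. wun V)"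

definition wsplit :: "wctx \<Rightarrow> wctx \<Rightarrow> wctx \<Rightarrow> bool" where
  "wsplit \<Gamma> \<Gamma>\<^sub>1 \<Gamma>\<^sub>2 \<longleftrightarrow>
     (\<forall>x. \<Gamma> x = \<Gamma>\<^sub>1 x \<union> \<Gamma>\<^sub>2 x \<and>
        (\<forall>V\<in>\<Gamma> x. if wun V then V \<in> \<Gamma>\<^sub>1 x \<and> V \<in> \<Gamma>\<^sub>2 x else \<not> (V \<in> \<Gamma>\<^sub>1 x \<and> V \<in> \<Gamma>\<^sub>2 x)))"

definition wsplit3 :: "wctx \<Rightarrow> wctx \<Rightarrow> wctx \<Rightarrow> wctx \<Rightarrow> bool" where
  "wsplit3 \<Gamma> \<Gamma>\<^sub>1 \<Gamma>\<^sub>2 \<Gamma>\<^sub>3 \<longleftrightarrow> (\<exists>\<Delta>. wsplit \<Gamma> \<Gamma>\<^sub>1 \<Delta> \<and> wsplit \<Delta> \<Gamma>\<^sub>2 \<Gamma>\<^sub>3)"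

definition wvar :: "wctx \<Rightarrow> name \<Rightarrow> wty \<Rightarrow> bool" where
  "wvar \<Gamma> x V \<longleftrightarrow> V \<in> \<Gamma> x \<and> wun_ctx (\<Gamma>(x := \<Gamma> x - {V}))"

text \<open>
  \<open>wtyped \<Gamma> P L\<close> is $\Gamma\vdash_{\mathsf w}P$ with $L = l(\mathrm{os}(P))$. The set $\mathrm{os}(P)$ contains bound
  names, whose types (and hence levels) are known only inside the derivation, so the levels of
  $\mathrm{os}(P)$ are collected by the rules, following the recursive definition of $\mathrm{os}$.
  With contexts as above, the variants of a rule for unrestricted $x:V$ and $x::V$ are one rule. If the
  two kinds of entry were unrelated, typing would not be preserved by $\tau$-steps: the continuation
  $y_2:V_2$ of a linear output becomes $y_2::V_2$ after the communication.
\<close>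

inductive wtyped :: "wctx \<Rightarrow> wproc \<Rightarrow> nat set \<Rightarrow> bool" where
  wt_nil: "wun_ctx \<Gamma> \<Longrightarrow> wtyped \<Gamma> WNil {}"
| wt_par: "wsplit \<Gamma> \<Gamma>\<^sub>1 \<Gamma>\<^sub>2 \<Longrightarrow> wtyped \<Gamma>\<^sub>1 P L\<^sub>1 \<Longrightarrow> wtyped \<Gamma>\<^sub>2 Q L\<^sub>2
           \<Longrightarrow> wtyped \<Gamma> (WPar P Q) (L\<^sub>1 \<union> L\<^sub>2)"
| wt_res: "weights_pos V \<Longrightarrow> wtyped (ext {V, wdual V} \<Gamma>) P L \<Longrightarrow> wtyped \<Gamma> (WRes P) L"
| wt_lin_in: "wsplit \<Gamma> \<Gamma>\<^sub>1 \<Gamma>\<^sub>2 \<Longrightarrow> wvar \<Gamma>\<^sub>1 x (VIn n V\<^sub>1 V\<^sub>2)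
           \<Longrightarrow> wtyped (ext {V\<^sub>1} (ext {V\<^sub>2} \<Gamma>\<^sub>2)) P L \<Longrightarrow> has_level V\<^sub>2 n
           \<Longrightarrow> wtyped \<Gamma> (WIn x P) L"
| wt_lin_in_srv: "wsplit \<Gamma> \<Gamma>\<^sub>1 \<Gamma>\<^sub>2 \<Longrightarrow> wvar \<Gamma>\<^sub>1 x (VSrv n V) \<Longrightarrow> VSrv n V \<in> \<Gamma>\<^sub>2 x
           \<Longrightarrow> wtyped (ext {V} (ext {VUnit} \<Gamma>\<^sub>2)) P L
           \<Longrightarrow> wtyped \<Gamma> (WIn x P) L"
| wt_lin_out: "wsplit3 \<Gamma> \<Gamma>\<^sub>1 \<Gamma>\<^sub>2 \<Gamma>\<^sub>3 \<Longrightarrow> wvar \<Gamma>\<^sub>1 x (VOut n V\<^sub>1 V\<^sub>2) \<Longrightarrow> wvar \<Gamma>\<^sub>2 y\<^sub>1 V\<^sub>1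
           \<Longrightarrow> \<Gamma>\<^sub>3 y\<^sub>2 = {V\<^sub>2, wdual V\<^sub>2} \<Longrightarrow> wtyped (\<Gamma>\<^sub>3(y\<^sub>2 := {V\<^sub>2})) P L \<Longrightarrow> has_level V\<^sub>2 n
           \<Longrightarrow> wtyped \<Gamma> (WOut x y\<^sub>1 y\<^sub>2 P) (insert n L)"
| wt_un_out: "wsplit3 \<Gamma> \<Gamma>\<^sub>1 \<Gamma>\<^sub>2 \<Gamma>\<^sub>3 \<Longrightarrow> wvar \<Gamma>\<^sub>1 x (VCli n V) \<Longrightarrow> VCli n V \<in> \<Gamma>\<^sub>2 x
           \<Longrightarrow> wvar \<Gamma>\<^sub>2 y\<^sub>1 V \<Longrightarrow> VCli n V \<in> \<Gamma>\<^sub>3 x \<Longrightarrow> \<Gamma>\<^sub>3 y\<^sub>2 = {}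
           \<Longrightarrow> wtyped (\<Gamma>\<^sub>3(y\<^sub>2 := {VUnit})) P L
           \<Longrightarrow> wtyped \<Gamma> (WOut x y\<^sub>1 y\<^sub>2 P) (insert n L)"
| wt_un_in: "wvar \<Gamma> x (VSrv n V) \<Longrightarrow> wtyped (ext {V} (ext {VUnit} \<Gamma>)) P L \<Longrightarrow> \<forall>m\<in>L. m < n
           \<Longrightarrow> wtyped \<Gamma> (WRep x P) {}"

definition wtyped_proc :: "wctx \<Rightarrow> wproc \<Rightarrow> bool" (infix "\<turnstile>\<^sub>w" 50) where
  "\<Gamma> \<turnstile>\<^sub>w P \<longleftrightarrow> (\<exists>L. wtyped \<Gamma> P L)"


section \<open>The translation\<close>

text \<open>
  The cases of the translation depend on the type of the subject of a prefix, so it is defined along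
  typing derivations: the rules repeat those of \<open>\<turnstile>\<^sub>s\<close>, and \<open>strans X \<Gamma> P W\<close> says that \<open>W\<close> is the
  translation of \<open>P\<close> with respect to some derivation of \<open>\<Gamma> \<turnstile>\<^sub>s P\<close>. It is a relation because a
  restriction may be typed in several ways and because in the last rule $z$ is an arbitrary fresh free
  name. \<open>X\<close> is the set of all names in scope, including those that \<open>\<Gamma>\<close> lacks since they were split
  off to other subprocesses; $z$ has to avoid them.

  Substitutions act on translated processes. In particular $(\nu xy)P$ is translated to
  $(\nu z)([\![P]\!]\{z/x\}\{z/y\})$: the process $P\{z/x\}\{z/y\}$ itself is not typable, since $x$
  and $y$ have dual types, and so has no type-directed translation.
\<close>

inductive strans :: "name set \<Rightarrow> sctx \<Rightarrow> sproc \<Rightarrow> wproc \<Rightarrow> bool" where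
  tr_nil: "sun_ctx \<Gamma> \<Longrightarrow> strans X \<Gamma> SNil WNil"
| tr_par: "ssplit \<Gamma> \<Gamma>\<^sub>1 \<Gamma>\<^sub>2 \<Longrightarrow> strans X \<Gamma>\<^sub>1 P W\<^sub>1 \<Longrightarrow> strans X \<Gamma>\<^sub>2 Q W\<^sub>2
           \<Longrightarrow> strans X \<Gamma> (SPar P Q) (WPar W\<^sub>1 W\<^sub>2)"
| tr_res: "strans ({0, 1} \<union> (\<lambda>i. i + 2) ` X) (ext (Some T) (ext (Some (sdual T)) \<Gamma>)) P W
           \<Longrightarrow> strans X \<Gamma> (SRes P) (WRes (wren (\<lambda>i. if i < 2 then 0 else i - 1) W))"
| tr_in_lin: "ssplit \<Gamma> \<Gamma>\<^sub>1 \<Gamma>\<^sub>2 \<Longrightarrow> svar \<Gamma>\<^sub>1 x (TLIn T S) \<Longrightarrow> supd_ok \<Gamma>\<^sub>2 x S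
           \<Longrightarrow> strans ({0} \<union> Suc ` X) (ext (Some T) (\<Gamma>\<^sub>2(x \<mapsto> S))) P W
           \<Longrightarrow> strans X \<Gamma> (SIn Lin x P)
                 (WIn x (wren (\<lambda>i. if i = 0 then 0 else if i = Suc x then 1 else i + 1) W))"
| tr_in_srv: "ssplit \<Gamma> \<Gamma>\<^sub>1 \<Gamma>\<^sub>2 \<Longrightarrow> svar \<Gamma>\<^sub>1 x (TSrv T) \<Longrightarrow> supd_ok \<Gamma>\<^sub>2 x (TSrv T)
           \<Longrightarrow> strans ({0} \<union> Suc ` X) (ext (Some T) (\<Gamma>\<^sub>2(x \<mapsto> TSrv T))) P W
           \<Longrightarrow> strans X \<Gamma> (SIn Lin x P) (WIn x (wren (\<lambda>i. if i = 0 then 0 else i + 1) W))"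
| tr_in_un: "ssplit \<Gamma> \<Gamma>\<^sub>1 \<Gamma>\<^sub>2 \<Longrightarrow> sun_ctx \<Gamma> \<Longrightarrow> svar \<Gamma>\<^sub>1 x (TSrv T) \<Longrightarrow> supd_ok \<Gamma>\<^sub>2 x (TSrv T)
           \<Longrightarrow> strans ({0} \<union> Suc ` X) (ext (Some T) (\<Gamma>\<^sub>2(x \<mapsto> TSrv T))) P W
           \<Longrightarrow> strans X \<Gamma> (SIn Unr x P) (WRep x (wren (\<lambda>i. if i = 0 then 0 else i + 1) W))"
| tr_out_lin: "ssplit3 \<Gamma> \<Gamma>\<^sub>1 \<Gamma>\<^sub>2 \<Gamma>\<^sub>3 \<Longrightarrow> svar \<Gamma>\<^sub>1 x (TLOut T S) \<Longrightarrow> svar \<Gamma>\<^sub>2 v T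
           \<Longrightarrow> supd_ok \<Gamma>\<^sub>3 x S \<Longrightarrow> strans X (\<Gamma>\<^sub>3(x \<mapsto> S)) P W
           \<Longrightarrow> strans X \<Gamma> (SOut x v P)
                 (WRes (WOut (Suc x) (Suc v) 0 (wren (\<lambda>i. if i = x then 0 else i + 1) W)))"
| tr_out_cli: "ssplit3 \<Gamma> \<Gamma>\<^sub>1 \<Gamma>\<^sub>2 \<Gamma>\<^sub>3 \<Longrightarrow> svar \<Gamma>\<^sub>1 x (TCli T) \<Longrightarrow> svar \<Gamma>\<^sub>2 v T
           \<Longrightarrow> supd_ok \<Gamma>\<^sub>3 x (TCli T) \<Longrightarrow> strans X (\<Gamma>\<^sub>3(x \<mapsto> TCli T)) P W
           \<Longrightarrow> z \<notin> X \<Longrightarrow> z \<notin> wfn W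
           \<Longrightarrow> strans X \<Gamma> (SOut x v P) (WOut x v z W)"

definition translates :: "sctx \<Rightarrow> sproc \<Rightarrow> wproc \<Rightarrow> bool" where
  "translates \<Gamma> P W \<longleftrightarrow> strans (dom \<Gamma>) \<Gamma> P W"

text \<open>
  Level functions are defined on names and on auxiliary names: \<open>Aux a k\<close> is the auxiliary name for
  the payload of the \<open>k\<close>-th action in the type of \<open>a\<close>. It does not depend on the polarity of that
  action, so that dual types have dual translations. In \<open>ty_trans l a k T\<close>, \<open>T\<close> is what remains of the
  type of \<open>a\<close> after \<open>k\<close> actions.
\<close>

datatype lname = Nm name | Aux lname nat

definition level_function :: "(lname \<Rightarrow> nat) \<Rightarrow> bool" where
  "level_function l \<longleftrightarrow> (\<forall>a. l a \<ge> 1)"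

primrec ty_trans :: "(lname \<Rightarrow> nat) \<Rightarrow> lname \<Rightarrow> nat \<Rightarrow> sty \<Rightarrow> wty" where
  "ty_trans l a k TEnd = VUnit"
| "ty_trans l a k (TLIn T S) = VIn (l a) (ty_trans l (Aux a k) 0 T) (ty_trans l a (Suc k) S)"
| "ty_trans l a k (TLOut T S) = VOut (l a) (ty_trans l (Aux a k) 0 T) (ty_trans l a (Suc k) S)"
| "ty_trans l a k (TSrv T) = VSrv (l a) (ty_trans l (Aux a k) 0 T)"
| "ty_trans l a k (TCli T) = VCli (l a) (ty_trans l (Aux a k) 0 T)"

definition ctx_trans :: "(lname \<Rightarrow> nat) \<Rightarrow> sctx \<Rightarrow> wctx" where
  "ctx_trans l \<Gamma> = (\<lambda>x. case \<Gamma> x of None \<Rightarrow> {} | Some T \<Rightarrow> {ty_trans l (Nm x) 0 T})"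

text \<open>
  \<open>in_W_via \<Gamma> l P W\<close>: the context \<open>\<Gamma>\<close> and the level function \<open>l\<close> witness $P\in\mathcal W$, where
  $[\![P]\!]$ is \<open>W\<close>.
\<close>

definition in_W_via :: "sctx \<Rightarrow> (lname \<Rightarrow> nat) \<Rightarrow> sproc \<Rightarrow> wproc \<Rightarrow> bool" where
  "in_W_via \<Gamma> l P W \<longleftrightarrow>
     finite (dom \<Gamma>) \<and> level_function l \<and>
     \<Gamma> \<turnstile>\<^sub>s P \<and> translates \<Gamma> P W \<and> ctx_trans l \<Gamma> \<turnstile>\<^sub>w W"

definition WW :: "sproc set" where
  "WW = {P. \<exists>\<Gamma> l W. in_W_via \<Gamma> l P W}"

end

theory Submission
  imports Defs
begin

text \<open>
  The transitions of a source process are functions of the process that yield residuals in the quotient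
  by structural congruence. Congruent processes then have equal transitions, so a reduction
  $P\longrightarrow Q$ is a communication of two subprocesses below the binder of the co-variables $x$
  and $y$, however far they are apart. A representative $R$ of the class of $Q$ is built in place, such
  that its translation is exactly the derivative of $[\![P]\!]$. After a communication with a server the
  names of the source stay as they are. After a linear communication the translation continues on the
  continuation name that the output extrudes, which is restricted at the communication; accordingly $R$
  continues on a new pair bound there, while the old pair stays bound with type $\mathbf{end}$. That
  $R\equiv Q$ is scope extrusion, exchange of restrictions and removal of the dead pair. Weighted
  typability, in the context of $[\![P]\!]$, is preserved along these transitions: the two copies of a
  server or client type that a restricted name has may be reused, and a linear pair of dual types is
  consumed as a whole and replaced by the dual types of the continuation.
\<close>

text \<open>The rule \<open>sr_cong\<close> rearranges a process freely before it reduces, whereas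
  \<open>wlts\<close> has no structural congruence and starts from one given translation
  \<open>W\<close>. Following the derivation of a reduction would require translations of processes
  other than the one that \<open>W\<close> translates; transitions with residuals in the quotient
  avoid this. The translation is a chain of renamings: binders and linear prefixes rename the
  translation of the body, and a restriction even identifies two names. A claim about
  \<open>W\<close> alone would not survive induction on the source, so transitions and weighted
  types are studied for \<open>wren g W\<close> with an arbitrary renaming \<open>g\<close>. The two
  names of a communication become equal only under the \<open>g\<close> that arises at their binder.
  Client outputs add free fresh names that no source context mentions. Renamings have to keep these
  apart from all other names, which is why scopes \<open>X\<close> are carried along. Weighted types
  are preserved with some set of levels. This suffices because reduction never takes place below a
  replicated input: the level bound on a server body travels unchanged with its prefix.\<close>

lemma ext_if: "ext a f i = (if i = 0 then a else f (i - 1))"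
  by (cases i) (auto simp: ext_def)

lemma lift_if: "lift f i = (if i = 0 then 0 else Suc (f (i - 1)))"
  by (simp add: lift_def ext_if)

lemma lift_simps [simp]: "lift f 0 = 0" "lift f (Suc i) = Suc (f i)"
  by (simp_all add: lift_if)

lemma ext_simps [simp]: "ext a f 0 = a" "ext a f (Suc i) = f i"
  by (simp_all add: ext_if)

lemma lift_comp [simp]: "lift f \<circ> lift g = lift (f \<circ> g)"
  by (auto simp: fun_eq_iff lift_if)

lemma lift_id [simp]: "lift id = id" "lift (\<lambda>i. i) = id"
  by (auto simp: fun_eq_iff lift_if)

section \<open>Renaming of source processes\<close>

lemma sren_sren: "sren f (sren g P) = sren (f \<circ> g) P"
  by (induction P arbitrary: f g) auto

lemma sren_id [simp]: "sren id P = P"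
proof -
  have "lift id = id" by simp
  then show ?thesis by (induction P) (auto simp only: sren.simps id_apply)
qed

text \<open>Renaming below binders fixes the bound indices and commutes with the permutations
  \<open>swap_res\<close> and \<open>swap_co\<close> and with the shift of an extruded process, so
  each axiom is mapped to an instance of itself.\<close>

lemma scong_sren: "P \<equiv>\<^sub>s Q \<Longrightarrow> sren f P \<equiv>\<^sub>s sren f Q"
proof (induction arbitrary: f rule: scong.induct)
  case (sc_res_res P)
  have "lift (lift (lift (lift f))) \<circ> swap_res = swap_res \<circ> lift (lift (lift (lift f)))"
    by (auto simp: fun_eq_iff lift_if swap_res_def numeral_eq_Suc)
  then show ?case
    using scong.sc_res_res[of "sren (lift (lift (lift (lift f)))) P"] by (simp add: sren_sren)
next
  case (sc_res_co P)
  have "lift (lift f) \<circ> swap_co = swap_co \<circ> lift (lift f)"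
    by (auto simp: fun_eq_iff lift_if swap_co_def)
  then show ?case
    using scong.sc_res_co[of "sren (lift (lift f)) P"] by (simp add: sren_sren)
next
  case (sc_extrude P Q)
  have "lift (lift f) \<circ> (\<lambda>i. i + 2) = (\<lambda>i. i + 2) \<circ> f"
    by (auto simp: fun_eq_iff lift_if)
  then show ?case
    using scong.sc_extrude[of "sren (lift (lift f)) P" "sren f Q"] by (simp add: sren_sren)
qed (auto intro: scong.intros)

section \<open>Processes up to structural congruence\<close>

quotient_type sq = sproc / scong
  by (rule equivpI) (auto intro: reflpI sympI transpI scong.intros)

lift_definition qnil :: sq is SNil .
lift_definition qpar :: "sq \<Rightarrow> sq \<Rightarrow> sq" (infixr "\<parallel>" 65) is SPar by (rule sc_par)
lift_definition qres :: "sq \<Rightarrow> sq" is SRes by (rule sc_res)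
lift_definition qren :: "(name \<Rightarrow> name) \<Rightarrow> sq \<Rightarrow> sq" is sren by (rule scong_sren)

lemma abs_sq_simps:
  "abs_sq SNil = qnil" "abs_sq (SPar P Q) = abs_sq P \<parallel> abs_sq Q"
  "abs_sq (SRes P) = qres (abs_sq P)" "abs_sq (sren f P) = qren f (abs_sq P)"
  by (simp_all add: qnil_def qpar.abs_eq qres.abs_eq qren.abs_eq)

lemma qren_SIn: "qren f (abs_sq (SIn q x P)) = abs_sq (SIn q (f x) (sren (lift f) P))"
  by (simp add: qren.abs_eq)

lemma abs_sq_eq_iff: "abs_sq P = abs_sq Q \<longleftrightarrow> P \<equiv>\<^sub>s Q"
  by (rule sq.abs_eq_iff)

text \<open>Makes associative-commutative rewriting available, so that residuals that differ in the
  order of their parallel components can be compared by \<open>simp\<close>.\<close>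

interpretation qpar: comm_monoid qpar qnil
  by unfold_locales (transfer; auto intro: scong.intros)+

lemma qren_qnil [simp]: "qren f qnil = qnil"
  by transfer (auto intro: scong.intros)

lemma qren_qpar [simp]: "qren f (p \<parallel> q) = qren f p \<parallel> qren f q"
  by transfer (auto intro: scong.intros)

lemma qren_qres [simp]: "qren f (qres p) = qres (qren (lift (lift f)) p)"
  by transfer (auto intro: scong.intros)

lemma qren_qren [simp]: "qren f (qren g p) = qren (f \<circ> g) p"
  by transfer (auto simp: sren_sren intro: scong.intros)

lemma qren_id [simp]: "qren id p = p"
  by transfer (auto intro: scong.intros)

lemma qres_qnil [simp]: "qres qnil = qnil"
  by transfer (auto intro: scong.intros)

lemma qres_swap_res: "qres (qres (qren swap_res p)) = qres (qres p)"
  by transfer (auto intro: scong.intros)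

lemma qres_swap_co: "qres (qren swap_co p) = qres p"
  by transfer (auto intro: scong.intros)

abbreviation up2 :: "name \<Rightarrow> name" where "up2 \<equiv> (\<lambda>i. i + 2)"

lemma qres_extrude: "qres p \<parallel> q = qres (p \<parallel> qren up2 q)"
  by transfer (rule sc_extrude)

lemma qres_extrude2: "q \<parallel> qres p = qres (qren up2 q \<parallel> p)"
  using qres_extrude[of p q] by (simp add: qpar.commute)

text \<open>Garbage collection of an absent pair is not an axiom. It is derived by extruding the
  scope of \<open>qres qnil\<close>, which is \<open>qnil\<close>.\<close>

lemma qres_dead: "qres (qren up2 p) = p"
  using qres_extrude[of qnil p] by simp

section \<open>Transitions up to structural congruence\<close>

text \<open>
  Residuals are congruence classes, so structurally congruent processes have equal transitions. Inputs
  are late: the parameter is index 0 of the residual. In a bound output the extruded pair is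
  indices 0 and 1 of the residual, and the name sent is index 0. A communication between an output
  on \<open>x\<close> and an input on \<open>y\<close> is labelled with \<open>x\<close> and \<open>y\<close> until it meets the binder of the two.
\<close>

definition open_in :: "name \<Rightarrow> name" where
  "open_in i = (if i = 0 then 2 else if i < 3 then i - 1 else i)"

primrec outs :: "sproc \<Rightarrow> name \<Rightarrow> name \<Rightarrow> sq \<Rightarrow> bool" where
  "outs SNil = (\<lambda>x v r. False)"
| "outs (SOut y w P) = (\<lambda>x v r. x = y \<and> v = w \<and> r = abs_sq P)"
| "outs (SIn q y P) = (\<lambda>x v r. False)"
| "outs (SPar P Q) = (\<lambda>x v r. (\<exists>p. outs P x v p \<and> r = p \<parallel> abs_sq Q)
     \<or> (\<exists>q. outs Q x v q \<and> r = abs_sq P \<parallel> q))"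
| "outs (SRes P) = (\<lambda>x v r. \<exists>p. outs P (x + 2) (v + 2) p \<and> r = qres p)"

text \<open>A restriction extrudes its pair when index 0 or index 1 is sent; \<open>swap_co\<close>
  puts the name sent at index 0. In the third clause an inner pair is extruded, and
  \<open>swap_res\<close> moves the restriction that stays behind inside the scope of the extruded
  pair.\<close>

primrec bouts :: "sproc \<Rightarrow> name \<Rightarrow> sq \<Rightarrow> bool" where
  "bouts SNil = (\<lambda>x r. False)"
| "bouts (SOut y w P) = (\<lambda>x r. False)"
| "bouts (SIn q y P) = (\<lambda>x r. False)"
| "bouts (SPar P Q) = (\<lambda>x r. (\<exists>p. bouts P x p \<and> r = p \<parallel> qren up2 (abs_sq Q))
     \<or> (\<exists>q. bouts Q x q \<and> r = qren up2 (abs_sq P) \<parallel> q))"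
| "bouts (SRes P) = (\<lambda>x r. outs P (x + 2) 0 r
     \<or> (\<exists>p. outs P (x + 2) 1 p \<and> r = qren swap_co p)
     \<or> (\<exists>p. bouts P (x + 2) p \<and> r = qres (qren swap_res p)))"

text \<open>A replicated prefix stays in the residual, shifted below the parameter. In the
  restriction clause \<open>open_in\<close> rotates the first three indices: the parameter leaves
  the front and the restricted pair takes its place, because the restriction now binds inside the
  parameter.\<close>

primrec ins :: "sproc \<Rightarrow> name \<Rightarrow> sq \<Rightarrow> bool" where
  "ins SNil = (\<lambda>y r. False)"
| "ins (SOut x w P) = (\<lambda>y r. False)"
| "ins (SIn q x P) = (\<lambda>y r. y = x \<and>
     r = (if q = Lin then abs_sq P else abs_sq (sren Suc (SIn Unr x P)) \<parallel> abs_sq P))"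
| "ins (SPar P Q) = (\<lambda>y r. (\<exists>p. ins P y p \<and> r = p \<parallel> qren Suc (abs_sq Q))
     \<or> (\<exists>q. ins Q y q \<and> r = qren Suc (abs_sq P) \<parallel> q))"
| "ins (SRes P) = (\<lambda>y r. \<exists>p. ins P (y + 2) p \<and> r = qres (qren open_in p))"

text \<open>Late inputs make the two clauses uniform: the parameter is replaced by the value sent,
  or by index 0 of an extruded pair whose restriction is then closed around both residuals.\<close>

definition meet :: "sproc \<Rightarrow> sproc \<Rightarrow> name \<Rightarrow> name \<Rightarrow> sq \<Rightarrow> bool" where
  "meet P Q = (\<lambda>x y r. \<exists>q. ins Q y q \<and>
     ((\<exists>v p. outs P x v p \<and> r = p \<parallel> qren (ext v id) q)
    \<or> (\<exists>p. bouts P x p \<and> r = qres (p \<parallel> qren (ext 0 up2) q))))"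

primrec coms :: "sproc \<Rightarrow> name \<Rightarrow> name \<Rightarrow> sq \<Rightarrow> bool" where
  "coms SNil = (\<lambda>x y r. False)"
| "coms (SOut z w P) = (\<lambda>x y r. False)"
| "coms (SIn q z P) = (\<lambda>x y r. False)"
| "coms (SPar P Q) = (\<lambda>x y r. (\<exists>p. coms P x y p \<and> r = p \<parallel> abs_sq Q)
     \<or> (\<exists>q. coms Q x y q \<and> r = abs_sq P \<parallel> q) \<or> meet P Q x y r \<or> meet Q P x y r)"
| "coms (SRes P) = (\<lambda>x y r. \<exists>p. coms P (x + 2) (y + 2) p \<and> r = qres p)"

text \<open>Parallel composition yields no silent step of its own: co-variables are different names,
  and only their common restriction tells that an output on one matches an input on the
  other.\<close>

primrec taus :: "sproc \<Rightarrow> sq \<Rightarrow> bool" where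
  "taus SNil = (\<lambda>r. False)"
| "taus (SOut x v P) = (\<lambda>r. False)"
| "taus (SIn q x P) = (\<lambda>r. False)"
| "taus (SPar P Q) = (\<lambda>r. (\<exists>p. taus P p \<and> r = p \<parallel> abs_sq Q)
     \<or> (\<exists>q. taus Q q \<and> r = abs_sq P \<parallel> q))"
| "taus (SRes P) = (\<lambda>r. \<exists>p. (taus P p \<or> coms P 0 1 p \<or> coms P 1 0 p) \<and> r = qres p)"

text \<open>Under \<open>lift (lift f)\<close> each of the bound indices 0 and 1 is the image of
  itself only, even if \<open>f\<close> is not injective. Hence renaming neither creates nor
  destroys a communication over a bound pair, and the transitions of a renamed process are exactly
  the renamed transitions.\<close>

lemma lift2_eq:
  "lift (lift f) a = Suc (Suc y) \<longleftrightarrow> (\<exists>b. a = Suc (Suc b) \<and> y = f b)"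
  "Suc (Suc y) = lift (lift f) a \<longleftrightarrow> (\<exists>b. a = Suc (Suc b) \<and> y = f b)"
  "lift (lift f) a = 0 \<longleftrightarrow> a = 0" "lift (lift f) a = Suc 0 \<longleftrightarrow> a = Suc 0"
  "0 = lift (lift f) a \<longleftrightarrow> a = 0" "Suc 0 = lift (lift f) a \<longleftrightarrow> a = Suc 0"
  by (cases a; cases "a - 1"; auto)+

text \<open>Normal form of transition predicates: a disjunction of clauses with the existential
  quantifiers in front. The default \<open>ex_simps\<close> would push the quantifiers inward again
  and is therefore removed wherever this is used.\<close>

lemmas norm_ex = fun_eq_iff abs_sq_simps lift2_eq ex_disj_distrib conj_disj_distribL conj_disj_distribR
  ex_simps(1,2)[symmetric]

lemma outs_sren:
  "outs (sren f P) = (\<lambda>x v r. \<exists>y w p. outs P y w p \<and> x = f y \<and> v = f w \<and> r = qren f p)"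
proof (induction P arbitrary: f)
  case (SRes P)
  then show ?case by (simp add: norm_ex del: ex_simps) blast
qed (simp_all add: norm_ex del: ex_simps)

text \<open>The index maps of the transition predicates are natural in the renaming: they permute or
  instantiate bound indices, while \<open>f\<close> acts on free names.\<close>

lemma lift_comps:
  "lift f \<circ> Suc = Suc \<circ> f"
  "lift (lift f) \<circ> up2 = up2 \<circ> f"
  "lift (lift f) \<circ> swap_co = swap_co \<circ> lift (lift f)"
  "lift (lift (lift (lift f))) \<circ> swap_res = swap_res \<circ> lift (lift (lift (lift f)))"
  "lift (lift (lift f)) \<circ> open_in = open_in \<circ> lift (lift (lift f))"
  "f \<circ> ext v id = ext (f v) id \<circ> lift f"
  "lift (lift f) \<circ> ext 0 up2 = ext 0 up2 \<circ> lift f"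
  by (auto simp: fun_eq_iff lift_if ext_if swap_res_def swap_co_def open_in_def numeral_eq_Suc)

lemma bouts_sren:
  "bouts (sren f P) = (\<lambda>x r. \<exists>y p. bouts P y p \<and> x = f y \<and> r = qren (lift (lift f)) p)"
proof (induction P arbitrary: f)
  case (SPar P Q)
  then show ?case
    by (simp add: norm_ex lift_comps[simplified] del: ex_simps)
next
  case (SRes P)
  then show ?case
    by (simp add: norm_ex lift_comps[simplified] outs_sren del: ex_simps) blast
qed (simp_all add: norm_ex del: ex_simps)

lemma ins_sren:
  "ins (sren f P) = (\<lambda>x r. \<exists>y p. ins P y p \<and> x = f y \<and> r = qren (lift f) p)"
proof (induction P arbitrary: f)
  case (SIn q x P)
  then show ?case
    by (simp add: norm_ex qren_SIn sren_sren lift_comps[simplified] del: ex_simps)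
next
  case (SPar P Q)
  then show ?case
    by (simp add: norm_ex lift_comps[simplified] del: ex_simps)
next
  case (SRes P)
  then show ?case
    by (simp add: norm_ex lift_comps[simplified] del: ex_simps) blast
qed (simp_all add: norm_ex del: ex_simps)

lemma meet_sren:
  "meet (sren f P) (sren f Q) = (\<lambda>x y r. \<exists>a b p. meet P Q a b p \<and> x = f a \<and> y = f b \<and> r = qren f p)"
  by (simp add: meet_def outs_sren bouts_sren ins_sren norm_ex lift_comps[simplified] del: ex_simps) blast

lemma coms_sren:
  "coms (sren f P) = (\<lambda>x y r. \<exists>a b p. coms P a b p \<and> x = f a \<and> y = f b \<and> r = qren f p)"
proof (induction P arbitrary: f)
  case (SRes P)
  then show ?case by (simp add: norm_ex del: ex_simps) blast
qed (simp_all add: meet_sren norm_ex del: ex_simps)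

lemma taus_sren: "taus (sren f P) = (\<lambda>r. \<exists>p. taus P p \<and> r = qren f p)"
  by (induction P arbitrary: f) (simp_all add: coms_sren norm_ex del: ex_simps)

lemma swap_co_eq: "swap_co i = j \<longleftrightarrow> i = swap_co j" "j = swap_co i \<longleftrightarrow> i = swap_co j"
  by (auto simp: swap_co_def split: if_splits)

lemma swap_res_eq: "swap_res i = j \<longleftrightarrow> i = swap_res j" "j = swap_res i \<longleftrightarrow> i = swap_res j"
  by (auto simp: swap_res_def split: if_splits)

lemma swap_vals [simp]:
  "swap_co 0 = Suc 0" "swap_co (Suc 0) = 0" "swap_co (Suc (Suc i)) = Suc (Suc i)"
  "swap_res 0 = Suc (Suc 0)" "swap_res (Suc 0) = Suc (Suc (Suc 0))" "swap_res (Suc (Suc 0)) = 0"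
  "swap_res (Suc (Suc (Suc 0))) = Suc 0" "swap_res (Suc (Suc (Suc (Suc i)))) = Suc (Suc (Suc (Suc i)))"
  by (simp_all add: swap_co_def swap_res_def)

lemma swap_comps:
  "swap_co \<circ> swap_co = id"
  "swap_res \<circ> lift (lift swap_co) = swap_co \<circ> swap_res"
  "open_in \<circ> lift swap_co = swap_co \<circ> open_in"
  by (auto simp: fun_eq_iff lift_if swap_res_def swap_co_def open_in_def)

lemma more_comps:
  "ext v id \<circ> Suc = id"
  "ext v up2 \<circ> Suc = up2"
  "ext (Suc (Suc v)) id \<circ> lift up2 = up2 \<circ> ext v id"
  "ext 0 id \<circ> lift up2 = ext 0 up2"
  "ext (Suc 0) id \<circ> lift up2 = swap_co \<circ> ext 0 up2"
  "ext 0 up2 \<circ> lift up2 = swap_res \<circ> (up2 \<circ> ext 0 up2)"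
  "open_in \<circ> Suc = lift (lift Suc)"
  "open_in \<circ> lift up2 = up2"
  "open_in \<circ> (Suc \<circ> up2) = up2 \<circ> Suc"
  "swap_co \<circ> up2 = up2"
  "swap_res \<circ> lift (lift up2) = up2"
  "swap_res \<circ> up2 = lift (lift up2)"
  "swap_res \<circ> (up2 \<circ> up2) = up2 \<circ> up2"
  "swap_res \<circ> (swap_co \<circ> swap_res) = lift (lift swap_co)"
  "swap_res \<circ> swap_res = id"
  "lift (lift swap_co) \<circ> swap_res = swap_res \<circ> swap_co"
  "(lift (lift open_in) \<circ> open_in) \<circ> lift swap_res = swap_res \<circ> (lift (lift open_in) \<circ> open_in)"
  "lift (lift open_in) \<circ> (open_in \<circ> lift swap_res) = swap_res \<circ> (lift (lift open_in) \<circ> open_in)"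
  by (auto simp: fun_eq_iff lift_if ext_if swap_res_def swap_co_def open_in_def numeral_eq_Suc)

text \<open>The braid relation for exchanges of adjacent pairs. Three pairs are in scope when a pair
  is extruded through two restrictions that are themselves exchanged, and the two orders of the
  exchanges have to agree.\<close>

lemma swap_res_braid:
  "lift (lift swap_res) \<circ> (swap_res \<circ> lift (lift swap_res)) = swap_res \<circ> (lift (lift swap_res) \<circ> swap_res)"
proof (rule ext)
  fix i :: nat
  have "i = 0 \<or> i = Suc 0 \<or> i = Suc (Suc 0) \<or> i = Suc (Suc (Suc 0)) \<or> i = Suc (Suc (Suc (Suc 0)))
      \<or> i = Suc (Suc (Suc (Suc (Suc 0)))) \<or> (\<exists>j. i = Suc (Suc (Suc (Suc (Suc (Suc j))))))"
    by (metis nat.exhaust)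
  then show "(lift (lift swap_res) \<circ> (swap_res \<circ> lift (lift swap_res))) i
      = (swap_res \<circ> (lift (lift swap_res) \<circ> swap_res)) i"
    by (elim disjE exE) simp_all
qed

lemma qres_swap_co_comp: "qres (qren (swap_co \<circ> f) p) = qres (qren f p)"
  using qres_swap_co[of "qren f p"] by simp

lemma qres_swap_res_comp: "qres (qres (qren (swap_res \<circ> f) p)) = qres (qres (qren f p))"
  using qres_swap_res[of "qren f p"] by simp

text \<open>The exchange is an involution that the restriction absorbs, so it can be moved from one
  parallel component to the other.\<close>

lemma qres_swap_co_move:
  "qres (qren swap_co p \<parallel> q) = qres (p \<parallel> qren swap_co q)"
  "qres (qren (swap_co \<circ> f) p \<parallel> q) = qres (qren f p \<parallel> qren swap_co q)"
  using qres_swap_co[of "qren swap_co p \<parallel> q"] qres_swap_co[of "qren (swap_co \<circ> f) p \<parallel> q"]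
  by (simp_all add: swap_comps flip: o_assoc) (simp_all add: swap_comps o_assoc)

lemma qres_swap_res_move:
  "qres (qres (qren swap_res p \<parallel> q)) = qres (qres (p \<parallel> qren swap_res q))"
  "qres (qres (qren (swap_res \<circ> f) p \<parallel> q)) = qres (qres (qren f p \<parallel> qren swap_res q))"
  using qres_swap_res[of "qren swap_res p \<parallel> q"] qres_swap_res[of "qren (swap_res \<circ> f) p \<parallel> q"]
  by (simp_all add: more_comps flip: o_assoc) (simp_all add: more_comps o_assoc)

text \<open>An opaque copy of equality, which keeps classical reasoners from substituting.\<close>

definition sq_eq :: "sq \<Rightarrow> sq \<Rightarrow> bool" where
  sq_eq: "sq_eq p q \<longleftrightarrow> p = q"

text \<open>Equality of the classes belongs to the invariant because the residual of a parallel
  composition contains the class of the idle component.\<close>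

definition same_trans :: "sproc \<Rightarrow> sproc \<Rightarrow> bool" where
  "same_trans P Q \<longleftrightarrow> abs_sq P = abs_sq Q \<and> outs P = outs Q \<and> bouts P = bouts Q \<and> ins P = ins Q
     \<and> coms P = coms Q \<and> taus P = taus Q"

lemma ex_nat_split2: "(\<exists>v. P v) \<longleftrightarrow> P 0 \<or> P (Suc 0) \<or> (\<exists>v. P (Suc (Suc v)))"
  by (metis not0_implies_Suc)

lemma extrude_comps:
   "(\<lambda>i. Suc (Suc i)) \<circ> ext v id = ext (Suc (Suc v)) id \<circ> lift up2"
  "ext 0 id \<circ> lift up2 = ext 0 up2"
   "lift (lift (ext v id)) \<circ> open_in = ext (Suc (Suc v)) id"
   "lift (lift (ext 0 up2)) \<circ> open_in = swap_res \<circ> ext 0 up2"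
   "swap_res \<circ> (up2 \<circ> ext 0 up2) = ext 0 up2 \<circ> lift up2"
   "swap_res \<circ> (ext 0 up2 \<circ> lift up2) = up2 \<circ> ext 0 up2"
   "swap_res \<circ> (swap_res \<circ> f) = f"
   "ext (Suc 0) id \<circ> lift up2 = swap_co \<circ> ext 0 up2"
   "lift (lift up2) = swap_res \<circ> up2"
  by (auto simp: fun_eq_iff lift_if ext_if open_in_def swap_res_def swap_co_def)

text \<open>The restriction is on the side of the output. A bound output of \<open>SRes P\<close>
  is, inside the restriction, a free output of index 0 or 1, and the enclosing \<open>qres\<close>
  does the closing.\<close>

lemma meet_extrude1:
  "(\<exists>p. meet P (sren (\<lambda>i. i + 2) Q) (x + 2) (y + 2) p \<and> r = qres p) \<longleftrightarrow> meet (SRes P) Q x y r"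
proof -
  have "meet P (sren (\<lambda>i. i + 2) Q) (x + 2) (y + 2) p \<longleftrightarrow>
     (\<exists>q. ins Q y q \<and> ((\<exists>t. outs P (x+2) 0 t \<and> p = t \<parallel> qren (ext 0 up2) q)
      \<or> (\<exists>t. outs P (x+2) 1 t \<and> p = t \<parallel> qren (swap_co \<circ> ext 0 up2) q)
      \<or> (\<exists>v t. outs P (x+2) (v+2) t \<and> p = t \<parallel> qren (ext (Suc (Suc v)) id \<circ> lift up2) q)
      \<or> (\<exists>t. bouts P (x+2) t \<and> p = qres (t \<parallel> qren (ext 0 up2 \<circ> lift up2) q))))" for p
    unfolding meet_def
    \<comment> \<open>The value sent by \<open>P\<close> is index 0, index 1 or a name outside of
      the pair. The first two are the bound outputs of \<open>SRes P\<close> that open this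
      restriction, the last is a free output.\<close>
    apply (subst ex_nat_split2) apply (simp add: ins_sren norm_ex extrude_comps[simplified] del: ex_simps)
   apply (simp only: sq_eq[symmetric], rule iffI; elim disjE exE conjE; meson)
   done
  then show ?thesis
    by (simp add: meet_def norm_ex qres_extrude qres_swap_co_move qres_swap_res_move extrude_comps[simplified] del: ex_simps)
   (simp only: sq_eq[symmetric], rule iffI; elim disjE exE conjE; meson)
qed

text \<open>Here the restriction encloses the receiver. A pair extruded by \<open>Q\<close> has to
  pass it, so the two restrictions occur in different orders and \<open>swap_res\<close> exchanges
  them.\<close>

lemma meet_extrude2:
  "(\<exists>p. meet (sren (\<lambda>i. i + 2) Q) P (x + 2) (y + 2) p \<and> r = qres p) \<longleftrightarrow> meet Q (SRes P) x y r"
    apply (simp add: meet_def norm_ex qres_extrude2 outs_sren bouts_sren qren_qren qres_swap_res_move extrude_comps[simplified] del: ex_simps)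
   apply (simp only: sq_eq[symmetric], rule iffI; elim disjE exE conjE; meson)
   done

text \<open>A process shifted past the pair cannot use index 0 or 1 as a subject, so scope extrusion
  creates no new silent step.\<close>

lemma meet_shift_False:
  "\<not> meet P (sren up2 Q) x 0 p" "\<not> meet P (sren up2 Q) x (Suc 0) p"
  "\<not> meet (sren up2 Q) P 0 y p" "\<not> meet (sren up2 Q) P (Suc 0) y p"
  by (auto simp: meet_def outs_sren bouts_sren ins_sren)

text \<open>If a pair is extruded between two of the three components, one grouping closes its
  restriction before the third component is added and the other one after. Scope extrusion
  identifies the two residuals.\<close>

lemma same_trans_assoc: "same_trans (SPar (SPar P Q) R) (SPar P (SPar Q R))"
  unfolding same_trans_def apply (intro conjI)
  apply (simp_all add: norm_ex meet_def qpar.assoc qpar.left_commute qpar.commute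
     qres_extrude qres_extrude2 more_comps[simplified] del: ex_simps)
  apply (simp only: sq_eq[symmetric], intro allI, rule iffI; elim disjE exE conjE; meson)
  done

lemma same_trans_res_res: "same_trans (SRes (SRes P)) (SRes (SRes (sren swap_res P)))"
  unfolding same_trans_def apply (intro conjI)
  apply (simp_all add: norm_ex qres_swap_res outs_sren ins_sren bouts_sren coms_sren taus_sren
    swap_res_eq more_comps swap_res_braid qres_swap_res_comp del: ex_simps)
  apply (simp only: sq_eq[symmetric], intro allI, rule iffI; elim disjE exE conjE; meson)
  apply (simp only: sq_eq[symmetric], intro allI, rule iffI; elim disjE exE conjE; meson)
  done

lemma same_trans_res_co: "same_trans (SRes P) (SRes (sren swap_co P))"
  unfolding same_trans_def apply (intro conjI)
  apply (simp_all add: norm_ex qres_swap_co outs_sren ins_sren bouts_sren coms_sren taus_sren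
     swap_co_eq swap_comps qres_swap_co_comp del: ex_simps)
  apply (simp only: sq_eq[symmetric], intro allI, rule iffI; elim disjE exE conjE; meson)
  apply (simp only: sq_eq[symmetric], intro allI, rule iffI; elim disjE exE conjE; meson)
  done

lemma same_trans_extrude: "same_trans (SPar (SRes P) Q) (SRes (SPar P (sren (\<lambda>i. i + 2) Q)))"
  unfolding same_trans_def apply (intro conjI)
  apply (simp_all add: meet_extrude1[simplified] meet_extrude2[simplified] norm_ex outs_sren
    ins_sren bouts_sren coms_sren taus_sren qres_extrude qres_extrude2 more_comps[simplified]
    meet_shift_False[simplified] del: ex_simps)
  apply (simp only: sq_eq[symmetric], intro allI, rule iffI; elim disjE exE conjE; meson)
  done

lemma scong_same_trans: "P \<equiv>\<^sub>s Q \<Longrightarrow> same_trans P Q"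
proof (induction rule: scong.induct)
  case (sc_trans P Q R)
  then show ?case by (simp add: same_trans_def)
next
  case (sc_out P Q x v)
  then have "P \<equiv>\<^sub>s Q" by (simp add: abs_sq_eq_iff)
  then have "abs_sq P = abs_sq Q" "abs_sq (SOut x v P) = abs_sq (SOut x v Q)"
    by (simp_all add: abs_sq_eq_iff scong.sc_out)
  then show ?case by (simp add: same_trans_def)
next
  case (sc_in P Q q x)
  then have "P \<equiv>\<^sub>s Q" by (simp add: abs_sq_eq_iff)
  \<comment> \<open>The residual of a replicated input contains the prefix itself, so the prefixed
    processes must be known to be congruent for \<open>Unr\<close> too.\<close>
  then have "SIn q x P \<equiv>\<^sub>s SIn q x Q" for q x by (rule scong.sc_in)
  then have "abs_sq (SIn q x P) = abs_sq (SIn q x Q)" for q x by (simp add: abs_sq_eq_iff)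
  with sc_in show ?case by (simp add: same_trans_def abs_sq_simps del: sren.simps)
next
  case (sc_par P P' Q Q')
  then show ?case by (simp add: same_trans_def abs_sq_simps meet_def)
next
  case (sc_res P Q)
  then show ?case by (simp add: same_trans_def abs_sq_simps)
next
  case (sc_par_comm P Q)
  then show ?case
    by (auto simp: same_trans_def norm_ex qpar.commute simp del: ex_simps)
next
  case (sc_par_nil P)
  then show ?case
    by (simp add: same_trans_def norm_ex meet_def del: ex_simps)
next
  case sc_res_nil
  then show ?case
    by (simp add: same_trans_def norm_ex meet_def del: ex_simps)
next
  case (sc_par_assoc P Q R)
  show ?case by (rule same_trans_assoc)
next
  case (sc_res_res P)
  show ?case by (rule same_trans_res_res)
next
  case (sc_res_co P)
  show ?case by (rule same_trans_res_co)
next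
  case (sc_extrude P Q)
  show ?case by (rule same_trans_extrude)
qed (simp_all add: same_trans_def)

text \<open>Each redex is a communication that meets its binder, and the congruence rule is absorbed
  because congruent processes have equal transitions.\<close>

lemma sred_taus: "P \<longrightarrow>\<^sub>s Q \<Longrightarrow> taus P (abs_sq Q)"
proof (induction rule: sred.induct)
  case (sr_lin v P Q R)
  show ?case
    by (auto simp: meet_def abs_sq_simps ssubst_def more_comps)
next
  case (sr_un v P Q R)
  \<comment> \<open>The residual of the input before its parameter is instantiated. Instantiation
    with \<open>v\<close> cancels the shift of the kept prefix and of \<open>R\<close>.\<close>
  let ?q = "(abs_sq (sren Suc (SIn Unr 1 Q)) \<parallel> abs_sq Q) \<parallel> qren Suc (abs_sq R)"
  have "ins (SPar (SIn Unr 1 Q) R) 1 ?q"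
    by auto
  then have "meet (SOut 0 v P) (SPar (SIn Unr 1 Q) R) 0 1 (abs_sq P \<parallel> qren (ext v id) ?q)"
    by (auto simp: meet_def simp del: ins.simps)
  then have "taus (SRes (SPar (SOut 0 v P) (SPar (SIn Unr 1 Q) R)))
      (qres (abs_sq P \<parallel> qren (ext v id) ?q))"
    by (auto simp del: ins.simps)
  moreover have "abs_sq (SRes (SPar P (SPar (ssubst v Q) (SPar (SIn Unr 1 Q) R))))
      = qres (abs_sq P \<parallel> qren (ext v id) ?q)"
    by (simp add: abs_sq_simps ssubst_def more_comps qpar.assoc qpar.left_commute del: sren.simps)
  ultimately show ?case
    by simp
next
  case (sr_cong P P' Q' Q)
  then show ?case
    using scong_same_trans[of P P'] abs_sq_eq_iff[of Q' Q] by (simp add: same_trans_def)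
qed (auto simp: abs_sq_simps)

section \<open>Renaming and free names of weighted processes\<close>

lemma wren_wren: "wren f (wren g W) = wren (f \<circ> g) W"
  by (induction W arbitrary: f g) auto

lemma wren_id [simp]: "wren id W = W"
proof -
  have "lift id = id" by simp
  then show ?thesis by (induction W) (auto simp only: wren.simps id_apply)
qed

lemma wfn_wren: "wfn (wren f W) = f ` wfn W"
proof (induction W arbitrary: f)
  case (WIn x W)
  then show ?case by (force simp: image_iff lift2_eq)
next
  case (WRep x W)
  then show ?case by (force simp: image_iff lift2_eq)
next
  case (WRes W)
  have "Suc i = lift f j \<longleftrightarrow> (\<exists>k. j = Suc k \<and> i = f k)" for i j
    by (cases j) auto
  then show ?case by (auto simp: WRes image_iff)
qed (simp_all add: image_Un)

section \<open>Translations, with contexts split on demand\<close>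

definition up :: "name set \<Rightarrow> name set" where
  "up X = insert 0 (Suc ` X)"

lemma up_iff [simp]: "0 \<in> up X" "Suc i \<in> up X \<longleftrightarrow> i \<in> X"
  by (auto simp: up_def)

lemma up_alt: "{0} \<union> Suc ` X = up X" "{0, 1} \<union> (\<lambda>i. i + 2) ` X = up (up X)"
  by (auto simp: up_def)

text \<open>\<open>srem T x \<Gamma>\<close> is what remains of \<open>\<Gamma>\<close> when a use of \<open>x : T\<close> is split off.\<close>

definition srem :: "sty \<Rightarrow> name \<Rightarrow> sctx \<Rightarrow> sctx" where
  "srem T x \<Gamma> = (if sun T then \<Gamma> else \<Gamma>(x := None))"

text \<open>Looking up a variable forces every other entry of \<open>\<Gamma>\<^sub>1\<close> to be
  unrestricted, so all other linear entries go to \<open>\<Gamma>\<^sub>2\<close>. The split at a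
  prefix is thus determined by the name that is used.\<close>

lemma ssplit_svarD:
  assumes "ssplit \<Gamma> \<Gamma>\<^sub>1 \<Gamma>\<^sub>2" "svar \<Gamma>\<^sub>1 x T"
  shows "\<Gamma> x = Some T" "\<Gamma>\<^sub>2 = srem T x \<Gamma>"
proof -
  have 1: "\<Gamma>\<^sub>1 x = Some T" and 2: "\<Gamma>\<^sub>1 y = Some S \<Longrightarrow> y \<noteq> x \<Longrightarrow> sun S" for y S
    using assms(2) unfolding svar_def sun_ctx_def by (metis fun_upd_apply)+
  have s: "case \<Gamma> y of None \<Rightarrow> \<Gamma>\<^sub>1 y = None \<and> \<Gamma>\<^sub>2 y = None
      | Some T \<Rightarrow> if sun T then \<Gamma>\<^sub>1 y = Some T \<and> \<Gamma>\<^sub>2 y = Some T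
                else (\<Gamma>\<^sub>1 y = Some T \<and> \<Gamma>\<^sub>2 y = None) \<or> (\<Gamma>\<^sub>1 y = None \<and> \<Gamma>\<^sub>2 y = Some T)" for y
    using assms(1) by (simp add: ssplit_def)
  show x: "\<Gamma> x = Some T"
    using s[of x] 1 by (auto split: option.splits if_splits)
  have "\<Gamma>\<^sub>2 y = srem T x \<Gamma> y" for y
    using s[of y] 1 2[of y] x by (cases "y = x") (auto simp: srem_def split: option.splits if_splits)
  then show "\<Gamma>\<^sub>2 = srem T x \<Gamma>" by blast
qed

lemma ssplit_svarI:
  assumes "\<Gamma> x = Some T"
  shows "\<exists>\<Gamma>\<^sub>1. ssplit \<Gamma> \<Gamma>\<^sub>1 (srem T x \<Gamma>) \<and> svar \<Gamma>\<^sub>1 x T"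
proof -
  let ?\<Gamma> = "\<lambda>y. if y = x then Some T else case \<Gamma> y of None \<Rightarrow> None | Some S \<Rightarrow> if sun S then Some S else None"
  have "ssplit \<Gamma> ?\<Gamma> (srem T x \<Gamma>)" "svar ?\<Gamma> x T"
    using assms by (auto simp: ssplit_def svar_def sun_ctx_def srem_def split: option.splits if_splits)
  then show ?thesis by blast
qed

text \<open>This and the next two maps are the substitutions of the translation on indices.
  \<open>res_map\<close> merges the co-variables into one restricted name; \<open>in_map\<close> and
  \<open>out_map\<close> put the continuation name, bound by the input or restricted at the output,
  in the place of the subject.\<close>

definition res_map :: "name \<Rightarrow> name" where
  "res_map i = (if i < 2 then 0 else i - 1)"

definition in_map :: "name \<Rightarrow> name \<Rightarrow> name" where
  "in_map x i = (if i = 0 then 0 else if i = Suc x then 1 else i + 1)"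

definition out_map :: "name \<Rightarrow> name \<Rightarrow> name" where
  "out_map x i = (if i = x then 0 else i + 1)"

lemma map_folds:
  "(\<lambda>i. if i < 2 then 0 else i - 1) = res_map"
  "(\<lambda>i. if i = 0 then 0 else if i = Suc x then 1 else i + 1) = in_map x"
  "(\<lambda>i. if i = x then 0 else i + 1) = out_map x"
  by (auto simp: res_map_def in_map_def out_map_def fun_eq_iff)

lemma lift_Suc_fold: "(\<lambda>i. if i = 0 then 0 else i + 1) = lift Suc"
  by (auto simp: lift_if fun_eq_iff)

text \<open>The relation \<open>strans\<close> with the splits at prefixes computed by
  \<open>srem\<close>; only \<open>par\<close> still chooses a split. In \<open>out_lin\<close> the
  linear subject is split off before the payload is looked up, which is the origin of
  \<open>v \<noteq> x\<close>.\<close>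

inductive tr :: "name set \<Rightarrow> sctx \<Rightarrow> sproc \<Rightarrow> wproc \<Rightarrow> bool" where
  nil: "sun_ctx \<Gamma> \<Longrightarrow> tr X \<Gamma> SNil WNil"
| par: "ssplit \<Gamma> \<Gamma>\<^sub>1 \<Gamma>\<^sub>2 \<Longrightarrow> tr X \<Gamma>\<^sub>1 P W\<^sub>1 \<Longrightarrow> tr X \<Gamma>\<^sub>2 Q W\<^sub>2 \<Longrightarrow> tr X \<Gamma> (SPar P Q) (WPar W\<^sub>1 W\<^sub>2)"
| res: "tr (up (up X)) (ext (Some T) (ext (Some (sdual T)) \<Gamma>)) P W
    \<Longrightarrow> tr X \<Gamma> (SRes P) (WRes (wren res_map W))"
| in_lin: "\<Gamma> x = Some (TLIn T S) \<Longrightarrow> tr (up X) (ext (Some T) (\<Gamma>(x \<mapsto> S))) P W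
    \<Longrightarrow> tr X \<Gamma> (SIn Lin x P) (WIn x (wren (in_map x) W))"
| in_srv: "\<Gamma> x = Some (TSrv T) \<Longrightarrow> tr (up X) (ext (Some T) \<Gamma>) P W
    \<Longrightarrow> tr X \<Gamma> (SIn Lin x P) (WIn x (wren (lift Suc) W))"
| in_un: "sun_ctx \<Gamma> \<Longrightarrow> \<Gamma> x = Some (TSrv T) \<Longrightarrow> tr (up X) (ext (Some T) \<Gamma>) P W
    \<Longrightarrow> tr X \<Gamma> (SIn Unr x P) (WRep x (wren (lift Suc) W))"
| out_lin: "\<Gamma> x = Some (TLOut T S) \<Longrightarrow> \<Gamma> v = Some T \<Longrightarrow> v \<noteq> x
    \<Longrightarrow> tr X ((srem T v \<Gamma>)(x \<mapsto> S)) P W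
    \<Longrightarrow> tr X \<Gamma> (SOut x v P) (WRes (WOut (Suc x) (Suc v) 0 (wren (out_map x) W)))"
| out_cli: "\<Gamma> x = Some (TCli T) \<Longrightarrow> \<Gamma> v = Some T \<Longrightarrow> tr X (srem T v \<Gamma>) P W
    \<Longrightarrow> z \<notin> X \<Longrightarrow> z \<notin> wfn W \<Longrightarrow> tr X \<Gamma> (SOut x v P) (WOut x v z W)"

text \<open>A type is not a proper part of itself. In a client output the payload therefore differs
  from the subject, although the subject stays in the context.\<close>

lemma srv_neq [simp]: "T \<noteq> TSrv T" "T \<noteq> TCli T"
proof -
  have "size (TSrv T) = Suc (size T)" "size (TCli T) = Suc (size T)" by simp_all
  then show "T \<noteq> TSrv T" "T \<noteq> TCli T" by (metis n_not_Suc_n)+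
qed

lemma upd_srem:
  "\<not> sun U \<Longrightarrow> (srem U x \<Gamma>)(x \<mapsto> S) = \<Gamma>(x \<mapsto> S)"
  "sun U \<Longrightarrow> srem U x \<Gamma> = \<Gamma>"
  by (simp_all add: srem_def)

lemma strans_imp_tr: "strans X \<Gamma> P W \<Longrightarrow> tr X \<Gamma> P W"
proof (induction rule: strans.induct)
  case (tr_nil \<Gamma> X) then show ?case by (rule tr.nil)
next
  case (tr_par \<Gamma> \<Gamma>\<^sub>1 \<Gamma>\<^sub>2 X P W\<^sub>1 Q W\<^sub>2) then show ?case by (intro tr.par)
next
  case (tr_res X T \<Gamma> P W)
  then show ?case unfolding map_folds up_alt by (intro tr.res)
next
  case (tr_in_lin \<Gamma> \<Gamma>\<^sub>1 \<Gamma>\<^sub>2 x T S X P W)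
  show ?case unfolding map_folds
    using ssplit_svarD[OF tr_in_lin(1,2)] tr_in_lin(5) by (intro tr.in_lin) (simp_all add: up_def upd_srem)
next
  case (tr_in_srv \<Gamma> \<Gamma>\<^sub>1 \<Gamma>\<^sub>2 x T X P W)
  show ?case unfolding lift_Suc_fold
    using ssplit_svarD[OF tr_in_srv(1,2)] tr_in_srv(5)
    by (intro tr.in_srv) (simp_all add: up_def upd_srem map_upd_triv)
next
  case (tr_in_un \<Gamma> \<Gamma>\<^sub>1 \<Gamma>\<^sub>2 x T X P W)
  show ?case unfolding lift_Suc_fold
    using ssplit_svarD[OF tr_in_un(1,3)] tr_in_un(2,6)
    by (intro tr.in_un) (simp_all add: up_def upd_srem map_upd_triv)
next
  case (tr_out_lin \<Gamma> \<Gamma>\<^sub>1 \<Gamma>\<^sub>2 \<Gamma>\<^sub>3 x T S v X P W)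
  then obtain \<Delta> where d: "ssplit \<Gamma> \<Gamma>\<^sub>1 \<Delta>" "ssplit \<Delta> \<Gamma>\<^sub>2 \<Gamma>\<^sub>3" by (auto simp: ssplit3_def)
  note 1 = ssplit_svarD[OF d(1) tr_out_lin(2)] and 2 = ssplit_svarD[OF d(2) tr_out_lin(3)]
  have "v \<noteq> x" using 1 2 by (auto simp: srem_def)
  moreover have "\<Gamma>\<^sub>3(x \<mapsto> S) = (srem T v \<Gamma>)(x \<mapsto> S)"
    using 1 2 by (auto simp: srem_def fun_eq_iff)
  moreover have "\<Gamma> v = Some T" using 1 2 by (auto simp: srem_def split: if_splits)
  ultimately show ?case unfolding map_folds
    using 1 tr_out_lin by (intro tr.out_lin) (simp_all del: fun_upd_apply)
next
  case (tr_out_cli \<Gamma> \<Gamma>\<^sub>1 \<Gamma>\<^sub>2 \<Gamma>\<^sub>3 x T v X P W z)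
  then obtain \<Delta> where d: "ssplit \<Gamma> \<Gamma>\<^sub>1 \<Delta>" "ssplit \<Delta> \<Gamma>\<^sub>2 \<Gamma>\<^sub>3" by (auto simp: ssplit3_def)
  note 1 = ssplit_svarD[OF d(1) tr_out_cli(2)] and 2 = ssplit_svarD[OF d(2) tr_out_cli(3)]
  have "v \<noteq> x" using 1 2 srv_neq(2)[of T] by (auto simp: srem_def)
  then have "\<Gamma>\<^sub>3(x \<mapsto> TCli T) = srem T v \<Gamma>"
    using 1 2 by (auto simp: srem_def fun_eq_iff)
  then show ?case
    using 1 2 tr_out_cli by (intro tr.out_cli) (auto simp: srem_def)
qed

lemma tr_imp_strans: "tr X \<Gamma> P W \<Longrightarrow> strans X \<Gamma> P W"
proof (induction rule: tr.induct)
  case (nil \<Gamma> X) then show ?case by (rule strans.intros)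
next
  case (par \<Gamma> \<Gamma>\<^sub>1 \<Gamma>\<^sub>2 X P W\<^sub>1 Q W\<^sub>2) then show ?case by (intro strans.intros)
next
  case (res X T \<Gamma> P W)
  then show ?case using strans.tr_res[of X T \<Gamma> P W] by (simp only: up_alt map_folds)
next
  case (in_lin \<Gamma> x T S X P W)
  obtain \<Gamma>\<^sub>1 where 1: "ssplit \<Gamma> \<Gamma>\<^sub>1 (srem (TLIn T S) x \<Gamma>)" "svar \<Gamma>\<^sub>1 x (TLIn T S)"
    using ssplit_svarI[of \<Gamma> x, OF in_lin(1)] by blast
  then show ?case unfolding map_folds[symmetric]
    using in_lin by (intro tr_in_lin[OF 1]) (simp_all add: up_def upd_srem, simp_all add: srem_def supd_ok_def)
next
  case (in_srv \<Gamma> x T X P W)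
  obtain \<Gamma>\<^sub>1 where 1: "ssplit \<Gamma> \<Gamma>\<^sub>1 (srem (TSrv T) x \<Gamma>)" "svar \<Gamma>\<^sub>1 x (TSrv T)"
    using ssplit_svarI[of \<Gamma> x, OF in_srv(1)] by blast
  then show ?case unfolding lift_Suc_fold[symmetric]
    using in_srv by (intro tr_in_srv[OF 1]) (simp_all add: up_def upd_srem supd_ok_def map_upd_triv)
next
  case (in_un \<Gamma> x T X P W)
  obtain \<Gamma>\<^sub>1 where 1: "ssplit \<Gamma> \<Gamma>\<^sub>1 (srem (TSrv T) x \<Gamma>)" "svar \<Gamma>\<^sub>1 x (TSrv T)"
    using ssplit_svarI[of \<Gamma> x, OF in_un(2)] by blast
  then show ?case unfolding lift_Suc_fold[symmetric]
    using in_un by (intro tr_in_un[OF 1(1) _ 1(2)]) (simp_all add: up_def upd_srem supd_ok_def map_upd_triv)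
next
  case (out_lin \<Gamma> x T S v X P W)
  let ?\<Delta> = "srem (TLOut T S) x \<Gamma>"
  obtain \<Gamma>\<^sub>1 where 1: "ssplit \<Gamma> \<Gamma>\<^sub>1 ?\<Delta>" "svar \<Gamma>\<^sub>1 x (TLOut T S)"
    using ssplit_svarI[of \<Gamma> x, OF out_lin(1)] by blast
  have "?\<Delta> v = Some T" using out_lin by (simp add: srem_def)
  from ssplit_svarI[of ?\<Delta>, OF this]
  obtain \<Gamma>\<^sub>2 where 2: "ssplit ?\<Delta> \<Gamma>\<^sub>2 (srem T v ?\<Delta>)" "svar \<Gamma>\<^sub>2 v T" by blast
  have 3: "ssplit3 \<Gamma> \<Gamma>\<^sub>1 \<Gamma>\<^sub>2 (srem T v ?\<Delta>)" using 1 2 by (auto simp: ssplit3_def)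
  have ok: "supd_ok (srem T v ?\<Delta>) x S" by (simp add: srem_def supd_ok_def)
  have "(srem T v ?\<Delta>)(x \<mapsto> S) = (srem T v \<Gamma>)(x \<mapsto> S)"
    by (auto simp: srem_def fun_eq_iff)
  then have "strans X ((srem T v ?\<Delta>)(x \<mapsto> S)) P W" using out_lin.IH by (simp only:)
  then show ?case unfolding map_folds[symmetric]
    by (rule tr_out_lin[OF 3 1(2) 2(2) ok])
next
  case (out_cli \<Gamma> x T v X P W z)
  let ?\<Delta> = "srem (TCli T) x \<Gamma>"
  obtain \<Gamma>\<^sub>1 where 1: "ssplit \<Gamma> \<Gamma>\<^sub>1 ?\<Delta>" "svar \<Gamma>\<^sub>1 x (TCli T)"
    using ssplit_svarI[of \<Gamma> x, OF out_cli(1)] by blast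
  have "?\<Delta> v = Some T" using out_cli by (simp add: srem_def)
  from ssplit_svarI[of ?\<Delta>, OF this]
  obtain \<Gamma>\<^sub>2 where 2: "ssplit ?\<Delta> \<Gamma>\<^sub>2 (srem T v ?\<Delta>)" "svar \<Gamma>\<^sub>2 v T" by blast
  have 3: "ssplit3 \<Gamma> \<Gamma>\<^sub>1 \<Gamma>\<^sub>2 (srem T v ?\<Delta>)" using 1 2 by (auto simp: ssplit3_def)
  have "v \<noteq> x" using out_cli srv_neq(2)[of T] by auto
  then have "(srem T v ?\<Delta>)(x \<mapsto> TCli T) = srem T v \<Gamma>" "srem T v \<Gamma> x = Some (TCli T)"
    using out_cli by (auto simp: srem_def fun_eq_iff)
  then have "strans X ((srem T v ?\<Delta>)(x \<mapsto> TCli T)) P W" "supd_ok (srem T v ?\<Delta>) x (TCli T)"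
    using out_cli.IH by (simp_all only: upd_srem(2) sun.simps supd_ok_def simp_thms option.inject)
  then show ?case
    using out_cli.hyps by (intro tr_out_cli[OF 3 1(2) 2(2)])
qed

lemma strans_styped: "strans X \<Gamma> P W \<Longrightarrow> \<Gamma> \<turnstile>\<^sub>s P"
  by (induction rule: strans.induct) (auto intro: styped.intros simp: qual_ctx_def simp del: fun_upd_apply)

lemma ext_dom: "dom (ext (Some T) \<Gamma>) = up (dom \<Gamma>)"
proof -
  have "i \<in> dom (ext (Some T) \<Gamma>) \<longleftrightarrow> i \<in> up (dom \<Gamma>)" for i
    by (cases i) (auto simp: domIff)
  then show ?thesis by blast
qed

text \<open>The free names of a translation are in the domain of the context or are continuations of
  client outputs, which lie outside of \<open>X\<close>. Names of the scope that were split off to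
  other components do not occur, so a renaming may be changed there.\<close>

lemma tr_wren_cong:
  "tr X \<Gamma> P W \<Longrightarrow> (\<And>i. i \<in> dom \<Gamma> \<or> i \<notin> X \<Longrightarrow> f i = g i) \<Longrightarrow> wren f W = wren g W"
proof (induction arbitrary: f g rule: tr.induct)
  case (par \<Gamma> \<Gamma>\<^sub>1 \<Gamma>\<^sub>2 X P W\<^sub>1 Q W\<^sub>2)
  have "dom \<Gamma>\<^sub>1 \<subseteq> dom \<Gamma>" "dom \<Gamma>\<^sub>2 \<subseteq> dom \<Gamma>"
    using par(1) by (force simp: ssplit_def split: option.splits)+
  with par show ?case by (metis subsetD wren.simps(5))
next
  case (res X T \<Gamma> P W)
  have "wren (lift f \<circ> res_map) W = wren (lift g \<circ> res_map) W"
  proof (rule res.IH)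
    fix i assume "i \<in> dom (ext (Some T) (ext (Some (sdual T)) \<Gamma>)) \<or> i \<notin> up (up X)"
    then show "(lift f \<circ> res_map) i = (lift g \<circ> res_map) i"
      using res.prems[of "i - 2"] unfolding ext_dom
      by (cases i; cases "i - 1") (auto simp: res_map_def)
  qed
  then show ?case by (simp add: wren_wren)
next
  case (in_lin \<Gamma> x T S X P W)
  have "wren (lift (lift f) \<circ> in_map x) W = wren (lift (lift g) \<circ> in_map x) W"
  proof (rule in_lin.IH)
    fix i assume "i \<in> dom (ext (Some T) (\<Gamma>(x \<mapsto> S))) \<or> i \<notin> up X"
    then show "(lift (lift f) \<circ> in_map x) i = (lift (lift g) \<circ> in_map x) i"
      using in_lin.prems[of "i - 1"] unfolding ext_dom
      by (cases i) (auto simp: in_map_def)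
  qed
  then show ?case using in_lin.prems[of x] in_lin.hyps by (simp add: wren_wren domIff)
next
  case (in_srv \<Gamma> x T X P W)
  have "wren (lift (lift f) \<circ> lift Suc) W = wren (lift (lift g) \<circ> lift Suc) W"
  proof (rule in_srv.IH)
    fix i assume "i \<in> dom (ext (Some T) \<Gamma>) \<or> i \<notin> up X"
    then show "(lift (lift f) \<circ> lift Suc) i = (lift (lift g) \<circ> lift Suc) i"
      using in_srv.prems[of "i - 1"] unfolding ext_dom by (cases i) auto
  qed
  then show ?case using in_srv.prems[of x] in_srv.hyps by (simp add: wren_wren domIff)
next
  case (in_un \<Gamma> x T X P W)
  have "wren (lift (lift f) \<circ> lift Suc) W = wren (lift (lift g) \<circ> lift Suc) W"
  proof (rule in_un.IH)
    fix i assume "i \<in> dom (ext (Some T) \<Gamma>) \<or> i \<notin> up X"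
    then show "(lift (lift f) \<circ> lift Suc) i = (lift (lift g) \<circ> lift Suc) i"
      using in_un.prems[of "i - 1"] unfolding ext_dom by (cases i) auto
  qed
  then show ?case using in_un.prems[of x] in_un.hyps by (simp add: wren_wren domIff)
next
  case (out_lin \<Gamma> x T S v X P W)
  have "wren (lift f \<circ> out_map x) W = wren (lift g \<circ> out_map x) W"
  proof (rule out_lin.IH)
    fix i assume "i \<in> dom ((srem T v \<Gamma>)(x \<mapsto> S)) \<or> i \<notin> X"
    then show "(lift f \<circ> out_map x) i = (lift g \<circ> out_map x) i"
      using out_lin.prems[of i] by (auto simp: out_map_def srem_def domIff split: if_splits)
  qed
  then show ?case using out_lin.prems[of x] out_lin.prems[of v] out_lin.hyps by (simp add: wren_wren domIff)
next
  case (out_cli \<Gamma> x T v X P W z)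
  have "wren f W = wren g W"
    by (rule out_cli.IH) (use out_cli.prems in \<open>auto simp: srem_def domIff split: if_splits\<close>)
  then show ?case using out_cli.prems[of x] out_cli.prems[of v] out_cli.prems[of z] out_cli.hyps by (simp add: domIff)
qed simp

text \<open>The source has no continuation names, so agreement on the domain of the context is
  enough here.\<close>

lemma tr_sren_cong:
  "tr X \<Gamma> P W \<Longrightarrow> (\<And>i. i \<in> dom \<Gamma> \<Longrightarrow> f i = g i) \<Longrightarrow> sren f P = sren g P"
proof (induction arbitrary: f g rule: tr.induct)
  case (par \<Gamma> \<Gamma>\<^sub>1 \<Gamma>\<^sub>2 X P W\<^sub>1 Q W\<^sub>2)
  have "dom \<Gamma>\<^sub>1 \<subseteq> dom \<Gamma>" "dom \<Gamma>\<^sub>2 \<subseteq> dom \<Gamma>"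
    using par(1) by (force simp: ssplit_def split: option.splits)+
  with par show ?case by (metis subsetD sren.simps(4))
next
  case (res X T \<Gamma> P W)
  have "sren (lift (lift f)) P = sren (lift (lift g)) P"
  proof (rule res.IH)
    fix i assume "i \<in> dom (ext (Some T) (ext (Some (sdual T)) \<Gamma>))"
    then show "lift (lift f) i = lift (lift g) i"
      using res.prems[of "i - 2"] unfolding ext_dom by (cases i; cases "i - 1") auto
  qed
  then show ?case by simp
next
  case (in_lin \<Gamma> x T S X P W)
  have "sren (lift f) P = sren (lift g) P"
  proof (rule in_lin.IH)
    fix i assume "i \<in> dom (ext (Some T) (\<Gamma>(x \<mapsto> S)))"
    then show "lift f i = lift g i"
      using in_lin.prems[of "i - 1"] in_lin.hyps unfolding ext_dom by (cases i) auto
  qed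
  then show ?case using in_lin.prems[of x] in_lin.hyps by (simp add: domIff)
next
  case (in_srv \<Gamma> x T X P W)
  have "sren (lift f) P = sren (lift g) P"
  proof (rule in_srv.IH)
    fix i assume "i \<in> dom (ext (Some T) \<Gamma>)"
    then show "lift f i = lift g i"
      using in_srv.prems[of "i - 1"] unfolding ext_dom by (cases i) auto
  qed
  then show ?case using in_srv.prems[of x] in_srv.hyps by (simp add: domIff)
next
  case (in_un \<Gamma> x T X P W)
  have "sren (lift f) P = sren (lift g) P"
  proof (rule in_un.IH)
    fix i assume "i \<in> dom (ext (Some T) \<Gamma>)"
    then show "lift f i = lift g i"
      using in_un.prems[of "i - 1"] unfolding ext_dom by (cases i) auto
  qed
  then show ?case using in_un.prems[of x] in_un.hyps by (simp add: domIff)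
next
  case (out_lin \<Gamma> x T S v X P W)
  have "sren f P = sren g P"
    by (rule out_lin.IH) (use out_lin(1) out_lin.prems in \<open>auto simp: srem_def domIff split: if_splits\<close>)
  then show ?case using out_lin.prems[of x] out_lin.prems[of v] out_lin.hyps by (simp add: domIff)
next
  case (out_cli \<Gamma> x T v X P W z)
  have "sren f P = sren g P"
    by (rule out_cli.IH) (use out_cli.prems in \<open>auto simp: srem_def domIff split: if_splits\<close>)
  then show ?case using out_cli.prems[of x] out_cli.prems[of v] out_cli.hyps by (simp add: domIff)
qed simp

section \<open>Renaming of translations\<close>

text \<open>
  The names outside of the scope \<open>X\<close> are the fresh continuations of client outputs. A renaming may
  identify names in scope, but it keeps these apart from all other names.
\<close>

definition keeps_fresh :: "(name \<Rightarrow> name) \<Rightarrow> name set \<Rightarrow> name set \<Rightarrow> bool" where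
  "keeps_fresh f X Y \<longleftrightarrow> (\<forall>z. z \<notin> X \<longrightarrow> f z \<notin> Y \<and> (\<forall>a. f a = f z \<longrightarrow> a = z))"

lemma keeps_fresh_id: "keeps_fresh id X X"
  by (auto simp: keeps_fresh_def)

lemma keeps_fresh_comp: "keeps_fresh g Y Z \<Longrightarrow> keeps_fresh f X Y \<Longrightarrow> keeps_fresh (g \<circ> f) X Z"
  by (auto simp: keeps_fresh_def)

lemma keeps_fresh_lift: "keeps_fresh f X Y \<Longrightarrow> keeps_fresh (lift f) (up X) (up Y)"
  by (auto simp: keeps_fresh_def all_conj_distrib lift_if up_def split: if_splits)
     (metis Suc_pred diff_Suc_1 image_eqI not_gr_zero)+

lemma keeps_fresh_up:
  "keeps_fresh Suc X (up X)" "keeps_fresh (lift Suc) (up X) (up (up X))"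
  "keeps_fresh res_map (up (up X)) (up X)"
  "x \<in> X \<Longrightarrow> keeps_fresh (in_map x) (up X) (up (up X))"
  "x \<in> X \<Longrightarrow> keeps_fresh (out_map x) X (up X)"
  by (auto simp: keeps_fresh_def up_def lift_if res_map_def in_map_def out_map_def image_iff split: if_splits)

text \<open>Linear entries correspond one to one. Unrestricted names may be identified by
  \<open>f\<close>, and \<open>\<Gamma>'\<close> may have further ones. Weakening is the case
  \<open>f = id\<close>; passing an unrestricted value to a parameter identifies two names.\<close>

definition srel :: "(name \<Rightarrow> name) \<Rightarrow> sctx \<Rightarrow> sctx \<Rightarrow> bool" where
  "srel f \<Gamma> \<Gamma>' \<longleftrightarrow> (\<forall>a T. \<Gamma> a = Some T \<longrightarrow> \<Gamma>' (f a) = Some T)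
     \<and> (\<forall>b T. \<Gamma>' b = Some T \<longrightarrow> \<not> sun T \<longrightarrow> (\<exists>!a. f a = b \<and> a \<in> dom \<Gamma>))"

lemma srelD:
  assumes "srel f \<Gamma> \<Gamma>'"
  shows "\<Gamma> a = Some T \<Longrightarrow> \<Gamma>' (f a) = Some T"
    "\<Gamma> a = Some T \<Longrightarrow> \<not> sun T \<Longrightarrow> f c = f a \<Longrightarrow> c \<in> dom \<Gamma> \<Longrightarrow> c = a"
    "\<Gamma>' b = Some T \<Longrightarrow> \<not> sun T \<Longrightarrow> \<exists>a. f a = b \<and> \<Gamma> a = Some T"
proof -
  show 1: "\<Gamma> a = Some T \<Longrightarrow> \<Gamma>' (f a) = Some T" for a T
    using assms by (simp add: srel_def)
  show "c = a" if "\<Gamma> a = Some T" "\<not> sun T" "f c = f a" "c \<in> dom \<Gamma>"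
  proof -
    have "\<exists>!a'. f a' = f a \<and> a' \<in> dom \<Gamma>"
      using assms that 1 unfolding srel_def by blast
    with that show ?thesis by (metis domI)
  qed
  show "\<exists>a. f a = b \<and> \<Gamma> a = Some T" if b: "\<Gamma>' b = Some T" "\<not> sun T"
  proof -
    obtain a where "f a = b" "a \<in> dom \<Gamma>"
      using assms b unfolding srel_def by blast
    with 1 b show ?thesis by (metis domD option.inject)
  qed
qed

lemma srelI:
  assumes "\<And>a T. \<Gamma> a = Some T \<Longrightarrow> \<Gamma>' (f a) = Some T"
    and "\<And>a c T. \<Gamma> a = Some T \<Longrightarrow> \<not> sun T \<Longrightarrow> f c = f a \<Longrightarrow> c \<in> dom \<Gamma> \<Longrightarrow> c = a"
    and "\<And>b T. \<Gamma>' b = Some T \<Longrightarrow> \<not> sun T \<Longrightarrow> \<exists>a. f a = b \<and> \<Gamma> a = Some T"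
  shows "srel f \<Gamma> \<Gamma>'"
  unfolding srel_def
proof (intro conjI allI impI)
  fix b T assume b: "\<Gamma>' b = Some T" "\<not> sun T"
  then obtain a where a: "f a = b" "\<Gamma> a = Some T" using assms(3) by blast
  then show "\<exists>!a. f a = b \<and> a \<in> dom \<Gamma>"
    using assms(2)[of a T] b by (intro ex1I[of _ a]) auto
qed (rule assms(1))

lemma srel_lift: "srel f \<Gamma> \<Gamma>' \<Longrightarrow> srel (lift f) (ext (Some T) \<Gamma>) (ext (Some T) \<Gamma>')"
proof (rule srelI)
  assume r: "srel f \<Gamma> \<Gamma>'"
  show "ext (Some T) \<Gamma>' (lift f a) = Some U" if "ext (Some T) \<Gamma> a = Some U" for a U
    using that srelD(1)[OF r] by (cases a) auto
  show "c = a" if "ext (Some T) \<Gamma> a = Some U" "\<not> sun U" "lift f c = lift f a" "c \<in> dom (ext (Some T) \<Gamma>)" for a c U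
    using that srelD(2)[OF r] unfolding ext_dom by (cases a; cases c) auto
  show "\<exists>a. lift f a = b \<and> ext (Some T) \<Gamma> a = Some U" if "ext (Some T) \<Gamma>' b = Some U" "\<not> sun U" for b U
    using that srelD(3)[OF r] by (cases b) (auto intro: exI[of _ 0], metis ext_simps(2) lift_simps(2))
qed

text \<open>The old type is linear, so \<open>x\<close> is the only name of the domain that is sent
  to \<open>f x\<close>, and a new type there affects no other name.\<close>

lemma srel_upd:
  assumes r: "srel f \<Gamma> \<Gamma>'" and x: "\<Gamma> x = Some U" "\<not> sun U"
  shows "srel f (\<Gamma>(x \<mapsto> S)) (\<Gamma>'(f x \<mapsto> S))"
proof (rule srelI)
  show "(\<Gamma>'(f x \<mapsto> S)) (f a) = Some T" if "(\<Gamma>(x \<mapsto> S)) a = Some T" for a T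
    using that srelD(1)[OF r, of a T] srelD(2)[OF r x, of a] by (auto split: if_splits)
  show "c = a" if "(\<Gamma>(x \<mapsto> S)) a = Some T" "\<not> sun T" "f c = f a" "c \<in> dom (\<Gamma>(x \<mapsto> S))" for a c T
  proof (cases "a = x \<or> c = x")
    case True
    then show ?thesis
      using that srelD(2)[OF r x, of a] srelD(2)[OF r x, of c] by (cases "a = x"; cases "c = x") auto
  next
    case False
    then show ?thesis using that srelD(2)[OF r, of a T c] by simp
  qed
  show "\<exists>a. f a = b \<and> (\<Gamma>(x \<mapsto> S)) a = Some T" if "(\<Gamma>'(f x \<mapsto> S)) b = Some T" "\<not> sun T" for b T
    using that srelD(3)[OF r, of b T] by (auto split: if_splits)
qed

lemma srel_srem:
  assumes r: "srel f \<Gamma> \<Gamma>'" and x: "\<Gamma> x = Some T"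
  shows "srel f (srem T x \<Gamma>) (srem T (f x) \<Gamma>')"
proof (cases "sun T")
  case False
  have "srel f (\<Gamma>(x := None)) (\<Gamma>'(f x := None))"
  proof (rule srelI)
    show "(\<Gamma>'(f x := None)) (f a) = Some T" if "(\<Gamma>(x := None)) a = Some T" for a T
      using that srelD(1)[OF r, of a T] srelD(2)[OF r x False, of a] by (auto split: if_splits)
    show "c = a" if "(\<Gamma>(x := None)) a = Some T" "\<not> sun T" "f c = f a" "c \<in> dom (\<Gamma>(x := None))" for a c T
      using that srelD(2)[OF r, of a T c] by (auto split: if_splits)
    show "\<exists>a. f a = b \<and> (\<Gamma>(x := None)) a = Some T" if "(\<Gamma>'(f x := None)) b = Some T" "\<not> sun T" for b T
      using that srelD(3)[OF r, of b T] by (auto split: if_splits)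
  qed
  then show ?thesis using False by (simp add: srem_def)
qed (use r in \<open>simp add: srem_def\<close>)

lemma srel_sun_ctx: "srel f \<Gamma> \<Gamma>' \<Longrightarrow> sun_ctx \<Gamma> \<Longrightarrow> sun_ctx \<Gamma>'"
  unfolding sun_ctx_def by (meson srelD(3))

lemma ssplit_alt:
  "ssplit \<Gamma> \<Gamma>\<^sub>1 \<Gamma>\<^sub>2 \<longleftrightarrow>
     (\<forall>x. (\<Gamma> x = None \<longrightarrow> \<Gamma>\<^sub>1 x = None \<and> \<Gamma>\<^sub>2 x = None) \<and>
       (\<forall>T. \<Gamma> x = Some T \<longrightarrow> (if sun T then \<Gamma>\<^sub>1 x = Some T \<and> \<Gamma>\<^sub>2 x = Some T
          else (\<Gamma>\<^sub>1 x = Some T \<and> \<Gamma>\<^sub>2 x = None) \<or> (\<Gamma>\<^sub>1 x = None \<and> \<Gamma>\<^sub>2 x = Some T))))"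
  unfolding ssplit_def by (intro all_cong1) (auto split: option.splits)

lemma ssplit_sub:
  assumes "ssplit \<Gamma> \<Gamma>\<^sub>1 \<Gamma>\<^sub>2"
  shows "\<Gamma>\<^sub>1 x = Some T \<Longrightarrow> \<Gamma> x = Some T" "\<Gamma>\<^sub>2 x = Some T \<Longrightarrow> \<Gamma> x = Some T"
    "\<Gamma> x = Some T \<Longrightarrow> sun T \<Longrightarrow> \<Gamma>\<^sub>1 x = Some T" "\<Gamma> x = Some T \<Longrightarrow> sun T \<Longrightarrow> \<Gamma>\<^sub>2 x = Some T"
    "\<Gamma>\<^sub>1 x = Some T \<Longrightarrow> \<not> sun T \<Longrightarrow> \<Gamma>\<^sub>2 x = None" "\<Gamma>\<^sub>2 x = Some T \<Longrightarrow> \<not> sun T \<Longrightarrow> \<Gamma>\<^sub>1 x = None"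
    "\<Gamma> x = Some T \<Longrightarrow> \<Gamma>\<^sub>1 x = Some T \<or> \<Gamma>\<^sub>2 x = Some T"
  using assms[unfolded ssplit_alt, rule_format, of x] by (cases "\<Gamma> x"; auto split: if_splits)+

text \<open>A linear entry of \<open>\<Gamma>'\<close> follows its unique preimage, and unrestricted
  entries go to both parts.\<close>

lemma srel_split:
  assumes r: "srel f \<Gamma> \<Gamma>'" and s: "ssplit \<Gamma> \<Gamma>\<^sub>1 \<Gamma>\<^sub>2"
  obtains \<Gamma>\<^sub>1' \<Gamma>\<^sub>2' where "ssplit \<Gamma>' \<Gamma>\<^sub>1' \<Gamma>\<^sub>2'" "srel f \<Gamma>\<^sub>1 \<Gamma>\<^sub>1'" "srel f \<Gamma>\<^sub>2 \<Gamma>\<^sub>2'"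
proof -
  define part where "part \<Delta> b = (case \<Gamma>' b of None \<Rightarrow> None
    | Some T \<Rightarrow> if sun T \<or> (\<exists>a. f a = b \<and> \<Delta> a = Some T) then Some T else None)" for \<Delta> :: sctx and b
  have rel: "srel f \<Delta> (part \<Delta>)" if "\<And>a T. \<Delta> a = Some T \<Longrightarrow> \<Gamma> a = Some T" for \<Delta>
  proof (rule srelI)
    show "part \<Delta> (f a) = Some T" if "\<Delta> a = Some T" for a T
      using that srelD(1)[OF r] \<open>\<And>a T. \<Delta> a = Some T \<Longrightarrow> \<Gamma> a = Some T\<close> by (auto simp: part_def)
    show "c = a" if "\<Delta> a = Some T" "\<not> sun T" "f c = f a" "c \<in> dom \<Delta>" for a c T
      using that srelD(2)[OF r] \<open>\<And>a T. \<Delta> a = Some T \<Longrightarrow> \<Gamma> a = Some T\<close> by blast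
    show "\<exists>a. f a = b \<and> \<Delta> a = Some T" if "part \<Delta> b = Some T" "\<not> sun T" for b T
      using that by (auto simp: part_def split: option.splits if_splits)
  qed
  have "ssplit \<Gamma>' (part \<Gamma>\<^sub>1) (part \<Gamma>\<^sub>2)"
    unfolding ssplit_alt
  proof (intro allI conjI impI)
    fix b T assume b: "\<Gamma>' b = Some T"
    show "if sun T then part \<Gamma>\<^sub>1 b = Some T \<and> part \<Gamma>\<^sub>2 b = Some T
      else (part \<Gamma>\<^sub>1 b = Some T \<and> part \<Gamma>\<^sub>2 b = None) \<or> (part \<Gamma>\<^sub>1 b = None \<and> part \<Gamma>\<^sub>2 b = Some T)"
    proof (cases "sun T")
      case False
      then obtain a where a: "f a = b" "\<Gamma> a = Some T"
        using srelD(3)[OF r b] by blast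
      have u: "c = a" if "f c = b" "\<Gamma> c = Some T" for c
        using srelD(2)[OF r a(2) False, of c] a that by auto
      have e: "(\<exists>c. f c = b \<and> \<Gamma>\<^sub>1 c = Some T) \<longleftrightarrow> \<Gamma>\<^sub>1 a = Some T"
        "(\<exists>c. f c = b \<and> \<Gamma>\<^sub>2 c = Some T) \<longleftrightarrow> \<Gamma>\<^sub>2 a = Some T"
        using a u ssplit_sub(1,2)[OF s] by blast+
      show ?thesis
        unfolding part_def using b False ssplit_sub(5-7)[OF s, of a T] a by (auto simp: e)
    qed (use b in \<open>simp add: part_def\<close>)
  qed (simp_all add: part_def)
  then show ?thesis
    using that rel ssplit_sub(1,2)[OF s] by blast
qed

text \<open>Substitution and weakening for source typings and translations at once. The source and
  its translation are renamed by the same \<open>f\<close>, which is how a received parameter is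
  instantiated in both after a communication.\<close>

lemma tr_ren:
  "tr X \<Gamma> P W \<Longrightarrow> srel f \<Gamma> \<Gamma>' \<Longrightarrow> keeps_fresh f X Y \<Longrightarrow> dom \<Gamma> \<subseteq> X
    \<Longrightarrow> tr Y \<Gamma>' (sren f P) (wren f W)"
proof (induction arbitrary: f \<Gamma>' Y rule: tr.induct)
  case (nil \<Gamma> X)
  then show ?case by (auto intro: tr.nil srel_sun_ctx)
next
  case (par \<Gamma> \<Gamma>\<^sub>1 \<Gamma>\<^sub>2 X P W\<^sub>1 Q W\<^sub>2)
  obtain \<Gamma>\<^sub>1' \<Gamma>\<^sub>2' where s: "ssplit \<Gamma>' \<Gamma>\<^sub>1' \<Gamma>\<^sub>2'" "srel f \<Gamma>\<^sub>1 \<Gamma>\<^sub>1'" "srel f \<Gamma>\<^sub>2 \<Gamma>\<^sub>2'"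
    using srel_split[OF par.prems(1) par.hyps(1)] .
  have d: "dom \<Gamma>\<^sub>1 \<subseteq> X" "dom \<Gamma>\<^sub>2 \<subseteq> X"
    using ssplit_sub(1,2)[OF par.hyps(1)] par.prems(3) by blast+
  show ?case
    using par.IH(1)[OF s(2) par.prems(2) d(1)] par.IH(2)[OF s(3) par.prems(2) d(2)] s(1)
    by (auto intro: tr.par)
next
  case (res X T \<Gamma> P W)
  have "lift f \<circ> res_map = res_map \<circ> lift (lift f)"
    by (auto simp: fun_eq_iff lift_if res_map_def numeral_eq_Suc)
  moreover have "dom (ext (Some T) (ext (Some (sdual T)) \<Gamma>)) \<subseteq> up (up X)"
    using res.prems(3) unfolding ext_dom by (auto simp: up_def)
  ultimately show ?case
    using tr.res[OF res.IH[OF srel_lift[OF srel_lift[OF res.prems(1)]]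
        keeps_fresh_lift[OF keeps_fresh_lift[OF res.prems(2)]]]]
    by (simp add: wren_wren)
next
  case (in_lin \<Gamma> x T S X P W)
  have x: "\<Gamma>' (f x) = Some (TLIn T S)" using srelD(1)[OF in_lin.prems(1) in_lin.hyps(1)] .
  have d: "dom (ext (Some T) (\<Gamma>(x \<mapsto> S))) \<subseteq> up X"
    using in_lin.prems(3) in_lin.hyps(1) unfolding ext_dom by (auto simp: up_def)
  \<comment> \<open>The two sides differ only at a name other than \<open>x\<close> that
    \<open>f\<close> sends to \<open>f x\<close>. Linearity of \<open>x\<close> excludes such a name
    in the domain, and \<open>keeps_fresh\<close> excludes one outside of the scope; no other name
    occurs in \<open>W\<close>.\<close>
  have "wren (lift (lift f) \<circ> in_map x) W = wren (in_map (f x) \<circ> lift f) W"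
  proof (rule tr_wren_cong[OF in_lin.hyps(2)])
    fix i assume i: "i \<in> dom (ext (Some T) (\<Gamma>(x \<mapsto> S))) \<or> i \<notin> up X"
    show "(lift (lift f) \<circ> in_map x) i = (in_map (f x) \<circ> lift f) i"
    proof (cases i)
      case (Suc j)
      consider "j = x" | "j \<in> dom \<Gamma>" | "j \<notin> X"
        using i Suc unfolding ext_dom by auto
      then have "j = x" if "f j = f x"
      proof cases
        case 2
        then show ?thesis using srelD(2)[OF in_lin.prems(1) in_lin.hyps(1) _ that] by simp
      next
        case 3
        then show ?thesis using in_lin.prems(2) that unfolding keeps_fresh_def by metis
      qed
      then show ?thesis using Suc by (auto simp: in_map_def)
    qed (simp add: in_map_def)
  qed
  moreover have "srel (lift f) (ext (Some T) (\<Gamma>(x \<mapsto> S))) (ext (Some T) (\<Gamma>'(f x \<mapsto> S)))"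
    by (intro srel_lift srel_upd[OF in_lin.prems(1) in_lin.hyps(1)]) simp
  ultimately show ?case
    using tr.in_lin[of \<Gamma>' "f x" T S, OF x in_lin.IH[OF _ keeps_fresh_lift[OF in_lin.prems(2)] d]]
    by (simp add: wren_wren del: fun_upd_apply)
next
  case (in_srv \<Gamma> x T X P W)
  have d: "dom (ext (Some T) \<Gamma>) \<subseteq> up X"
    using in_srv.prems(3) unfolding ext_dom by (auto simp: up_def)
  have "lift (lift f) \<circ> lift Suc = lift Suc \<circ> lift f"
    by (auto simp: fun_eq_iff lift_if)
  then show ?case
    using tr.in_srv[of \<Gamma>' "f x", OF srelD(1)[OF in_srv.prems(1) in_srv.hyps(1)]
      in_srv.IH[OF srel_lift[OF in_srv.prems(1)] keeps_fresh_lift[OF in_srv.prems(2)] d]]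
    by (simp only: wren_wren sren.simps wren.simps)
next
  case (in_un \<Gamma> x T X P W)
  have d: "dom (ext (Some T) \<Gamma>) \<subseteq> up X"
    using in_un.prems(3) unfolding ext_dom by (auto simp: up_def)
  have "lift (lift f) \<circ> lift Suc = lift Suc \<circ> lift f"
    by (auto simp: fun_eq_iff lift_if)
  then show ?case
    using tr.in_un[of \<Gamma>' "f x", OF srel_sun_ctx[OF in_un.prems(1) in_un.hyps(1)]
      srelD(1)[OF in_un.prems(1) in_un.hyps(2)]
      in_un.IH[OF srel_lift[OF in_un.prems(1)] keeps_fresh_lift[OF in_un.prems(2)] d]]
    by (simp only: wren_wren sren.simps wren.simps)
next
  case (out_lin \<Gamma> x T S v X P W)
  note r = out_lin.prems(1) and h = out_lin.hyps
  have x: "\<Gamma>' (f x) = Some (TLOut T S)" and v: "\<Gamma>' (f v) = Some T"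
    using srelD(1)[OF r] h by auto
  have vx: "f v \<noteq> f x"
    using srelD(2)[OF r h(1), of v] h by (auto intro: domI)
  have d: "dom ((srem T v \<Gamma>)(x \<mapsto> S)) \<subseteq> X"
    using out_lin.prems(3) h by (auto simp: srem_def split: if_splits)
  have "wren (lift f \<circ> out_map x) W = wren (out_map (f x) \<circ> f) W"
  proof (rule tr_wren_cong[OF h(4)])
    fix i assume i: "i \<in> dom ((srem T v \<Gamma>)(x \<mapsto> S)) \<or> i \<notin> X"
    consider "i = x" | "i \<in> dom \<Gamma>" | "i \<notin> X"
      using i by (auto simp: srem_def split: if_splits)
    then have "i = x" if "f i = f x"
    proof cases
      case 2
      then show ?thesis using srelD(2)[OF r h(1) _ that] by simp
    next
      case 3
      then show ?thesis using out_lin.prems(2) that unfolding keeps_fresh_def by metis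
    qed
    then show "(lift f \<circ> out_map x) i = (out_map (f x) \<circ> f) i"
      by (auto simp: out_map_def)
  qed
  moreover have "srel f ((srem T v \<Gamma>)(x \<mapsto> S)) ((srem T (f v) \<Gamma>')(f x \<mapsto> S))"
    using h by (intro srel_upd[OF srel_srem[OF r]]) (auto simp: srem_def)
  ultimately show ?case
    using tr.out_lin[of \<Gamma>' "f x" T S "f v", OF x v vx out_lin.IH[OF _ out_lin.prems(2) d]]
    by (simp add: wren_wren del: fun_upd_apply)
next
  case (out_cli \<Gamma> x T v X P W z)
  note r = out_cli.prems(1) and h = out_cli.hyps
  have d: "dom (srem T v \<Gamma>) \<subseteq> X"
    using out_cli.prems(3) h by (auto simp: srem_def split: if_splits)
  have "f z \<notin> Y" "f z \<notin> wfn (wren f W)"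
    using out_cli.prems(2) h by (auto simp: keeps_fresh_def wfn_wren)
  then show ?case
    using tr.out_cli[of \<Gamma>' "f x" T "f v", OF srelD(1)[OF r h(1)] srelD(1)[OF r h(2)]
      out_cli.IH[OF srel_srem[OF r h(2)] out_cli.prems(2) d]]
    by simp
qed

text \<open>The contexts of the components may lack unrestricted entries of \<open>\<Gamma>\<close>.
  Renaming by the identity adds them and turns the two contexts into a split.\<close>

lemma tr_join:
  assumes "tr X \<Gamma>\<^sub>1 P W\<^sub>1" "tr X \<Gamma>\<^sub>2 Q W\<^sub>2" "dom \<Gamma> \<subseteq> X"
    and sub: "\<And>a T. \<Gamma>\<^sub>1 a = Some T \<Longrightarrow> \<Gamma> a = Some T" "\<And>a T. \<Gamma>\<^sub>2 a = Some T \<Longrightarrow> \<Gamma> a = Some T"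
    and lin: "\<And>a T. \<Gamma> a = Some T \<Longrightarrow> \<not> sun T \<Longrightarrow> \<Gamma>\<^sub>1 a = Some T \<longleftrightarrow> \<Gamma>\<^sub>2 a = None"
  shows "tr X \<Gamma> (SPar P Q) (WPar W\<^sub>1 W\<^sub>2)"
proof -
  define part where "part \<Delta> a = (case \<Gamma> a of None \<Rightarrow> None
    | Some T \<Rightarrow> if sun T \<or> \<Delta> a = Some T then Some T else None)" for \<Delta> :: sctx and a
  have rel: "srel id \<Delta> (part \<Delta>)" if "\<And>a T. \<Delta> a = Some T \<Longrightarrow> \<Gamma> a = Some T" for \<Delta>
    by (rule srelI) (use that in \<open>auto simp: part_def split: option.splits if_splits\<close>)
  have "ssplit \<Gamma> (part \<Gamma>\<^sub>1) (part \<Gamma>\<^sub>2)"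
    unfolding ssplit_alt
  proof (intro allI conjI impI)
    fix a T assume a: "\<Gamma> a = Some T"
    have "\<Gamma>\<^sub>1 a = None \<or> \<Gamma>\<^sub>1 a = Some T" "\<Gamma>\<^sub>2 a = None \<or> \<Gamma>\<^sub>2 a = Some T"
      using sub a by (metis option.exhaust option.inject)+
    then show "if sun T then part \<Gamma>\<^sub>1 a = Some T \<and> part \<Gamma>\<^sub>2 a = Some T
      else (part \<Gamma>\<^sub>1 a = Some T \<and> part \<Gamma>\<^sub>2 a = None) \<or> (part \<Gamma>\<^sub>1 a = None \<and> part \<Gamma>\<^sub>2 a = Some T)"
      using a lin[OF a] by (auto simp: part_def)
  qed (simp_all add: part_def)
  moreover have "dom \<Gamma>\<^sub>1 \<subseteq> X" "dom \<Gamma>\<^sub>2 \<subseteq> X" using sub assms(3) by blast+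
  ultimately show ?thesis
    using tr_ren[OF assms(1) rel keeps_fresh_id] tr_ren[OF assms(2) rel keeps_fresh_id] sub
    by (auto intro: tr.par)
qed

section \<open>Weighted typing, with contexts split on demand\<close>

text \<open>Counterpart of \<open>srem\<close>. If a linear entry holds two dual assumptions, one
  use removes its own assumption and leaves the other.\<close>

definition rem :: "wty \<Rightarrow> name \<Rightarrow> wctx \<Rightarrow> wctx" where
  "rem V x \<Gamma> = (if wun V then \<Gamma> else \<Gamma>(x := \<Gamma> x - {V}))"

lemma wsplit_sub:
  assumes "wsplit \<Gamma> \<Gamma>\<^sub>1 \<Gamma>\<^sub>2"
  shows "V \<in> \<Gamma>\<^sub>1 x \<Longrightarrow> V \<in> \<Gamma> x" "V \<in> \<Gamma>\<^sub>2 x \<Longrightarrow> V \<in> \<Gamma> x"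
    "V \<in> \<Gamma> x \<Longrightarrow> wun V \<Longrightarrow> V \<in> \<Gamma>\<^sub>1 x" "V \<in> \<Gamma> x \<Longrightarrow> wun V \<Longrightarrow> V \<in> \<Gamma>\<^sub>2 x"
    "V \<in> \<Gamma>\<^sub>1 x \<Longrightarrow> \<not> wun V \<Longrightarrow> V \<notin> \<Gamma>\<^sub>2 x" "V \<in> \<Gamma>\<^sub>2 x \<Longrightarrow> \<not> wun V \<Longrightarrow> V \<notin> \<Gamma>\<^sub>1 x"
    "V \<in> \<Gamma> x \<Longrightarrow> V \<in> \<Gamma>\<^sub>1 x \<or> V \<in> \<Gamma>\<^sub>2 x"
proof -
  have a: "\<Gamma> x = \<Gamma>\<^sub>1 x \<union> \<Gamma>\<^sub>2 x \<and>
      (\<forall>V\<in>\<Gamma> x. if wun V then V \<in> \<Gamma>\<^sub>1 x \<and> V \<in> \<Gamma>\<^sub>2 x else \<not> (V \<in> \<Gamma>\<^sub>1 x \<and> V \<in> \<Gamma>\<^sub>2 x))"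
    using assms unfolding wsplit_def by (rule spec)
  have u: "V \<in> \<Gamma> x \<longleftrightarrow> V \<in> \<Gamma>\<^sub>1 x \<or> V \<in> \<Gamma>\<^sub>2 x"
    using conjunct1[OF a] by (metis Un_iff)
  have s: "wun V \<Longrightarrow> V \<in> \<Gamma> x \<Longrightarrow> V \<in> \<Gamma>\<^sub>1 x \<and> V \<in> \<Gamma>\<^sub>2 x"
    "\<not> wun V \<Longrightarrow> V \<in> \<Gamma> x \<Longrightarrow> \<not> (V \<in> \<Gamma>\<^sub>1 x \<and> V \<in> \<Gamma>\<^sub>2 x)"
    using bspec[OF conjunct2[OF a], of V] by (simp_all only: if_True if_False simp_thms)
  show "V \<in> \<Gamma>\<^sub>1 x \<Longrightarrow> V \<in> \<Gamma> x" "V \<in> \<Gamma>\<^sub>2 x \<Longrightarrow> V \<in> \<Gamma> x" "V \<in> \<Gamma> x \<Longrightarrow> V \<in> \<Gamma>\<^sub>1 x \<or> V \<in> \<Gamma>\<^sub>2 x"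
    "V \<in> \<Gamma> x \<Longrightarrow> wun V \<Longrightarrow> V \<in> \<Gamma>\<^sub>1 x" "V \<in> \<Gamma> x \<Longrightarrow> wun V \<Longrightarrow> V \<in> \<Gamma>\<^sub>2 x"
    "V \<in> \<Gamma>\<^sub>1 x \<Longrightarrow> \<not> wun V \<Longrightarrow> V \<notin> \<Gamma>\<^sub>2 x" "V \<in> \<Gamma>\<^sub>2 x \<Longrightarrow> \<not> wun V \<Longrightarrow> V \<notin> \<Gamma>\<^sub>1 x"
    using u s by iprover+
qed

lemma wsplitI:
  assumes "\<And>x V. V \<in> \<Gamma> x \<longleftrightarrow> V \<in> \<Gamma>\<^sub>1 x \<or> V \<in> \<Gamma>\<^sub>2 x"
    and "\<And>x V. V \<in> \<Gamma> x \<Longrightarrow> wun V \<Longrightarrow> V \<in> \<Gamma>\<^sub>1 x \<and> V \<in> \<Gamma>\<^sub>2 x"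
    and "\<And>x V. V \<in> \<Gamma>\<^sub>1 x \<Longrightarrow> V \<in> \<Gamma>\<^sub>2 x \<Longrightarrow> wun V"
  shows "wsplit \<Gamma> \<Gamma>\<^sub>1 \<Gamma>\<^sub>2"
  unfolding wsplit_def using assms by (intro allI conjI ballI set_eqI) (simp_all, blast)

lemma wsplit_wvarD:
  assumes s: "wsplit \<Gamma> \<Gamma>\<^sub>1 \<Gamma>\<^sub>2" and v: "wvar \<Gamma>\<^sub>1 x V"
  shows "V \<in> \<Gamma> x" "\<Gamma>\<^sub>2 = rem V x \<Gamma>"
proof -
  have x: "V \<in> \<Gamma>\<^sub>1 x" using v by (simp add: wvar_def)
  have un: "wun U" if "U \<in> \<Gamma>\<^sub>1 y" "y \<noteq> x \<or> U \<noteq> V" for y U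
    using v that unfolding wvar_def wun_ctx_def
    by (metis DiffI empty_iff fun_upd_other fun_upd_same insert_iff)
  show "V \<in> \<Gamma> x" using x wsplit_sub(1)[OF s] by blast
  have "U \<in> \<Gamma>\<^sub>2 y \<longleftrightarrow> U \<in> rem V x \<Gamma> y" for U y
  proof (cases "wun U")
    case True
    then have "U \<in> \<Gamma>\<^sub>2 y \<longleftrightarrow> U \<in> \<Gamma> y" using wsplit_sub(2,4)[OF s] by blast
    then show ?thesis using True by (auto simp: rem_def)
  next
    case False
    show ?thesis
    proof (cases "y = x \<and> U = V")
      case True
      then show ?thesis using wsplit_sub(5)[OF s x] False by (simp add: rem_def)
    next
      case neq: False
      then have "U \<notin> \<Gamma>\<^sub>1 y" using un[of U y] False by blast
      then have "U \<in> \<Gamma>\<^sub>2 y \<longleftrightarrow> U \<in> \<Gamma> y" using wsplit_sub(2,7)[OF s, of U y] by blast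
      then show ?thesis using neq by (auto simp: rem_def)
    qed
  qed
  then show "\<Gamma>\<^sub>2 = rem V x \<Gamma>" by blast
qed

text \<open>Unrestricted assumptions are kept in \<open>\<Gamma>\<^sub>1\<close> as well: in a
  client output the context that types the payload must still contain the type of the
  subject.\<close>

lemma wsplit_wvarI:
  assumes "V \<in> \<Gamma> x"
  obtains \<Gamma>\<^sub>1 where "wsplit \<Gamma> \<Gamma>\<^sub>1 (rem V x \<Gamma>)" "wvar \<Gamma>\<^sub>1 x V"
    "\<And>y U. U \<in> \<Gamma> y \<Longrightarrow> wun U \<Longrightarrow> U \<in> \<Gamma>\<^sub>1 y"
proof -
  let ?\<Gamma> = "\<lambda>y. {U \<in> \<Gamma> y. wun U \<or> (y = x \<and> U = V)}"
  have "wsplit \<Gamma> ?\<Gamma> (rem V x \<Gamma>)"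
    by (rule wsplitI) (auto simp: rem_def split: if_splits)
  moreover have "wvar ?\<Gamma> x V"
    using assms by (auto simp: wvar_def wun_ctx_def)
  ultimately show ?thesis using that by auto
qed

text \<open>The relation \<open>wtyped\<close> with the splits at prefixes computed by
  \<open>rem\<close>, as \<open>tr\<close> does it for \<open>strans\<close>.\<close>

inductive wta :: "wctx \<Rightarrow> wproc \<Rightarrow> nat set \<Rightarrow> bool" where
  nil: "wun_ctx \<Gamma> \<Longrightarrow> wta \<Gamma> WNil {}"
| par: "wsplit \<Gamma> \<Gamma>\<^sub>1 \<Gamma>\<^sub>2 \<Longrightarrow> wta \<Gamma>\<^sub>1 P L\<^sub>1 \<Longrightarrow> wta \<Gamma>\<^sub>2 Q L\<^sub>2 \<Longrightarrow> wta \<Gamma> (WPar P Q) (L\<^sub>1 \<union> L\<^sub>2)"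
| res: "weights_pos V \<Longrightarrow> wta (ext {V, wdual V} \<Gamma>) P L \<Longrightarrow> wta \<Gamma> (WRes P) L"
| lin_in: "VIn n V\<^sub>1 V\<^sub>2 \<in> \<Gamma> x \<Longrightarrow> wta (ext {V\<^sub>1} (ext {V\<^sub>2} (rem (VIn n V\<^sub>1 V\<^sub>2) x \<Gamma>))) P L
    \<Longrightarrow> has_level V\<^sub>2 n \<Longrightarrow> wta \<Gamma> (WIn x P) L"
| lin_in_srv: "VSrv n V \<in> \<Gamma> x \<Longrightarrow> wta (ext {V} (ext {VUnit} \<Gamma>)) P L \<Longrightarrow> wta \<Gamma> (WIn x P) L"
| lin_out: "VOut n V\<^sub>1 V\<^sub>2 \<in> \<Gamma> x \<Longrightarrow> V\<^sub>1 \<in> rem (VOut n V\<^sub>1 V\<^sub>2) x \<Gamma> y\<^sub>1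
    \<Longrightarrow> \<Delta> = rem V\<^sub>1 y\<^sub>1 (rem (VOut n V\<^sub>1 V\<^sub>2) x \<Gamma>) \<Longrightarrow> \<Delta> y\<^sub>2 = {V\<^sub>2, wdual V\<^sub>2}
    \<Longrightarrow> wta (\<Delta>(y\<^sub>2 := {V\<^sub>2})) P L \<Longrightarrow> has_level V\<^sub>2 n \<Longrightarrow> wta \<Gamma> (WOut x y\<^sub>1 y\<^sub>2 P) (insert n L)"
| un_out: "VCli n V \<in> \<Gamma> x \<Longrightarrow> V \<in> \<Gamma> y\<^sub>1 \<Longrightarrow> \<Delta> = rem V y\<^sub>1 \<Gamma> \<Longrightarrow> \<Delta> y\<^sub>2 = {}
    \<Longrightarrow> wta (\<Delta>(y\<^sub>2 := {VUnit})) P L \<Longrightarrow> wta \<Gamma> (WOut x y\<^sub>1 y\<^sub>2 P) (insert n L)"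
| un_in: "wun_ctx \<Gamma> \<Longrightarrow> VSrv n V \<in> \<Gamma> x \<Longrightarrow> wta (ext {V} (ext {VUnit} \<Gamma>)) P L \<Longrightarrow> \<forall>m\<in>L. m < n
    \<Longrightarrow> wta \<Gamma> (WRep x P) {}"

lemma rem_un [simp]: "wun V \<Longrightarrow> rem V x \<Gamma> = \<Gamma>"
  by (simp add: rem_def)

lemma wtyped_imp_wta: "wtyped \<Gamma> P L \<Longrightarrow> wta \<Gamma> P L"
proof (induction rule: wtyped.induct)
  case (wt_lin_in \<Gamma> \<Gamma>\<^sub>1 \<Gamma>\<^sub>2 x n V\<^sub>1 V\<^sub>2 P L)
  then show ?case using wsplit_wvarD[OF wt_lin_in(1,2)] by (auto intro: wta.lin_in)
next
  case (wt_lin_in_srv \<Gamma> \<Gamma>\<^sub>1 \<Gamma>\<^sub>2 x n V P L)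
  then show ?case using wsplit_wvarD[OF wt_lin_in_srv(1,2)] by (auto intro: wta.lin_in_srv)
next
  case (wt_lin_out \<Gamma> \<Gamma>\<^sub>1 \<Gamma>\<^sub>2 \<Gamma>\<^sub>3 x n V\<^sub>1 V\<^sub>2 y\<^sub>1 y\<^sub>2 P L)
  then obtain \<Delta> where d: "wsplit \<Gamma> \<Gamma>\<^sub>1 \<Delta>" "wsplit \<Delta> \<Gamma>\<^sub>2 \<Gamma>\<^sub>3" by (auto simp: wsplit3_def)
  show ?case
    using wsplit_wvarD[OF d(1) wt_lin_out(2)] wsplit_wvarD[OF d(2) wt_lin_out(3)] wt_lin_out
    by (intro wta.lin_out[of n V\<^sub>1 V\<^sub>2 \<Gamma> x y\<^sub>1 \<Gamma>\<^sub>3]) (simp_all del: fun_upd_apply)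
next
  case (wt_un_out \<Gamma> \<Gamma>\<^sub>1 \<Gamma>\<^sub>2 \<Gamma>\<^sub>3 x n V y\<^sub>1 y\<^sub>2 P L)
  then obtain \<Delta> where d: "wsplit \<Gamma> \<Gamma>\<^sub>1 \<Delta>" "wsplit \<Delta> \<Gamma>\<^sub>2 \<Gamma>\<^sub>3" by (auto simp: wsplit3_def)
  show ?case
    using wsplit_wvarD[OF d(1) wt_un_out(2)] wsplit_wvarD[OF d(2) wt_un_out(4)] wt_un_out
    by (intro wta.un_out[of n V \<Gamma> x y\<^sub>1 \<Gamma>\<^sub>3]) (simp_all del: fun_upd_apply)
next
  case (wt_un_in \<Gamma> x n V P L)
  \<comment> \<open>The variable rule makes all other assumptions unrestricted, and the one that is
    used is a server type.\<close>
  have "wun_ctx \<Gamma>"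
    using wt_un_in(1) unfolding wvar_def wun_ctx_def
    by (metis DiffI empty_iff fun_upd_other fun_upd_same insert_iff wun.simps(4))
  then show ?case using wt_un_in by (auto simp: wvar_def intro: wta.un_in)
qed (auto intro: wta.intros)

lemma wta_imp_wtyped: "wta \<Gamma> P L \<Longrightarrow> wtyped \<Gamma> P L"
proof (induction rule: wta.induct)
  case (lin_in n V\<^sub>1 V\<^sub>2 \<Gamma> x P L)
  then show ?case using wsplit_wvarI[of _ \<Gamma> x, OF lin_in(1)] by (metis wt_lin_in)
next
  case (lin_in_srv n V \<Gamma> x P L)
  then show ?case using wsplit_wvarI[of _ \<Gamma> x, OF lin_in_srv(1)] wt_lin_in_srv
    by (metis rem_un wun.simps(4))
next
  case (lin_out n V\<^sub>1 V\<^sub>2 \<Gamma> x y\<^sub>1 \<Delta> y\<^sub>2 P L)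
  let ?\<Gamma> = "rem (VOut n V\<^sub>1 V\<^sub>2) x \<Gamma>"
  obtain \<Gamma>\<^sub>1 where 1: "wsplit \<Gamma> \<Gamma>\<^sub>1 ?\<Gamma>" "wvar \<Gamma>\<^sub>1 x (VOut n V\<^sub>1 V\<^sub>2)"
    using wsplit_wvarI[of _ \<Gamma> x, OF lin_out(1)] by metis
  obtain \<Gamma>\<^sub>2 where 2: "wsplit ?\<Gamma> \<Gamma>\<^sub>2 \<Delta>" "wvar \<Gamma>\<^sub>2 y\<^sub>1 V\<^sub>1"
    using wsplit_wvarI[of _ ?\<Gamma> y\<^sub>1, OF lin_out(2)] lin_out(3) by metis
  have 3: "wsplit3 \<Gamma> \<Gamma>\<^sub>1 \<Gamma>\<^sub>2 \<Delta>" using 1 2 by (auto simp: wsplit3_def)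
  show ?case using lin_out by (intro wt_lin_out[OF 3 1(2) 2(2)])
next
  case (un_out n V \<Gamma> x y\<^sub>1 \<Delta> y\<^sub>2 P L)
  obtain \<Gamma>\<^sub>1 where 1: "wsplit \<Gamma> \<Gamma>\<^sub>1 \<Gamma>" "wvar \<Gamma>\<^sub>1 x (VCli n V)"
    using wsplit_wvarI[of _ \<Gamma> x, OF un_out(1)] by (metis rem_un wun.simps(5))
  obtain \<Gamma>\<^sub>2 where 2: "wsplit \<Gamma> \<Gamma>\<^sub>2 \<Delta>" "wvar \<Gamma>\<^sub>2 y\<^sub>1 V" "VCli n V \<in> \<Gamma>\<^sub>2 x"
    using wsplit_wvarI[of _ \<Gamma> y\<^sub>1, OF un_out(2)] un_out(1,3) by (metis wun.simps(5))
  have 3: "wsplit3 \<Gamma> \<Gamma>\<^sub>1 \<Gamma>\<^sub>2 \<Delta>" using 1 2 by (auto simp: wsplit3_def)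
  have "VCli n V \<in> \<Delta> x" using un_out(1) wsplit_sub(4)[OF 2(1)] by simp
  then show ?case using un_out by (intro wt_un_out[OF 3 1(2) 2(3,2)])
next
  case (un_in \<Gamma> n V x P L)
  then show ?case by (intro wt_un_in[of _ x n V]) (auto simp: wvar_def wun_ctx_def)
qed (auto intro: wtyped.intros)

section \<open>Renaming of weighted typings\<close>

text \<open>
  The discipline that translations obey: the second object of an output is bound at that output or
  fresh for everything in scope.
\<close>

inductive wgood :: "name set \<Rightarrow> wproc \<Rightarrow> bool" where
  nil: "wgood X WNil"
| par: "wgood X P \<Longrightarrow> wgood X Q \<Longrightarrow> wgood X (WPar P Q)"
| res: "wgood (up X) P \<Longrightarrow> wgood X (WRes P)"
| input: "wgood (up (up X)) P \<Longrightarrow> wgood X (WIn x P)"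
| rep: "wgood (up (up X)) P \<Longrightarrow> wgood X (WRep x P)"
| lin: "wgood (up X) P \<Longrightarrow> wgood X (WRes (WOut (Suc x) (Suc v) 0 P))"
| cli: "z \<notin> X \<Longrightarrow> wgood (insert z X) P \<Longrightarrow> wgood X (WOut x v z P)"

lemma up_insert: "up (insert z X) = insert (Suc z) (up X)"
  by (auto simp: up_def)

text \<open>Serves client outputs, whose continuation joins the scope of the residual without
  occurring in it.\<close>

lemma wgood_insert: "wgood X P \<Longrightarrow> z \<notin> wfn P \<Longrightarrow> wgood (insert z X) P"
proof (induction arbitrary: z rule: wgood.induct)
  case (cli z' X P x v)
  then have "wgood (insert z (insert z' X)) P" "z \<noteq> z'" by auto
  then show ?case using cli by (auto intro!: wgood.cli simp: insert_commute)
qed (auto intro!: wgood.intros simp flip: up_insert, auto simp: up_insert)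

lemma wgood_wren: "wgood X P \<Longrightarrow> keeps_fresh f X Y \<Longrightarrow> wgood Y (wren f P)"
proof (induction arbitrary: f Y rule: wgood.induct)
  case (lin X P x v)
  then show ?case by (auto intro!: wgood.lin keeps_fresh_lift)
next
  case (cli z X P x v)
  then have "keeps_fresh f (insert z X) (insert (f z) Y)"
    by (auto simp: keeps_fresh_def)
  then show ?case using cli by (auto intro!: wgood.cli simp: keeps_fresh_def)
qed (auto intro!: wgood.intros keeps_fresh_lift)

lemma tr_wgood: "tr X \<Gamma> P W \<Longrightarrow> dom \<Gamma> \<subseteq> X \<Longrightarrow> wgood X W"
proof (induction rule: tr.induct)
  case (par \<Gamma> \<Gamma>\<^sub>1 \<Gamma>\<^sub>2 X P W\<^sub>1 Q W\<^sub>2)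
  then have "dom \<Gamma>\<^sub>1 \<subseteq> X" "dom \<Gamma>\<^sub>2 \<subseteq> X"
    using ssplit_sub(1,2)[OF par(1)] by blast+
  with par show ?case by (intro wgood.par)
next
  case (res X T \<Gamma> P W)
  then have "wgood (up (up X)) W" unfolding ext_dom by (auto simp: up_def)
  then show ?case by (intro wgood.res wgood_wren[OF _ keeps_fresh_up(3)])
next
  case (in_lin \<Gamma> x T S X P W)
  then have "wgood (up X) W" "x \<in> X" unfolding ext_dom by (auto simp: up_def)
  then show ?case by (intro wgood.input wgood_wren[OF _ keeps_fresh_up(4)])
next
  case (in_srv \<Gamma> x T X P W)
  then have "wgood (up X) W" unfolding ext_dom by (auto simp: up_def)
  then show ?case by (intro wgood.input wgood_wren[OF _ keeps_fresh_up(2)])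
next
  case (in_un \<Gamma> x T X P W)
  then have "wgood (up X) W" unfolding ext_dom by (auto simp: up_def)
  then show ?case by (intro wgood.rep wgood_wren[OF _ keeps_fresh_up(2)])
next
  case (out_lin \<Gamma> x T S v X P W)
  then have "dom ((srem T v \<Gamma>)(x \<mapsto> S)) \<subseteq> X" by (auto simp: srem_def split: if_splits)
  then have "wgood X W" "x \<in> X" using out_lin.IH out_lin.prems out_lin.hyps by blast+
  then show ?case by (intro wgood.lin wgood_wren[OF _ keeps_fresh_up(5)])
next
  case (out_cli \<Gamma> x T v X P W z)
  then have "dom (srem T v \<Gamma>) \<subseteq> X" by (auto simp: srem_def split: if_splits)
  then have "wgood X W" using out_cli.IH by blast
  then show ?case using out_cli by (intro wgood.cli wgood_insert)
qed (rule wgood.nil)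

text \<open>The analogue of \<open>srel\<close> for sets of assumptions. Only names in
  \<open>A\<close>, in applications the free names of the process, have to keep their assumptions; a
  renaming can thus also discard the unit entry of an absent continuation.\<close>

definition wrel :: "name set \<Rightarrow> (name \<Rightarrow> name) \<Rightarrow> wctx \<Rightarrow> wctx \<Rightarrow> bool" where
  "wrel A f \<Gamma> \<Gamma>' \<longleftrightarrow> (\<forall>a\<in>A. \<Gamma> a \<subseteq> \<Gamma>' (f a))
     \<and> (\<forall>b V. V \<in> \<Gamma>' b \<longrightarrow> \<not> wun V \<longrightarrow> (\<exists>!a. f a = b \<and> V \<in> \<Gamma> a))"

lemma wrelD:
  assumes "wrel A f \<Gamma> \<Gamma>'"
  shows "V \<in> \<Gamma> a \<Longrightarrow> a \<in> A \<Longrightarrow> V \<in> \<Gamma>' (f a)"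
    "V \<in> \<Gamma>' (f a) \<Longrightarrow> \<not> wun V \<Longrightarrow> V \<in> \<Gamma> a \<Longrightarrow> V \<in> \<Gamma> c \<Longrightarrow> f c = f a \<Longrightarrow> c = a"
    "V \<in> \<Gamma>' b \<Longrightarrow> \<not> wun V \<Longrightarrow> \<exists>a. f a = b \<and> V \<in> \<Gamma> a"
proof -
  show "V \<in> \<Gamma> a \<Longrightarrow> a \<in> A \<Longrightarrow> V \<in> \<Gamma>' (f a)" using assms unfolding wrel_def by blast
  show "c = a" if "V \<in> \<Gamma>' (f a)" "\<not> wun V" "V \<in> \<Gamma> a" "V \<in> \<Gamma> c" "f c = f a"
  proof -
    have "\<exists>!a'. f a' = f a \<and> V \<in> \<Gamma> a'" using assms that unfolding wrel_def by blast
    with that show ?thesis by metis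
  qed
  show "\<exists>a. f a = b \<and> V \<in> \<Gamma> a" if "V \<in> \<Gamma>' b" "\<not> wun V"
    using assms that unfolding wrel_def by blast
qed

lemma wrelI:
  assumes "\<And>a V. V \<in> \<Gamma> a \<Longrightarrow> a \<in> A \<Longrightarrow> V \<in> \<Gamma>' (f a)"
    and "\<And>a c V. V \<in> \<Gamma>' (f a) \<Longrightarrow> \<not> wun V \<Longrightarrow> V \<in> \<Gamma> a \<Longrightarrow> V \<in> \<Gamma> c \<Longrightarrow> f c = f a \<Longrightarrow> c = a"
    and "\<And>b V. V \<in> \<Gamma>' b \<Longrightarrow> \<not> wun V \<Longrightarrow> \<exists>a. f a = b \<and> V \<in> \<Gamma> a"
  shows "wrel A f \<Gamma> \<Gamma>'"
  unfolding wrel_def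
proof (intro conjI allI impI ballI subsetI)
  fix b V assume b: "V \<in> \<Gamma>' b" "\<not> wun V"
  then obtain a where a: "f a = b" "V \<in> \<Gamma> a" using assms(3) by blast
  show "\<exists>!a. f a = b \<and> V \<in> \<Gamma> a"
  proof (rule ex1I[of _ a])
    fix c assume c: "f c = b \<and> V \<in> \<Gamma> c"
    show "c = a" by (rule assms(2)[of V a c]) (simp_all add: a b c)
  qed (simp add: a)
qed (rule assms(1))

lemma wrel_mono: "wrel A f \<Gamma> \<Gamma>' \<Longrightarrow> B \<subseteq> A \<Longrightarrow> wrel B f \<Gamma> \<Gamma>'"
  unfolding wrel_def by blast

lemma wrel_lift:
  assumes r: "wrel A f \<Gamma> \<Gamma>'" and A: "\<And>i. Suc i \<in> B \<Longrightarrow> i \<in> A"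
  shows "wrel B (lift f) (ext C \<Gamma>) (ext C \<Gamma>')"
proof (rule wrelI)
  show "V \<in> ext C \<Gamma>' (lift f a)" if "V \<in> ext C \<Gamma> a" "a \<in> B" for a V
    using that wrelD(1)[OF r] A by (cases a) auto
  show "c = a" if "V \<in> ext C \<Gamma>' (lift f a)" "\<not> wun V" "V \<in> ext C \<Gamma> a" "V \<in> ext C \<Gamma> c"
      "lift f c = lift f a" for a c V
    using that wrelD(2)[OF r] by (cases a; cases c) auto
  show "\<exists>a. lift f a = b \<and> V \<in> ext C \<Gamma> a" if "V \<in> ext C \<Gamma>' b" "\<not> wun V" for b V
  proof (cases b)
    case 0
    then show ?thesis using that by (intro exI[of _ 0]) simp
  next
    case (Suc b')
    then obtain a where "f a = b'" "V \<in> \<Gamma> a" using wrelD(3)[OF r, of V b'] \<open>V \<in> ext C \<Gamma>' b\<close> \<open>\<not> wun V\<close> by auto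
    then show ?thesis using Suc by (intro exI[of _ "Suc a"]) simp
  qed
qed

lemma wrel_rem:
  assumes r: "wrel A f \<Gamma> \<Gamma>'" and V: "V \<in> \<Gamma> x" "x \<in> A"
  shows "wrel A f (rem V x \<Gamma>) (rem V (f x) \<Gamma>')"
proof (cases "wun V")
  case False
  have Vx: "V \<in> \<Gamma>' (f x)" using wrelD(1)[OF r V] .
  have "wrel A f (\<Gamma>(x := \<Gamma> x - {V})) (\<Gamma>'(f x := \<Gamma>' (f x) - {V}))"
  proof (rule wrelI)
    show "U \<in> (\<Gamma>'(f x := \<Gamma>' (f x) - {V})) (f a)" if "U \<in> (\<Gamma>(x := \<Gamma> x - {V})) a" "a \<in> A" for a U
      using that wrelD(1)[OF r, of U a] wrelD(2)[OF r Vx False V(1), of a] by (auto split: if_splits)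
    show "c = a" if "U \<in> (\<Gamma>'(f x := \<Gamma>' (f x) - {V})) (f a)" "\<not> wun U"
      "U \<in> (\<Gamma>(x := \<Gamma> x - {V})) a" "U \<in> (\<Gamma>(x := \<Gamma> x - {V})) c" "f c = f a" for a c U
    proof -
      have "U \<in> \<Gamma>' (f a)" "U \<in> \<Gamma> a" "U \<in> \<Gamma> c" using that(1,3,4) by (simp_all split: if_splits)
      then show ?thesis using wrelD(2)[OF r] that(2,5) by metis
    qed
    show "\<exists>a. f a = b \<and> U \<in> (\<Gamma>(x := \<Gamma> x - {V})) a"
      if "U \<in> (\<Gamma>'(f x := \<Gamma>' (f x) - {V})) b" "\<not> wun U" for b U
      using that wrelD(3)[OF r, of U b] by (auto split: if_splits)
  qed
  then show ?thesis using False by (simp add: rem_def)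
qed (use r in simp)

lemma wrel_wun: "wrel A f \<Gamma> \<Gamma>' \<Longrightarrow> wun_ctx \<Gamma> \<Longrightarrow> wun_ctx \<Gamma>'"
  unfolding wun_ctx_def by (meson wrelD(3))

lemma wrel_split:
  assumes r: "wrel A f \<Gamma> \<Gamma>'" and s: "wsplit \<Gamma> \<Gamma>\<^sub>1 \<Gamma>\<^sub>2"
  obtains \<Gamma>\<^sub>1' \<Gamma>\<^sub>2' where "wsplit \<Gamma>' \<Gamma>\<^sub>1' \<Gamma>\<^sub>2'" "wrel A f \<Gamma>\<^sub>1 \<Gamma>\<^sub>1'" "wrel A f \<Gamma>\<^sub>2 \<Gamma>\<^sub>2'"
proof -
  define part where "part \<Delta> b = {V \<in> \<Gamma>' b. wun V \<or> (\<exists>a. f a = b \<and> V \<in> \<Delta> a)}" for \<Delta> :: wctx and b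
  have rel: "wrel A f \<Delta> (part \<Delta>)" if sub: "\<And>a V. V \<in> \<Delta> a \<Longrightarrow> V \<in> \<Gamma> a" for \<Delta>
  proof (rule wrelI)
    show "V \<in> part \<Delta> (f a)" if "V \<in> \<Delta> a" "a \<in> A" for a V
      using that wrelD(1)[OF r] sub by (auto simp: part_def)
    show "c = a" if "V \<in> part \<Delta> (f a)" "\<not> wun V" "V \<in> \<Delta> a" "V \<in> \<Delta> c" "f c = f a" for a c V
      using that wrelD(2)[OF r, of V a c] sub by (simp add: part_def)
    show "\<exists>a. f a = b \<and> V \<in> \<Delta> a" if "V \<in> part \<Delta> b" "\<not> wun V" for b V
      using that by (auto simp: part_def)
  qed
  have "wsplit \<Gamma>' (part \<Gamma>\<^sub>1) (part \<Gamma>\<^sub>2)"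
  proof (rule wsplitI)
    show "V \<in> \<Gamma>' b \<longleftrightarrow> V \<in> part \<Gamma>\<^sub>1 b \<or> V \<in> part \<Gamma>\<^sub>2 b" for b V
      using wrelD(3)[OF r, of V b] wsplit_sub(7)[OF s, of V] by (auto simp: part_def)
    show "wun V" if "V \<in> part \<Gamma>\<^sub>1 b" "V \<in> part \<Gamma>\<^sub>2 b" for b V
    proof (rule ccontr)
      assume lin: "\<not> wun V"
      then obtain a c where "f a = b" "V \<in> \<Gamma>\<^sub>1 a" "f c = b" "V \<in> \<Gamma>\<^sub>2 c" "V \<in> \<Gamma>' b"
        using \<open>V \<in> part \<Gamma>\<^sub>1 b\<close> \<open>V \<in> part \<Gamma>\<^sub>2 b\<close> by (auto simp: part_def)
      moreover from this have "c = a"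
        using wrelD(2)[OF r, of V a c] lin wsplit_sub(1,2)[OF s] by simp
      ultimately show False using wsplit_sub(5)[OF s] lin by simp
    qed
  qed (simp add: part_def)
  then show ?thesis
    using that rel wsplit_sub(1,2)[OF s] by blast
qed

lemma rem_ext: "rem V (Suc x) (ext A \<Gamma>) = ext A (rem V x \<Gamma>)" "rem V 0 (ext A \<Gamma>) = ext (if wun V then A else A - {V}) \<Gamma>"
  by (auto simp: rem_def fun_eq_iff ext_if)

lemma ext_upd: "(ext A \<Gamma>)(0 := B) = ext B \<Gamma>" "(ext A \<Gamma>)(Suc i := B) = ext A (\<Gamma>(i := B))"
  by (auto simp: fun_eq_iff ext_if)

lemma rem_sub: "rem V x \<Gamma> y \<subseteq> \<Gamma> y"
  by (auto simp: rem_def)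

inductive_cases wta_WResE: "wta \<Gamma> (WRes P) L"
inductive_cases wta_WParE: "wta \<Gamma> (WPar P Q) L"
inductive_cases wta_WRepE: "wta \<Gamma> (WRep x P) L"
inductive_cases wta_WNilE: "wta \<Gamma> WNil L"

inductive_cases wta_WOutE0: "wta \<Gamma> (WOut x y z P) L"

lemma wta_WOutE:
  assumes "wta \<Gamma> (WOut x y z P) L"
  obtains (lin) n V\<^sub>1 V\<^sub>2 M where "L = insert n M" "VOut n V\<^sub>1 V\<^sub>2 \<in> \<Gamma> x" "V\<^sub>1 \<in> rem (VOut n V\<^sub>1 V\<^sub>2) x \<Gamma> y"
      "rem V\<^sub>1 y (rem (VOut n V\<^sub>1 V\<^sub>2) x \<Gamma>) z = {V\<^sub>2, wdual V\<^sub>2}"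
      "wta ((rem V\<^sub>1 y (rem (VOut n V\<^sub>1 V\<^sub>2) x \<Gamma>))(z := {V\<^sub>2})) P M" "has_level V\<^sub>2 n"
    | (cli) n V M where "L = insert n M" "VCli n V \<in> \<Gamma> x" "V \<in> \<Gamma> y" "rem V y \<Gamma> z = {}"
      "wta ((rem V y \<Gamma>)(z := {VUnit})) P M"
  by (rule wta_WOutE0[OF assms]) (rule that; assumption)+

inductive_cases wta_WInE0: "wta \<Gamma> (WIn x P) L"

lemma wta_WInE:
  assumes "wta \<Gamma> (WIn x P) L"
  obtains (lin) n V\<^sub>1 V\<^sub>2 where "VIn n V\<^sub>1 V\<^sub>2 \<in> \<Gamma> x"
      "wta (ext {V\<^sub>1} (ext {V\<^sub>2} (rem (VIn n V\<^sub>1 V\<^sub>2) x \<Gamma>))) P L" "has_level V\<^sub>2 n"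
    | (srv) n V where "VSrv n V \<in> \<Gamma> x" "wta (ext {V} (ext {VUnit} \<Gamma>)) P L"
  by (rule wta_WInE0[OF assms]) (rule that; assumption)+

text \<open>The second object is restricted right here and holds a dual pair, whereas the client
  rule wants its entry to be empty. So the shape alone shows that the linear rule was
  applied.\<close>

lemma wta_lin_outE:
  assumes "wta \<Gamma> (WRes (WOut (Suc x) (Suc v) 0 P)) L"
  obtains n V\<^sub>1 V\<^sub>2 L' where "weights_pos V\<^sub>2" "VOut n V\<^sub>1 V\<^sub>2 \<in> \<Gamma> x" "V\<^sub>1 \<in> rem (VOut n V\<^sub>1 V\<^sub>2) x \<Gamma> v"
    "wta (ext {V\<^sub>2} (rem V\<^sub>1 v (rem (VOut n V\<^sub>1 V\<^sub>2) x \<Gamma>))) P L'" "has_level V\<^sub>2 n" "L = insert n L'"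
proof -
  obtain V where V: "weights_pos V" and t: "wta (ext {V, wdual V} \<Gamma>) (WOut (Suc x) (Suc v) 0 P) L"
    using assms by (rule wta_WResE)
  \<comment> \<open>The entry fixes the restricted type only up to duality, which preserves positive
    weights.\<close>
  have wd: "weights_pos (wdual U) = weights_pos U" for U by (induction U) auto
  have pos: "weights_pos V\<^sub>2" if "{V, wdual V} = {V\<^sub>2, wdual V\<^sub>2}" for V\<^sub>2
    using V wd[of V] that by (metis insertCI insert_iff singletonD)
  from t show ?thesis
  proof (cases rule: wta_WOutE)
    case (lin n V\<^sub>1 V\<^sub>2 M)
    then have "{V, wdual V} = {V\<^sub>2, wdual V\<^sub>2}" by (simp add: rem_ext)
    from pos[OF this] show ?thesis
      by (rule that[of V\<^sub>2 n V\<^sub>1 M]) (use lin in \<open>simp_all add: rem_ext ext_upd\<close>)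
  next
    case (cli n V' M)
    then show ?thesis by (cases v) (simp_all add: rem_def ext_if split: if_splits)
  qed
qed

text \<open>The discipline \<open>wgood\<close> makes typings stable under renaming: both output
  rules prescribe the exact entry of the second object, and a renaming that identified this name
  with another one would change the entry.\<close>

lemma wta_ren:
  "wgood X W \<Longrightarrow> wta \<Gamma> W L \<Longrightarrow> wrel (wfn W) f \<Gamma> \<Gamma>' \<Longrightarrow> keeps_fresh f X Y
    \<Longrightarrow> (\<And>z. z \<notin> X \<Longrightarrow> \<Gamma> z = {}) \<Longrightarrow> (\<And>z. z \<notin> Y \<Longrightarrow> \<Gamma>' z = {}) \<Longrightarrow> wta \<Gamma>' (wren f W) L"
proof (induction arbitrary: \<Gamma> \<Gamma>' f Y L rule: wgood.induct)
  case (nil X)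
  then show ?case by (auto elim!: wta_WNilE intro: wta.nil wrel_wun)
next
  case (par X P Q)
  from par.prems(1) obtain \<Gamma>\<^sub>1 \<Gamma>\<^sub>2 L\<^sub>1 L\<^sub>2 where s: "wsplit \<Gamma> \<Gamma>\<^sub>1 \<Gamma>\<^sub>2" "wta \<Gamma>\<^sub>1 P L\<^sub>1" "wta \<Gamma>\<^sub>2 Q L\<^sub>2" "L = L\<^sub>1 \<union> L\<^sub>2"
    by (rule wta_WParE)
  obtain \<Gamma>\<^sub>1' \<Gamma>\<^sub>2' where s': "wsplit \<Gamma>' \<Gamma>\<^sub>1' \<Gamma>\<^sub>2'" "wrel (wfn (WPar P Q)) f \<Gamma>\<^sub>1 \<Gamma>\<^sub>1'" "wrel (wfn (WPar P Q)) f \<Gamma>\<^sub>2 \<Gamma>\<^sub>2'"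
    using wrel_split[OF par.prems(2) s(1)] .
  have e: "\<Gamma>\<^sub>1 z = {}" "\<Gamma>\<^sub>2 z = {}" if "z \<notin> X" for z
    using that par.prems(4) wsplit_sub(1,2)[OF s(1)] by blast+
  have e': "\<Gamma>\<^sub>1' z = {}" "\<Gamma>\<^sub>2' z = {}" if "z \<notin> Y" for z
    using that par.prems(5) wsplit_sub(1,2)[OF s'(1)] by blast+
  have "wta \<Gamma>\<^sub>1' (wren f P) L\<^sub>1" "wta \<Gamma>\<^sub>2' (wren f Q) L\<^sub>2"
    by (rule par.IH(1)[OF s(2) wrel_mono[OF s'(2)] par.prems(3)] par.IH(2)[OF s(3) wrel_mono[OF s'(3)] par.prems(3)];
        simp add: e e')+
  then show ?case using s'(1) s(4) by (auto intro: wta.par)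
next
  case (res X P)
  from res.prems(1) obtain V where V: "weights_pos V" "wta (ext {V, wdual V} \<Gamma>) P L"
    by (rule wta_WResE)
  have "wta (ext {V, wdual V} \<Gamma>') (wren (lift f) P) L"
  proof (rule res.IH[OF V(2) wrel_lift[OF res.prems(2)] keeps_fresh_lift[OF res.prems(3)]])
    show "ext {V, wdual V} \<Gamma> z = {}" if "z \<notin> up X" for z
      using that res.prems(4) by (cases z) auto
    show "ext {V, wdual V} \<Gamma>' z = {}" if "z \<notin> up Y" for z
      using that res.prems(5) by (cases z) auto
  qed simp
  then show ?case using V(1) by (auto intro: wta.res)
next
  case (input X P x)
  have sub: "ext A (ext B (rem V x \<Gamma>)) z = {}" if "z \<notin> up (up X)" for z A B V
    using that input.prems(4) rem_sub[of V x \<Gamma>] by (cases z; cases "z - 1") auto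
  have sub': "ext A (ext B (rem V (f x) \<Gamma>')) z = {}" if "z \<notin> up (up Y)" for z A B V
    using that input.prems(5) rem_sub[of V "f x" \<Gamma>'] by (cases z; cases "z - 1") auto
  \<comment> \<open>Stated with \<open>rem\<close> for an arbitrary type, this serves both input
    rules, as \<open>rem\<close> leaves the context unchanged for a server type.\<close>
  have *: "wta (ext A (ext B (rem V (f x) \<Gamma>'))) (wren (lift (lift f)) P) L"
    if "wta (ext A (ext B (rem V x \<Gamma>))) P L" "V \<in> \<Gamma> x" for A B V
  proof (rule input.IH[OF that(1) _ keeps_fresh_lift[OF keeps_fresh_lift[OF input.prems(3)]] sub sub'])
    show "wrel (wfn P) (lift (lift f)) (ext A (ext B (rem V x \<Gamma>))) (ext A (ext B (rem V (f x) \<Gamma>')))"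
      by (rule wrel_lift[OF wrel_lift[OF wrel_rem[OF input.prems(2) that(2)], of "{i. Suc i \<in> wfn P}"]]) auto
  qed
  from input.prems(1) show ?case
  proof (cases rule: wta_WInE)
    case (lin n V\<^sub>1 V\<^sub>2)
    then show ?thesis using *[OF lin(2,1)] wrelD(1)[OF input.prems(2) lin(1)] by (auto intro: wta.lin_in)
  next
    case (srv n V)
    then show ?thesis using *[of "{V}" "{VUnit}" "VSrv n V"] wrelD(1)[OF input.prems(2) srv(1)]
      by (auto intro: wta.lin_in_srv)
  qed
next
  case (rep X P x)
  from rep.prems(1) obtain n V M where 1: "wun_ctx \<Gamma>" "VSrv n V \<in> \<Gamma> x"
    "wta (ext {V} (ext {VUnit} \<Gamma>)) P M" "\<forall>m\<in>M. m < n" "L = {}"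
    by (rule wta_WRepE)
  have sub: "ext A (ext B \<Gamma>) z = {}" if "z \<notin> up (up X)" for z A B
    using that rep.prems(4) by (cases z; cases "z - 1") auto
  have sub': "ext A (ext B \<Gamma>') z = {}" if "z \<notin> up (up Y)" for z A B
    using that rep.prems(5) by (cases z; cases "z - 1") auto
  have "wta (ext {V} (ext {VUnit} \<Gamma>')) (wren (lift (lift f)) P) M"
  proof (rule rep.IH[OF 1(3) _ keeps_fresh_lift[OF keeps_fresh_lift[OF rep.prems(3)]] sub sub'])
    show "wrel (wfn P) (lift (lift f)) (ext {V} (ext {VUnit} \<Gamma>)) (ext {V} (ext {VUnit} \<Gamma>'))"
      by (rule wrel_lift[OF wrel_lift[OF rep.prems(2), of "{i. Suc i \<in> wfn P}"]]) auto
  qed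
  then show ?case using 1 wrelD(1)[OF rep.prems(2) 1(2)] wrel_wun[OF rep.prems(2)]
    by (auto intro: wta.un_in)
next
  case (lin X P x v)
  from lin.prems(1) obtain n V\<^sub>1 V\<^sub>2 L' where 1: "weights_pos V\<^sub>2" "VOut n V\<^sub>1 V\<^sub>2 \<in> \<Gamma> x"
    "V\<^sub>1 \<in> rem (VOut n V\<^sub>1 V\<^sub>2) x \<Gamma> v"
    "wta (ext {V\<^sub>2} (rem V\<^sub>1 v (rem (VOut n V\<^sub>1 V\<^sub>2) x \<Gamma>))) P L'" "has_level V\<^sub>2 n" "L = insert n L'"
    by (rule wta_lin_outE)
  let ?\<Gamma> = "rem (VOut n V\<^sub>1 V\<^sub>2) x \<Gamma>" and ?\<Gamma>' = "rem (VOut n V\<^sub>1 V\<^sub>2) (f x) \<Gamma>'"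
  have x: "x \<in> wfn (WRes (WOut (Suc x) (Suc v) 0 P))" and v: "v \<in> wfn (WRes (WOut (Suc x) (Suc v) 0 P))"
    by auto
  note r = wrel_rem[OF lin.prems(2) 1(2) x] and r2 = wrel_rem[OF wrel_rem[OF lin.prems(2) 1(2) x] 1(3) v]
  have "wta (ext {V\<^sub>2} (rem V\<^sub>1 (f v) ?\<Gamma>')) (wren (lift f) P) L'"
  proof (rule lin.IH[OF 1(4) wrel_lift[OF r2] keeps_fresh_lift[OF lin.prems(3)]])
    show "ext {V\<^sub>2} (rem V\<^sub>1 v ?\<Gamma>) z = {}" if "z \<notin> up X" for z
      using that lin.prems(4) rem_sub[of V\<^sub>1 v ?\<Gamma>] rem_sub[of _ x \<Gamma>] by (cases z) (simp, fastforce)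
    show "ext {V\<^sub>2} (rem V\<^sub>1 (f v) ?\<Gamma>') z = {}" if "z \<notin> up Y" for z
      using that lin.prems(5) rem_sub[of V\<^sub>1 "f v" ?\<Gamma>'] rem_sub[of _ "f x" \<Gamma>'] by (cases z) (simp, fastforce)
  qed simp
  then have "wta (ext {V\<^sub>2, wdual V\<^sub>2} \<Gamma>') (WOut (Suc (f x)) (Suc (f v)) 0 (wren (lift f) P)) L"
    unfolding 1(6) using 1(5) wrelD(1)[OF lin.prems(2) 1(2) x] wrelD(1)[OF r 1(3) v]
    by (intro wta.lin_out[OF _ _ refl]) (auto simp: rem_ext ext_upd)
  then show ?case using 1(1) by (auto intro: wta.res)
next
  case (cli z X P x v)
  note prems = cli.prems and IH = cli.IH and hyps = cli.hyps
  have Gz: "\<Gamma> z = {}" using prems(4) hyps(1) by blast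
  from prems(1) show ?case
  proof (cases rule: wta_WOutE)
    case (lin n V\<^sub>1 V\<^sub>2 M)
    \<comment> \<open>The linear rule would require an entry for \<open>z\<close>, which is out of
      scope.\<close>
    then have "\<Gamma> z \<noteq> {}" using rem_sub by (metis insert_not_empty subset_empty)
    then show ?thesis using Gz by blast
  next
    case (cli n V M)
    have fz: "f z \<notin> Y" "\<And>a. f a = f z \<Longrightarrow> a = z"
      using prems(3) hyps(1) by (auto simp: keeps_fresh_def)
    have k: "keeps_fresh f (insert z X) (insert (f z) Y)"
      using prems(3) fz by (auto simp: keeps_fresh_def)
    let ?\<Delta> = "rem V v \<Gamma>" and ?\<Delta>' = "rem V (f v) \<Gamma>'"
    have r: "wrel (wfn (WOut x v z P)) f ?\<Delta> ?\<Delta>'"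
      by (rule wrel_rem[OF prems(2) cli(3)]) simp
    have z': "?\<Delta>' (f z) = {}" using prems(5)[OF fz(1)] rem_sub[of V "f v" \<Gamma>' "f z"] by simp
    have "wta (?\<Delta>'(f z := {VUnit})) (wren f P) M"
    proof (rule IH[OF cli(5) _ k])
      show "wrel (wfn P) f (?\<Delta>(z := {VUnit})) (?\<Delta>'(f z := {VUnit}))"
      proof (rule wrelI)
        show "U \<in> (?\<Delta>'(f z := {VUnit})) (f a)" if "U \<in> (?\<Delta>(z := {VUnit})) a" "a \<in> wfn P" for a U
          using that wrelD(1)[OF r, of U a] fz(2)[of a] by (auto split: if_splits)
        show "c = a" if "U \<in> (?\<Delta>'(f z := {VUnit})) (f a)" "\<not> wun U" "U \<in> (?\<Delta>(z := {VUnit})) a"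
          "U \<in> (?\<Delta>(z := {VUnit})) c" "f c = f a" for a c U
        proof (cases "a = z \<or> c = z")
          case True
          then show ?thesis using fz(2)[of a] fz(2)[of c] that(5) by metis
        next
          case False
          then have "U \<in> ?\<Delta>' (f a)" "U \<in> ?\<Delta> a" "U \<in> ?\<Delta> c"
            using that(1,3,4) fz(2)[of a] by (simp_all split: if_splits)
          then show ?thesis using wrelD(2)[OF r] that(2,5) by metis
        qed
        show "\<exists>a. f a = b \<and> U \<in> (?\<Delta>(z := {VUnit})) a"
          if "U \<in> (?\<Delta>'(f z := {VUnit})) b" "\<not> wun U" for b U
          using that wrelD(3)[OF r, of U b] by (auto split: if_splits)
      qed
      show "(?\<Delta>(z := {VUnit})) y = {}" if "y \<notin> insert z X" for y
        using that prems(4)[of y] rem_sub[of V v \<Gamma> y] by auto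
      show "(?\<Delta>'(f z := {VUnit})) y = {}" if "y \<notin> insert (f z) Y" for y
        using that prems(5)[of y] rem_sub[of V "f v" \<Gamma>' y] by auto
    qed
    then show ?thesis
      using wrelD(1)[OF prems(2) cli(2)] wrelD(1)[OF prems(2) cli(3)] z' cli(1)
      by (auto intro!: wta.un_out)
  qed
qed

text \<open>Weakening is renaming by the identity: the added assumptions are unrestricted and lie in
  the scope.\<close>

lemma wta_weaken:
  assumes "wgood X W" "wta \<Gamma> W L" "\<And>z. z \<notin> X \<Longrightarrow> \<Gamma>' z = {}"
    and "\<And>a V. V \<in> \<Gamma> a \<Longrightarrow> V \<in> \<Gamma>' a" "\<And>a V. V \<in> \<Gamma>' a \<Longrightarrow> \<not> wun V \<Longrightarrow> V \<in> \<Gamma> a"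
  shows "wta \<Gamma>' W L"
proof -
  have "wrel (wfn W) id \<Gamma> \<Gamma>'"
    by (rule wrelI) (use assms in auto)
  moreover have "\<Gamma> z = {}" if "z \<notin> X" for z using assms(3)[OF that] assms(4)[of _ z] by auto
  ultimately show ?thesis
    using wta_ren[OF assms(1,2) _ keeps_fresh_id] assms(3) by auto
qed

lemma wta_join:
  assumes "wta \<Gamma>\<^sub>1 P L\<^sub>1" "wta \<Gamma>\<^sub>2 Q L\<^sub>2" "wgood X P" "wgood X Q"
    and "\<And>z. z \<notin> X \<Longrightarrow> \<Gamma> z = {}"
    and "\<And>a V. V \<in> \<Gamma> a \<longleftrightarrow> V \<in> \<Gamma>\<^sub>1 a \<or> V \<in> \<Gamma>\<^sub>2 a"
    and "\<And>a V. V \<in> \<Gamma>\<^sub>1 a \<Longrightarrow> V \<in> \<Gamma>\<^sub>2 a \<Longrightarrow> wun V"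
  shows "wta \<Gamma> (WPar P Q) (L\<^sub>1 \<union> L\<^sub>2)"
proof -
  let ?p = "\<lambda>\<Delta> a. {V \<in> \<Gamma> a. wun V \<or> V \<in> \<Delta> a}"
  have "wta (?p \<Gamma>\<^sub>1) P L\<^sub>1"
    by (rule wta_weaken[OF assms(3,1)]) (use assms(5,6) in auto)
  moreover have "wta (?p \<Gamma>\<^sub>2) Q L\<^sub>2"
    by (rule wta_weaken[OF assms(4,2)]) (use assms(5,6) in auto)
  moreover have "wsplit \<Gamma> (?p \<Gamma>\<^sub>1) (?p \<Gamma>\<^sub>2)"
    by (rule wsplitI) (use assms(6,7) in auto)
  ultimately show ?thesis by (intro wta.par)
qed

section \<open>Transitions of translations\<close>

text \<open>A split up to weakening, where each side may lack unrestricted entries. Exact splits are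
  not stable when only one side enters a binder or changes a linear type into an unrestricted one;
  joins are.\<close>

definition sjoin :: "sctx \<Rightarrow> sctx \<Rightarrow> sctx \<Rightarrow> bool" where
  "sjoin \<Gamma> \<Gamma>\<^sub>1 \<Gamma>\<^sub>2 \<longleftrightarrow> (\<forall>a T. \<Gamma>\<^sub>1 a = Some T \<longrightarrow> \<Gamma> a = Some T) \<and> (\<forall>a T. \<Gamma>\<^sub>2 a = Some T \<longrightarrow> \<Gamma> a = Some T)
     \<and> (\<forall>a T. \<Gamma> a = Some T \<longrightarrow> \<not> sun T \<longrightarrow> (\<Gamma>\<^sub>1 a = Some T \<longleftrightarrow> \<Gamma>\<^sub>2 a = None))"

lemma sjoin_sub:
  assumes "sjoin \<Gamma> \<Gamma>\<^sub>1 \<Gamma>\<^sub>2"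
  shows "\<Gamma>\<^sub>1 a = Some T \<Longrightarrow> \<Gamma> a = Some T" "\<Gamma>\<^sub>2 a = Some T \<Longrightarrow> \<Gamma> a = Some T"
    "\<Gamma>\<^sub>1 a = Some T \<Longrightarrow> \<not> sun T \<Longrightarrow> \<Gamma>\<^sub>2 a = None" "\<Gamma>\<^sub>2 a = Some T \<Longrightarrow> \<not> sun T \<Longrightarrow> \<Gamma>\<^sub>1 a = None"
    "\<Gamma> a = Some T \<Longrightarrow> \<not> sun T \<Longrightarrow> \<Gamma>\<^sub>1 a = Some T \<or> \<Gamma>\<^sub>2 a = Some T"
proof -
  have 1: "\<And>a T. \<Gamma>\<^sub>1 a = Some T \<Longrightarrow> \<Gamma> a = Some T" "\<And>a T. \<Gamma>\<^sub>2 a = Some T \<Longrightarrow> \<Gamma> a = Some T"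
    "\<And>a T. \<Gamma> a = Some T \<Longrightarrow> \<not> sun T \<Longrightarrow> \<Gamma>\<^sub>1 a = Some T \<longleftrightarrow> \<Gamma>\<^sub>2 a = None"
    using assms unfolding sjoin_def by blast+
  show "\<Gamma>\<^sub>1 a = Some T \<Longrightarrow> \<Gamma> a = Some T" "\<Gamma>\<^sub>2 a = Some T \<Longrightarrow> \<Gamma> a = Some T"
    "\<Gamma>\<^sub>1 a = Some T \<Longrightarrow> \<not> sun T \<Longrightarrow> \<Gamma>\<^sub>2 a = None"
    using 1 by blast+
  show "\<Gamma>\<^sub>2 a = Some T \<Longrightarrow> \<not> sun T \<Longrightarrow> \<Gamma>\<^sub>1 a = None"
    using 1 by (metis not_None_eq option.distinct(1) option.inject)
  show "\<Gamma> a = Some T \<Longrightarrow> \<not> sun T \<Longrightarrow> \<Gamma>\<^sub>1 a = Some T \<or> \<Gamma>\<^sub>2 a = Some T"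
    using 1 by (metis not_None_eq)
qed

lemma sjoinI:
  assumes "\<And>a T. \<Gamma>\<^sub>1 a = Some T \<Longrightarrow> \<Gamma> a = Some T" "\<And>a T. \<Gamma>\<^sub>2 a = Some T \<Longrightarrow> \<Gamma> a = Some T"
    "\<And>a T. \<Gamma> a = Some T \<Longrightarrow> \<not> sun T \<Longrightarrow> \<Gamma>\<^sub>1 a = Some T \<longleftrightarrow> \<Gamma>\<^sub>2 a = None"
  shows "sjoin \<Gamma> \<Gamma>\<^sub>1 \<Gamma>\<^sub>2"
  unfolding sjoin_def
proof (intro conjI allI impI)
  show "\<Gamma>\<^sub>1 a = Some T \<Longrightarrow> \<Gamma> a = Some T" for a T by (rule assms(1))
  show "\<Gamma>\<^sub>2 a = Some T \<Longrightarrow> \<Gamma> a = Some T" for a T by (rule assms(2))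
  show "\<Gamma> a = Some T \<Longrightarrow> \<not> sun T \<Longrightarrow> \<Gamma>\<^sub>1 a = Some T \<longleftrightarrow> \<Gamma>\<^sub>2 a = None" for a T by (rule assms(3))
qed

lemma ssplit_sjoin: "ssplit \<Gamma> \<Gamma>\<^sub>1 \<Gamma>\<^sub>2 \<Longrightarrow> sjoin \<Gamma> \<Gamma>\<^sub>1 \<Gamma>\<^sub>2"
proof (rule sjoinI)
  assume s: "ssplit \<Gamma> \<Gamma>\<^sub>1 \<Gamma>\<^sub>2"
  show "\<Gamma>\<^sub>1 a = Some T \<Longrightarrow> \<Gamma> a = Some T" for a T by (rule ssplit_sub(1)[OF s])
  show "\<Gamma>\<^sub>2 a = Some T \<Longrightarrow> \<Gamma> a = Some T" for a T by (rule ssplit_sub(2)[OF s])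
  show "\<Gamma> a = Some T \<Longrightarrow> \<not> sun T \<Longrightarrow> \<Gamma>\<^sub>1 a = Some T \<longleftrightarrow> \<Gamma>\<^sub>2 a = None" for a T
    using ssplit_sub(5,7)[OF s, of a T] by auto
qed

lemma sjoin_sym: "sjoin \<Gamma> \<Gamma>\<^sub>1 \<Gamma>\<^sub>2 \<Longrightarrow> sjoin \<Gamma> \<Gamma>\<^sub>2 \<Gamma>\<^sub>1"
proof (rule sjoinI)
  assume j: "sjoin \<Gamma> \<Gamma>\<^sub>1 \<Gamma>\<^sub>2"
  fix a T assume "\<Gamma> a = Some T" "\<not> sun T"
  then show "\<Gamma>\<^sub>2 a = Some T \<longleftrightarrow> \<Gamma>\<^sub>1 a = None"
    using sjoin_sub(4,5)[OF j, of a T] by auto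
next
  assume j: "sjoin \<Gamma> \<Gamma>\<^sub>1 \<Gamma>\<^sub>2"
  show "\<Gamma>\<^sub>1 a = Some T \<Longrightarrow> \<Gamma> a = Some T" for a T by (rule sjoin_sub(1)[OF j])
  show "\<Gamma>\<^sub>2 a = Some T \<Longrightarrow> \<Gamma> a = Some T" for a T by (rule sjoin_sub(2)[OF j])
qed

text \<open>A linear name occurs on one side only, so its entry can be changed or removed there
  alone, even if the new type is unrestricted.\<close>

lemma sjoin_upd: "sjoin \<Gamma> \<Gamma>\<^sub>1 \<Gamma>\<^sub>2 \<Longrightarrow> \<Gamma>\<^sub>1 x = Some U \<Longrightarrow> \<not> sun U \<Longrightarrow> sjoin (\<Gamma>(x := s)) (\<Gamma>\<^sub>1(x := s)) \<Gamma>\<^sub>2"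
proof (rule sjoinI)
  assume j: "sjoin \<Gamma> \<Gamma>\<^sub>1 \<Gamma>\<^sub>2" and x: "\<Gamma>\<^sub>1 x = Some U" "\<not> sun U"
  note n = sjoin_sub(3)[OF j x]
  show "(\<Gamma>(x := s)) a = Some T" if "(\<Gamma>\<^sub>1(x := s)) a = Some T" for a T
    using that sjoin_sub(1)[OF j] by (simp split: if_splits)
  show "(\<Gamma>(x := s)) a = Some T" if "\<Gamma>\<^sub>2 a = Some T" for a T
    using that sjoin_sub(2)[OF j] n by (cases "a = x") simp_all
  show "(\<Gamma>\<^sub>1(x := s)) a = Some T \<longleftrightarrow> \<Gamma>\<^sub>2 a = None" if "(\<Gamma>(x := s)) a = Some T" "\<not> sun T" for a T
    using that n sjoin_sub(3,5)[OF j, of a T] by (cases "a = x") auto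
qed

lemma sjoin_srem: "sjoin \<Gamma> \<Gamma>\<^sub>1 \<Gamma>\<^sub>2 \<Longrightarrow> \<Gamma>\<^sub>1 v = Some T \<Longrightarrow> sjoin (srem T v \<Gamma>) (srem T v \<Gamma>\<^sub>1) \<Gamma>\<^sub>2"
  by (auto simp: srem_def intro: sjoin_upd)

lemma sjoin_ext: "sjoin \<Gamma> \<Gamma>\<^sub>1 \<Gamma>\<^sub>2 \<Longrightarrow> sjoin (ext A \<Gamma>) (ext A \<Gamma>\<^sub>1) (ext None \<Gamma>\<^sub>2)"
proof (rule sjoinI)
  assume j: "sjoin \<Gamma> \<Gamma>\<^sub>1 \<Gamma>\<^sub>2"
  show "ext A \<Gamma> a = Some T" if "ext A \<Gamma>\<^sub>1 a = Some T" for a T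
    using that sjoin_sub(1)[OF j] by (cases a) simp_all
  show "ext A \<Gamma> a = Some T" if "ext None \<Gamma>\<^sub>2 a = Some T" for a T
    using that sjoin_sub(2)[OF j] by (cases a) simp_all
  show "ext A \<Gamma>\<^sub>1 a = Some T \<longleftrightarrow> ext None \<Gamma>\<^sub>2 a = None" if "ext A \<Gamma> a = Some T" "\<not> sun T" for a T
    using that sjoin_sub(3,5)[OF j, of "a - 1" T] by (cases a) auto
qed

lemma tr_sjoin:
  assumes "tr X \<Gamma>\<^sub>1 P W\<^sub>1" "tr X \<Gamma>\<^sub>2 Q W\<^sub>2" "dom \<Gamma> \<subseteq> X" "sjoin \<Gamma> \<Gamma>\<^sub>1 \<Gamma>\<^sub>2"
  shows "tr X \<Gamma> (SPar P Q) (WPar W\<^sub>1 W\<^sub>2)" "tr X \<Gamma> (SPar Q P) (WPar W\<^sub>2 W\<^sub>1)"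
  using tr_join[OF assms(1,2,3)] tr_join[OF assms(2,1,3)] assms(4) sjoin_sym[OF assms(4)]
  unfolding sjoin_def by blast+

lemma tr_shift:
  assumes "tr X \<Gamma> P W" "dom \<Gamma> \<subseteq> X"
  shows "tr (up X) (ext None \<Gamma>) (sren Suc P) (wren Suc W)"
proof (rule tr_ren[OF assms(1) _ keeps_fresh_up(1) assms(2)])
  show "srel Suc \<Gamma> (ext None \<Gamma>)"
  proof (rule srelI)
    show "\<exists>a. Suc a = b \<and> \<Gamma> a = Some T" if "ext None \<Gamma> b = Some T" for b T
      using that by (cases b) auto
  qed auto
qed

definition wjoin :: "wctx \<Rightarrow> wctx \<Rightarrow> wctx \<Rightarrow> bool" where
  "wjoin \<Gamma> \<Gamma>\<^sub>1 \<Gamma>\<^sub>2 \<longleftrightarrow> (\<forall>a V. V \<in> \<Gamma> a \<longleftrightarrow> V \<in> \<Gamma>\<^sub>1 a \<or> V \<in> \<Gamma>\<^sub>2 a) \<and> (\<forall>a V. V \<in> \<Gamma>\<^sub>1 a \<longrightarrow> V \<in> \<Gamma>\<^sub>2 a \<longrightarrow> wun V)"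

lemma wjoinD:
  assumes "wjoin \<Gamma> \<Gamma>\<^sub>1 \<Gamma>\<^sub>2"
  shows "V \<in> \<Gamma> a \<longleftrightarrow> V \<in> \<Gamma>\<^sub>1 a \<or> V \<in> \<Gamma>\<^sub>2 a" "V \<in> \<Gamma>\<^sub>1 a \<Longrightarrow> V \<in> \<Gamma>\<^sub>2 a \<Longrightarrow> wun V"
  using assms unfolding wjoin_def by blast+

lemma wsplit_wjoin: "wsplit \<Gamma> \<Gamma>\<^sub>1 \<Gamma>\<^sub>2 \<Longrightarrow> wjoin \<Gamma> \<Gamma>\<^sub>1 \<Gamma>\<^sub>2"
  unfolding wjoin_def by (meson wsplit_sub)

lemma wjoin_sym: "wjoin \<Gamma> \<Gamma>\<^sub>1 \<Gamma>\<^sub>2 \<Longrightarrow> wjoin \<Gamma> \<Gamma>\<^sub>2 \<Gamma>\<^sub>1"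
  unfolding wjoin_def by blast

lemma wjoin_rem:
  assumes j: "wjoin \<Gamma> \<Gamma>\<^sub>1 \<Gamma>\<^sub>2" and V: "V \<in> \<Gamma>\<^sub>1 x"
  shows "wjoin (rem V x \<Gamma>) (rem V x \<Gamma>\<^sub>1) \<Gamma>\<^sub>2"
proof (cases "wun V")
  case False
  then have "V \<notin> \<Gamma>\<^sub>2 x" using wjoinD(2)[OF j V] by blast
  then show ?thesis using j False unfolding wjoin_def rem_def by (auto split: if_splits)
qed (use j in simp)

lemma wjoin_ext: "wjoin \<Gamma> \<Gamma>\<^sub>1 \<Gamma>\<^sub>2 \<Longrightarrow> wjoin (ext A \<Gamma>) (ext A \<Gamma>\<^sub>1) (ext {} \<Gamma>\<^sub>2)"
  unfolding wjoin_def by (simp add: ext_if)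

lemma wta_wjoin:
  assumes "wta \<Gamma>\<^sub>1 P L\<^sub>1" "wta \<Gamma>\<^sub>2 Q L\<^sub>2" "wgood X P" "wgood X Q" "\<And>z. z \<notin> X \<Longrightarrow> \<Gamma> z = {}" "wjoin \<Gamma> \<Gamma>\<^sub>1 \<Gamma>\<^sub>2"
  shows "wta \<Gamma> (WPar P Q) (L\<^sub>1 \<union> L\<^sub>2)" "wta \<Gamma> (WPar Q P) (L\<^sub>2 \<union> L\<^sub>1)"
proof -
  show "wta \<Gamma> (WPar P Q) (L\<^sub>1 \<union> L\<^sub>2)"
    by (rule wta_join[OF assms(1-5) wjoinD[OF assms(6)]])
  show "wta \<Gamma> (WPar Q P) (L\<^sub>2 \<union> L\<^sub>1)"
    by (rule wta_join[OF assms(2,1,4,3,5) wjoinD[OF wjoin_sym[OF assms(6)]]])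
qed

text \<open>What the inductions below require of the renaming \<open>g\<close> of a translation with
  scope \<open>X\<close> and of the weighted context that types the renamed translation. Below a
  restriction \<open>g\<close> becomes \<open>lift g \<circ> res_map\<close>.\<close>

definition wfits :: "(name \<Rightarrow> name) \<Rightarrow> name set \<Rightarrow> name set \<Rightarrow> wctx \<Rightarrow> bool" where
  "wfits g X Y \<Gamma> \<longleftrightarrow> keeps_fresh g X Y \<and> (\<forall>z. z \<notin> Y \<longrightarrow> \<Gamma> z = {})"

lemma wfits_res: "wfits g X Y \<Gamma> \<Longrightarrow> wfits (lift g \<circ> res_map) (up (up X)) (up Y) (ext A \<Gamma>)"
  unfolding wfits_def
proof (intro conjI allI impI)
  assume w: "keeps_fresh g X Y \<and> (\<forall>z. z \<notin> Y \<longrightarrow> \<Gamma> z = {})"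
  show "keeps_fresh (lift g \<circ> res_map) (up (up X)) (up Y)"
    using w by (intro keeps_fresh_comp[OF keeps_fresh_lift keeps_fresh_up(3)]) simp
  show "ext A \<Gamma> z = {}" if "z \<notin> up Y" for z using w that by (cases z) auto
qed

lemma wfits_split:
  assumes "wsplit \<Gamma> \<Gamma>\<^sub>1 \<Gamma>\<^sub>2" "wfits g X Y \<Gamma>"
  shows "wfits g X Y \<Gamma>\<^sub>1" "wfits g X Y \<Gamma>\<^sub>2"
  using assms(2) wsplit_sub(1,2)[OF assms(1)] unfolding wfits_def by blast+

lemma wta_shift:
  assumes "wta \<Gamma> W L" "wgood X W" "\<And>z. z \<notin> X \<Longrightarrow> \<Gamma> z = {}"
  shows "wta (ext {} \<Gamma>) (wren Suc W) L"
proof (rule wta_ren[OF assms(2,1) _ keeps_fresh_up(1) assms(3)])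
  show "wrel (wfn W) Suc \<Gamma> (ext {} \<Gamma>)"
  proof (rule wrelI)
    show "\<exists>a. Suc a = b \<and> V \<in> \<Gamma> a" if "V \<in> ext {} \<Gamma> b" for b V
      using that by (cases b) auto
  qed auto
  show "ext {} \<Gamma> z = {}" if "z \<notin> up X" for z using that assms(3) by (cases z) auto
qed

lemma keeps_fresh_swap_co: "keeps_fresh swap_co (up (up X)) (up (up X))"
  by (auto simp: keeps_fresh_def up_def swap_co_def split: if_splits)

lemma wta_swap:
  assumes "wta (ext A (ext B \<Gamma>)) W L" "wgood (up (up X)) W" "\<And>z. z \<notin> X \<Longrightarrow> \<Gamma> z = {}"
  shows "wta (ext B (ext A \<Gamma>)) (wren swap_co W) L"
proof (rule wta_ren[OF assms(2,1) _ keeps_fresh_swap_co])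
  have eq: "ext B (ext A \<Gamma>) (swap_co a) = ext A (ext B \<Gamma>) a" for a
    by (auto simp: swap_co_def ext_if)
  have sw: "swap_co (swap_co a) = a" for a by (simp add: swap_co_def)
  show "wrel (wfn W) swap_co (ext A (ext B \<Gamma>)) (ext B (ext A \<Gamma>))"
  proof (rule wrelI)
    show "\<exists>a. swap_co a = b \<and> V \<in> ext A (ext B \<Gamma>) a" if "V \<in> ext B (ext A \<Gamma>) b" for b V
      using that eq[of "swap_co b"] sw by (intro exI[of _ "swap_co b"]) simp
    show "c = a" if "swap_co c = swap_co a" for a c using that sw by metis
  qed (simp add: eq)
  show "ext A (ext B \<Gamma>) z = {}" "ext B (ext A \<Gamma>) z = {}" if "z \<notin> up (up X)" for z
    using that assms(3) by (cases z; cases "z - 1"; auto)+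
qed

lemma wrot2: "wrot 2 0 = Suc 0" "wrot 2 (Suc 0) = Suc (Suc 0)" "wrot 2 (Suc (Suc 0)) = 0" "wrot 2 (Suc (Suc (Suc i))) = Suc (Suc (Suc i))"
  by (simp_all add: wrot_def)

lemma wrot1: "wrot (Suc 0) = swap_co"
  by (auto simp: wrot_def swap_co_def fun_eq_iff)

text \<open>A restriction passes two binders at once: the continuation and the payload of a bound
  linear output, or the two parameters of a linear input.\<close>

lemma wta_rot:
  assumes "wta (ext A (ext B (ext C \<Gamma>))) W L" "wgood (up (up (up X))) W" "\<And>z. z \<notin> X \<Longrightarrow> \<Gamma> z = {}"
  shows "wta (ext C (ext A (ext B \<Gamma>))) (wren (wrot 2) W) L"
proof (rule wta_ren[OF assms(2,1)])
  have cases3: "a = 0 \<or> a = Suc 0 \<or> a = Suc (Suc 0) \<or> (\<exists>i. a = Suc (Suc (Suc i)))" for a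
    by (metis not0_implies_Suc)
  have eq: "ext C (ext A (ext B \<Gamma>)) (wrot 2 a) = ext A (ext B (ext C \<Gamma>)) a" for a
    using cases3[of a] by (auto simp: wrot2)
  have inj: "c = a" if "wrot 2 c = wrot 2 a" for a c
    using that by (auto simp: wrot_def split: if_splits)
  have surj: "\<exists>a. wrot 2 a = b" for b
    using cases3[of b] by (metis wrot2)
  show "wrel (wfn W) (wrot 2) (ext A (ext B (ext C \<Gamma>))) (ext C (ext A (ext B \<Gamma>)))"
  proof (rule wrelI)
    show "\<exists>a. wrot 2 a = b \<and> V \<in> ext A (ext B (ext C \<Gamma>)) a" if "V \<in> ext C (ext A (ext B \<Gamma>)) b" for b V
      using that surj[of b] eq by metis
  qed (simp_all add: eq inj)
  show "keeps_fresh (wrot 2) (up (up (up X))) (up (up (up X)))"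
    unfolding keeps_fresh_def
  proof (intro allI impI conjI)
    fix z assume "z \<notin> up (up (up X))"
    then show "wrot 2 z \<notin> up (up (up X))"
      using cases3[of z] by (auto simp: wrot2)
    fix a assume "wrot 2 a = wrot 2 z" then show "a = z" by (rule inj)
  qed
  show "ext A (ext B (ext C \<Gamma>)) z = {}" "ext C (ext A (ext B \<Gamma>)) z = {}" if "z \<notin> up (up (up X))" for z
    using that assms(3) cases3[of z] by auto
qed

lemma rem_empty: "\<Gamma> z = {} \<Longrightarrow> rem V x \<Gamma> z = {}"
  using rem_sub[of V x \<Gamma> z] by simp

subsection \<open>Outputs\<close>

inductive_cases tr_SOutE: "tr X \<Gamma> (SOut x v P) W"
inductive_cases tr_SInE: "tr X \<Gamma> (SIn q x P) W"
inductive_cases tr_SParE: "tr X \<Gamma> (SPar P Q) W"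
inductive_cases tr_SResE: "tr X \<Gamma> (SRes P) W"

text \<open>Shows which component of a split owns a linear subject: the label can only come from a
  context that gives the subject an output type.\<close>

lemma outs_type:
  "outs P x v p \<Longrightarrow> tr X \<Gamma> P W \<Longrightarrow> \<exists>T. (\<exists>S. \<Gamma> x = Some (TLOut T S)) \<or> \<Gamma> x = Some (TCli T)"
proof (induction P arbitrary: x v p X \<Gamma> W)
  case (SOut y w P)
  then show ?case by (auto elim!: tr_SOutE)
next
  case (SPar P Q)
  from SPar.prems(2) obtain \<Gamma>\<^sub>1 \<Gamma>\<^sub>2 W\<^sub>1 W\<^sub>2 where "ssplit \<Gamma> \<Gamma>\<^sub>1 \<Gamma>\<^sub>2" "tr X \<Gamma>\<^sub>1 P W\<^sub>1" "tr X \<Gamma>\<^sub>2 Q W\<^sub>2"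
    by (rule tr_SParE)
  then show ?case using SPar.prems(1) SPar.IH ssplit_sub(1,2) by (simp, meson)
next
  case (SRes P)
  from SRes.prems obtain p' where "outs P (Suc (Suc x)) (Suc (Suc v)) p'" by auto
  from SRes.prems(2) SRes.IH[OF this] show ?case by (auto elim!: tr_SResE) fastforce+
qed auto

lemma bouts_type:
  "bouts P x p \<Longrightarrow> tr X \<Gamma> P W \<Longrightarrow> \<exists>T. (\<exists>S. \<Gamma> x = Some (TLOut T S)) \<or> \<Gamma> x = Some (TCli T)"
proof (induction P arbitrary: x p X \<Gamma> W)
  case (SPar P Q)
  from SPar.prems(2) obtain \<Gamma>\<^sub>1 \<Gamma>\<^sub>2 W\<^sub>1 W\<^sub>2 where "ssplit \<Gamma> \<Gamma>\<^sub>1 \<Gamma>\<^sub>2" "tr X \<Gamma>\<^sub>1 P W\<^sub>1" "tr X \<Gamma>\<^sub>2 Q W\<^sub>2"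
    by (rule tr_SParE)
  then show ?case using SPar.prems(1) SPar.IH ssplit_sub(1,2) by (simp, meson)
next
  case (SRes P)
  from SRes.prems(2) obtain T V where
    t: "tr (up (up X)) (ext (Some T) (ext (Some (sdual T)) \<Gamma>)) P V" by (auto elim!: tr_SResE)
  consider v p' where "outs P (x + 2) v p'" | p' where "bouts P (x + 2) p'" using SRes.prems(1) by auto
  then show ?case
    by cases (use outs_type[OF _ t] SRes.IH[OF _ t] in fastforce)+
qed auto

lemma ins_type:
  "ins P y p \<Longrightarrow> tr X \<Gamma> P W \<Longrightarrow> \<exists>T. (\<exists>S. \<Gamma> y = Some (TLIn T S)) \<or> \<Gamma> y = Some (TSrv T)"
proof (induction P arbitrary: y p X \<Gamma> W)
  case (SIn q x P)
  then show ?case by (auto elim!: tr_SInE)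
next
  case (SPar P Q)
  from SPar.prems(2) obtain \<Gamma>\<^sub>1 \<Gamma>\<^sub>2 W\<^sub>1 W\<^sub>2 where "ssplit \<Gamma> \<Gamma>\<^sub>1 \<Gamma>\<^sub>2" "tr X \<Gamma>\<^sub>1 P W\<^sub>1" "tr X \<Gamma>\<^sub>2 Q W\<^sub>2"
    by (rule tr_SParE)
  then show ?case using SPar.prems(1) SPar.IH ssplit_sub(1,2) by (simp, meson)
next
  case (SRes P)
  from SRes.prems obtain p' where "ins P (Suc (Suc y)) p'" by auto
  from SRes.prems(2) SRes.IH[OF this] show ?case by (auto elim!: tr_SResE) fastforce+
qed auto

text \<open>The renaming \<open>lift g \<circ> out_map x\<close> in closed form; index 0 is the
  continuation that the linear output extrudes.\<close>

definition out_ren :: "(name \<Rightarrow> name) \<Rightarrow> name \<Rightarrow> name \<Rightarrow> name" where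
  "out_ren g x i = (if i = x then 0 else Suc (g i))"

lemma keeps_fresh_out_ren: "keeps_fresh g X Y \<Longrightarrow> x \<in> X \<Longrightarrow> keeps_fresh (out_ren g x) X (up Y)"
  by (auto simp: keeps_fresh_def out_ren_def split: if_splits)

lemma tr_dom_par:
  assumes "ssplit \<Gamma> \<Gamma>\<^sub>1 \<Gamma>\<^sub>2" "dom \<Gamma> \<subseteq> X"
  shows "dom \<Gamma>\<^sub>1 \<subseteq> X" "dom \<Gamma>\<^sub>2 \<subseteq> X"
  using ssplit_sub(1,2)[OF assms(1)] assms(2) by blast+

lemma ssplit_sym: "ssplit \<Gamma> \<Gamma>\<^sub>1 \<Gamma>\<^sub>2 \<Longrightarrow> ssplit \<Gamma> \<Gamma>\<^sub>2 \<Gamma>\<^sub>1"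
  unfolding ssplit_alt by (simp split: if_splits) blast

lemma wsplit_sym: "wsplit \<Gamma> \<Gamma>\<^sub>1 \<Gamma>\<^sub>2 \<Longrightarrow> wsplit \<Gamma> \<Gamma>\<^sub>2 \<Gamma>\<^sub>1"
  unfolding wsplit_def by (metis Un_commute)

lemma wfits_fresh: "wfits g X Y \<Gamma> \<Longrightarrow> z \<notin> Y \<Longrightarrow> \<Gamma> z = {}"
  by (simp add: wfits_def)

lemma wfits_wgood:
  assumes "wfits g X Y \<Gamma>" "tr X \<Delta> P W" "dom \<Delta> \<subseteq> X"
  shows "wgood Y (wren g W)"
  using assms by (auto simp: wfits_def intro: wgood_wren tr_wgood)

lemma sjoin_dom: "sjoin \<Gamma> \<Gamma>\<^sub>1 \<Gamma>\<^sub>2 \<Longrightarrow> \<Gamma>\<^sub>1 x = Some U \<Longrightarrow> \<not> sun U \<Longrightarrow> x \<notin> dom \<Gamma>\<^sub>2"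
  by (simp add: domIff sjoin_sub(3))

lemma dom_upd_srem: "dom \<Gamma> \<subseteq> X \<Longrightarrow> x \<in> X \<Longrightarrow> dom ((srem T v \<Gamma>)(x := s)) \<subseteq> X" "dom \<Gamma> \<subseteq> X \<Longrightarrow> dom (srem T v \<Gamma>) \<subseteq> X"
  by (auto simp: srem_def split: if_splits)

lemma srem_ext: "srem T (Suc v) (ext A \<Gamma>) = ext A (srem T v \<Gamma>)"
  by (auto simp: srem_def fun_eq_iff ext_if)

lemma ext_upd_Suc: "(ext A \<Gamma>)(Suc x := s) = ext A (\<Gamma>(x := s))"
  by (auto simp: fun_eq_iff ext_if)

text \<open>A restriction that stays behind has to pass the extruded continuation. This is the
  exchange that \<open>wl_res_out\<close> performs for one extruded name.\<close>

lemma lift_out_ren: "lift (out_ren g x) \<circ> res_map = swap_co \<circ> out_ren (lift g \<circ> res_map) (Suc (Suc x))"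
  by (auto simp: fun_eq_iff lift_if out_ren_def res_map_def swap_co_def numeral_eq_Suc)

text \<open>
  The residual of the source keeps the name \<open>x\<close>, with its continuation type, where the residual of the
  translation has the extruded continuation, which is index 0.
\<close>

definition out_lin_typed :: "(name \<Rightarrow> name) \<Rightarrow> name \<Rightarrow> name \<Rightarrow> wproc \<Rightarrow> wctx \<Rightarrow> bool" where
  "out_lin_typed g x v W' \<Gamma> \<longleftrightarrow> (\<exists>n V\<^sub>1 V\<^sub>2 L. weights_pos V\<^sub>2 \<and> VOut n V\<^sub>1 V\<^sub>2 \<in> \<Gamma> (g x)
     \<and> V\<^sub>1 \<in> rem (VOut n V\<^sub>1 V\<^sub>2) (g x) \<Gamma> (g v)
     \<and> wta (ext {V\<^sub>2} (rem V\<^sub>1 (g v) (rem (VOut n V\<^sub>1 V\<^sub>2) (g x) \<Gamma>))) (wren (out_ren g x) W') L)"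

text \<open>The idle component is shifted below the extruded name and has no assumption on it; the
  continuation type remains with the sender.\<close>

lemma out_lin_typed_par:
  assumes j: "wjoin \<Delta> \<Delta>\<^sub>1 \<Delta>\<^sub>2" and f: "wfits g X Y \<Delta>" and xX: "x \<in> X"
    and o: "out_lin_typed g x v W' \<Delta>\<^sub>1"
    and Q: "wta \<Delta>\<^sub>2 V L" "wgood Y V" and W': "wgood X W'" and ren: "wren Suc V = wren (out_ren g x) W\<^sub>Q"
  shows "out_lin_typed g x v (WPar W' W\<^sub>Q) \<Delta>" "out_lin_typed g x v (WPar W\<^sub>Q W') \<Delta>"
proof -
  from o obtain n V\<^sub>1 V\<^sub>2 L' where o: "weights_pos V\<^sub>2" "VOut n V\<^sub>1 V\<^sub>2 \<in> \<Delta>\<^sub>1 (g x)"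
    "V\<^sub>1 \<in> rem (VOut n V\<^sub>1 V\<^sub>2) (g x) \<Delta>\<^sub>1 (g v)"
    "wta (ext {V\<^sub>2} (rem V\<^sub>1 (g v) (rem (VOut n V\<^sub>1 V\<^sub>2) (g x) \<Delta>\<^sub>1))) (wren (out_ren g x) W') L'"
    unfolding out_lin_typed_def by blast
  let ?\<Delta> = "rem (VOut n V\<^sub>1 V\<^sub>2) (g x) \<Delta>"
  note j1 = wjoin_rem[OF j o(2)]
  note j2 = wjoin_ext[OF wjoin_rem[OF j1 o(3)], of "{V\<^sub>2}"]
  have fr2: "\<Delta>\<^sub>2 z = {}" if "z \<notin> Y" for z
    using wfits_fresh[OF f that] wjoinD(1)[OF j] by blast
  have sh: "wta (ext {} \<Delta>\<^sub>2) (wren (out_ren g x) W\<^sub>Q) L"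
    using wta_shift[OF Q fr2] unfolding ren by simp
  have gd: "wgood (up Y) (wren (out_ren g x) W')" "wgood (up Y) (wren (out_ren g x) W\<^sub>Q)"
    using f xX W' wgood_wren[OF Q(2) keeps_fresh_up(1)] unfolding ren
    by (auto simp: wfits_def intro!: wgood_wren keeps_fresh_out_ren)
  have fr: "ext {V\<^sub>2} (rem V\<^sub>1 (g v) ?\<Delta>) z = {}" if "z \<notin> up Y" for z
    using that wfits_fresh[OF f] by (cases z) (simp_all add: rem_empty)
  have "V\<^sub>1 \<in> ?\<Delta> (g v)" "VOut n V\<^sub>1 V\<^sub>2 \<in> \<Delta> (g x)"
    using o(2,3) wjoinD(1)[OF j1] wjoinD(1)[OF j] by blast+
  with o(1) wta_wjoin[OF o(4) sh gd fr j2]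
  show "out_lin_typed g x v (WPar W' W\<^sub>Q) \<Delta>" "out_lin_typed g x v (WPar W\<^sub>Q W') \<Delta>"
    unfolding out_lin_typed_def by auto
qed

text \<open>One induction delivers the residual of the source, the transition of the translation
  under every renaming, and the typing of the derivative, because all three must speak of the same
  \<open>P'\<close> and \<open>W'\<close>.\<close>

lemma out_lin:
  "outs P x v p \<Longrightarrow> tr X \<Gamma> P W \<Longrightarrow> dom \<Gamma> \<subseteq> X \<Longrightarrow> \<Gamma> x = Some (TLOut T S) \<Longrightarrow>
    \<exists>P' W'. \<Gamma> v = Some T \<and> v \<noteq> x \<and> abs_sq P' = p \<and> tr X ((srem T v \<Gamma>)(x \<mapsto> S)) P' W'
      \<and> (\<forall>g. wlts (wren g W) (AOut 1 (g x) (Suc (g v)) 0) (wren (out_ren g x) W'))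
      \<and> (\<forall>g Y \<Delta> L. wfits g X Y \<Delta> \<longrightarrow> wta \<Delta> (wren g W) L \<longrightarrow> out_lin_typed g x v W' \<Delta>)"
proof (induction P arbitrary: x v p X \<Gamma> W)
  case (SOut y w P)
  then have e: "y = x" "w = v" "p = abs_sq P" by auto
  from SOut.prems(2,4) obtain W' where t: "\<Gamma> v = Some T" "v \<noteq> x" "tr X ((srem T v \<Gamma>)(x \<mapsto> S)) P W'"
    "W = WRes (WOut (Suc x) (Suc v) 0 (wren (out_map x) W'))"
    unfolding e by (auto elim!: tr_SOutE)
  have g: "wren g W = WRes (WOut (Suc (g x)) (Suc (g v)) 0 (wren (out_ren g x) W'))" for g
  proof -
    have "lift g \<circ> out_map x = out_ren g x" by (auto simp: out_map_def out_ren_def)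
    then show ?thesis by (simp add: t wren_wren)
  qed
  have "wlts (wren g W) (AOut 1 (g x) (Suc (g v)) 0) (wren (out_ren g x) W')" for g
    unfolding g using wl_open[OF wl_out] by simp
  moreover have "out_lin_typed g x v W' \<Delta>" if "wta \<Delta> (wren g W) L" for g \<Delta> L
    using that unfolding g out_lin_typed_def by (elim wta_lin_outE) blast
  ultimately show ?case using t e by blast
next
  case (SPar P Q)
  from SPar.prems(2) obtain \<Gamma>\<^sub>1 \<Gamma>\<^sub>2 W\<^sub>1 W\<^sub>2 where W: "W = WPar W\<^sub>1 W\<^sub>2" and s: "ssplit \<Gamma> \<Gamma>\<^sub>1 \<Gamma>\<^sub>2"
    and t: "tr X \<Gamma>\<^sub>1 P W\<^sub>1" "tr X \<Gamma>\<^sub>2 Q W\<^sub>2" by (auto elim!: tr_SParE)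
  note d = tr_dom_par[OF s SPar.prems(3)]
  have xX: "x \<in> X" using SPar.prems(3,4) by auto
  \<comment> \<open>Either component can be the sender; this treats the sender \<open>P'\<close> and
    the idle \<open>Q\<close> in both orders.\<close>
  have step: "\<Gamma> v = Some T \<and> v \<noteq> x
      \<and> tr X ((srem T v \<Gamma>)(x \<mapsto> S)) (SPar P' Q) (WPar W' W\<^sub>Q) \<and> tr X ((srem T v \<Gamma>)(x \<mapsto> S)) (SPar Q P') (WPar W\<^sub>Q W')
      \<and> (\<forall>g. wren (\<lambda>i. i + 1) (wren g W\<^sub>Q) = wren (out_ren g x) W\<^sub>Q)
      \<and> (\<forall>g Y \<Delta> \<Delta>\<^sub>1 \<Delta>\<^sub>2 L. wfits g X Y \<Delta> \<longrightarrow> wsplit \<Delta> \<Delta>\<^sub>1 \<Delta>\<^sub>2 \<longrightarrow> out_lin_typed g x v W' \<Delta>\<^sub>1 \<longrightarrow> wta \<Delta>\<^sub>2 (wren g W\<^sub>Q) L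
          \<longrightarrow> out_lin_typed g x v (WPar W' W\<^sub>Q) \<Delta> \<and> out_lin_typed g x v (WPar W\<^sub>Q W') \<Delta>)"
    if s: "ssplit \<Gamma> \<Gamma>\<^sub>P \<Gamma>\<^sub>Q" and tQ: "tr X \<Gamma>\<^sub>Q Q W\<^sub>Q" and x: "\<Gamma>\<^sub>P x = Some (TLOut T S)" and v: "\<Gamma>\<^sub>P v = Some T" "v \<noteq> x"
      and t': "tr X ((srem T v \<Gamma>\<^sub>P)(x \<mapsto> S)) P' W'"
    for \<Gamma>\<^sub>P \<Gamma>\<^sub>Q P' Q W' W\<^sub>Q
  proof -
    note d = tr_dom_par[OF s SPar.prems(3)]
    have j: "sjoin ((srem T v \<Gamma>)(x \<mapsto> S)) ((srem T v \<Gamma>\<^sub>P)(x \<mapsto> S)) \<Gamma>\<^sub>Q"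
      using x v by (intro sjoin_upd[OF sjoin_srem[OF ssplit_sjoin[OF s]]]) (auto simp: srem_def)
    note tr = tr_sjoin[OF t' tQ dom_upd_srem(1)[OF SPar.prems(3) xX] j]
    \<comment> \<open>The linear subject belongs to the sender, so on the idle component the
      replacement of \<open>x\<close> is a mere shift.\<close>
    have xQ: "x \<notin> dom \<Gamma>\<^sub>Q" using sjoin_dom[OF ssplit_sjoin[OF s] x] by simp
    have ren: "wren (\<lambda>i. i + 1) (wren g W\<^sub>Q) = wren (out_ren g x) W\<^sub>Q" for g
      unfolding wren_wren by (rule tr_wren_cong[OF tQ]) (use xQ xX in \<open>auto simp: out_ren_def\<close>)
    have "out_lin_typed g x v (WPar W' W\<^sub>Q) \<Delta> \<and> out_lin_typed g x v (WPar W\<^sub>Q W') \<Delta>"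
      if f: "wfits g X Y \<Delta>" and ws: "wsplit \<Delta> \<Delta>\<^sub>1 \<Delta>\<^sub>2" and o: "out_lin_typed g x v W' \<Delta>\<^sub>1" and wQ: "wta \<Delta>\<^sub>2 (wren g W\<^sub>Q) L"
      for g Y \<Delta> \<Delta>\<^sub>1 \<Delta>\<^sub>2 L
      using out_lin_typed_par[OF wsplit_wjoin[OF ws] f xX o wQ wfits_wgood[OF f tQ d(2)]
          tr_wgood[OF t' dom_upd_srem(1)[OF d(1) xX]]] ren by simp
    with tr ren ssplit_sub(1)[OF s v(1)] v(2) show ?thesis by blast
  qed
  from SPar.prems(1) consider (l) p' where "outs P x v p'" "p = p' \<parallel> abs_sq Q"
    | (r) q' where "outs Q x v q'" "p = abs_sq P \<parallel> q'" by auto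
  then show ?case
  proof cases
    case l
    have x: "\<Gamma>\<^sub>1 x = Some (TLOut T S)"
      using outs_type[OF l(1) t(1)] ssplit_sub(1)[OF s] SPar.prems(4) by fastforce
    from SPar.IH(1)[OF l(1) t(1) d(1) x] obtain P' W' where h: "\<Gamma>\<^sub>1 v = Some T" "v \<noteq> x" "abs_sq P' = p'"
      "tr X ((srem T v \<Gamma>\<^sub>1)(x \<mapsto> S)) P' W'"
      "\<And>g. wlts (wren g W\<^sub>1) (AOut 1 (g x) (Suc (g v)) 0) (wren (out_ren g x) W')"
      "\<And>g Y \<Delta> L. wfits g X Y \<Delta> \<Longrightarrow> wta \<Delta> (wren g W\<^sub>1) L \<Longrightarrow> out_lin_typed g x v W' \<Delta>" by blast
    note st = step[OF s t(2) x h(1,2,4)]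
    have "wlts (wren g W) (AOut 1 (g x) (Suc (g v)) 0) (wren (out_ren g x) (WPar W' W\<^sub>2))" for g
      using wl_par_out1[OF h(5)[of g], of "wren g W\<^sub>2"] st by (simp add: W)
    moreover have "out_lin_typed g x v (WPar W' W\<^sub>2) \<Delta>" if "wfits g X Y \<Delta>" "wta \<Delta> (wren g W) L" for g Y \<Delta> L
      using that(2) unfolding W wren.simps
      by (elim wta_WParE) (use st h(6) that(1) wfits_split in meson)
    ultimately show ?thesis using st h(3) l(2) by (intro exI[of _ "SPar P' Q"] exI[of _ "WPar W' W\<^sub>2"]) (simp add: abs_sq_simps del: fun_upd_apply)
  next
    case r
    have x: "\<Gamma>\<^sub>2 x = Some (TLOut T S)"
      using outs_type[OF r(1) t(2)] ssplit_sub(2)[OF s] SPar.prems(4) by fastforce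
    from SPar.IH(2)[OF r(1) t(2) d(2) x] obtain P' W' where h: "\<Gamma>\<^sub>2 v = Some T" "v \<noteq> x" "abs_sq P' = q'"
      "tr X ((srem T v \<Gamma>\<^sub>2)(x \<mapsto> S)) P' W'"
      "\<And>g. wlts (wren g W\<^sub>2) (AOut 1 (g x) (Suc (g v)) 0) (wren (out_ren g x) W')"
      "\<And>g Y \<Delta> L. wfits g X Y \<Delta> \<Longrightarrow> wta \<Delta> (wren g W\<^sub>2) L \<Longrightarrow> out_lin_typed g x v W' \<Delta>" by blast
    note st = step[OF ssplit_sym[OF s] t(1) x h(1,2,4)]
    have "wlts (wren g W) (AOut 1 (g x) (Suc (g v)) 0) (wren (out_ren g x) (WPar W\<^sub>1 W'))" for g
      using wl_par_out2[OF h(5)[of g], of "wren g W\<^sub>1"] st by (simp add: W)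
    moreover have "out_lin_typed g x v (WPar W\<^sub>1 W') \<Delta>" if "wfits g X Y \<Delta>" "wta \<Delta> (wren g W) L" for g Y \<Delta> L
      using that(2) unfolding W wren.simps
      by (elim wta_WParE) (use st h(6) that(1) wfits_split wsplit_sym in meson)
    ultimately show ?thesis using st h(3) r(2) by (intro exI[of _ "SPar P P'"] exI[of _ "WPar W\<^sub>1 W'"]) (simp add: abs_sq_simps del: fun_upd_apply)
  qed
next
  case (SRes P)
  from SRes.prems(1) obtain q where q: "outs P (Suc (Suc x)) (Suc (Suc v)) q" "p = qres q" by auto
  from SRes.prems(2) obtain U W\<^sub>0 where W: "W = WRes (wren res_map W\<^sub>0)"
    and t: "tr (up (up X)) (ext (Some U) (ext (Some (sdual U)) \<Gamma>)) P W\<^sub>0" by (auto elim!: tr_SResE)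
  let ?\<Gamma> = "ext (Some U) (ext (Some (sdual U)) \<Gamma>)"
  have d: "dom ?\<Gamma> \<subseteq> up (up X)" using SRes.prems(3) unfolding ext_dom by (auto simp: up_def)
  have x': "?\<Gamma> (Suc (Suc x)) = Some (TLOut T S)" using SRes.prems(4) by simp
  from SRes.IH[OF q(1) t d x'] obtain P' W' where h: "\<Gamma> v = Some T" "v \<noteq> x" "abs_sq P' = q"
    "tr (up (up X)) ((srem T (Suc (Suc v)) ?\<Gamma>)(Suc (Suc x) \<mapsto> S)) P' W'"
    "\<And>g. wlts (wren g W\<^sub>0) (AOut 1 (g (Suc (Suc x))) (Suc (g (Suc (Suc v)))) 0) (wren (out_ren g (Suc (Suc x))) W')"
    "\<And>g Y \<Delta> L. wfits g (up (up X)) Y \<Delta> \<Longrightarrow> wta \<Delta> (wren g W\<^sub>0) L \<Longrightarrow> out_lin_typed g (Suc (Suc x)) (Suc (Suc v)) W' \<Delta>"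
    unfolding ext_simps by blast
  have t': "tr X ((srem T v \<Gamma>)(x \<mapsto> S)) (SRes P') (WRes (wren res_map W'))"
    using h(4) unfolding srem_ext ext_upd_Suc by (rule tr.res)
  have dW': "wgood (up (up X)) W'"
    by (rule tr_wgood[OF h(4) dom_upd_srem(1)[OF d]]) (use SRes.prems(3,4) in auto)
  have g: "wren g W = WRes (wren (lift g \<circ> res_map) W\<^sub>0)"
    "wren (out_ren g x) (WRes (wren res_map W')) = WRes (wren swap_co (wren (out_ren (lift g \<circ> res_map) (Suc (Suc x))) W'))"
    "(lift g \<circ> res_map) (Suc (Suc i)) = Suc (g i)" for g i
    by (simp_all add: W wren_wren lift_out_ren) (simp add: res_map_def)
  have "wlts (wren g W) (AOut 1 (g x) (Suc (g v)) 0) (wren (out_ren g x) (WRes (wren res_map W')))" for g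
  proof -
    have "wlts (wren (lift g \<circ> res_map) W\<^sub>0) (AOut 1 (Suc (g x)) (Suc (Suc (g v))) 0)
        (wren (out_ren (lift g \<circ> res_map) (Suc (Suc x))) W')"
      using h(5)[of "lift g \<circ> res_map"] unfolding g(3) .
    \<comment> \<open>Below the extruded continuation the restricted name has index 1 and is neither
      of the two objects, so it stays behind.\<close>
    from wl_res_out[OF this] show ?thesis unfolding g by (simp add: wrot1 wdrop_def)
  qed
  moreover have "out_lin_typed g x v (WRes (wren res_map W')) \<Delta>"
    if f: "wfits g X Y \<Delta>" and w: "wta \<Delta> (wren g W) L" for g Y \<Delta> L
  proof -
    from w obtain V where V: "weights_pos V" "wta (ext {V, wdual V} \<Delta>) (wren (lift g \<circ> res_map) W\<^sub>0) L"
      unfolding g by (rule wta_WResE)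
    from h(6)[OF wfits_res[OF f] V(2)] obtain n V\<^sub>1 V\<^sub>2 L' where o: "weights_pos V\<^sub>2" "VOut n V\<^sub>1 V\<^sub>2 \<in> \<Delta> (g x)"
        "V\<^sub>1 \<in> rem (VOut n V\<^sub>1 V\<^sub>2) (g x) \<Delta> (g v)"
        "wta (ext {V\<^sub>2} (ext {V, wdual V} (rem V\<^sub>1 (g v) (rem (VOut n V\<^sub>1 V\<^sub>2) (g x) \<Delta>))))
          (wren (out_ren (lift g \<circ> res_map) (Suc (Suc x))) W') L'"
      unfolding out_lin_typed_def g(3) rem_ext ext_simps by blast
    have "wgood (up (up Y)) (wren (out_ren (lift g \<circ> res_map) (Suc (Suc x))) W')"
      using wfits_res[OF f] SRes.prems(3,4)
      by (intro wgood_wren[OF dW'] keeps_fresh_out_ren) (auto simp: wfits_def)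
    from wta_swap[OF o(4) this] wfits_fresh[OF f] V(1)
    have "wta (ext {V\<^sub>2} (rem V\<^sub>1 (g v) (rem (VOut n V\<^sub>1 V\<^sub>2) (g x) \<Delta>))) (wren (out_ren g x) (WRes (wren res_map W'))) L'"
      unfolding g(2) by (auto intro!: wta.res rem_empty)
    with o show ?thesis unfolding out_lin_typed_def by blast
  qed
  ultimately show ?case
    using h(1-3) t' q(2) by (intro exI[of _ "SRes P'"] exI[of _ "WRes (wren res_map W')"]) (auto simp: abs_sq_simps simp del: fun_upd_apply)
qed auto

section \<open>Free outputs of clients\<close>

definition out_cli_typed :: "(name \<Rightarrow> name) \<Rightarrow> name \<Rightarrow> name \<Rightarrow> wproc \<Rightarrow> wctx \<Rightarrow> bool" where
  "out_cli_typed g x v W' \<Gamma> \<longleftrightarrow> (\<exists>n V L. VCli n V \<in> \<Gamma> (g x) \<and> V \<in> \<Gamma> (g v)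
     \<and> wta (rem V (g v) \<Gamma>) (wren g W') L)"

lemma out_cli_typed_par:
  assumes j: "wjoin \<Delta> \<Delta>\<^sub>1 \<Delta>\<^sub>2" and f: "wfits g X Y \<Delta>" and o: "out_cli_typed g x v W' \<Delta>\<^sub>1"
    and Q: "wta \<Delta>\<^sub>2 (wren g W\<^sub>Q) L" "wgood Y (wren g W\<^sub>Q)" and W': "wgood X W'"
  shows "out_cli_typed g x v (WPar W' W\<^sub>Q) \<Delta>" "out_cli_typed g x v (WPar W\<^sub>Q W') \<Delta>"
proof -
  from o obtain n V L' where o: "VCli n V \<in> \<Delta>\<^sub>1 (g x)" "V \<in> \<Delta>\<^sub>1 (g v)" "wta (rem V (g v) \<Delta>\<^sub>1) (wren g W') L'"
    unfolding out_cli_typed_def by blast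
  have fr: "rem V (g v) \<Delta> z = {}" if "z \<notin> Y" for z
    using that wfits_fresh[OF f] by (simp add: rem_empty)
  have gd: "wgood Y (wren g W')" using f W' by (auto simp: wfits_def intro: wgood_wren)
  have "VCli n V \<in> \<Delta> (g x)" "V \<in> \<Delta> (g v)" using o(1,2) wjoinD(1)[OF j] by blast+
  with wta_wjoin[OF o(3) Q(1) gd Q(2) fr wjoin_rem[OF j o(2)]]
  show "out_cli_typed g x v (WPar W' W\<^sub>Q) \<Delta>" "out_cli_typed g x v (WPar W\<^sub>Q W') \<Delta>"
    unfolding out_cli_typed_def by auto
qed

text \<open>After a client output the continuation carries a unit assumption. It is fresh and does
  not occur in the residual, so the assumption can be discarded.\<close>

lemma wta_drop:
  assumes "wta (\<Gamma>(z := A)) W L" "wgood X W" "z \<notin> X" "z \<notin> wfn W" "\<And>y. y \<notin> X \<Longrightarrow> \<Gamma> y = {}"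
  shows "wta \<Gamma> W L"
proof -
  have "wrel (wfn W) id (\<Gamma>(z := A)) \<Gamma>"
    by (rule wrelI) (use assms(3,4,5) in \<open>auto split: if_splits\<close>)
  moreover have "keeps_fresh id (insert z X) X" by (simp add: keeps_fresh_def)
  moreover have "(\<Gamma>(z := A)) y = {}" if "y \<notin> insert z X" for y using that assms(5) by simp
  ultimately show ?thesis
    using wta_ren[OF wgood_insert[OF assms(2,4)] assms(1)] assms(5) by fastforce
qed

lemma out_cli:
  "outs P x v p \<Longrightarrow> tr X \<Gamma> P W \<Longrightarrow> dom \<Gamma> \<subseteq> X \<Longrightarrow> \<Gamma> x = Some (TCli T) \<Longrightarrow>
    \<exists>P' W' z. \<Gamma> v = Some T \<and> abs_sq P' = p \<and> tr X (srem T v \<Gamma>) P' W' \<and> z \<notin> X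
      \<and> (\<forall>g. wlts (wren g W) (AOut 0 (g x) (g v) (g z)) (wren g W'))
      \<and> (\<forall>g Y \<Delta> L. wfits g X Y \<Delta> \<longrightarrow> wta \<Delta> (wren g W) L \<longrightarrow> out_cli_typed g x v W' \<Delta>)"
proof (induction P arbitrary: x v p X \<Gamma> W)
  case (SOut y w P)
  then have e: "y = x" "w = v" "p = abs_sq P" by auto
  from SOut.prems(2,4) obtain W' z where t: "\<Gamma> v = Some T" "tr X (srem T v \<Gamma>) P W'"
    "W = WOut x v z W'" "z \<notin> X" "z \<notin> wfn W'"
    unfolding e by (auto elim!: tr_SOutE)
  have "wlts (wren g W) (AOut 0 (g x) (g v) (g z)) (wren g W')" for g
    unfolding t by (auto intro: wl_out)
  moreover have "out_cli_typed g x v W' \<Delta>" if f: "wfits g X Y \<Delta>" and w: "wta \<Delta> (wren g W) L" for g Y \<Delta> L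
  proof -
    have gz: "g z \<notin> Y" "g z \<notin> wfn (wren g W')"
      using f t(4,5) by (auto simp: wfits_def keeps_fresh_def wfn_wren)
    from w[unfolded t wren.simps] show ?thesis
    proof (cases rule: wta_WOutE)
      case (lin n V\<^sub>1 V\<^sub>2 M)
      \<comment> \<open>The continuation lies outside of the scope and has an empty entry, which
        excludes the linear rule.\<close>
      then show ?thesis using wfits_fresh[OF f gz(1)] by (simp add: rem_empty)
    next
      case (cli n V M)
      have fr: "rem V (g v) \<Delta> y = {}" if "y \<notin> Y" for y
        using that wfits_fresh[OF f] by (simp add: rem_empty)
      have "wta (rem V (g v) \<Delta>) (wren g W') M"
        by (rule wta_drop[OF cli(5) wfits_wgood[OF f t(2) dom_upd_srem(2)[OF SOut.prems(3)]] gz fr])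
      then show ?thesis using cli unfolding out_cli_typed_def by blast
    qed
  qed
  ultimately show ?case using t e by blast
next
  case (SPar P Q)
  from SPar.prems(2) obtain \<Gamma>\<^sub>1 \<Gamma>\<^sub>2 W\<^sub>1 W\<^sub>2 where W: "W = WPar W\<^sub>1 W\<^sub>2" and s: "ssplit \<Gamma> \<Gamma>\<^sub>1 \<Gamma>\<^sub>2"
    and t: "tr X \<Gamma>\<^sub>1 P W\<^sub>1" "tr X \<Gamma>\<^sub>2 Q W\<^sub>2" by (auto elim!: tr_SParE)
  note d = tr_dom_par[OF s SPar.prems(3)]
  have step: "\<Gamma> v = Some T
      \<and> tr X (srem T v \<Gamma>) (SPar P' Q) (WPar W' W\<^sub>Q) \<and> tr X (srem T v \<Gamma>) (SPar Q P') (WPar W\<^sub>Q W')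
      \<and> (\<forall>g Y \<Delta> \<Delta>\<^sub>1 \<Delta>\<^sub>2 L. wfits g X Y \<Delta> \<longrightarrow> wsplit \<Delta> \<Delta>\<^sub>1 \<Delta>\<^sub>2 \<longrightarrow> out_cli_typed g x v W' \<Delta>\<^sub>1 \<longrightarrow> wta \<Delta>\<^sub>2 (wren g W\<^sub>Q) L
          \<longrightarrow> out_cli_typed g x v (WPar W' W\<^sub>Q) \<Delta> \<and> out_cli_typed g x v (WPar W\<^sub>Q W') \<Delta>)"
    if s: "ssplit \<Gamma> \<Gamma>\<^sub>P \<Gamma>\<^sub>Q" and tQ: "tr X \<Gamma>\<^sub>Q Q W\<^sub>Q" and v: "\<Gamma>\<^sub>P v = Some T"
      and t': "tr X (srem T v \<Gamma>\<^sub>P) P' W'"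
    for \<Gamma>\<^sub>P \<Gamma>\<^sub>Q P' Q W' W\<^sub>Q
  proof -
    note d = tr_dom_par[OF s SPar.prems(3)]
    note tr = tr_sjoin[OF t' tQ dom_upd_srem(2)[OF SPar.prems(3)] sjoin_srem[OF ssplit_sjoin[OF s] v]]
    have "out_cli_typed g x v (WPar W' W\<^sub>Q) \<Delta> \<and> out_cli_typed g x v (WPar W\<^sub>Q W') \<Delta>"
      if f: "wfits g X Y \<Delta>" and ws: "wsplit \<Delta> \<Delta>\<^sub>1 \<Delta>\<^sub>2" and o: "out_cli_typed g x v W' \<Delta>\<^sub>1" and wQ: "wta \<Delta>\<^sub>2 (wren g W\<^sub>Q) L"
      for g Y \<Delta> \<Delta>\<^sub>1 \<Delta>\<^sub>2 L
      using out_cli_typed_par[OF wsplit_wjoin[OF ws] f o wQ wfits_wgood[OF f tQ d(2)]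
          tr_wgood[OF t' dom_upd_srem(2)[OF d(1)]]] by simp
    with tr ssplit_sub(1)[OF s v] show ?thesis by blast
  qed
  \<comment> \<open>No name is extruded, so the parallel rules shift the idle component by
    0.\<close>
  have up0: "wren (\<lambda>i. i + 0) V = V" for V
    using wren_id[of V] by (simp add: id_def)
  from SPar.prems(1) consider (l) p' where "outs P x v p'" "p = p' \<parallel> abs_sq Q"
    | (r) q' where "outs Q x v q'" "p = abs_sq P \<parallel> q'" by auto
  then show ?case
  proof cases
    case l
    have x: "\<Gamma>\<^sub>1 x = Some (TCli T)"
      using outs_type[OF l(1) t(1)] ssplit_sub(1)[OF s] SPar.prems(4) by fastforce
    from SPar.IH(1)[OF l(1) t(1) d(1) x] obtain P' W' z where h: "\<Gamma>\<^sub>1 v = Some T" "abs_sq P' = p'"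
      "tr X (srem T v \<Gamma>\<^sub>1) P' W'" "z \<notin> X"
      "\<And>g. wlts (wren g W\<^sub>1) (AOut 0 (g x) (g v) (g z)) (wren g W')"
      "\<And>g Y \<Delta> L. wfits g X Y \<Delta> \<Longrightarrow> wta \<Delta> (wren g W\<^sub>1) L \<Longrightarrow> out_cli_typed g x v W' \<Delta>" by blast
    note st = step[OF s t(2) h(1,3)]
    have "wlts (wren g W) (AOut 0 (g x) (g v) (g z)) (wren g (WPar W' W\<^sub>2))" for g
      using wl_par_out1[OF h(5)[of g], of "wren g W\<^sub>2"] unfolding up0 by (simp add: W)
    moreover have "out_cli_typed g x v (WPar W' W\<^sub>2) \<Delta>" if "wfits g X Y \<Delta>" "wta \<Delta> (wren g W) L" for g Y \<Delta> L
      using that(2) unfolding W wren.simps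
      by (elim wta_WParE) (use st h(6) that(1) wfits_split in meson)
    ultimately show ?thesis using st h(2,4) l(2)
      by (intro exI[of _ "SPar P' Q"] exI[of _ "WPar W' W\<^sub>2"] exI[of _ z]) (simp add: abs_sq_simps)
  next
    case r
    have x: "\<Gamma>\<^sub>2 x = Some (TCli T)"
      using outs_type[OF r(1) t(2)] ssplit_sub(2)[OF s] SPar.prems(4) by fastforce
    from SPar.IH(2)[OF r(1) t(2) d(2) x] obtain P' W' z where h: "\<Gamma>\<^sub>2 v = Some T" "abs_sq P' = q'"
      "tr X (srem T v \<Gamma>\<^sub>2) P' W'" "z \<notin> X"
      "\<And>g. wlts (wren g W\<^sub>2) (AOut 0 (g x) (g v) (g z)) (wren g W')"
      "\<And>g Y \<Delta> L. wfits g X Y \<Delta> \<Longrightarrow> wta \<Delta> (wren g W\<^sub>2) L \<Longrightarrow> out_cli_typed g x v W' \<Delta>" by blast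
    note st = step[OF ssplit_sym[OF s] t(1) h(1,3)]
    have "wlts (wren g W) (AOut 0 (g x) (g v) (g z)) (wren g (WPar W\<^sub>1 W'))" for g
      using wl_par_out2[OF h(5)[of g], of "wren g W\<^sub>1"] unfolding up0 by (simp add: W)
    moreover have "out_cli_typed g x v (WPar W\<^sub>1 W') \<Delta>" if "wfits g X Y \<Delta>" "wta \<Delta> (wren g W) L" for g Y \<Delta> L
      using that(2) unfolding W wren.simps
      by (elim wta_WParE) (use st h(6) that(1) wfits_split wsplit_sym in meson)
    ultimately show ?thesis using st h(2,4) r(2)
      by (intro exI[of _ "SPar P P'"] exI[of _ "WPar W\<^sub>1 W'"] exI[of _ z]) (simp add: abs_sq_simps)
  qed
next
  case (SRes P)
  from SRes.prems(1) obtain q where q: "outs P (Suc (Suc x)) (Suc (Suc v)) q" "p = qres q" by auto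
  from SRes.prems(2) obtain U W\<^sub>0 where W: "W = WRes (wren res_map W\<^sub>0)"
    and t: "tr (up (up X)) (ext (Some U) (ext (Some (sdual U)) \<Gamma>)) P W\<^sub>0" by (auto elim!: tr_SResE)
  let ?\<Gamma> = "ext (Some U) (ext (Some (sdual U)) \<Gamma>)"
  have d: "dom ?\<Gamma> \<subseteq> up (up X)" using SRes.prems(3) unfolding ext_dom by (auto simp: up_def)
  have x': "?\<Gamma> (Suc (Suc x)) = Some (TCli T)" using SRes.prems(4) by simp
  from SRes.IH[OF q(1) t d x'] obtain P' W' z where h: "\<Gamma> v = Some T" "abs_sq P' = q"
    "tr (up (up X)) (srem T (Suc (Suc v)) ?\<Gamma>) P' W'" "z \<notin> up (up X)"
    "\<And>g. wlts (wren g W\<^sub>0) (AOut 0 (g (Suc (Suc x))) (g (Suc (Suc v))) (g z)) (wren g W')"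
    "\<And>g Y \<Delta> L. wfits g (up (up X)) Y \<Delta> \<Longrightarrow> wta \<Delta> (wren g W\<^sub>0) L \<Longrightarrow> out_cli_typed g (Suc (Suc x)) (Suc (Suc v)) W' \<Delta>"
    unfolding ext_simps by blast
  \<comment> \<open>The fresh continuation lies outside of the pair, so it is not the name
    restricted here, and nothing is extruded.\<close>
  obtain y where y: "z = Suc (Suc y)" "y \<notin> X" using h(4) by (cases z; cases "z - 1") auto
  have t': "tr X (srem T v \<Gamma>) (SRes P') (WRes (wren res_map W'))"
    using h(3) unfolding srem_ext by (rule tr.res)
  have g: "wren g (WRes (wren res_map V)) = WRes (wren (lift g \<circ> res_map) V)"
    "(lift g \<circ> res_map) (Suc (Suc i)) = Suc (g i)" for g i V
    by (simp_all add: wren_wren) (simp add: res_map_def)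
  have "wlts (wren g W) (AOut 0 (g x) (g v) (g y)) (wren g (WRes (wren res_map W')))" for g
  proof -
    have "wlts (wren (lift g \<circ> res_map) W\<^sub>0) (AOut 0 (Suc (g x)) (Suc (g v)) (Suc (g y))) (wren (lift g \<circ> res_map) W')"
      using h(5)[of "lift g \<circ> res_map"] unfolding g(2) y .
    from wl_res_out[OF this] have "wlts (wren g W) (AOut 0 (g x) (g v) (g y)) (WRes (wren (wrot 0) (wren (lift g \<circ> res_map) W')))"
      unfolding W g by (simp add: wdrop_def)
    moreover have "wrot 0 = id" by (auto simp: wrot_def)
    ultimately show ?thesis unfolding g by simp
  qed
  moreover have "out_cli_typed g x v (WRes (wren res_map W')) \<Delta>"
    if f: "wfits g X Y \<Delta>" and w: "wta \<Delta> (wren g W) L" for g Y \<Delta> L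
  proof -
    from w obtain V where V: "weights_pos V" "wta (ext {V, wdual V} \<Delta>) (wren (lift g \<circ> res_map) W\<^sub>0) L"
      unfolding W g by (rule wta_WResE)
    from h(6)[OF wfits_res[OF f] V(2)] obtain n V\<^sub>1 L' where o: "VCli n V\<^sub>1 \<in> \<Delta> (g x)" "V\<^sub>1 \<in> \<Delta> (g v)"
        "wta (ext {V, wdual V} (rem V\<^sub>1 (g v) \<Delta>)) (wren (lift g \<circ> res_map) W') L'"
      unfolding out_cli_typed_def g(2) rem_ext ext_simps by blast
    from wta.res[OF V(1) o(3)] o show ?thesis unfolding out_cli_typed_def g by blast
  qed
  ultimately show ?case
    using h(1,2) t' q(2) y(2) by (intro exI[of _ "SRes P'"] exI[of _ "WRes (wren res_map W')"] exI[of _ y]) (auto simp: abs_sq_simps)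
qed auto

section \<open>Bound outputs on linear names\<close>

lemma sdual_sdual [simp]: "sdual (sdual T) = T"
  by (induction T) simp_all

lemma up2_alt: "up2 = Suc \<circ> Suc"
  by (simp add: fun_eq_iff)

lemma srel_bij:
  assumes "\<And>a. \<Gamma>' (f a) = \<Gamma> a" "\<And>a. h (f a) = a" "\<And>b. f (h b) = b"
  shows "srel f \<Gamma> \<Gamma>'"
proof (rule srelI)
  show "c = a" if "f c = f a" for a c using that assms(2) by metis
  show "\<exists>a. f a = b \<and> \<Gamma> a = Some T" if "\<Gamma>' b = Some T" for b T
    using that assms by (intro exI[of _ "h b"]) (simp flip: assms(1))
qed (simp add: assms)

lemma keeps_fresh_bij:
  assumes "\<And>i. f i \<in> X \<longleftrightarrow> i \<in> X" "\<And>a. h (f a) = a"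
  shows "keeps_fresh f X X"
  unfolding keeps_fresh_def using assms by metis

lemma nat_cases4:
  "i = 0 \<or> i = Suc 0 \<or> i = Suc (Suc 0) \<or> i = Suc (Suc (Suc 0)) \<or> (\<exists>j. i = Suc (Suc (Suc (Suc j))))"
  by (metis not0_implies_Suc)

lemma swap_invol: "swap_co (swap_co i) = i" "swap_res (swap_res i) = i"
proof -
  show "swap_co (swap_co i) = i" by (simp add: swap_co_def)
  show "swap_res (swap_res i) = i" using nat_cases4[of i] by (elim disjE exE) simp_all
qed

lemma keeps_fresh_swap_res: "keeps_fresh swap_res (up (up (up (up X)))) (up (up (up (up X))))"
proof (rule keeps_fresh_bij)
  show "swap_res i \<in> up (up (up (up X))) \<longleftrightarrow> i \<in> up (up (up (up X)))" for i
    using nat_cases4[of i] by (elim disjE exE) simp_all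
qed (rule swap_invol)

lemma tr_swap_co:
  assumes "tr (up (up X)) \<Gamma> P W" "dom \<Gamma> \<subseteq> up (up X)" "\<And>a. \<Gamma>' (swap_co a) = \<Gamma> a"
  shows "tr (up (up X)) \<Gamma>' (sren swap_co P) (wren swap_co W)"
  by (rule tr_ren[OF assms(1) srel_bij[where h = swap_co] keeps_fresh_swap_co assms(2)])
     (simp_all only: assms(3) swap_invol)

lemma tr_swap_res:
  assumes "tr (up (up (up (up X)))) \<Gamma> P W" "dom \<Gamma> \<subseteq> up (up (up (up X)))" "\<And>a. \<Gamma>' (swap_res a) = \<Gamma> a"
  shows "tr (up (up (up (up X)))) \<Gamma>' (sren swap_res P) (wren swap_res W)"
  by (rule tr_ren[OF assms(1) srel_bij[where h = swap_res] keeps_fresh_swap_res assms(2)])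
     (simp_all only: assms(3) swap_invol)

lemma dom_ext2: "dom \<Gamma> \<subseteq> X \<Longrightarrow> dom (ext (Some T) (ext (Some U) \<Gamma>)) \<subseteq> up (up X)"
  unfolding ext_dom by (auto simp: up_def)

text \<open>In the translation the co-variables are one name, so an exchange within the extruded
  pair is invisible there. An exchange with another restriction becomes the rotation past the two
  extruded names.\<close>

lemma out_ren_res:
  "out_ren (lift g \<circ> res_map) (Suc (Suc x)) \<circ> swap_co = out_ren (lift g \<circ> res_map) (Suc (Suc x))"
  "lift (out_ren (lift g \<circ> res_map) (Suc (Suc x))) \<circ> (res_map \<circ> swap_res)
    = wrot 2 \<circ> out_ren (lift (lift g \<circ> res_map) \<circ> res_map) (Suc (Suc (Suc (Suc x))))"
proof -
  show "out_ren (lift g \<circ> res_map) (Suc (Suc x)) \<circ> swap_co = out_ren (lift g \<circ> res_map) (Suc (Suc x))"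
    by (auto simp: fun_eq_iff out_ren_def swap_co_def res_map_def)
  show "lift (out_ren (lift g \<circ> res_map) (Suc (Suc x))) \<circ> (res_map \<circ> swap_res)
    = wrot 2 \<circ> out_ren (lift (lift g \<circ> res_map) \<circ> res_map) (Suc (Suc (Suc (Suc x))))"
  proof
    fix i
    show "(lift (out_ren (lift g \<circ> res_map) (Suc (Suc x))) \<circ> (res_map \<circ> swap_res)) i
        = (wrot 2 \<circ> out_ren (lift (lift g \<circ> res_map) \<circ> res_map) (Suc (Suc (Suc (Suc x))))) i"
      using nat_cases4[of i] by (elim disjE exE) (simp_all add: res_map_def out_ren_def wrot_def)
  qed
qed

text \<open>Opening the restriction reduces a bound output to a free output of index 0. The type
  \<open>U\<close> is that of the opened restriction, and \<open>res_map\<close> turns the extruded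
  pair of the source into its single name.\<close>

definition bout_lin_typed :: "(name \<Rightarrow> name) \<Rightarrow> name \<Rightarrow> wproc \<Rightarrow> wctx \<Rightarrow> bool" where
  "bout_lin_typed g x W' \<Gamma> \<longleftrightarrow> (\<exists>U. weights_pos U
     \<and> out_lin_typed (lift g \<circ> res_map) (Suc (Suc x)) 0 W' (ext {U, wdual U} \<Gamma>))"

text \<open>The context of a residual that holds an extruded pair, whose index 0 has been sent.\<close>

abbreviation opened :: "sty \<Rightarrow> sctx \<Rightarrow> sctx" where
  "opened T \<Gamma> \<equiv> ext (Some T) (ext (Some (sdual T)) \<Gamma>)"

text \<open>The translation extrudes two names, the continuation as index 0 and the payload, which
  stands for both co-variables, as index 1. The source extrudes the two co-variables, with the one
  that is sent in front.\<close>

lemma bout_lin: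
  "bouts P x p \<Longrightarrow> tr X \<Gamma> P W \<Longrightarrow> dom \<Gamma> \<subseteq> X \<Longrightarrow> \<Gamma> x = Some (TLOut T S) \<Longrightarrow>
    \<exists>P' W'. abs_sq P' = p \<and> tr (up (up X)) ((srem T 0 (opened T \<Gamma>))(Suc (Suc x) \<mapsto> S)) P' W'
      \<and> (\<forall>g. wlts (wren g W) (AOut 2 (g x) 1 0) (wren (out_ren (lift g \<circ> res_map) (Suc (Suc x))) W'))
      \<and> (\<forall>g Y \<Delta> L. wfits g X Y \<Delta> \<longrightarrow> wta \<Delta> (wren g W) L \<longrightarrow> bout_lin_typed g x W' \<Delta>)"
proof (induction P arbitrary: x p X \<Gamma> W)
  case (SPar P Q)
  from SPar.prems(2) obtain \<Gamma>\<^sub>1 \<Gamma>\<^sub>2 W\<^sub>1 W\<^sub>2 where W: "W = WPar W\<^sub>1 W\<^sub>2" and s: "ssplit \<Gamma> \<Gamma>\<^sub>1 \<Gamma>\<^sub>2"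
    and t: "tr X \<Gamma>\<^sub>1 P W\<^sub>1" "tr X \<Gamma>\<^sub>2 Q W\<^sub>2" by (auto elim!: tr_SParE)
  note d = tr_dom_par[OF s SPar.prems(3)]
  have xX: "x \<in> X" using SPar.prems(3,4) by auto
  let ?o = "\<lambda>\<Gamma>. (srem T 0 (opened T \<Gamma>))(Suc (Suc x) \<mapsto> S)"
  let ?sh = "\<lambda>W. wren Suc (wren Suc W)" and ?sh' = "\<lambda>P. sren Suc (sren Suc P)"
  have step: "tr (up (up X)) (?o \<Gamma>) (SPar P' (?sh' Q)) (WPar W' (?sh W\<^sub>Q))
      \<and> tr (up (up X)) (?o \<Gamma>) (SPar (?sh' Q) P') (WPar (?sh W\<^sub>Q) W')
      \<and> (\<forall>g. wren (\<lambda>i. i + 2) (wren g W\<^sub>Q) = wren (out_ren (lift g \<circ> res_map) (Suc (Suc x))) (?sh W\<^sub>Q))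
      \<and> (\<forall>g Y \<Delta> \<Delta>\<^sub>1 \<Delta>\<^sub>2 L. wfits g X Y \<Delta> \<longrightarrow> wsplit \<Delta> \<Delta>\<^sub>1 \<Delta>\<^sub>2 \<longrightarrow> bout_lin_typed g x W' \<Delta>\<^sub>1 \<longrightarrow> wta \<Delta>\<^sub>2 (wren g W\<^sub>Q) L
          \<longrightarrow> bout_lin_typed g x (WPar W' (?sh W\<^sub>Q)) \<Delta> \<and> bout_lin_typed g x (WPar (?sh W\<^sub>Q) W') \<Delta>)"
    if s: "ssplit \<Gamma> \<Gamma>\<^sub>P \<Gamma>\<^sub>Q" and tQ: "tr X \<Gamma>\<^sub>Q Q W\<^sub>Q" and x: "\<Gamma>\<^sub>P x = Some (TLOut T S)"
      and t': "tr (up (up X)) (?o \<Gamma>\<^sub>P) P' W'"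
    for \<Gamma>\<^sub>P \<Gamma>\<^sub>Q P' Q W' W\<^sub>Q
  proof -
    note d = tr_dom_par[OF s SPar.prems(3)]
    have j: "sjoin (?o \<Gamma>) (?o \<Gamma>\<^sub>P) (ext None (ext None \<Gamma>\<^sub>Q))"
      using x by (intro sjoin_upd[OF sjoin_srem[OF sjoin_ext[OF sjoin_ext[OF ssplit_sjoin[OF s]]]]]) (auto simp: srem_def)
    have dn: "dom (ext None \<Gamma>\<^sub>Q) \<subseteq> up X"
      using d(2) by (auto simp: ext_if up_def split: if_splits) (metis Suc_pred image_eqI domI subsetD not_gr_zero)
    have "dom (?o \<Gamma>) \<subseteq> up (up X)"
      by (rule dom_upd_srem(1)[OF dom_ext2[OF SPar.prems(3)]]) (simp add: xX)
    note tr = tr_sjoin[OF t' tr_shift[OF tr_shift[OF tQ d(2)] dn] this j]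
    have xQ: "x \<notin> dom \<Gamma>\<^sub>Q" using sjoin_dom[OF ssplit_sjoin[OF s] x] by simp
    have ren: "?sh (wren g W\<^sub>Q) = wren (out_ren (lift g \<circ> res_map) (Suc (Suc x))) (?sh W\<^sub>Q)" for g
      unfolding wren_wren by (rule tr_wren_cong[OF tQ]) (use xQ xX in \<open>auto simp: out_ren_def res_map_def\<close>)
    have dP: "dom (?o \<Gamma>\<^sub>P) \<subseteq> up (up X)"
      by (rule dom_upd_srem(1)[OF dom_ext2[OF d(1)]]) (simp add: xX)
    have "bout_lin_typed g x (WPar W' (?sh W\<^sub>Q)) \<Delta> \<and> bout_lin_typed g x (WPar (?sh W\<^sub>Q) W') \<Delta>"
      if f: "wfits g X Y \<Delta>" and ws: "wsplit \<Delta> \<Delta>\<^sub>1 \<Delta>\<^sub>2" and o: "bout_lin_typed g x W' \<Delta>\<^sub>1" and wQ: "wta \<Delta>\<^sub>2 (wren g W\<^sub>Q) L"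
      for g Y \<Delta> \<Delta>\<^sub>1 \<Delta>\<^sub>2 L
    proof -
      from o obtain U where U: "weights_pos U"
        "out_lin_typed (lift g \<circ> res_map) (Suc (Suc x)) 0 W' (ext {U, wdual U} \<Delta>\<^sub>1)"
        unfolding bout_lin_typed_def by blast
      have "Suc (Suc x) \<in> up (up X)" using xX by simp
      note p = out_lin_typed_par[OF wjoin_ext[OF wsplit_wjoin[OF ws]] wfits_res[OF f] this U(2)
          wta_shift[OF wQ wfits_wgood[OF f tQ d(2)] wfits_fresh[OF wfits_split(2)[OF ws f]]]
          wgood_wren[OF wfits_wgood[OF f tQ d(2)] keeps_fresh_up(1)] tr_wgood[OF t' dP] ren]
      with U(1) show ?thesis unfolding bout_lin_typed_def by blast
    qed
    moreover have "wren (\<lambda>i. i + 2) V = ?sh V" for V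
      by (simp add: wren_wren comp_def)
    ultimately show ?thesis using tr ren by simp
  qed
  have abs: "abs_sq (?sh' R) = qren up2 (abs_sq R)" for R
    unfolding up2_alt by (simp add: abs_sq_simps)
  from SPar.prems(1) consider (l) p' where "bouts P x p'" "p = p' \<parallel> qren up2 (abs_sq Q)"
    | (r) q' where "bouts Q x q'" "p = qren up2 (abs_sq P) \<parallel> q'" by auto
  then show ?case
  proof cases
    case l
    have x: "\<Gamma>\<^sub>1 x = Some (TLOut T S)"
      using bouts_type[OF l(1) t(1)] ssplit_sub(1)[OF s] SPar.prems(4) by fastforce
    from SPar.IH(1)[OF l(1) t(1) d(1) x] obtain P' W' where h: "abs_sq P' = p'"
      "tr (up (up X)) (?o \<Gamma>\<^sub>1) P' W'"
      "\<And>g. wlts (wren g W\<^sub>1) (AOut 2 (g x) 1 0) (wren (out_ren (lift g \<circ> res_map) (Suc (Suc x))) W')"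
      "\<And>g Y \<Delta> L. wfits g X Y \<Delta> \<Longrightarrow> wta \<Delta> (wren g W\<^sub>1) L \<Longrightarrow> bout_lin_typed g x W' \<Delta>" by blast
    note st = step[OF s t(2) x h(2)]
    have "wlts (wren g W) (AOut 2 (g x) 1 0) (wren (out_ren (lift g \<circ> res_map) (Suc (Suc x))) (WPar W' (?sh W\<^sub>2)))" for g
      using wl_par_out1[OF h(3)[of g], of "wren g W\<^sub>2"] st by (simp add: W)
    moreover have "bout_lin_typed g x (WPar W' (?sh W\<^sub>2)) \<Delta>" if "wfits g X Y \<Delta>" "wta \<Delta> (wren g W) L" for g Y \<Delta> L
      using that(2) unfolding W wren.simps
      by (elim wta_WParE) (use st h(4) that(1) wfits_split in meson)
    moreover have "abs_sq (SPar P' (?sh' Q)) = p" by (simp only: abs_sq_simps(2) abs h(1) l(2))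
    ultimately show ?thesis using st by blast
  next
    case r
    have x: "\<Gamma>\<^sub>2 x = Some (TLOut T S)"
      using bouts_type[OF r(1) t(2)] ssplit_sub(2)[OF s] SPar.prems(4) by fastforce
    from SPar.IH(2)[OF r(1) t(2) d(2) x] obtain P' W' where h: "abs_sq P' = q'"
      "tr (up (up X)) (?o \<Gamma>\<^sub>2) P' W'"
      "\<And>g. wlts (wren g W\<^sub>2) (AOut 2 (g x) 1 0) (wren (out_ren (lift g \<circ> res_map) (Suc (Suc x))) W')"
      "\<And>g Y \<Delta> L. wfits g X Y \<Delta> \<Longrightarrow> wta \<Delta> (wren g W\<^sub>2) L \<Longrightarrow> bout_lin_typed g x W' \<Delta>" by blast
    note st = step[OF ssplit_sym[OF s] t(1) x h(2)]
    have "wlts (wren g W) (AOut 2 (g x) 1 0) (wren (out_ren (lift g \<circ> res_map) (Suc (Suc x))) (WPar (?sh W\<^sub>1) W'))" for g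
      using wl_par_out2[OF h(3)[of g], of "wren g W\<^sub>1"] st by (simp add: W)
    moreover have "bout_lin_typed g x (WPar (?sh W\<^sub>1) W') \<Delta>" if "wfits g X Y \<Delta>" "wta \<Delta> (wren g W) L" for g Y \<Delta> L
      using that(2) unfolding W wren.simps
      by (elim wta_WParE) (use st h(4) that(1) wfits_split wsplit_sym in meson)
    moreover have "abs_sq (SPar (?sh' P) P') = p" by (simp only: abs_sq_simps(2) abs h(1) r(2))
    ultimately show ?thesis using st by blast
  qed
next
  case (SRes P)
  from SRes.prems(2) obtain U W\<^sub>0 where W: "W = WRes (wren res_map W\<^sub>0)"
    and t: "tr (up (up X)) (opened U \<Gamma>) P W\<^sub>0" by (auto elim!: tr_SResE)
  note d = dom_ext2[OF SRes.prems(3), of U "sdual U"]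
  have x': "opened U \<Gamma> (Suc (Suc x)) = Some (TLOut T S)" using SRes.prems(4) by simp
  have g: "wren g W = WRes (wren (lift g \<circ> res_map) W\<^sub>0)"
    "(lift g \<circ> res_map) (Suc (Suc i)) = Suc (g i)" "(lift g \<circ> res_map) 0 = 0" "(lift g \<circ> res_map) (Suc 0) = 0" for g i
    by (simp_all add: W wren_wren) (simp_all add: res_map_def)
  have xX: "x \<in> X" using SRes.prems(3,4) by auto
  from SRes.prems(1) consider (zero) "outs P (Suc (Suc x)) 0 p"
    | (one) q where "outs P (Suc (Suc x)) (Suc 0) q" "p = qren swap_co q"
    | (bound) q where "bouts P (Suc (Suc x)) q" "p = qres (qren swap_res q)" by auto
  then show ?case
  proof cases
    case zero
    from out_lin[OF zero t d x'] obtain P' W' where h: "U = T" "abs_sq P' = p"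
      "tr (up (up X)) ((srem T 0 (opened U \<Gamma>))(Suc (Suc x) \<mapsto> S)) P' W'"
      "\<And>g. wlts (wren g W\<^sub>0) (AOut 1 (g (Suc (Suc x))) (Suc (g 0)) 0) (wren (out_ren g (Suc (Suc x))) W')"
      "\<And>g Y \<Delta> L. wfits g (up (up X)) Y \<Delta> \<Longrightarrow> wta \<Delta> (wren g W\<^sub>0) L \<Longrightarrow> out_lin_typed g (Suc (Suc x)) 0 W' \<Delta>"
      unfolding ext_simps option.inject by blast
    \<comment> \<open>The payload is the restricted name itself, index 1 below the extruded
      continuation, so the restriction is opened as the second extruded name.\<close>
    have "wlts (wren g W) (AOut 2 (g x) 1 0) (wren (out_ren (lift g \<circ> res_map) (Suc (Suc x))) W')" for g
      using wl_open[OF h(4)[of "lift g \<circ> res_map", unfolded g]] unfolding g(1) by (simp add: numeral_2_eq_2)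
    moreover have "bout_lin_typed g x W' \<Delta>" if "wfits g X Y \<Delta>" "wta \<Delta> (wren g W) L" for g Y \<Delta> L
      using that(2) unfolding g(1) bout_lin_typed_def
      by (elim wta_WResE) (use h(5) wfits_res[OF that(1)] in meson)
    ultimately show ?thesis using h(1-3) by blast
  next
    case one
    from out_lin[OF one(1) t d x'] obtain P' W' where h: "sdual U = T" "abs_sq P' = q"
      "tr (up (up X)) ((srem T (Suc 0) (opened U \<Gamma>))(Suc (Suc x) \<mapsto> S)) P' W'"
      "\<And>g. wlts (wren g W\<^sub>0) (AOut 1 (g (Suc (Suc x))) (Suc (g (Suc 0))) 0) (wren (out_ren g (Suc (Suc x))) W')"
      "\<And>g Y \<Delta> L. wfits g (up (up X)) Y \<Delta> \<Longrightarrow> wta \<Delta> (wren g W\<^sub>0) L \<Longrightarrow> out_lin_typed g (Suc (Suc x)) (Suc 0) W' \<Delta>"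
      unfolding ext_simps option.inject by blast
    \<comment> \<open>The name sent is the second co-variable, so the first one has the dual type.
      Exchanging the two gives the context \<open>opened T\<close>.\<close>
    have U: "U = sdual T" using h(1) by auto
    have sw: "wren (out_ren (lift g \<circ> res_map) (Suc (Suc x))) (wren swap_co W')
        = wren (out_ren (lift g \<circ> res_map) (Suc (Suc x))) W'" for g
      by (simp add: wren_wren out_ren_res)
    have "tr (up (up X)) ((srem T 0 (opened T \<Gamma>))(Suc (Suc x) \<mapsto> S)) (sren swap_co P') (wren swap_co W')"
    proof (rule tr_swap_co[OF h(3)])
      show "dom ((srem T (Suc 0) (opened U \<Gamma>))(Suc (Suc x) \<mapsto> S)) \<subseteq> up (up X)"
        by (rule dom_upd_srem(1)[OF d]) (simp add: xX)
      show "((srem T 0 (opened T \<Gamma>))(Suc (Suc x) \<mapsto> S)) (swap_co a) = ((srem T (Suc 0) (opened U \<Gamma>))(Suc (Suc x) \<mapsto> S)) a" for a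
        using nat_cases4[of a] by (elim disjE exE) (simp_all add: U srem_def)
    qed
    moreover have "wlts (wren g W) (AOut 2 (g x) 1 0) (wren (out_ren (lift g \<circ> res_map) (Suc (Suc x))) (wren swap_co W'))" for g
      using wl_open[OF h(4)[of "lift g \<circ> res_map", unfolded g]] unfolding g(1) sw by (simp add: numeral_2_eq_2)
    moreover have "bout_lin_typed g x (wren swap_co W') \<Delta>" if "wfits g X Y \<Delta>" "wta \<Delta> (wren g W) L" for g Y \<Delta> L
    proof -
      from that(2) obtain V where V: "weights_pos V" "wta (ext {V, wdual V} \<Delta>) (wren (lift g \<circ> res_map) W\<^sub>0) L"
        unfolding g by (rule wta_WResE)
      show ?thesis using h(5)[OF wfits_res[OF that(1)] V(2)] V(1)
        unfolding bout_lin_typed_def out_lin_typed_def sw g by blast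
    qed
    moreover have "abs_sq (sren swap_co P') = p" by (simp only: abs_sq_simps h(2) one(2))
    ultimately show ?thesis by blast
  next
    case bound
    let ?x = "Suc (Suc (Suc (Suc x)))"
    from SRes.IH[OF bound(1) t d x'] obtain P' W' where h: "abs_sq P' = q"
      "tr (up (up (up (up X)))) ((srem T 0 (opened T (opened U \<Gamma>)))(?x \<mapsto> S)) P' W'"
      "\<And>g. wlts (wren g W\<^sub>0) (AOut 2 (g (Suc (Suc x))) 1 0) (wren (out_ren (lift g \<circ> res_map) ?x) W')"
      "\<And>g Y \<Delta> L. wfits g (up (up X)) Y \<Delta> \<Longrightarrow> wta \<Delta> (wren g W\<^sub>0) L \<Longrightarrow> bout_lin_typed g (Suc (Suc x)) W' \<Delta>"
      by blast
    \<comment> \<open>The pair comes from further inside. The present restriction stays behind and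
      is moved below it, by \<open>swap_res\<close> in the source and by the rotation
      \<open>wrot 2\<close> in the translation.\<close>
    let ?W = "WRes (wren res_map (wren swap_res W'))"
    have dW: "dom ((srem T 0 (opened T (opened U \<Gamma>)))(?x \<mapsto> S)) \<subseteq> up (up (up (up X)))"
      by (rule dom_upd_srem(1)[OF dom_ext2[OF d]]) (simp add: xX)
    have "tr (up (up (up (up X)))) (opened U ((srem T 0 (opened T \<Gamma>))(Suc (Suc x) \<mapsto> S))) (sren swap_res P') (wren swap_res W')"
    proof (rule tr_swap_res[OF h(2) dW])
      show "opened U ((srem T 0 (opened T \<Gamma>))(Suc (Suc x) \<mapsto> S)) (swap_res a) = ((srem T 0 (opened T (opened U \<Gamma>)))(?x \<mapsto> S)) a" for a
        using nat_cases4[of a] by (elim disjE exE) (simp_all add: srem_def)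
    qed
    from tr.res[OF this]
    have tr': "tr (up (up X)) ((srem T 0 (opened T \<Gamma>))(Suc (Suc x) \<mapsto> S)) (SRes (sren swap_res P')) ?W" .
    have rW: "wren (out_ren (lift g \<circ> res_map) (Suc (Suc x))) ?W
        = WRes (wren (wrot 2) (wren (out_ren (lift (lift g \<circ> res_map) \<circ> res_map) ?x) W'))" for g
      by (simp add: wren_wren out_ren_res)
    have "wlts (wren g W) (AOut 2 (g x) 1 0) (wren (out_ren (lift g \<circ> res_map) (Suc (Suc x))) ?W)" for g
      using wl_res_out[OF h(3)[of "lift g \<circ> res_map", unfolded g]] unfolding g(1) rW by (simp add: wdrop_def)
    moreover have "bout_lin_typed g x ?W \<Delta>" if f: "wfits g X Y \<Delta>" and w: "wta \<Delta> (wren g W) L" for g Y \<Delta> L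
    proof -
      from w obtain V where V: "weights_pos V" "wta (ext {V, wdual V} \<Delta>) (wren (lift g \<circ> res_map) W\<^sub>0) L"
        unfolding g by (rule wta_WResE)
      let ?g = "lift (lift g \<circ> res_map) \<circ> res_map"
      note f2 = wfits_res[OF wfits_res[OF f]]
      have g2: "?g ?x = Suc (Suc (g x))" "?g 0 = 0" by (simp_all add: res_map_def)
      from h(4)[OF wfits_res[OF f] V(2)] obtain Z where Z: "weights_pos Z"
        "out_lin_typed ?g ?x 0 W' (ext {Z, wdual Z} (ext {V, wdual V} \<Delta>))"
        unfolding bout_lin_typed_def by blast
      then obtain n V\<^sub>1 V\<^sub>2 L' where o: "weights_pos V\<^sub>2" "VOut n V\<^sub>1 V\<^sub>2 \<in> \<Delta> (g x)" "V\<^sub>1 \<in> {Z, wdual Z}"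
        "wta (ext {V\<^sub>2} (ext (if wun V\<^sub>1 then {Z, wdual Z} else {Z, wdual Z} - {V\<^sub>1})
            (ext {V, wdual V} (rem (VOut n V\<^sub>1 V\<^sub>2) (g x) \<Delta>)))) (wren (out_ren ?g ?x) W') L'"
        unfolding out_lin_typed_def g2 rem_ext ext_simps by blast
      have gd: "wgood (up (up (up Y))) (wren (out_ren ?g ?x) W')"
        using f2 xX by (intro wgood_wren[OF tr_wgood[OF h(2) dW]] keeps_fresh_out_ren) (auto simp: wfits_def)
      have fr: "rem (VOut n V\<^sub>1 V\<^sub>2) (g x) \<Delta> z = {}" if "z \<notin> Y" for z
        using that wfits_fresh[OF f] by (simp add: rem_empty)
      from wta.res[OF V(1) wta_rot[OF o(4) gd fr]]
      have "wta (ext {V\<^sub>2} (rem V\<^sub>1 0 (ext {Z, wdual Z} (rem (VOut n V\<^sub>1 V\<^sub>2) (g x) \<Delta>))))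
          (wren (out_ren (lift g \<circ> res_map) (Suc (Suc x))) ?W) L'"
        unfolding rW rem_ext .
      with o Z(1) show ?thesis
        unfolding bout_lin_typed_def out_lin_typed_def g rem_ext ext_simps by blast
    qed
    moreover have "abs_sq (SRes (sren swap_res P')) = p" by (simp only: abs_sq_simps h(1) bound(2))
    ultimately show ?thesis using tr' by blast
  qed
qed auto

lemma nat_cases2: "i = 0 \<or> i = Suc 0 \<or> (\<exists>j. i = Suc (Suc j))"
  by (metis not0_implies_Suc)

lemma nat_cases3: "i = 0 \<or> i = Suc 0 \<or> i = Suc (Suc 0) \<or> (\<exists>j. i = Suc (Suc (Suc j)))"
  by (metis not0_implies_Suc)

lemma res_map_simps [simp]: "res_map 0 = 0" "res_map (Suc 0) = 0" "res_map (Suc (Suc i)) = Suc i"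
  by (simp_all add: res_map_def)

lemma dom_ext_None: "dom \<Gamma> \<subseteq> X \<Longrightarrow> dom (ext None \<Gamma>) \<subseteq> up X"
  by (auto simp: ext_if up_def split: if_splits) (metis Suc_pred image_eqI domI subsetD not_gr_zero)

section \<open>Bound outputs of clients\<close>

definition bout_cli_typed :: "(name \<Rightarrow> name) \<Rightarrow> name \<Rightarrow> wproc \<Rightarrow> wctx \<Rightarrow> bool" where
  "bout_cli_typed g x W' \<Gamma> \<longleftrightarrow> (\<exists>U. weights_pos U
     \<and> out_cli_typed (lift g \<circ> res_map) (Suc (Suc x)) 0 W' (ext {U, wdual U} \<Gamma>))"

text \<open>The translation extrudes the payload only: the continuation of a client is a free name,
  seen as \<open>Suc (g z)\<close> below the extruded one.\<close>

lemma bout_cli: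
  "bouts P x p \<Longrightarrow> tr X \<Gamma> P W \<Longrightarrow> dom \<Gamma> \<subseteq> X \<Longrightarrow> \<Gamma> x = Some (TCli T) \<Longrightarrow>
    \<exists>P' W' z. abs_sq P' = p \<and> tr (up (up X)) (srem T 0 (opened T \<Gamma>)) P' W' \<and> z \<notin> X
      \<and> (\<forall>g. wlts (wren g W) (AOut 1 (g x) 0 (Suc (g z))) (wren (lift g \<circ> res_map) W'))
      \<and> (\<forall>g Y \<Delta> L. wfits g X Y \<Delta> \<longrightarrow> wta \<Delta> (wren g W) L \<longrightarrow> bout_cli_typed g x W' \<Delta>)"
proof (induction P arbitrary: x p X \<Gamma> W)
  case (SPar P Q)
  from SPar.prems(2) obtain \<Gamma>\<^sub>1 \<Gamma>\<^sub>2 W\<^sub>1 W\<^sub>2 where W: "W = WPar W\<^sub>1 W\<^sub>2" and s: "ssplit \<Gamma> \<Gamma>\<^sub>1 \<Gamma>\<^sub>2"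
    and t: "tr X \<Gamma>\<^sub>1 P W\<^sub>1" "tr X \<Gamma>\<^sub>2 Q W\<^sub>2" by (auto elim!: tr_SParE)
  note d = tr_dom_par[OF s SPar.prems(3)]
  let ?o = "\<lambda>\<Gamma>. srem T 0 (opened T \<Gamma>)"
  let ?sh = "\<lambda>W. wren Suc (wren Suc W)" and ?sh' = "\<lambda>P. sren Suc (sren Suc P)"
  have ren: "?sh V = wren up2 V" "wren Suc (wren g V) = wren (lift g \<circ> res_map) (?sh V)"
    "wren (\<lambda>i. i + 1) V = wren Suc V" for g V
    by (simp_all add: wren_wren comp_def)
  have step: "tr (up (up X)) (?o \<Gamma>) (SPar P' (?sh' Q)) (WPar W' (?sh W\<^sub>Q))
      \<and> tr (up (up X)) (?o \<Gamma>) (SPar (?sh' Q) P') (WPar (?sh W\<^sub>Q) W')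
      \<and> (\<forall>g Y \<Delta> \<Delta>\<^sub>1 \<Delta>\<^sub>2 L. wfits g X Y \<Delta> \<longrightarrow> wsplit \<Delta> \<Delta>\<^sub>1 \<Delta>\<^sub>2 \<longrightarrow> bout_cli_typed g x W' \<Delta>\<^sub>1 \<longrightarrow> wta \<Delta>\<^sub>2 (wren g W\<^sub>Q) L
          \<longrightarrow> bout_cli_typed g x (WPar W' (?sh W\<^sub>Q)) \<Delta> \<and> bout_cli_typed g x (WPar (?sh W\<^sub>Q) W') \<Delta>)"
    if s: "ssplit \<Gamma> \<Gamma>\<^sub>P \<Gamma>\<^sub>Q" and tQ: "tr X \<Gamma>\<^sub>Q Q W\<^sub>Q"
      and t': "tr (up (up X)) (?o \<Gamma>\<^sub>P) P' W'"
    for \<Gamma>\<^sub>P \<Gamma>\<^sub>Q P' Q W' W\<^sub>Q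
  proof -
    note d = tr_dom_par[OF s SPar.prems(3)]
    have j: "sjoin (?o \<Gamma>) (?o \<Gamma>\<^sub>P) (ext None (ext None \<Gamma>\<^sub>Q))"
      by (intro sjoin_srem[OF sjoin_ext[OF sjoin_ext[OF ssplit_sjoin[OF s]]]]) simp
    note tr = tr_sjoin[OF t' tr_shift[OF tr_shift[OF tQ d(2)] dom_ext_None[OF d(2)]]
        dom_upd_srem(2)[OF dom_ext2[OF SPar.prems(3)]] j]
    have "bout_cli_typed g x (WPar W' (?sh W\<^sub>Q)) \<Delta> \<and> bout_cli_typed g x (WPar (?sh W\<^sub>Q) W') \<Delta>"
      if f: "wfits g X Y \<Delta>" and ws: "wsplit \<Delta> \<Delta>\<^sub>1 \<Delta>\<^sub>2" and o: "bout_cli_typed g x W' \<Delta>\<^sub>1" and wQ: "wta \<Delta>\<^sub>2 (wren g W\<^sub>Q) L"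
      for g Y \<Delta> \<Delta>\<^sub>1 \<Delta>\<^sub>2 L
    proof -
      from o obtain U where U: "weights_pos U"
        "out_cli_typed (lift g \<circ> res_map) (Suc (Suc x)) 0 W' (ext {U, wdual U} \<Delta>\<^sub>1)"
        unfolding bout_cli_typed_def by blast
      note p = out_cli_typed_par[OF wjoin_ext[OF wsplit_wjoin[OF ws]] wfits_res[OF f] U(2)
          wta_shift[OF wQ wfits_wgood[OF f tQ d(2)] wfits_fresh[OF wfits_split(2)[OF ws f]], unfolded ren(2)[of g W\<^sub>Q]]
          wgood_wren[OF wfits_wgood[OF f tQ d(2)] keeps_fresh_up(1), unfolded ren(2)[of g W\<^sub>Q]]
          tr_wgood[OF t' dom_upd_srem(2)[OF dom_ext2[OF d(1)]]]]
      with U(1) show ?thesis unfolding bout_cli_typed_def by blast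
    qed
    with tr show ?thesis by blast
  qed
  have abs: "abs_sq (?sh' R) = qren up2 (abs_sq R)" for R
    unfolding up2_alt by (simp add: abs_sq_simps)
  from SPar.prems(1) consider (l) p' where "bouts P x p'" "p = p' \<parallel> qren up2 (abs_sq Q)"
    | (r) q' where "bouts Q x q'" "p = qren up2 (abs_sq P) \<parallel> q'" by auto
  then show ?case
  proof cases
    case l
    have x: "\<Gamma>\<^sub>1 x = Some (TCli T)"
      using bouts_type[OF l(1) t(1)] ssplit_sub(1)[OF s] SPar.prems(4) by fastforce
    from SPar.IH(1)[OF l(1) t(1) d(1) x] obtain P' W' z where h: "abs_sq P' = p'"
      "tr (up (up X)) (?o \<Gamma>\<^sub>1) P' W'" "z \<notin> X"
      "\<And>g. wlts (wren g W\<^sub>1) (AOut 1 (g x) 0 (Suc (g z))) (wren (lift g \<circ> res_map) W')"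
      "\<And>g Y \<Delta> L. wfits g X Y \<Delta> \<Longrightarrow> wta \<Delta> (wren g W\<^sub>1) L \<Longrightarrow> bout_cli_typed g x W' \<Delta>" by blast
    note st = step[OF s t(2) h(2)]
    have "wlts (wren g W) (AOut 1 (g x) 0 (Suc (g z))) (wren (lift g \<circ> res_map) (WPar W' (?sh W\<^sub>2)))" for g
      using wl_par_out1[OF h(4)[of g], of "wren g W\<^sub>2"] by (simp only: ren(2)[of g W\<^sub>2] ren(3) W wren.simps)
    moreover have "bout_cli_typed g x (WPar W' (?sh W\<^sub>2)) \<Delta>" if "wfits g X Y \<Delta>" "wta \<Delta> (wren g W) L" for g Y \<Delta> L
      using that(2) unfolding W wren.simps(5)
      by (elim wta_WParE) (use st h(5) that(1) wfits_split in meson)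
    moreover have "abs_sq (SPar P' (?sh' Q)) = p" by (simp only: abs_sq_simps(2) abs h(1) l(2))
    ultimately show ?thesis using st h(3) by blast
  next
    case r
    have x: "\<Gamma>\<^sub>2 x = Some (TCli T)"
      using bouts_type[OF r(1) t(2)] ssplit_sub(2)[OF s] SPar.prems(4) by fastforce
    from SPar.IH(2)[OF r(1) t(2) d(2) x] obtain P' W' z where h: "abs_sq P' = q'"
      "tr (up (up X)) (?o \<Gamma>\<^sub>2) P' W'" "z \<notin> X"
      "\<And>g. wlts (wren g W\<^sub>2) (AOut 1 (g x) 0 (Suc (g z))) (wren (lift g \<circ> res_map) W')"
      "\<And>g Y \<Delta> L. wfits g X Y \<Delta> \<Longrightarrow> wta \<Delta> (wren g W\<^sub>2) L \<Longrightarrow> bout_cli_typed g x W' \<Delta>" by blast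
    note st = step[OF ssplit_sym[OF s] t(1) h(2)]
    have "wlts (wren g W) (AOut 1 (g x) 0 (Suc (g z))) (wren (lift g \<circ> res_map) (WPar (?sh W\<^sub>1) W'))" for g
      using wl_par_out2[OF h(4)[of g], of "wren g W\<^sub>1"] by (simp only: ren(2)[of g W\<^sub>1] ren(3) W wren.simps)
    moreover have "bout_cli_typed g x (WPar (?sh W\<^sub>1) W') \<Delta>" if "wfits g X Y \<Delta>" "wta \<Delta> (wren g W) L" for g Y \<Delta> L
      using that(2) unfolding W wren.simps(5)
      by (elim wta_WParE) (use st h(5) that(1) wfits_split wsplit_sym in meson)
    moreover have "abs_sq (SPar (?sh' P) P') = p" by (simp only: abs_sq_simps(2) abs h(1) r(2))
    ultimately show ?thesis using st h(3) by blast
  qed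
next
  case (SRes P)
  from SRes.prems(2) obtain U W\<^sub>0 where W: "W = WRes (wren res_map W\<^sub>0)"
    and t: "tr (up (up X)) (opened U \<Gamma>) P W\<^sub>0" by (auto elim!: tr_SResE)
  note d = dom_ext2[OF SRes.prems(3), of U "sdual U"]
  have x': "opened U \<Gamma> (Suc (Suc x)) = Some (TCli T)" using SRes.prems(4) by simp
  have g: "wren g W = WRes (wren (lift g \<circ> res_map) W\<^sub>0)"
    "(lift g \<circ> res_map) (Suc (Suc i)) = Suc (g i)" "(lift g \<circ> res_map) 0 = 0" "(lift g \<circ> res_map) (Suc 0) = 0" for g i
    by (simp_all add: W wren_wren)
  \<comment> \<open>Whichever co-variable is sent, in the translation it is the restricted name, and
    the restriction is opened.\<close>
  have out: "\<exists>y. y \<notin> X \<and> (\<forall>g. wlts (wren g W) (AOut 1 (g x) 0 (Suc (g y))) (wren (lift g \<circ> res_map) W'))"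
    if z: "z \<notin> up (up X)" and st: "\<And>g. wlts (wren g W\<^sub>0) (AOut 0 (g (Suc (Suc x))) (g v) (g z)) (wren g W')"
      and v: "v = 0 \<or> v = Suc 0" for v z W'
  proof -
    obtain y where y: "z = Suc (Suc y)" "y \<notin> X" using z nat_cases2[of z] by auto
    have "(lift g \<circ> res_map) v = 0" for g using v by auto
    then have "wlts (wren g W) (AOut 1 (g x) 0 (Suc (g y))) (wren (lift g \<circ> res_map) W')" for g
      using wl_open[OF st[of "lift g \<circ> res_map", unfolded g y]] unfolding g(1) by simp
    with y show ?thesis by blast
  qed
  from SRes.prems(1) consider (zero) "outs P (Suc (Suc x)) 0 p"
    | (one) q where "outs P (Suc (Suc x)) (Suc 0) q" "p = qren swap_co q"
    | (bound) q where "bouts P (Suc (Suc x)) q" "p = qres (qren swap_res q)" by auto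
  then show ?case
  proof cases
    case zero
    from out_cli[OF zero t d x'] obtain P' W' z where h: "U = T" "abs_sq P' = p"
      "tr (up (up X)) (srem T 0 (opened U \<Gamma>)) P' W'" "z \<notin> up (up X)"
      "\<And>g. wlts (wren g W\<^sub>0) (AOut 0 (g (Suc (Suc x))) (g 0) (g z)) (wren g W')"
      "\<And>g Y \<Delta> L. wfits g (up (up X)) Y \<Delta> \<Longrightarrow> wta \<Delta> (wren g W\<^sub>0) L \<Longrightarrow> out_cli_typed g (Suc (Suc x)) 0 W' \<Delta>"
      unfolding ext_simps option.inject by blast
    have "bout_cli_typed g x W' \<Delta>" if "wfits g X Y \<Delta>" "wta \<Delta> (wren g W) L" for g Y \<Delta> L
      using that(2) unfolding g(1) bout_cli_typed_def
      by (elim wta_WResE) (use h(6) wfits_res[OF that(1)] in meson)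
    with out[OF h(4,5)] show ?thesis using h(1-3) by blast
  next
    case one
    from out_cli[OF one(1) t d x'] obtain P' W' z where h: "sdual U = T" "abs_sq P' = q"
      "tr (up (up X)) (srem T (Suc 0) (opened U \<Gamma>)) P' W'" "z \<notin> up (up X)"
      "\<And>g. wlts (wren g W\<^sub>0) (AOut 0 (g (Suc (Suc x))) (g (Suc 0)) (g z)) (wren g W')"
      "\<And>g Y \<Delta> L. wfits g (up (up X)) Y \<Delta> \<Longrightarrow> wta \<Delta> (wren g W\<^sub>0) L \<Longrightarrow> out_cli_typed g (Suc (Suc x)) (Suc 0) W' \<Delta>"
      unfolding ext_simps option.inject by blast
    have U: "U = sdual T" using h(1) by auto
    have sw: "wren (lift g \<circ> res_map) (wren swap_co W') = wren (lift g \<circ> res_map) W'" for g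
    proof -
      have "(lift g \<circ> res_map) \<circ> swap_co = lift g \<circ> res_map"
        by (auto simp: fun_eq_iff swap_co_def)
      then show ?thesis by (simp add: wren_wren)
    qed
    have "tr (up (up X)) (srem T 0 (opened T \<Gamma>)) (sren swap_co P') (wren swap_co W')"
    proof (rule tr_swap_co[OF h(3) dom_upd_srem(2)[OF d]])
      show "srem T 0 (opened T \<Gamma>) (swap_co a) = srem T (Suc 0) (opened U \<Gamma>) a" for a
        using nat_cases2[of a] by (elim disjE exE) (simp_all add: U srem_def)
    qed
    moreover have "bout_cli_typed g x (wren swap_co W') \<Delta>" if "wfits g X Y \<Delta>" "wta \<Delta> (wren g W) L" for g Y \<Delta> L
    proof -
      from that(2) obtain V where V: "weights_pos V" "wta (ext {V, wdual V} \<Delta>) (wren (lift g \<circ> res_map) W\<^sub>0) L"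
        unfolding g by (rule wta_WResE)
      show ?thesis using h(6)[OF wfits_res[OF that(1)] V(2)] V(1)
        unfolding bout_cli_typed_def out_cli_typed_def sw g by blast
    qed
    moreover have "abs_sq (sren swap_co P') = p" by (simp only: abs_sq_simps h(2) one(2))
    moreover obtain y where "y \<notin> X"
      "\<And>g. wlts (wren g W) (AOut 1 (g x) 0 (Suc (g y))) (wren (lift g \<circ> res_map) (wren swap_co W'))"
      using out[OF h(4,5)] unfolding sw by blast
    ultimately show ?thesis by blast
  next
    case bound
    let ?x = "Suc (Suc (Suc (Suc x)))"
    from SRes.IH[OF bound(1) t d x'] obtain P' W' z where h: "abs_sq P' = q"
      "tr (up (up (up (up X)))) (srem T 0 (opened T (opened U \<Gamma>))) P' W'" "z \<notin> up (up X)"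
      "\<And>g. wlts (wren g W\<^sub>0) (AOut 1 (g (Suc (Suc x))) 0 (Suc (g z))) (wren (lift g \<circ> res_map) W')"
      "\<And>g Y \<Delta> L. wfits g (up (up X)) Y \<Delta> \<Longrightarrow> wta \<Delta> (wren g W\<^sub>0) L \<Longrightarrow> bout_cli_typed g (Suc (Suc x)) W' \<Delta>"
      by blast
    obtain y where y: "z = Suc (Suc y)" "y \<notin> X" using h(3) nat_cases2[of z] by auto
    let ?W = "WRes (wren res_map (wren swap_res W'))"
    note dW = dom_upd_srem(2)[OF dom_ext2[OF d]]
    have "tr (up (up (up (up X)))) (opened U (srem T 0 (opened T \<Gamma>))) (sren swap_res P') (wren swap_res W')"
    proof (rule tr_swap_res[OF h(2) dW])
      show "opened U (srem T 0 (opened T \<Gamma>)) (swap_res a) = srem T 0 (opened T (opened U \<Gamma>)) a" for a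
        using nat_cases4[of a] by (elim disjE exE) (simp_all add: srem_def)
    qed
    from tr.res[OF this]
    have tr': "tr (up (up X)) (srem T 0 (opened T \<Gamma>)) (SRes (sren swap_res P')) ?W" .
    have rW: "wren (lift g \<circ> res_map) ?W
        = WRes (wren swap_co (wren (lift (lift g \<circ> res_map) \<circ> res_map) W'))" for g
    proof -
      have "(lift (lift g \<circ> res_map) \<circ> (res_map \<circ> swap_res)) i = (swap_co \<circ> (lift (lift g \<circ> res_map) \<circ> res_map)) i" for i
        using nat_cases4[of i] by (elim disjE exE) simp_all
      then have "lift (lift g \<circ> res_map) \<circ> (res_map \<circ> swap_res) = swap_co \<circ> (lift (lift g \<circ> res_map) \<circ> res_map)"
        by blast
      then show ?thesis by (simp add: wren_wren)
    qed
    have "wlts (wren g W) (AOut 1 (g x) 0 (Suc (g y))) (wren (lift g \<circ> res_map) ?W)" for g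
      using wl_res_out[OF h(4)[of "lift g \<circ> res_map", unfolded g y]] unfolding g(1) rW
      by (simp add: wdrop_def wrot1)
    moreover have "bout_cli_typed g x ?W \<Delta>" if f: "wfits g X Y \<Delta>" and w: "wta \<Delta> (wren g W) L" for g Y \<Delta> L
    proof -
      from w obtain V where V: "weights_pos V" "wta (ext {V, wdual V} \<Delta>) (wren (lift g \<circ> res_map) W\<^sub>0) L"
        unfolding g by (rule wta_WResE)
      let ?g = "lift (lift g \<circ> res_map) \<circ> res_map"
      note f2 = wfits_res[OF wfits_res[OF f]]
      have g2: "?g ?x = Suc (Suc (g x))" "?g 0 = 0" by simp_all
      from h(5)[OF wfits_res[OF f] V(2)] obtain Z where Z: "weights_pos Z"
        "out_cli_typed ?g ?x 0 W' (ext {Z, wdual Z} (ext {V, wdual V} \<Delta>))"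
        unfolding bout_cli_typed_def by blast
      then obtain n V\<^sub>1 L' where o: "VCli n V\<^sub>1 \<in> \<Delta> (g x)" "V\<^sub>1 \<in> {Z, wdual Z}"
        "wta (ext (if wun V\<^sub>1 then {Z, wdual Z} else {Z, wdual Z} - {V\<^sub>1}) (ext {V, wdual V} \<Delta>)) (wren ?g W') L'"
        unfolding out_cli_typed_def g2 rem_ext ext_simps by blast
      have gd: "wgood (up (up Y)) (wren ?g W')"
        using f2 by (intro wgood_wren[OF tr_wgood[OF h(2) dW]]) (auto simp: wfits_def)
      from wta.res[OF V(1) wta_swap[OF o(3) gd wfits_fresh[OF f]]]
      have "wta (rem V\<^sub>1 0 (ext {Z, wdual Z} \<Delta>)) (wren (lift g \<circ> res_map) ?W) L'"
        unfolding rW rem_ext .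
      with o Z(1) show ?thesis
        unfolding bout_cli_typed_def out_cli_typed_def g rem_ext ext_simps by blast
    qed
    moreover have "abs_sq (SRes (sren swap_res P')) = p" by (simp only: abs_sq_simps h(1) bound(2))
    ultimately show ?thesis using tr' y(2) by blast
  qed
qed auto

subsection \<open>Inputs\<close>

text \<open>Describes the derivative of a linear input that receives \<open>b\<close> and
  \<open>c\<close>: the parameter becomes \<open>b\<close>, and the subject, on which the source
  goes on, becomes the received continuation \<open>c\<close>.\<close>

definition in_ren :: "(name \<Rightarrow> name) \<Rightarrow> name \<Rightarrow> name \<Rightarrow> name \<Rightarrow> name \<Rightarrow> name" where
  "in_ren g y b c i = (if i = 0 then b else if i = Suc y then c else g (i - 1))"

lemma in_ren_simps [simp]: "in_ren g y b c 0 = b" "in_ren g y b c (Suc i) = (if i = y then c else g i)"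
  by (simp_all add: in_ren_def)

text \<open>
  The first disjunct covers a linear input that is typed as a server. It cannot occur in a communication,
  where the matching output determines the type.
\<close>

definition in_lin_typed :: "(name \<Rightarrow> name) \<Rightarrow> name \<Rightarrow> wproc \<Rightarrow> wctx \<Rightarrow> bool" where
  "in_lin_typed g y F \<Gamma> \<longleftrightarrow> (\<exists>n V. VSrv n V \<in> \<Gamma> (g y))
     \<or> (\<exists>n V\<^sub>1 V\<^sub>2 L. VIn n V\<^sub>1 V\<^sub>2 \<in> \<Gamma> (g y)
          \<and> wta (ext {V\<^sub>1} (ext {V\<^sub>2} (rem (VIn n V\<^sub>1 V\<^sub>2) (g y) \<Gamma>))) (wren (in_ren (Suc \<circ> (Suc \<circ> g)) y 0 1) F) L)"

lemma keeps_fresh_in_ren: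
  "keeps_fresh g X Y \<Longrightarrow> y \<in> X \<Longrightarrow> keeps_fresh (in_ren (Suc \<circ> (Suc \<circ> g)) y 0 1) (up X) (up (up Y))"
  unfolding keeps_fresh_def
proof (intro allI impI conjI)
  fix z assume g: "\<forall>z. z \<notin> X \<longrightarrow> g z \<notin> Y \<and> (\<forall>a. g a = g z \<longrightarrow> a = z)" and y: "y \<in> X" and z: "z \<notin> up X"
  then obtain z' where z': "z = Suc z'" "z' \<notin> X" by (cases z) auto
  then have n: "z' \<noteq> y" using y by blast
  then show "in_ren (Suc \<circ> (Suc \<circ> g)) y 0 1 z \<notin> up (up Y)" using z' g by simp
  fix a assume "in_ren (Suc \<circ> (Suc \<circ> g)) y 0 1 a = in_ren (Suc \<circ> (Suc \<circ> g)) y 0 1 z"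
  then show "a = z" using z' g n by (cases a) (auto split: if_splits)
qed

lemma in_lin_typed_par:
  assumes j: "wjoin \<Delta> \<Delta>\<^sub>1 \<Delta>\<^sub>2" and f: "wfits g X Y \<Delta>" and yX: "y \<in> X"
    and o: "in_lin_typed g y F \<Delta>\<^sub>1"
    and Q: "wta \<Delta>\<^sub>2 V L" "wgood Y V" and F: "wgood (up X) F"
    and ren: "wren Suc (wren Suc V) = wren (in_ren (Suc \<circ> (Suc \<circ> g)) y 0 1) W\<^sub>Q"
  shows "in_lin_typed g y (WPar F W\<^sub>Q) \<Delta>" "in_lin_typed g y (WPar W\<^sub>Q F) \<Delta>"
proof -
  from o consider (srv) n V where "VSrv n V \<in> \<Delta>\<^sub>1 (g y)"
    | (lin) n V\<^sub>1 V\<^sub>2 L' where "VIn n V\<^sub>1 V\<^sub>2 \<in> \<Delta>\<^sub>1 (g y)"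
      "wta (ext {V\<^sub>1} (ext {V\<^sub>2} (rem (VIn n V\<^sub>1 V\<^sub>2) (g y) \<Delta>\<^sub>1))) (wren (in_ren (Suc \<circ> (Suc \<circ> g)) y 0 1) F) L'"
    unfolding in_lin_typed_def by blast
  then have "in_lin_typed g y (WPar F W\<^sub>Q) \<Delta> \<and> in_lin_typed g y (WPar W\<^sub>Q F) \<Delta>"
  proof cases
    case srv
    then show ?thesis using wjoinD(1)[OF j] unfolding in_lin_typed_def by blast
  next
    case lin
    let ?\<Delta> = "rem (VIn n V\<^sub>1 V\<^sub>2) (g y) \<Delta>"
    note j2 = wjoin_ext[OF wjoin_ext[OF wjoin_rem[OF j lin(1)], of "{V\<^sub>2}"], of "{V\<^sub>1}"]
    have fr2: "\<Delta>\<^sub>2 z = {}" if "z \<notin> Y" for z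
      using wfits_fresh[OF f that] wjoinD(1)[OF j] by blast
    have fr3: "ext {} \<Delta>\<^sub>2 z = {}" if "z \<notin> up Y" for z
      using fr2 that by (cases z) auto
    have sh: "wta (ext {} (ext {} \<Delta>\<^sub>2)) (wren (in_ren (Suc \<circ> (Suc \<circ> g)) y 0 1) W\<^sub>Q) L"
      using wta_shift[OF wta_shift[OF Q fr2] wgood_wren[OF Q(2) keeps_fresh_up(1)] fr3] unfolding ren by simp
    have gd: "wgood (up (up Y)) (wren (in_ren (Suc \<circ> (Suc \<circ> g)) y 0 1) F)"
        "wgood (up (up Y)) (wren (in_ren (Suc \<circ> (Suc \<circ> g)) y 0 1) W\<^sub>Q)"
      using f yX F wgood_wren[OF wgood_wren[OF Q(2) keeps_fresh_up(1)] keeps_fresh_up(1)] unfolding ren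
      by (auto simp: wfits_def intro!: wgood_wren keeps_fresh_in_ren[simplified])
    have fr: "ext {V\<^sub>1} (ext {V\<^sub>2} ?\<Delta>) z = {}" if "z \<notin> up (up Y)" for z
      using that wfits_fresh[OF f] nat_cases2[of z] by (auto simp: rem_empty)
    have "VIn n V\<^sub>1 V\<^sub>2 \<in> \<Delta> (g y)" using lin(1) wjoinD(1)[OF j] by blast
    with wta_wjoin[OF lin(2) sh gd fr j2] show ?thesis unfolding in_lin_typed_def wren.simps by blast
  qed
  then show "in_lin_typed g y (WPar F W\<^sub>Q) \<Delta>" "in_lin_typed g y (WPar W\<^sub>Q F) \<Delta>" by blast+
qed

text \<open>The rotation \<open>open_in\<close> is a bijection with inverse \<open>wrot 2\<close>,
  so it is an admissible renaming of contexts and scopes.\<close>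

lemma tr_open_in:
  assumes "tr (up (up (up X))) \<Gamma> P W" "dom \<Gamma> \<subseteq> up (up (up X))" "\<And>a. \<Gamma>' (open_in a) = \<Gamma> a"
  shows "tr (up (up (up X))) \<Gamma>' (sren open_in P) (wren open_in W)"
proof (rule tr_ren[OF assms(1) srel_bij[where h = "wrot 2"] keeps_fresh_bij[where h = "wrot 2"] assms(2)])
  show "\<Gamma>' (open_in a) = \<Gamma> a" for a by (rule assms(3))
  show "wrot 2 (open_in a) = a" "open_in (wrot 2 a) = a" for a
    by (auto simp: open_in_def wrot_def)
  show "wrot 2 (open_in a) = a" for a by (auto simp: open_in_def wrot_def)
  show "open_in i \<in> up (up (up X)) \<longleftrightarrow> i \<in> up (up (up X))" for i
    using nat_cases3[of i] by (elim disjE exE) (simp_all add: open_in_def numeral_eq_Suc)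
qed

lemma open_in_simps [simp]: "open_in 0 = Suc (Suc 0)" "open_in (Suc 0) = 0" "open_in (Suc (Suc 0)) = Suc 0"
    "open_in (Suc (Suc (Suc i))) = Suc (Suc (Suc i))"
  by (simp_all add: open_in_def)

text \<open>The input of the source is late and that of the translation early. One residual
  \<open>W'\<close> is therefore fixed, and the transition is claimed for all received names
  \<open>b\<close> and \<open>c\<close>.\<close>

lemma in_lin:
  "ins P y p \<Longrightarrow> tr X \<Gamma> P W \<Longrightarrow> dom \<Gamma> \<subseteq> X \<Longrightarrow> \<Gamma> y = Some (TLIn T S) \<Longrightarrow>
    \<exists>F W'. abs_sq F = p \<and> tr (up X) (ext (Some T) (\<Gamma>(y \<mapsto> S))) F W'
      \<and> (\<forall>g b c. wlts (wren g W) (AIn (g y) b c) (wren (in_ren g y b c) W'))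
      \<and> (\<forall>g Y \<Delta> L. wfits g X Y \<Delta> \<longrightarrow> wta \<Delta> (wren g W) L \<longrightarrow> in_lin_typed g y W' \<Delta>)"
proof (induction P arbitrary: y p X \<Gamma> W)
  case (SIn q x P)
  then have e: "x = y" by simp
  from SIn.prems(2,4) obtain W' where t: "q = Lin" "tr (up X) (ext (Some T) (\<Gamma>(y \<mapsto> S))) P W'"
    "W = WIn y (wren (in_map y) W')"
    unfolding e by (auto elim!: tr_SInE)
  have p: "abs_sq P = p" using SIn.prems(1) t(1) by simp
  \<comment> \<open>Renaming below the two parameters and then instantiating them amounts to the
    single renaming \<open>in_ren\<close>.\<close>
  have c: "lift (lift g) \<circ> in_map y = in_ren (Suc \<circ> (Suc \<circ> g)) y 0 1"
    "ext b (ext c id) \<circ> in_ren (Suc \<circ> (Suc \<circ> g)) y 0 1 = in_ren g y b c" for g b c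
    by (auto simp: fun_eq_iff lift_if ext_if in_map_def in_ren_def)
  have g: "wren g W = WIn (g y) (wren (in_ren (Suc \<circ> (Suc \<circ> g)) y 0 1) W')" for g
    by (simp only: t wren.simps wren_wren c)
  have "wlts (wren g W) (AIn (g y) b c) (wren (in_ren g y b c) W')" for g b c
    using wl_in[of "g y" "wren (in_ren (Suc \<circ> (Suc \<circ> g)) y 0 1) W'" b c]
    by (simp only: g wsubst_def wren_wren c(2))
  moreover have "in_lin_typed g y W' \<Delta>" if "wta \<Delta> (wren g W) L" for g \<Delta> L
    using that unfolding g in_lin_typed_def by (elim wta_WInE) blast+
  ultimately show ?case using t p by blast
next
  case (SPar P Q)
  from SPar.prems(2) obtain \<Gamma>\<^sub>1 \<Gamma>\<^sub>2 W\<^sub>1 W\<^sub>2 where W: "W = WPar W\<^sub>1 W\<^sub>2" and s: "ssplit \<Gamma> \<Gamma>\<^sub>1 \<Gamma>\<^sub>2"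
    and t: "tr X \<Gamma>\<^sub>1 P W\<^sub>1" "tr X \<Gamma>\<^sub>2 Q W\<^sub>2" by (auto elim!: tr_SParE)
  note d = tr_dom_par[OF s SPar.prems(3)]
  have yX: "y \<in> X" using SPar.prems(3,4) by auto
  let ?o = "\<lambda>\<Gamma>. ext (Some T) (\<Gamma>(y \<mapsto> S))"
  have dom_o: "dom (?o \<Gamma>) \<subseteq> up X" if "dom \<Gamma> \<subseteq> X" for \<Gamma> :: sctx
    using that yX unfolding ext_dom by (auto simp: up_def)
  have step: "tr (up X) (?o \<Gamma>) (SPar F (sren Suc Q)) (WPar W' (wren Suc W\<^sub>Q))
      \<and> tr (up X) (?o \<Gamma>) (SPar (sren Suc Q) F) (WPar (wren Suc W\<^sub>Q) W')
      \<and> (\<forall>g b c. wren g W\<^sub>Q = wren (in_ren g y b c) (wren Suc W\<^sub>Q))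
      \<and> (\<forall>g Y \<Delta> \<Delta>\<^sub>1 \<Delta>\<^sub>2 L. wfits g X Y \<Delta> \<longrightarrow> wsplit \<Delta> \<Delta>\<^sub>1 \<Delta>\<^sub>2 \<longrightarrow> in_lin_typed g y W' \<Delta>\<^sub>1 \<longrightarrow> wta \<Delta>\<^sub>2 (wren g W\<^sub>Q) L
          \<longrightarrow> in_lin_typed g y (WPar W' (wren Suc W\<^sub>Q)) \<Delta> \<and> in_lin_typed g y (WPar (wren Suc W\<^sub>Q) W') \<Delta>)"
    if s: "ssplit \<Gamma> \<Gamma>\<^sub>P \<Gamma>\<^sub>Q" and tQ: "tr X \<Gamma>\<^sub>Q Q W\<^sub>Q" and y: "\<Gamma>\<^sub>P y = Some (TLIn T S)"
      and t': "tr (up X) (?o \<Gamma>\<^sub>P) F W'"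
    for \<Gamma>\<^sub>P \<Gamma>\<^sub>Q F Q W' W\<^sub>Q
  proof -
    note d = tr_dom_par[OF s SPar.prems(3)]
    have j: "sjoin (?o \<Gamma>) (?o \<Gamma>\<^sub>P) (ext None \<Gamma>\<^sub>Q)"
      using y by (intro sjoin_ext sjoin_upd[OF ssplit_sjoin[OF s]]) auto
    note tr = tr_sjoin[OF t' tr_shift[OF tQ d(2)] dom_o[OF SPar.prems(3)] j]
    have yQ: "y \<notin> dom \<Gamma>\<^sub>Q" using sjoin_dom[OF ssplit_sjoin[OF s] y] by simp
    have ren: "wren g W\<^sub>Q = wren (in_ren g y b c) (wren Suc W\<^sub>Q)" for g b c
      unfolding wren_wren by (rule tr_wren_cong[OF tQ]) (use yQ yX in auto)
    have "in_lin_typed g y (WPar W' (wren Suc W\<^sub>Q)) \<Delta> \<and> in_lin_typed g y (WPar (wren Suc W\<^sub>Q) W') \<Delta>"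
      if f: "wfits g X Y \<Delta>" and ws: "wsplit \<Delta> \<Delta>\<^sub>1 \<Delta>\<^sub>2" and o: "in_lin_typed g y W' \<Delta>\<^sub>1" and wQ: "wta \<Delta>\<^sub>2 (wren g W\<^sub>Q) L"
      for g Y \<Delta> \<Delta>\<^sub>1 \<Delta>\<^sub>2 L
    proof -
      have "wren Suc (wren Suc (wren g W\<^sub>Q)) = wren (in_ren (Suc \<circ> (Suc \<circ> g)) y 0 1) (wren Suc W\<^sub>Q)"
        using ren[of "Suc \<circ> (Suc \<circ> g)" 0 1] by (simp only: wren_wren)
      from in_lin_typed_par[OF wsplit_wjoin[OF ws] f yX o wQ wfits_wgood[OF f tQ d(2)] tr_wgood[OF t' dom_o[OF d(1)]] this]
      show ?thesis by blast
    qed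
    with tr ren show ?thesis by blast
  qed
  from SPar.prems(1) consider (l) p' where "ins P y p'" "p = p' \<parallel> qren Suc (abs_sq Q)"
    | (r) q' where "ins Q y q'" "p = qren Suc (abs_sq P) \<parallel> q'" by auto
  then show ?case
  proof cases
    case l
    have y: "\<Gamma>\<^sub>1 y = Some (TLIn T S)"
      using ins_type[OF l(1) t(1)] ssplit_sub(1)[OF s] SPar.prems(4) by fastforce
    from SPar.IH(1)[OF l(1) t(1) d(1) y] obtain F W' where h: "abs_sq F = p'"
      "tr (up X) (?o \<Gamma>\<^sub>1) F W'"
      "\<And>g b c. wlts (wren g W\<^sub>1) (AIn (g y) b c) (wren (in_ren g y b c) W')"
      "\<And>g Y \<Delta> L. wfits g X Y \<Delta> \<Longrightarrow> wta \<Delta> (wren g W\<^sub>1) L \<Longrightarrow> in_lin_typed g y W' \<Delta>" by blast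
    note st = step[OF s t(2) y h(2)]
    have r: "wren g W\<^sub>2 = wren (in_ren g y b c) (wren Suc W\<^sub>2)" for g b c using st by blast
    have "wlts (wren g W) (AIn (g y) b c) (wren (in_ren g y b c) (WPar W' (wren Suc W\<^sub>2)))" for g b c
      using wl_par_in1[OF h(3)[of g b c], of "wren g W\<^sub>2"] by (simp only: W wren.simps r[of g b c, symmetric])
    moreover have "in_lin_typed g y (WPar W' (wren Suc W\<^sub>2)) \<Delta>" if "wfits g X Y \<Delta>" "wta \<Delta> (wren g W) L" for g Y \<Delta> L
      using that(2) unfolding W wren.simps(5)
      by (elim wta_WParE) (use st h(4) that(1) wfits_split in meson)
    moreover have "abs_sq (SPar F (sren Suc Q)) = p" by (simp only: abs_sq_simps h(1) l(2))
    ultimately show ?thesis using st by blast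
  next
    case r
    have y: "\<Gamma>\<^sub>2 y = Some (TLIn T S)"
      using ins_type[OF r(1) t(2)] ssplit_sub(2)[OF s] SPar.prems(4) by fastforce
    from SPar.IH(2)[OF r(1) t(2) d(2) y] obtain F W' where h: "abs_sq F = q'"
      "tr (up X) (?o \<Gamma>\<^sub>2) F W'"
      "\<And>g b c. wlts (wren g W\<^sub>2) (AIn (g y) b c) (wren (in_ren g y b c) W')"
      "\<And>g Y \<Delta> L. wfits g X Y \<Delta> \<Longrightarrow> wta \<Delta> (wren g W\<^sub>2) L \<Longrightarrow> in_lin_typed g y W' \<Delta>" by blast
    note st = step[OF ssplit_sym[OF s] t(1) y h(2)]
    have r': "wren g W\<^sub>1 = wren (in_ren g y b c) (wren Suc W\<^sub>1)" for g b c using st by blast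
    have "wlts (wren g W) (AIn (g y) b c) (wren (in_ren g y b c) (WPar (wren Suc W\<^sub>1) W'))" for g b c
      using wl_par_in2[OF h(3)[of g b c], of "wren g W\<^sub>1"] by (simp only: W wren.simps r'[of g b c, symmetric])
    moreover have "in_lin_typed g y (WPar (wren Suc W\<^sub>1) W') \<Delta>" if "wfits g X Y \<Delta>" "wta \<Delta> (wren g W) L" for g Y \<Delta> L
      using that(2) unfolding W wren.simps(5)
      by (elim wta_WParE) (use st h(4) that(1) wfits_split wsplit_sym in meson)
    moreover have "abs_sq (SPar (sren Suc P) F) = p" by (simp only: abs_sq_simps h(1) r(2))
    ultimately show ?thesis using st by blast
  qed
next
  case (SRes P)
  from SRes.prems(1) obtain q where q: "ins P (Suc (Suc y)) q" "p = qres (qren open_in q)" by auto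
  from SRes.prems(2) obtain U W\<^sub>0 where W: "W = WRes (wren res_map W\<^sub>0)"
    and t: "tr (up (up X)) (opened U \<Gamma>) P W\<^sub>0" by (auto elim!: tr_SResE)
  note d = dom_ext2[OF SRes.prems(3), of U "sdual U"]
  have y': "opened U \<Gamma> (Suc (Suc y)) = Some (TLIn T S)" using SRes.prems(4) by simp
  have g: "wren g W = WRes (wren (lift g \<circ> res_map) W\<^sub>0)" "(lift g \<circ> res_map) (Suc (Suc i)) = Suc (g i)" for g i
    by (simp_all add: W wren_wren)
  have yX: "y \<in> X" using SRes.prems(3,4) by auto
  from SRes.IH[OF q(1) t d y'] obtain F W' where h: "abs_sq F = q"
    "tr (up (up (up X))) (ext (Some T) ((opened U \<Gamma>)(Suc (Suc y) \<mapsto> S))) F W'"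
    "\<And>g b c. wlts (wren g W\<^sub>0) (AIn (g (Suc (Suc y))) b c) (wren (in_ren g (Suc (Suc y)) b c) W')"
    "\<And>g Y \<Delta> L. wfits g (up (up X)) Y \<Delta> \<Longrightarrow> wta \<Delta> (wren g W\<^sub>0) L \<Longrightarrow> in_lin_typed g (Suc (Suc y)) W' \<Delta>"
    by blast
  let ?W = "WRes (wren res_map (wren open_in W'))"
  have dW: "dom (ext (Some T) ((opened U \<Gamma>)(Suc (Suc y) \<mapsto> S))) \<subseteq> up (up (up X))"
    using SRes.prems(3) yX unfolding ext_upd_Suc ext_dom by (auto simp: up_def)
  have "tr (up (up (up X))) (opened U (ext (Some T) (\<Gamma>(y \<mapsto> S)))) (sren open_in F) (wren open_in W')"
  proof (rule tr_open_in[OF h(2) dW])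
    show "opened U (ext (Some T) (\<Gamma>(y \<mapsto> S))) (open_in a) = ext (Some T) ((opened U \<Gamma>)(Suc (Suc y) \<mapsto> S)) a" for a
      using nat_cases3[of a] by (elim disjE exE) simp_all
  qed
  from tr.res[OF this] have tr': "tr (up X) (ext (Some T) (\<Gamma>(y \<mapsto> S))) (SRes (sren open_in F)) ?W" .
  have "(lift (in_ren g y b c) \<circ> (res_map \<circ> open_in)) i = in_ren (lift g \<circ> res_map) (Suc (Suc y)) (Suc b) (Suc c) i" for g b c i
    using nat_cases3[of i] by (elim disjE exE) simp_all
  then have c1: "lift (in_ren g y b c) \<circ> (res_map \<circ> open_in) = in_ren (lift g \<circ> res_map) (Suc (Suc y)) (Suc b) (Suc c)" for g b c
    by blast
  have "(lift (in_ren (Suc \<circ> (Suc \<circ> g)) y 0 1) \<circ> (res_map \<circ> open_in)) i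
      = (wrot 2 \<circ> in_ren (Suc \<circ> (Suc \<circ> (lift g \<circ> res_map))) (Suc (Suc y)) 0 1) i" for g i
    using nat_cases3[of i] by (elim disjE exE) (simp_all add: wrot_def)
  then have c2: "lift (in_ren (Suc \<circ> (Suc \<circ> g)) y 0 1) \<circ> (res_map \<circ> open_in)
      = wrot 2 \<circ> in_ren (Suc \<circ> (Suc \<circ> (lift g \<circ> res_map))) (Suc (Suc y)) 0 1" for g by blast
  have "wlts (wren g W) (AIn (g y) b c) (wren (in_ren g y b c) ?W)" for g b c
    using wl_res_in[OF h(3)[of "lift g \<circ> res_map" "Suc b" "Suc c", unfolded g]]
    unfolding g(1) wren.simps wren_wren c1 .
  moreover have "in_lin_typed g y ?W \<Delta>" if f: "wfits g X Y \<Delta>" and w: "wta \<Delta> (wren g W) L" for g Y \<Delta> L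
  proof -
    from w obtain V where V: "weights_pos V" "wta (ext {V, wdual V} \<Delta>) (wren (lift g \<circ> res_map) W\<^sub>0) L"
      unfolding g by (rule wta_WResE)
    let ?g = "lift g \<circ> res_map" let ?r = "in_ren (Suc \<circ> (Suc \<circ> ?g)) (Suc (Suc y)) 0 1"
    from h(4)[OF wfits_res[OF f] V(2)] consider (srv) n Z where "VSrv n Z \<in> \<Delta> (g y)"
      | (lin) n V\<^sub>1 V\<^sub>2 L' where "VIn n V\<^sub>1 V\<^sub>2 \<in> \<Delta> (g y)"
        "wta (ext {V\<^sub>1} (ext {V\<^sub>2} (ext {V, wdual V} (rem (VIn n V\<^sub>1 V\<^sub>2) (g y) \<Delta>)))) (wren ?r W') L'"
      unfolding in_lin_typed_def g rem_ext ext_simps by blast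
    then show ?thesis
    proof cases
      case srv
      then show ?thesis unfolding in_lin_typed_def by blast
    next
      case lin
      have "wgood (up (up (up Y))) (wren ?r W')"
        using wfits_res[OF f] yX
        by (intro wgood_wren[OF tr_wgood[OF h(2) dW]] keeps_fresh_in_ren) (auto simp: wfits_def)
      moreover have "rem (VIn n V\<^sub>1 V\<^sub>2) (g y) \<Delta> z = {}" if "z \<notin> Y" for z
        using that wfits_fresh[OF f] by (simp add: rem_empty)
      ultimately have "wta (ext {V\<^sub>1} (ext {V\<^sub>2} (rem (VIn n V\<^sub>1 V\<^sub>2) (g y) \<Delta>))) (WRes (wren (wrot 2) (wren ?r W'))) L'"
        by (intro wta.res[OF V(1) wta_rot[OF lin(2)]])
      then have "wta (ext {V\<^sub>1} (ext {V\<^sub>2} (rem (VIn n V\<^sub>1 V\<^sub>2) (g y) \<Delta>))) (wren (in_ren (Suc \<circ> (Suc \<circ> g)) y 0 1) ?W) L'"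
        by (simp only: wren.simps wren_wren c2)
      with lin(1) show ?thesis unfolding in_lin_typed_def by blast
    qed
  qed
  moreover have "abs_sq (SRes (sren open_in F)) = p" by (simp only: abs_sq_simps h(1) q(2))
  ultimately show ?case using tr' by blast
qed auto

text \<open>The first disjunct is again a mismatch, an input on a server that is typed as linear. In
  the second, the unit parameter of the translated input is already discarded, so that one binder
  remains as in the source.\<close>

definition in_srv_typed :: "(name \<Rightarrow> name) \<Rightarrow> name \<Rightarrow> wproc \<Rightarrow> wctx \<Rightarrow> bool" where
  "in_srv_typed g y F \<Gamma> \<longleftrightarrow> (\<exists>n V\<^sub>1 V\<^sub>2. VIn n V\<^sub>1 V\<^sub>2 \<in> \<Gamma> (g y))
     \<or> (\<exists>n V L. VSrv n V \<in> \<Gamma> (g y) \<and> wta (ext {V} \<Gamma>) (wren (lift g) F) L)"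

lemma in_srv_typed_par:
  assumes j: "wjoin \<Delta> \<Delta>\<^sub>1 \<Delta>\<^sub>2" and f: "wfits g X Y \<Delta>"
    and o: "in_srv_typed g y F \<Delta>\<^sub>1"
    and Q: "wta \<Delta>\<^sub>2 (wren g V) L" "wgood Y (wren g V)" and F: "wgood (up X) F"
  shows "in_srv_typed g y (WPar F (wren Suc V)) \<Delta>" "in_srv_typed g y (WPar (wren Suc V) F) \<Delta>"
proof -
  have ren: "wren Suc (wren g V) = wren (lift g) (wren Suc V)"
    by (simp add: wren_wren comp_def)
  from o consider (lin) n V\<^sub>1 V\<^sub>2 where "VIn n V\<^sub>1 V\<^sub>2 \<in> \<Delta>\<^sub>1 (g y)"
    | (srv) n V\<^sub>1 L' where "VSrv n V\<^sub>1 \<in> \<Delta>\<^sub>1 (g y)" "wta (ext {V\<^sub>1} \<Delta>\<^sub>1) (wren (lift g) F) L'"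
    unfolding in_srv_typed_def by blast
  then have "in_srv_typed g y (WPar F (wren Suc V)) \<Delta> \<and> in_srv_typed g y (WPar (wren Suc V) F) \<Delta>"
  proof cases
    case lin
    then show ?thesis using wjoinD(1)[OF j] unfolding in_srv_typed_def by blast
  next
    case srv
    have fr2: "\<Delta>\<^sub>2 z = {}" if "z \<notin> Y" for z
      using wfits_fresh[OF f that] wjoinD(1)[OF j] by blast
    note sh = wta_shift[OF Q fr2, unfolded ren]
    have gd: "wgood (up Y) (wren (lift g) F)" "wgood (up Y) (wren (lift g) (wren Suc V))"
      using f F wgood_wren[OF Q(2) keeps_fresh_up(1)] unfolding ren
      by (auto simp: wfits_def intro!: wgood_wren keeps_fresh_lift)
    have fr: "ext {V\<^sub>1} \<Delta> z = {}" if "z \<notin> up Y" for z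
      using that wfits_fresh[OF f] by (cases z) auto
    have "VSrv n V\<^sub>1 \<in> \<Delta> (g y)" using srv(1) wjoinD(1)[OF j] by blast
    with wta_wjoin[OF srv(2) sh gd fr wjoin_ext[OF j]] show ?thesis unfolding in_srv_typed_def wren.simps by blast
  qed
  then show "in_srv_typed g y (WPar F (wren Suc V)) \<Delta>" "in_srv_typed g y (WPar (wren Suc V) F) \<Delta>" by blast+
qed

text \<open>The second parameter, index 1, is not in the image of \<open>lift Suc\<close> and does
  not occur in the body. The map \<open>res_map\<close>, which folds index 1 onto index 0, is reused
  here to discard it together with its unit assumption.\<close>

lemma wta_srv_body:
  assumes "wta (ext {V} (ext {VUnit} \<Delta>)) (wren (lift (lift g) \<circ> lift Suc) W) L" "wgood (up X) W" "wfits g X Y \<Delta>"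
  shows "wta (ext {V} \<Delta>) (wren (lift g) W) L"
proof -
  let ?W = "wren (lift (lift g) \<circ> lift Suc) W"
  have e: "(lift (lift g) \<circ> lift Suc) = lift (Suc \<circ> g)" by (auto simp: fun_eq_iff lift_if)
  have gd: "wgood (up (up Y)) ?W"
    using assms(3) unfolding wfits_def
    by (intro wgood_wren[OF assms(2)] keeps_fresh_comp[OF keeps_fresh_lift[OF keeps_fresh_lift] keeps_fresh_up(2)]) simp
  have nf: "Suc 0 \<notin> wfn ?W" unfolding wfn_wren e by (auto simp: lift_if)
  have "wta (ext {V} \<Delta>) (wren res_map ?W) L"
  proof (rule wta_ren[OF gd assms(1) _ keeps_fresh_up(3)])
    show "wrel (wfn ?W) res_map (ext {V} (ext {VUnit} \<Delta>)) (ext {V} \<Delta>)"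
    proof (rule wrelI)
      show "U \<in> ext {V} \<Delta> (res_map a)" if "U \<in> ext {V} (ext {VUnit} \<Delta>) a" "a \<in> wfn ?W" for a U
        using that nf nat_cases2[of a] by auto
      show "c = a" if "\<not> wun U" "U \<in> ext {V} (ext {VUnit} \<Delta>) a" "U \<in> ext {V} (ext {VUnit} \<Delta>) c"
        "res_map c = res_map a" for a c U
        using that nat_cases2[of a] nat_cases2[of c] by (elim disjE exE) auto
      show "\<exists>a. res_map a = b \<and> U \<in> ext {V} (ext {VUnit} \<Delta>) a" if "U \<in> ext {V} \<Delta> b" for b U
      proof (cases b)
        case 0 then show ?thesis using that by (intro exI[of _ 0]) simp
      next
        case (Suc c) then show ?thesis using that by (intro exI[of _ "Suc (Suc c)"]) simp
      qed
    qed
    show "ext {V} (ext {VUnit} \<Delta>) z = {}" if "z \<notin> up (up Y)" for z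
      using that wfits_fresh[OF assms(3)] nat_cases2[of z] by auto
    show "ext {V} \<Delta> z = {}" if "z \<notin> up Y" for z
      using that wfits_fresh[OF assms(3)] by (cases z) auto
  qed
  moreover have "res_map \<circ> lift (Suc \<circ> g) = lift g" by (auto simp: fun_eq_iff lift_if)
  ultimately show ?thesis by (simp only: wren_wren e)
qed

text \<open>Linear and replicated inputs on a server name are treated together: the subject keeps
  its type in both, and the derivative does not depend on the received continuation
  \<open>c\<close>.\<close>

lemma in_srv:
  "ins P y p \<Longrightarrow> tr X \<Gamma> P W \<Longrightarrow> dom \<Gamma> \<subseteq> X \<Longrightarrow> \<Gamma> y = Some (TSrv T) \<Longrightarrow>
    \<exists>F W'. abs_sq F = p \<and> tr (up X) (ext (Some T) \<Gamma>) F W'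
      \<and> (\<forall>g b c. wlts (wren g W) (AIn (g y) b c) (wren (ext b g) W'))
      \<and> (\<forall>g Y \<Delta> L. wfits g X Y \<Delta> \<longrightarrow> wta \<Delta> (wren g W) L \<longrightarrow> in_srv_typed g y W' \<Delta>)"
proof (induction P arbitrary: y p X \<Gamma> W)
  case (SIn q x P)
  then have e: "x = y" by simp
  have c: "lift (lift g) \<circ> lift Suc = lift (Suc \<circ> g)" "ext b (ext c id) \<circ> lift (Suc \<circ> g) = ext b g"
    "ext b g \<circ> Suc = g" for g b c
    by (auto simp: fun_eq_iff lift_if ext_if)
  have dT: "dom (ext (Some T) \<Gamma>) \<subseteq> up X" using SIn.prems(3) unfolding ext_dom by (auto simp: up_def)
  show ?case
  proof (cases q)
    case Lin
    from SIn.prems(2,4) obtain W' where t: "tr (up X) (ext (Some T) \<Gamma>) P W'" "W = WIn y (wren (lift Suc) W')"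
      unfolding e Lin by (auto elim!: tr_SInE)
    have g: "wren g W = WIn (g y) (wren (lift (Suc \<circ> g)) W')" for g
      by (simp only: t wren.simps wren_wren c)
    have "wlts (wren g W) (AIn (g y) b c) (wren (ext b g) W')" for g b c
      using wl_in[of "g y" "wren (lift (Suc \<circ> g)) W'" b c] by (simp only: g wsubst_def wren_wren c(2))
    moreover have "in_srv_typed g y W' \<Delta>" if f: "wfits g X Y \<Delta>" and w: "wta \<Delta> (wren g W) L" for g Y \<Delta> L
      using w[unfolded g]
    proof (cases rule: wta_WInE)
      case (srv n V)
      then show ?thesis using wta_srv_body[OF _ tr_wgood[OF t(1) dT] f] unfolding in_srv_typed_def c by blast
    qed (auto simp: in_srv_typed_def)
    moreover have "abs_sq P = p" using SIn.prems(1) Lin by simp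
    ultimately show ?thesis using t by blast
  next
    case Unr
    from SIn.prems(2,4) obtain W' where t: "sun_ctx \<Gamma>" "tr (up X) (ext (Some T) \<Gamma>) P W'" "W = WRep y (wren (lift Suc) W')"
      unfolding e Unr by (auto elim!: tr_SInE)
    have g: "wren g W = WRep (g y) (wren (lift (Suc \<circ> g)) W')" for g
      by (simp only: t wren.simps wren_wren c)
    let ?F = "SPar (sren Suc (SIn Unr y P)) P" and ?W = "WPar (wren Suc W) W'"
    \<comment> \<open>A replicated input is typed in an unrestricted context, which the kept prefix
      and the body share; the parameter belongs to the body alone.\<close>
    have "sjoin (ext (Some T) \<Gamma>) (ext None \<Gamma>) (ext (Some T) \<Gamma>)"
    proof (rule sjoinI)
      show "ext (Some T) \<Gamma> a = Some U" if "ext None \<Gamma> a = Some U" for a U using that by (cases a) auto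
      show "ext None \<Gamma> a = Some U \<longleftrightarrow> ext (Some T) \<Gamma> a = None" if "ext (Some T) \<Gamma> a = Some U" "\<not> sun U" for a U
        using that t(1) by (cases a) (auto simp: sun_ctx_def)
    qed
    then have tr': "tr (up X) (ext (Some T) \<Gamma>) ?F ?W"
      using tr_sjoin(1)[OF tr_shift[OF SIn.prems(2,3)] t(2) dT] unfolding e Unr by blast
    have "wlts (wren g W) (AIn (g y) b c) (wren (ext b g) ?W)" for g b c
      using wl_rep[of "g y" "wren (lift (Suc \<circ> g)) W'" b c]
      unfolding g[symmetric] wsubst_def wren_wren c(2) by (simp only: wren.simps wren_wren c(3))
    moreover have "in_srv_typed g y ?W \<Delta>" if f: "wfits g X Y \<Delta>" and w: "wta \<Delta> (wren g W) L" for g Y \<Delta> L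
    proof -
      from w[unfolded g] obtain n V M where v: "wun_ctx \<Delta>" "VSrv n V \<in> \<Delta> (g y)"
        "wta (ext {V} (ext {VUnit} \<Delta>)) (wren (lift (Suc \<circ> g)) W') M" by (rule wta_WRepE)
      have gW: "wgood Y (wren g W)" by (rule wfits_wgood[OF f SIn.prems(2,3)])
      have eq: "wren (lift g) (wren Suc W) = wren Suc (wren g W)" by (simp add: wren_wren comp_def)
      have b: "wta (ext {V} \<Delta>) (wren (lift g) W') M"
        using wta_srv_body[OF v(3)[folded c] tr_wgood[OF t(2) dT] f] .
      have gW': "wgood (up Y) (wren (lift g) W')"
        using f tr_wgood[OF t(2) dT] by (auto simp: wfits_def intro!: wgood_wren keeps_fresh_lift)
      have fr: "ext {V} \<Delta> z = {}" if "z \<notin> up Y" for z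
        using that wfits_fresh[OF f] by (cases z) auto
      have "wjoin (ext {V} \<Delta>) (ext {V} \<Delta>) (ext {} \<Delta>)"
        by (rule wjoin_ext) (use v(1) in \<open>auto simp: wjoin_def wun_ctx_def\<close>)
      moreover have "wta (ext {} \<Delta>) (wren Suc (wren g W)) L"
        by (rule wta_shift[OF w gW wfits_fresh[OF f]])
      ultimately have "wta (ext {V} \<Delta>) (WPar (wren Suc (wren g W)) (wren (lift g) W')) (L \<union> M)"
        using wta_wjoin(2)[where \<Gamma> = "ext {V} \<Delta>", OF b _ gW' wgood_wren[OF gW keeps_fresh_up(1)] fr] by blast
      then have "wta (ext {V} \<Delta>) (wren (lift g) ?W) (L \<union> M)" by (simp only: wren.simps eq)
      with v(2) show ?thesis unfolding in_srv_typed_def by blast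
    qed
    moreover have "abs_sq ?F = p" using SIn.prems(1) by (simp add: Unr abs_sq_simps del: sren.simps)
    ultimately show ?thesis using tr' by blast
  qed
next
  case (SPar P Q)
  from SPar.prems(2) obtain \<Gamma>\<^sub>1 \<Gamma>\<^sub>2 W\<^sub>1 W\<^sub>2 where W: "W = WPar W\<^sub>1 W\<^sub>2" and s: "ssplit \<Gamma> \<Gamma>\<^sub>1 \<Gamma>\<^sub>2"
    and t: "tr X \<Gamma>\<^sub>1 P W\<^sub>1" "tr X \<Gamma>\<^sub>2 Q W\<^sub>2" by (auto elim!: tr_SParE)
  note d = tr_dom_par[OF s SPar.prems(3)]
  let ?o = "\<lambda>\<Gamma>. ext (Some T) \<Gamma>"
  have dom_o: "dom (?o \<Gamma>) \<subseteq> up X" if "dom \<Gamma> \<subseteq> X" for \<Gamma> :: sctx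
    using that unfolding ext_dom by (auto simp: up_def)
  have r: "wren (ext b g) (wren Suc V) = wren g V" for b g V
    by (simp add: wren_wren comp_def)
  have step: "tr (up X) (?o \<Gamma>) (SPar F (sren Suc Q)) (WPar W' (wren Suc W\<^sub>Q))
      \<and> tr (up X) (?o \<Gamma>) (SPar (sren Suc Q) F) (WPar (wren Suc W\<^sub>Q) W')
      \<and> (\<forall>g Y \<Delta> \<Delta>\<^sub>1 \<Delta>\<^sub>2 L. wfits g X Y \<Delta> \<longrightarrow> wsplit \<Delta> \<Delta>\<^sub>1 \<Delta>\<^sub>2 \<longrightarrow> in_srv_typed g y W' \<Delta>\<^sub>1 \<longrightarrow> wta \<Delta>\<^sub>2 (wren g W\<^sub>Q) L
          \<longrightarrow> in_srv_typed g y (WPar W' (wren Suc W\<^sub>Q)) \<Delta> \<and> in_srv_typed g y (WPar (wren Suc W\<^sub>Q) W') \<Delta>)"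
    if s: "ssplit \<Gamma> \<Gamma>\<^sub>P \<Gamma>\<^sub>Q" and tQ: "tr X \<Gamma>\<^sub>Q Q W\<^sub>Q" and t': "tr (up X) (?o \<Gamma>\<^sub>P) F W'"
    for \<Gamma>\<^sub>P \<Gamma>\<^sub>Q F Q W' W\<^sub>Q
  proof -
    note d = tr_dom_par[OF s SPar.prems(3)]
    note tr = tr_sjoin[OF t' tr_shift[OF tQ d(2)] dom_o[OF SPar.prems(3)] sjoin_ext[OF ssplit_sjoin[OF s]]]
    have "in_srv_typed g y (WPar W' (wren Suc W\<^sub>Q)) \<Delta> \<and> in_srv_typed g y (WPar (wren Suc W\<^sub>Q) W') \<Delta>"
      if f: "wfits g X Y \<Delta>" and ws: "wsplit \<Delta> \<Delta>\<^sub>1 \<Delta>\<^sub>2" and o: "in_srv_typed g y W' \<Delta>\<^sub>1" and wQ: "wta \<Delta>\<^sub>2 (wren g W\<^sub>Q) L"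
      for g Y \<Delta> \<Delta>\<^sub>1 \<Delta>\<^sub>2 L
      using in_srv_typed_par[OF wsplit_wjoin[OF ws] f o wQ wfits_wgood[OF f tQ d(2)] tr_wgood[OF t' dom_o[OF d(1)]]]
      by blast
    with tr show ?thesis by blast
  qed
  from SPar.prems(1) consider (l) p' where "ins P y p'" "p = p' \<parallel> qren Suc (abs_sq Q)"
    | (r) q' where "ins Q y q'" "p = qren Suc (abs_sq P) \<parallel> q'" by auto
  then show ?case
  proof cases
    case l
    have y: "\<Gamma>\<^sub>1 y = Some (TSrv T)"
      using ins_type[OF l(1) t(1)] ssplit_sub(1)[OF s] SPar.prems(4) by fastforce
    from SPar.IH(1)[OF l(1) t(1) d(1) y] obtain F W' where h: "abs_sq F = p'"
      "tr (up X) (?o \<Gamma>\<^sub>1) F W'"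
      "\<And>g b c. wlts (wren g W\<^sub>1) (AIn (g y) b c) (wren (ext b g) W')"
      "\<And>g Y \<Delta> L. wfits g X Y \<Delta> \<Longrightarrow> wta \<Delta> (wren g W\<^sub>1) L \<Longrightarrow> in_srv_typed g y W' \<Delta>" by blast
    note st = step[OF s t(2) h(2)]
    have "wlts (wren g W) (AIn (g y) b c) (wren (ext b g) (WPar W' (wren Suc W\<^sub>2)))" for g b c
      using wl_par_in1[OF h(3)[of g b c], of "wren g W\<^sub>2"] by (simp only: W wren.simps r)
    moreover have "in_srv_typed g y (WPar W' (wren Suc W\<^sub>2)) \<Delta>" if "wfits g X Y \<Delta>" "wta \<Delta> (wren g W) L" for g Y \<Delta> L
      using that(2) unfolding W wren.simps(5)
      by (elim wta_WParE) (use st h(4) that(1) wfits_split in meson)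
    moreover have "abs_sq (SPar F (sren Suc Q)) = p" by (simp only: abs_sq_simps h(1) l(2))
    ultimately show ?thesis using st by blast
  next
    case right: r
    have y: "\<Gamma>\<^sub>2 y = Some (TSrv T)"
      using ins_type[OF right(1) t(2)] ssplit_sub(2)[OF s] SPar.prems(4) by fastforce
    from SPar.IH(2)[OF right(1) t(2) d(2) y] obtain F W' where h: "abs_sq F = q'"
      "tr (up X) (?o \<Gamma>\<^sub>2) F W'"
      "\<And>g b c. wlts (wren g W\<^sub>2) (AIn (g y) b c) (wren (ext b g) W')"
      "\<And>g Y \<Delta> L. wfits g X Y \<Delta> \<Longrightarrow> wta \<Delta> (wren g W\<^sub>2) L \<Longrightarrow> in_srv_typed g y W' \<Delta>" by blast
    note st = step[OF ssplit_sym[OF s] t(1) h(2)]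
    have "wlts (wren g W) (AIn (g y) b c) (wren (ext b g) (WPar (wren Suc W\<^sub>1) W'))" for g b c
      using wl_par_in2[OF h(3)[of g b c], of "wren g W\<^sub>1"] by (simp only: W wren.simps r)
    moreover have "in_srv_typed g y (WPar (wren Suc W\<^sub>1) W') \<Delta>" if "wfits g X Y \<Delta>" "wta \<Delta> (wren g W) L" for g Y \<Delta> L
      using that(2) unfolding W wren.simps(5)
      by (elim wta_WParE) (use st h(4) that(1) wfits_split wsplit_sym in meson)
    moreover have "abs_sq (SPar (sren Suc P) F) = p" by (simp only: abs_sq_simps h(1) right(2))
    ultimately show ?thesis using st by blast
  qed
next
  case (SRes P)
  from SRes.prems(1) obtain q where q: "ins P (Suc (Suc y)) q" "p = qres (qren open_in q)" by auto
  from SRes.prems(2) obtain U W\<^sub>0 where W: "W = WRes (wren res_map W\<^sub>0)"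
    and t: "tr (up (up X)) (opened U \<Gamma>) P W\<^sub>0" by (auto elim!: tr_SResE)
  note d = dom_ext2[OF SRes.prems(3), of U "sdual U"]
  have y': "opened U \<Gamma> (Suc (Suc y)) = Some (TSrv T)" using SRes.prems(4) by simp
  have g: "wren g W = WRes (wren (lift g \<circ> res_map) W\<^sub>0)" "(lift g \<circ> res_map) (Suc (Suc i)) = Suc (g i)" for g i
    by (simp_all add: W wren_wren)
  from SRes.IH[OF q(1) t d y'] obtain F W' where h: "abs_sq F = q"
    "tr (up (up (up X))) (ext (Some T) (opened U \<Gamma>)) F W'"
    "\<And>g b c. wlts (wren g W\<^sub>0) (AIn (g (Suc (Suc y))) b c) (wren (ext b g) W')"
    "\<And>g Y \<Delta> L. wfits g (up (up X)) Y \<Delta> \<Longrightarrow> wta \<Delta> (wren g W\<^sub>0) L \<Longrightarrow> in_srv_typed g (Suc (Suc y)) W' \<Delta>"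
    by blast
  let ?W = "WRes (wren res_map (wren open_in W'))"
  have dW: "dom (ext (Some T) (opened U \<Gamma>)) \<subseteq> up (up (up X))"
    using SRes.prems(3) unfolding ext_dom by (auto simp: up_def)
  have "tr (up (up (up X))) (opened U (ext (Some T) \<Gamma>)) (sren open_in F) (wren open_in W')"
  proof (rule tr_open_in[OF h(2) dW])
    show "opened U (ext (Some T) \<Gamma>) (open_in a) = ext (Some T) (opened U \<Gamma>) a" for a
      using nat_cases3[of a] by (elim disjE exE) simp_all
  qed
  from tr.res[OF this] have tr': "tr (up X) (ext (Some T) \<Gamma>) (SRes (sren open_in F)) ?W" .
  have "(lift (ext b g) \<circ> (res_map \<circ> open_in)) i = ext (Suc b) (lift g \<circ> res_map) i" for g b i
    using nat_cases3[of i] by (elim disjE exE) simp_all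
  then have c1: "lift (ext b g) \<circ> (res_map \<circ> open_in) = ext (Suc b) (lift g \<circ> res_map)" for g b
    by blast
  have "(lift (lift g) \<circ> (res_map \<circ> open_in)) i = (swap_co \<circ> lift (lift g \<circ> res_map)) i" for g i
    using nat_cases3[of i] by (elim disjE exE) simp_all
  then have c2: "lift (lift g) \<circ> (res_map \<circ> open_in) = swap_co \<circ> lift (lift g \<circ> res_map)" for g by blast
  have "wlts (wren g W) (AIn (g y) b c) (wren (ext b g) ?W)" for g b c
    using wl_res_in[OF h(3)[of "lift g \<circ> res_map" "Suc b" "Suc c", unfolded g]]
    unfolding g(1) wren.simps wren_wren c1 .
  moreover have "in_srv_typed g y ?W \<Delta>" if f: "wfits g X Y \<Delta>" and w: "wta \<Delta> (wren g W) L" for g Y \<Delta> L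
  proof -
    from w obtain V where V: "weights_pos V" "wta (ext {V, wdual V} \<Delta>) (wren (lift g \<circ> res_map) W\<^sub>0) L"
      unfolding g by (rule wta_WResE)
    let ?g = "lift g \<circ> res_map"
    from h(4)[OF wfits_res[OF f] V(2)] consider (lin) n V\<^sub>1 V\<^sub>2 where "VIn n V\<^sub>1 V\<^sub>2 \<in> \<Delta> (g y)"
      | (srv) n Z L' where "VSrv n Z \<in> \<Delta> (g y)" "wta (ext {Z} (ext {V, wdual V} \<Delta>)) (wren (lift ?g) W') L'"
      unfolding in_srv_typed_def g ext_simps by blast
    then show ?thesis
    proof cases
      case lin
      then show ?thesis unfolding in_srv_typed_def by blast
    next
      case srv
      have "wgood (up (up Y)) (wren (lift ?g) W')"
        using wfits_res[OF f]
        by (intro wgood_wren[OF tr_wgood[OF h(2) dW]] keeps_fresh_lift) (auto simp: wfits_def)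
      then have "wta (ext {V, wdual V} (ext {Z} \<Delta>)) (wren swap_co (wren (lift ?g) W')) L'"
        by (rule wta_swap[OF srv(2) _ wfits_fresh[OF f]])
      from wta.res[OF V(1) this] have "wta (ext {Z} \<Delta>) (wren (lift g) ?W) L'"
        by (simp only: wren.simps wren_wren c2)
      with srv(1) show ?thesis unfolding in_srv_typed_def by blast
    qed
  qed
  moreover have "abs_sq (SRes (sren open_in F)) = p" by (simp only: abs_sq_simps h(1) q(2))
  ultimately show ?case using tr' by blast
qed auto

subsection \<open>Communications\<close>

text \<open>After a linear communication the source goes on with a new pair at indices 0 and 1 in
  the place of \<open>x\<close> and \<open>y\<close>. Once \<open>res_map\<close> merges the two
  indices, they are the continuation name of the translation.\<close>

definition sig :: "name \<Rightarrow> name \<Rightarrow> name \<Rightarrow> name" where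
  "sig x y i = (if i = x then 0 else if i = y then Suc 0 else Suc (Suc i))"

lemma sig_inj: "x \<noteq> y \<Longrightarrow> sig x y a = sig x y b \<Longrightarrow> a = b"
  by (auto simp: sig_def split: if_splits)

lemma keeps_fresh_sig: "x \<in> X \<Longrightarrow> y \<in> X \<Longrightarrow> keeps_fresh (sig x y) X (up (up X))"
  by (auto simp: keeps_fresh_def sig_def split: if_splits)

lemma keeps_fresh_subst: "v \<in> X \<Longrightarrow> keeps_fresh (ext v id) (up X) X"
  by (auto simp: keeps_fresh_def ext_if up_def image_iff split: if_splits)

text \<open>Three transfers make the residuals fit: the continuation types \<open>S\<close> and
  \<open>sdual S\<close> move to the new pair, the payload moves from the sender's context to the
  receiver's, and the old \<open>x\<close> and \<open>y\<close> leave the context.\<close>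

lemma com_lin_tr:
  assumes j: "sjoin \<Gamma> \<Gamma>\<^sub>1 \<Gamma>\<^sub>2" and d: "dom \<Gamma> \<subseteq> X"
    and x: "\<Gamma>\<^sub>1 x = Some (TLOut T S)" and y: "\<Gamma>\<^sub>2 y = Some (TLIn T (sdual S))" and v: "\<Gamma>\<^sub>1 v = Some T" "v \<noteq> x"
    and P: "tr X ((srem T v \<Gamma>\<^sub>1)(x \<mapsto> S)) P W" and F: "tr (up X) (ext (Some T) (\<Gamma>\<^sub>2(y \<mapsto> sdual S))) F W'"
  shows "tr (up (up X)) (opened S (\<Gamma>(x := None, y := None)))
      (SPar (sren (sig x y) P) (sren (sig x y \<circ> ext v id) F)) (WPar (wren (sig x y) W) (wren (sig x y \<circ> ext v id) W'))"
    (is "?t1") and "tr (up (up X)) (opened S (\<Gamma>(x := None, y := None)))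
      (SPar (sren (sig x y \<circ> ext v id) F) (sren (sig x y) P)) (WPar (wren (sig x y \<circ> ext v id) W') (wren (sig x y) W))"
    (is "?t2")
proof -
  note sub = sjoin_sub[OF j]
  have x2: "\<Gamma>\<^sub>2 x = None" using sub(3)[OF x] by simp
  have y1: "\<Gamma>\<^sub>1 y = None" using sub(4)[OF y] by simp
  have xy: "x \<noteq> y" and vy: "v \<noteq> y" using x y1 v by auto
  have X: "x \<in> X" "y \<in> X" "v \<in> X" using d sub(1)[OF x] sub(2)[OF y] sub(1)[OF v(1)] by auto
  let ?A = "ext (Some S) (ext None ((srem T v \<Gamma>\<^sub>1)(x := None)))"
  let ?B = "ext None (ext (Some (sdual S)) ((\<Gamma>\<^sub>2(v \<mapsto> T))(y := None)))"
  have d1: "dom \<Gamma>\<^sub>1 \<subseteq> X" "dom \<Gamma>\<^sub>2 \<subseteq> X" using d sub(1,2) by blast+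
  have srem1: "srem T v \<Gamma>\<^sub>1 a = Some U \<Longrightarrow> \<Gamma>\<^sub>1 a = Some U" for a U
    by (auto simp: srem_def split: if_splits)
  have sig: "sig x y x = 0" "sig x y y = Suc 0" "a \<noteq> x \<Longrightarrow> a \<noteq> y \<Longrightarrow> sig x y a = Suc (Suc a)" for a
    using xy by (auto simp: sig_def)
  have A: "tr (up (up X)) ?A (sren (sig x y) P) (wren (sig x y) W)"
  proof (rule tr_ren[OF P _ keeps_fresh_sig[OF X(1,2)] dom_upd_srem(1)[OF d1(1) X(1)]], rule srelI)
    show "?A (sig x y a) = Some U" if "((srem T v \<Gamma>\<^sub>1)(x \<mapsto> S)) a = Some U" for a U
    proof (cases "a = x")
      case False
      then have "a \<noteq> y" using that srem1[of a U] y1 by auto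
      then show ?thesis using that False by (simp add: sig)
    qed (use that in \<open>simp add: sig\<close>)
    show "c = a" if "sig x y c = sig x y a" for a c using sig_inj[OF xy that] .
    show "\<exists>a. sig x y a = b \<and> ((srem T v \<Gamma>\<^sub>1)(x \<mapsto> S)) a = Some U" if b: "?A b = Some U" for b U
      using nat_cases2[of b]
    proof (elim disjE exE)
      assume "b = 0" then show ?thesis using b by (intro exI[of _ x]) (simp add: sig)
    next
      assume "b = Suc 0" then show ?thesis using b by simp
    next
      fix a assume a: "b = Suc (Suc a)"
      then have "a \<noteq> x" "srem T v \<Gamma>\<^sub>1 a = Some U" using b by (auto split: if_splits)
      moreover from this have "a \<noteq> y" using srem1 y1 by fastforce
      ultimately show ?thesis using a by (intro exI[of _ a]) (simp add: sig)
    qed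
  qed
  let ?f = "sig x y \<circ> ext v id"
  have f: "?f 0 = Suc (Suc v)" "?f (Suc a) = sig x y a" for a using v vy by (simp_all add: sig)
  have B: "tr (up (up X)) ?B (sren ?f F) (wren ?f W')"
  proof (rule tr_ren[OF F _ keeps_fresh_comp[OF keeps_fresh_sig[OF X(1,2)] keeps_fresh_subst[OF X(3)]]], rule srelI)
    show "?B (?f a) = Some U" if a: "ext (Some T) (\<Gamma>\<^sub>2(y \<mapsto> sdual S)) a = Some U" for a U
    proof (cases a)
      case 0 then show ?thesis using a vy by (simp only: f ext_simps) simp
    next
      case (Suc b)
      show ?thesis
      proof (cases "b = y")
        case True then show ?thesis using a Suc by (simp only: f sig ext_simps) simp
      next
        case False
        then have b: "\<Gamma>\<^sub>2 b = Some U" using a Suc by simp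
        then have "b \<noteq> x" using x2 by auto
        moreover have "b = v \<Longrightarrow> U = T" using sub(1)[OF v(1)] sub(2)[OF b] by simp
        ultimately show ?thesis using False b by (simp only: Suc f) (simp add: sig)
      qed
    qed
    \<comment> \<open>The parameter and the value \<open>v\<close> become one name. If the receiver
      has an entry for \<open>v\<close> too, then both components share it, and its type is
      unrestricted.\<close>
    show "c = a" if a: "ext (Some T) (\<Gamma>\<^sub>2(y \<mapsto> sdual S)) a = Some U" "\<not> sun U" and c: "?f c = ?f a"
      "c \<in> dom (ext (Some T) (\<Gamma>\<^sub>2(y \<mapsto> sdual S)))" for a c U
    proof -
      have sv: "sig x y v = Suc (Suc v)" by (rule sig(3)[OF v(2) vy])
      show ?thesis
      proof (cases a; cases c)
        fix b b' assume "a = Suc b" "c = Suc b'"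
        then show ?thesis using c(1) unfolding f by (auto dest: sig_inj[OF xy])
      next
        fix b assume e: "a = 0" "c = Suc b"
        have "b = v" by (rule sig_inj[OF xy]) (use c(1) in \<open>simp only: e f sv\<close>)
        moreover have "\<Gamma>\<^sub>2 v = None" using sub(3)[OF v(1)] a e by simp
        ultimately show ?thesis using c(2) e vy unfolding ext_dom by auto
      next
        fix b assume e: "a = Suc b" "c = 0"
        have "b = v" by (rule sig_inj[OF xy]) (use c(1) in \<open>simp only: e f sv\<close>)
        then have "\<Gamma>\<^sub>2 v = Some U" using a e vy by simp
        then have "\<Gamma>\<^sub>1 v = None" using sub(4) a(2) by blast
        then show ?thesis using v(1) by simp
      qed simp
    qed
    show "\<exists>a. ?f a = b \<and> ext (Some T) (\<Gamma>\<^sub>2(y \<mapsto> sdual S)) a = Some U" if b: "?B b = Some U" for b U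
      using nat_cases2[of b]
    proof (elim disjE exE)
      assume "b = 0" then show ?thesis using b by simp
    next
      assume "b = Suc 0" then show ?thesis using b by (intro exI[of _ "Suc y"]) (simp only: f sig ext_simps, simp)
    next
      fix a assume a: "b = Suc (Suc a)"
      show ?thesis
      proof (cases "a = v")
        case True
        then show ?thesis using a b vy by (intro exI[of _ 0]) (simp only: f ext_simps, simp)
      next
        case False
        then have "a \<noteq> y" "\<Gamma>\<^sub>2 a = Some U" using a b by (auto split: if_splits)
        moreover from this have "a \<noteq> x" using x2 by auto
        ultimately show ?thesis using a by (intro exI[of _ "Suc a"]) (simp only: f, simp add: sig)
      qed
    qed
    show "dom (ext (Some T) (\<Gamma>\<^sub>2(y \<mapsto> sdual S))) \<subseteq> up X"
      using d1(2) X(2) unfolding ext_dom by (auto simp: up_def)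
  qed
  have J: "sjoin (opened S (\<Gamma>(x := None, y := None))) ?A ?B"
  proof (rule sjoinI)
    show "opened S (\<Gamma>(x := None, y := None)) a = Some U" if a: "?A a = Some U" for a U
      using nat_cases2[of a]
    proof (elim disjE exE)
      fix b assume b: "a = Suc (Suc b)"
      then have "b \<noteq> x" "\<Gamma>\<^sub>1 b = Some U" using a srem1[of b U] by (auto split: if_splits)
      moreover from this have "b \<noteq> y" using y1 by auto
      ultimately show ?thesis using b sub(1) by simp
    qed (use a in simp_all)
    show "opened S (\<Gamma>(x := None, y := None)) a = Some U" if a: "?B a = Some U" for a U
      using nat_cases2[of a]
    proof (elim disjE exE)
      fix b assume b: "a = Suc (Suc b)"
      show ?thesis
      proof (cases "b = v")
        case True
        then show ?thesis using a b sub(1)[OF v(1)] v(2) vy by simp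
      next
        case False
        then have "b \<noteq> y" "\<Gamma>\<^sub>2 b = Some U" using a b by (auto split: if_splits)
        moreover from this have "b \<noteq> x" using x2 by auto
        ultimately show ?thesis using b sub(2) by simp
      qed
    qed (use a in simp_all)
    show "?A a = Some U \<longleftrightarrow> ?B a = None" if a: "opened S (\<Gamma>(x := None, y := None)) a = Some U" "\<not> sun U" for a U
      using nat_cases2[of a]
    proof (elim disjE exE)
      fix b assume b: "a = Suc (Suc b)"
      then have g: "b \<noteq> x" "b \<noteq> y" "\<Gamma> b = Some U" using a by (auto split: if_splits)
      show ?thesis
      proof (cases "b = v")
        case True
        then have "U = T" using g(3) sub(1)[OF v(1)] by simp
        then show ?thesis using b True a(2) g by (simp add: srem_def)
      next
        case False
        then have "srem T v \<Gamma>\<^sub>1 b = \<Gamma>\<^sub>1 b" by (simp add: srem_def)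
        then show ?thesis using b False g sub(3,5)[of b U] a(2) by auto
      qed
    qed (use a in simp_all)
  qed
  have D: "dom (opened S (\<Gamma>(x := None, y := None))) \<subseteq> up (up X)"
    using d unfolding ext_dom by (auto simp: up_def split: if_splits)
  show ?t1 ?t2 using tr_sjoin[OF A B D J] by blast+
qed

text \<open>Neither residual contains the subject of the other. On its own names, \<open>sig\<close>
  followed by \<open>res_map\<close> therefore agrees with the renaming from its transition, which
  puts the continuation at index 0 on both sides.\<close>

lemma com_lin_ren:
  assumes x: "x \<notin> dom \<Gamma>\<^sub>2" "x \<in> X" and y: "y \<notin> dom \<Gamma>\<^sub>1" "y \<in> X" "x \<noteq> y" "v \<noteq> x" "v \<noteq> y"
    and P: "tr X (\<Gamma>\<^sub>1(x \<mapsto> S)) P W" and F: "tr (up X) (ext (Some T) (\<Gamma>\<^sub>2(y \<mapsto> S'))) F W'"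
  shows "wren (lift g \<circ> (res_map \<circ> sig x y)) W = wren (out_ren g x) W"
    "wren (lift g \<circ> (res_map \<circ> (sig x y \<circ> ext v id))) W' = wren (in_ren (Suc \<circ> g) y (Suc (g v)) 0) W'"
proof -
  show "wren (lift g \<circ> (res_map \<circ> sig x y)) W = wren (out_ren g x) W"
    by (rule tr_wren_cong[OF P]) (use y in \<open>auto simp: sig_def out_ren_def\<close>)
  show "wren (lift g \<circ> (res_map \<circ> (sig x y \<circ> ext v id))) W' = wren (in_ren (Suc \<circ> g) y (Suc (g v)) 0) W'"
  proof (rule tr_wren_cong[OF F])
    fix i assume i: "i \<in> dom (ext (Some T) (\<Gamma>\<^sub>2(y \<mapsto> S'))) \<or> i \<notin> up X"
    show "(lift g \<circ> (res_map \<circ> (sig x y \<circ> ext v id))) i = in_ren (Suc \<circ> g) y (Suc (g v)) 0 i"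
    proof (cases i)
      case 0
      then show ?thesis using y by (simp add: sig_def)
    next
      case (Suc j)
      then have "j \<noteq> x" using i x y unfolding ext_dom by auto
      then show ?thesis using Suc y by (simp add: sig_def)
    qed
  qed
qed

lemma wdual_wdual [simp]: "wdual (wdual V) = V"
  by (induction V) simp_all

text \<open>Duality exchanges input with output and server with client, so only the unit type is
  self-dual.\<close>

lemma wdual_eq_wun: "V = wdual V \<Longrightarrow> wun V"
  by (cases V) auto

text \<open>The entry of the channel is contained in a pair of duals. The sender's output type
  determines this pair, hence also the type that the receiver uses: same payload, dual continuation.
  Both assumptions are consumed, and the new restriction is typed with the continuation type and its
  dual.\<close>

lemma com_lin_typed:
  assumes j: "wjoin \<Delta> \<Delta>\<^sub>1 \<Delta>\<^sub>2" and f: "wfits g X Y \<Delta>" and X: "x \<in> X" "y \<in> X" and xy: "g x = g y"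
    and dual: "\<Delta> (g x) \<subseteq> {U, wdual U}"
    and out: "out_lin_typed g x v W \<Delta>\<^sub>1" and inp: "in_lin_typed g y W' \<Delta>\<^sub>2"
    and gd: "wgood X W" "wgood (up X) W'"
  shows "\<exists>V. \<not> wun V \<and> V \<in> \<Delta> (g x) \<and> wdual V \<in> \<Delta> (g x)" (is ?t0)
    "\<exists>L. wta (\<Delta>(g x := {})) (WRes (WPar (wren (out_ren g x) W) (wren (in_ren (Suc \<circ> g) y (Suc (g v)) 0) W'))) L" (is ?t1)
    "\<exists>L. wta (\<Delta>(g x := {})) (WRes (WPar (wren (in_ren (Suc \<circ> g) y (Suc (g v)) 0) W') (wren (out_ren g x) W))) L" (is ?t2)
proof -
  define a where "a = g x"
  have ay: "g y = a" using xy by (simp add: a_def)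
  from out obtain n V\<^sub>1 V\<^sub>2 L\<^sub>1 where o: "weights_pos V\<^sub>2" "VOut n V\<^sub>1 V\<^sub>2 \<in> \<Delta>\<^sub>1 a"
    "V\<^sub>1 \<in> rem (VOut n V\<^sub>1 V\<^sub>2) a \<Delta>\<^sub>1 (g v)"
    "wta (ext {V\<^sub>2} (rem V\<^sub>1 (g v) (rem (VOut n V\<^sub>1 V\<^sub>2) a \<Delta>\<^sub>1))) (wren (out_ren g x) W) L\<^sub>1"
    unfolding out_lin_typed_def a_def by blast
  let ?O = "VOut n V\<^sub>1 V\<^sub>2" and ?I = "VIn n V\<^sub>1 (wdual V\<^sub>2)"
  have O: "?O \<in> \<Delta> a" using o(2) wjoinD(1)[OF j] by blast
  \<comment> \<open>An output type in the entry forces \<open>U\<close> to be that type or its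
    dual.\<close>
  have U: "{U, wdual U} = {?O, ?I}"
    using O dual unfolding a_def[symmetric] by (cases U) auto
  have D: "\<Delta> a \<subseteq> {?O, ?I}" using dual U unfolding a_def by simp
  \<comment> \<open>This excludes the mismatch that \<open>in_lin_typed\<close> admits.\<close>
  have no_srv: "VSrv m V \<notin> \<Delta>\<^sub>2 a" for m V
  proof
    assume "VSrv m V \<in> \<Delta>\<^sub>2 a"
    then have "VSrv m V \<in> \<Delta> a" using wjoinD(1)[OF j] by blast
    then show False using D by auto
  qed
  from inp obtain m Z\<^sub>1 Z\<^sub>2 L\<^sub>2 where i0: "VIn m Z\<^sub>1 Z\<^sub>2 \<in> \<Delta>\<^sub>2 a"
    "wta (ext {Z\<^sub>1} (ext {Z\<^sub>2} (rem (VIn m Z\<^sub>1 Z\<^sub>2) a \<Delta>\<^sub>2))) (wren (in_ren (Suc \<circ> (Suc \<circ> g)) y 0 1) W') L\<^sub>2"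
    using no_srv unfolding in_lin_typed_def ay by blast
  have "VIn m Z\<^sub>1 Z\<^sub>2 \<in> \<Delta> a" using i0(1) wjoinD(1)[OF j] by blast
  then have "VIn m Z\<^sub>1 Z\<^sub>2 = ?I" using D by auto
  with i0 have I: "?I \<in> \<Delta>\<^sub>2 a"
    and i: "wta (ext {V\<^sub>1} (ext {wdual V\<^sub>2} (rem ?I a \<Delta>\<^sub>2))) (wren (in_ren (Suc \<circ> (Suc \<circ> g)) y 0 1) W') L\<^sub>2"
    by simp_all
  show ?t0 using O I wjoinD(1)[OF j, of ?I a] unfolding a_def[symmetric]
    by (intro exI[of _ ?O]) simp
  define R1 where "R1 = rem ?O a \<Delta>\<^sub>1"
  define R2 where "R2 = rem ?I a \<Delta>\<^sub>2"
  have R1a: "R1 a = {}" and R2a: "R2 a = {}"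
  proof -
    have "?I \<notin> \<Delta>\<^sub>1 a" "?O \<notin> \<Delta>\<^sub>2 a" using wjoinD(2)[OF j] o(2) I by force+
    moreover have "\<Delta>\<^sub>1 a \<subseteq> {?O, ?I}" "\<Delta>\<^sub>2 a \<subseteq> {?O, ?I}" using D wjoinD(1)[OF j] by blast+
    ultimately show "R1 a = {}" "R2 a = {}" by (auto simp: R1_def R2_def rem_def)
  qed
  have R1: "R1 b = \<Delta>\<^sub>1 b" and R2: "R2 b = \<Delta>\<^sub>2 b" if "b \<noteq> a" for b
    using that by (simp_all add: R1_def R2_def rem_def)
  have V1: "V\<^sub>1 \<in> R1 (g v)" using o(3) by (simp add: R1_def)
  \<comment> \<open>The sender has used up the channel, so the channel cannot be its own
    payload.\<close>
  then have va: "g v \<noteq> a" using R1a by auto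
  have V1': "V\<^sub>1 \<in> \<Delta>\<^sub>1 (g v)" "V\<^sub>1 \<in> \<Delta> (g v)" using V1 R1[OF va] wjoinD(1)[OF j] by auto
  then have vY: "g v \<in> Y" using wfits_fresh[OF f] by fastforce
  have fr2: "R2 z = {}" "R1 z = {}" if "z \<notin> Y" for z
    using wfits_fresh[OF f that] wjoinD(1)[OF j, of _ z] R1a R2a R1[of z] R2[of z] by (cases "z = a"; auto)+
  \<comment> \<open>The payload parameter becomes the value sent, seen below the new restriction,
    and the continuation parameter becomes index 0 of that restriction. \<open>?B\<close> hands the
    payload assumption over to the receiver.\<close>
  let ?h = "ext (Suc (g v)) (ext 0 Suc)"
  let ?B = "R2(g v := insert V\<^sub>1 (R2 (g v)))"
  have kh: "keeps_fresh ?h (up (up Y)) (up Y)"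
    unfolding keeps_fresh_def
  proof (intro allI impI conjI)
    fix z assume "z \<notin> up (up Y)"
    then obtain z' where z: "z = Suc (Suc z')" "z' \<notin> Y" using nat_cases2[of z] by auto
    then show "?h z \<notin> up Y" by simp
    fix b assume "?h b = ?h z"
    then show "b = z" using nat_cases2[of b] z vY by auto
  qed
  have g1: "wgood (up (up Y)) (wren (in_ren (Suc \<circ> (Suc \<circ> g)) y 0 1) W')"
    using f gd(2) X(2) by (intro wgood_wren[OF _ keeps_fresh_in_ren]) (auto simp: wfits_def)
  have "wta (ext {wdual V\<^sub>2} ?B) (wren ?h (wren (in_ren (Suc \<circ> (Suc \<circ> g)) y 0 1) W')) L\<^sub>2"
  proof (rule wta_ren[OF g1 i[folded R2_def] _ kh], rule wrelI)
    show "V \<in> ext {wdual V\<^sub>2} ?B (?h b)" if "V \<in> ext {V\<^sub>1} (ext {wdual V\<^sub>2} R2) b" for b V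
      using that nat_cases2[of b] by auto
    show "c = b" if "\<not> wun V" "V \<in> ext {V\<^sub>1} (ext {wdual V\<^sub>2} R2) b" "V \<in> ext {V\<^sub>1} (ext {wdual V\<^sub>2} R2) c"
      "?h c = ?h b" for b c V
    proof -
      \<comment> \<open>If the receiver already holds \<open>V\<^sub>1\<close> for the value, then
        both sides do, and a join allows this for unrestricted types only.\<close>
      have "wun V\<^sub>1" if "V\<^sub>1 \<in> R2 (g v)" using wjoinD(2)[OF j V1'(1)] that R2[OF va] by blast
      then show ?thesis using that nat_cases2[of b] nat_cases2[of c] by (elim disjE exE) auto
    qed
    show "\<exists>c. ?h c = b \<and> V \<in> ext {V\<^sub>1} (ext {wdual V\<^sub>2} R2) c" if "V \<in> ext {wdual V\<^sub>2} ?B b" for b V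
    proof (cases b)
      case 0
      then show ?thesis using that by (intro exI[of _ "Suc 0"]) simp
    next
      case (Suc c)
      show ?thesis
      proof (cases "c = g v \<and> V = V\<^sub>1")
        case True
        then show ?thesis using Suc by (intro exI[of _ 0]) simp
      next
        case False
        then show ?thesis using Suc that by (intro exI[of _ "Suc (Suc c)"]) (auto split: if_splits)
      qed
    qed
    show "ext {V\<^sub>1} (ext {wdual V\<^sub>2} R2) z = {}" if "z \<notin> up (up Y)" for z
      using that fr2(1) nat_cases2[of z] by auto
    show "ext {wdual V\<^sub>2} ?B z = {}" if "z \<notin> up Y" for z
      using that fr2(1) vY by (cases z) auto
  qed
  moreover have hr: "?h \<circ> in_ren (Suc \<circ> (Suc \<circ> g)) y 0 1 = in_ren (Suc \<circ> g) y (Suc (g v)) 0"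
    by (auto simp: fun_eq_iff in_ren_def)
  ultimately have B: "wta (ext {wdual V\<^sub>2} ?B) (wren (in_ren (Suc \<circ> g) y (Suc (g v)) 0) W') L\<^sub>2"
    by (simp only: wren_wren hr)
  have gB: "wgood (up Y) (wren (in_ren (Suc \<circ> g) y (Suc (g v)) 0) W')"
    using wgood_wren[OF g1 kh] by (simp only: wren_wren hr)
  have gA: "wgood (up Y) (wren (out_ren g x) W)"
    using f X(1) by (intro wgood_wren[OF gd(1) keeps_fresh_out_ren]) (auto simp: wfits_def)
  \<comment> \<open>On the old names this is the given join without the channel and with the payload
    handed over. On the new name the two assumptions are dual and can coincide only if they are
    unrestricted.\<close>
  have J: "wjoin (ext {V\<^sub>2, wdual V\<^sub>2} (\<Delta>(a := {}))) (ext {V\<^sub>2} (rem V\<^sub>1 (g v) R1)) (ext {wdual V\<^sub>2} ?B)"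
    unfolding wjoin_def
  proof (intro conjI allI impI)
    fix b V
    show "V \<in> ext {V\<^sub>2, wdual V\<^sub>2} (\<Delta>(a := {})) b
        \<longleftrightarrow> V \<in> ext {V\<^sub>2} (rem V\<^sub>1 (g v) R1) b \<or> V \<in> ext {wdual V\<^sub>2} ?B b"
    proof (cases b)
      case (Suc c)
      consider "c = a" | "c \<noteq> a" "c = g v" | "c \<noteq> a" "c \<noteq> g v" by blast
      then show ?thesis
      proof cases
        case 1
        then show ?thesis using Suc va R1a R2a rem_empty[of R1 a] by auto
      next
        case 2
        then show ?thesis
          using Suc V1' R1[OF 2(1)] R2[OF 2(1)] wjoinD(1)[OF j, of V c] by (auto simp: rem_def)
      next
        case 3
        then show ?thesis
          using Suc R1[OF 3(1)] R2[OF 3(1)] wjoinD(1)[OF j, of V c] by (simp add: rem_def)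
      qed
    qed auto
    assume b: "V \<in> ext {V\<^sub>2} (rem V\<^sub>1 (g v) R1) b" "V \<in> ext {wdual V\<^sub>2} ?B b"
    show "wun V"
    proof (cases b)
      case 0
      then show ?thesis using b wdual_eq_wun by auto
    next
      case (Suc c)
      have "V \<in> R1 c" using b(1) Suc rem_sub[of V\<^sub>1 "g v" R1 c] by auto
      then have c: "c \<noteq> a" "V \<in> \<Delta>\<^sub>1 c" using R1a R1[of c] by auto
      show ?thesis
      proof (cases "c = g v \<and> V = V\<^sub>1")
        case True
        then show ?thesis using b(1) Suc by (auto simp: rem_def split: if_splits)
      next
        case False
        then have "V \<in> \<Delta>\<^sub>2 c" using b(2) Suc R2[OF c(1)] by (auto split: if_splits)
        then show ?thesis using wjoinD(2)[OF j c(2)] by blast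
      qed
    qed
  qed
  have fr: "ext {V\<^sub>2, wdual V\<^sub>2} (\<Delta>(a := {})) z = {}" if "z \<notin> up Y" for z
    using that wfits_fresh[OF f] by (cases z) auto
  note w = wta_wjoin[OF o(4)[folded R1_def] B gA gB fr J]
  show ?t1 ?t2 using wta.res[OF o(1) w(1)] wta.res[OF o(1) w(2)] unfolding a_def by blast+
qed

text \<open>Server and client types are not consumed, so the context stays as it is, and only the
  payload moves from the sender to the receiver.\<close>

lemma com_cli_tr:
  assumes j: "sjoin \<Gamma> \<Gamma>\<^sub>1 \<Gamma>\<^sub>2" and d: "dom \<Gamma> \<subseteq> X" and v: "\<Gamma>\<^sub>1 v = Some T"
    and P: "tr X (srem T v \<Gamma>\<^sub>1) P W" and F: "tr (up X) (ext (Some T) \<Gamma>\<^sub>2) F W'"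
  shows "tr X \<Gamma> (SPar P (sren (ext v id) F)) (WPar W (wren (ext v id) W'))"
    and "tr X \<Gamma> (SPar (sren (ext v id) F) P) (WPar (wren (ext v id) W') W)"
proof -
  note sub = sjoin_sub[OF j]
  have d2: "dom \<Gamma>\<^sub>2 \<subseteq> X" and vX: "v \<in> X" using d sub(2) sub(1)[OF v] by blast+
  have B: "tr X (\<Gamma>\<^sub>2(v \<mapsto> T)) (sren (ext v id) F) (wren (ext v id) W')"
  proof (rule tr_ren[OF F _ keeps_fresh_subst[OF vX]], rule srelI)
    show "(\<Gamma>\<^sub>2(v \<mapsto> T)) (ext v id a) = Some U" if "ext (Some T) \<Gamma>\<^sub>2 a = Some U" for a U
    proof (cases a)
      case (Suc b)
      then have "\<Gamma>\<^sub>2 b = Some U" using that by simp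
      then show ?thesis using Suc sub(1)[OF v] sub(2)[of b U] by auto
    qed (use that in simp)
    show "c = a" if "ext (Some T) \<Gamma>\<^sub>2 a = Some U" "\<not> sun U" "ext v id c = ext v id a"
      "c \<in> dom (ext (Some T) \<Gamma>\<^sub>2)" for a c U
      using that v sub(3)[OF v] sub(4)[of v U] unfolding ext_dom by (cases a; cases c) auto
    show "\<exists>a. ext v id a = b \<and> ext (Some T) \<Gamma>\<^sub>2 a = Some U" if "(\<Gamma>\<^sub>2(v \<mapsto> T)) b = Some U" for b U
    proof (cases "b = v")
      case True
      then show ?thesis using that by (intro exI[of _ 0]) simp
    next
      case False
      then show ?thesis using that by (intro exI[of _ "Suc b"]) simp
    qed
    show "dom (ext (Some T) \<Gamma>\<^sub>2) \<subseteq> up X" using d2 unfolding ext_dom by (auto simp: up_def)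
  qed
  have J: "sjoin \<Gamma> (srem T v \<Gamma>\<^sub>1) (\<Gamma>\<^sub>2(v \<mapsto> T))"
  proof (rule sjoinI)
    show "\<Gamma> a = Some U" if "srem T v \<Gamma>\<^sub>1 a = Some U" for a U
      using that sub(1) by (auto simp: srem_def split: if_splits)
    show "\<Gamma> a = Some U" if "(\<Gamma>\<^sub>2(v \<mapsto> T)) a = Some U" for a U
      using that sub(2) sub(1)[OF v] by (auto split: if_splits)
    show "srem T v \<Gamma>\<^sub>1 a = Some U \<longleftrightarrow> (\<Gamma>\<^sub>2(v \<mapsto> T)) a = None" if "\<Gamma> a = Some U" "\<not> sun U" for a U
    proof (cases "a = v")
      case True
      then show ?thesis using that sub(1)[OF v] by (auto simp: srem_def)
    next
      case False
      then show ?thesis using that sub(3,5)[of a U] by (auto simp: srem_def)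
    qed
  qed
  show "tr X \<Gamma> (SPar P (sren (ext v id) F)) (WPar W (wren (ext v id) W'))"
    "tr X \<Gamma> (SPar (sren (ext v id) F) P) (WPar (wren (ext v id) W') W)"
    using tr_sjoin[OF P B d J] by blast+
qed

text \<open>Again the sender's type fixes the dual pair and with it the payload type of the server;
  but both assumptions are unrestricted and remain.\<close>

lemma com_cli_typed:
  assumes j: "wjoin \<Delta> \<Delta>\<^sub>1 \<Delta>\<^sub>2" and f: "wfits g X Y \<Delta>" and xy: "g x = g y"
    and dual: "\<Delta> (g x) \<subseteq> {U, wdual U}"
    and out: "out_cli_typed g x v W \<Delta>\<^sub>1" and inp: "in_srv_typed g y W' \<Delta>\<^sub>2"
    and gd: "wgood X W" "wgood (up X) W'"
  shows "\<exists>L. wta \<Delta> (WPar (wren g W) (wren (ext (g v) g) W')) L" (is ?t1)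
    "\<exists>L. wta \<Delta> (WPar (wren (ext (g v) g) W') (wren g W)) L" (is ?t2)
proof -
  from out obtain n V\<^sub>1 L\<^sub>1 where o: "VCli n V\<^sub>1 \<in> \<Delta>\<^sub>1 (g x)" "V\<^sub>1 \<in> \<Delta>\<^sub>1 (g v)"
    "wta (rem V\<^sub>1 (g v) \<Delta>\<^sub>1) (wren g W) L\<^sub>1" unfolding out_cli_typed_def by blast
  have C: "VCli n V\<^sub>1 \<in> \<Delta> (g x)" using o(1) wjoinD(1)[OF j] by blast
  have "{U, wdual U} = {VCli n V\<^sub>1, VSrv n V\<^sub>1}" using C dual by (cases U) auto
  then have D: "\<Delta> (g x) \<subseteq> {VCli n V\<^sub>1, VSrv n V\<^sub>1}" using dual by simp
  have "VIn m Z\<^sub>1 Z\<^sub>2 \<notin> \<Delta>\<^sub>2 (g x)" for m Z\<^sub>1 Z\<^sub>2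
  proof
    assume "VIn m Z\<^sub>1 Z\<^sub>2 \<in> \<Delta>\<^sub>2 (g x)"
    then have "VIn m Z\<^sub>1 Z\<^sub>2 \<in> \<Delta> (g x)" using wjoinD(1)[OF j] by blast
    then show False using D by auto
  qed
  then obtain m V L\<^sub>2 where i0: "VSrv m V \<in> \<Delta>\<^sub>2 (g x)" "wta (ext {V} \<Delta>\<^sub>2) (wren (lift g) W') L\<^sub>2"
    using inp unfolding in_srv_typed_def xy by blast
  have "VSrv m V \<in> \<Delta> (g x)" using i0(1) wjoinD(1)[OF j] by blast
  then have "VSrv m V = VSrv n V\<^sub>1" using D by auto
  with i0 have i: "wta (ext {V\<^sub>1} \<Delta>\<^sub>2) (wren (lift g) W') L\<^sub>2" by simp
  have V1: "V\<^sub>1 \<in> \<Delta> (g v)" using o(2) wjoinD(1)[OF j] by blast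
  then have vY: "g v \<in> Y" using wfits_fresh[OF f] by fastforce
  have fr2: "\<Delta>\<^sub>2 z = {}" if "z \<notin> Y" for z
    using wfits_fresh[OF f that] wjoinD(1)[OF j] by blast
  let ?h = "ext (g v) id" and ?B = "\<Delta>\<^sub>2(g v := insert V\<^sub>1 (\<Delta>\<^sub>2 (g v)))"
  have g1: "wgood (up Y) (wren (lift g) W')"
    using f by (intro wgood_wren[OF gd(2)] keeps_fresh_lift) (auto simp: wfits_def)
  have "wta ?B (wren ?h (wren (lift g) W')) L\<^sub>2"
  proof (rule wta_ren[OF g1 i _ keeps_fresh_subst[OF vY]], rule wrelI)
    show "V \<in> ?B (?h b)" if "V \<in> ext {V\<^sub>1} \<Delta>\<^sub>2 b" for b V
      using that by (cases b) auto
    show "c = b" if "\<not> wun V" "V \<in> ext {V\<^sub>1} \<Delta>\<^sub>2 b" "V \<in> ext {V\<^sub>1} \<Delta>\<^sub>2 c" "?h c = ?h b" for b c V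
    proof -
      have "wun V\<^sub>1" if "V\<^sub>1 \<in> \<Delta>\<^sub>2 (g v)" using wjoinD(2)[OF j o(2) that] .
      then show ?thesis using that by (cases b; cases c) auto
    qed
    show "\<exists>c. ?h c = b \<and> V \<in> ext {V\<^sub>1} \<Delta>\<^sub>2 c" if "V \<in> ?B b" for b V
    proof (cases "b = g v \<and> V = V\<^sub>1")
      case True
      then show ?thesis by (intro exI[of _ 0]) simp
    next
      case False
      then show ?thesis using that by (intro exI[of _ "Suc b"]) (auto split: if_splits)
    qed
    show "ext {V\<^sub>1} \<Delta>\<^sub>2 z = {}" if "z \<notin> up Y" for z using that fr2 by (cases z) auto
    show "?B z = {}" if "z \<notin> Y" for z using that fr2 vY by auto
  qed
  moreover have hr: "?h \<circ> lift g = ext (g v) g" by (auto simp: fun_eq_iff ext_if lift_if)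
  ultimately have B: "wta ?B (wren (ext (g v) g) W') L\<^sub>2" by (simp only: wren_wren hr)
  have gB: "wgood Y (wren (ext (g v) g) W')"
    using wgood_wren[OF g1 keeps_fresh_subst[OF vY]] by (simp only: wren_wren hr)
  have gA: "wgood Y (wren g W)" using f gd(1) by (auto simp: wfits_def intro: wgood_wren)
  have J: "wjoin \<Delta> (rem V\<^sub>1 (g v) \<Delta>\<^sub>1) ?B"
    unfolding wjoin_def
  proof (intro conjI allI impI)
    fix b V
    show "V \<in> \<Delta> b \<longleftrightarrow> V \<in> rem V\<^sub>1 (g v) \<Delta>\<^sub>1 b \<or> V \<in> ?B b"
      using V1 wjoinD(1)[OF j, of V b] by (auto simp: rem_def)
    assume b: "V \<in> rem V\<^sub>1 (g v) \<Delta>\<^sub>1 b" "V \<in> ?B b"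
    show "wun V"
    proof (cases "b = g v \<and> V = V\<^sub>1")
      case True
      then show ?thesis using b(1) by (auto simp: rem_def split: if_splits)
    next
      case False
      then have "V \<in> \<Delta>\<^sub>2 b" "V \<in> \<Delta>\<^sub>1 b" using b rem_sub[of V\<^sub>1 "g v" \<Delta>\<^sub>1 b] by (auto split: if_splits)
      then show ?thesis using wjoinD(2)[OF j] by blast
    qed
  qed
  show ?t1 ?t2 using wta_wjoin[OF o(3) B gA gB wfits_fresh[OF f] J] by blast+
qed

section \<open>Receivers below an extruded pair\<close>

lemma up2_shift: "srel (Suc \<circ> Suc) \<Gamma> (ext None (ext None \<Gamma>))"
proof (rule srelI)
  show "\<exists>a. (Suc \<circ> Suc) a = b \<and> \<Gamma> a = Some T" if "ext None (ext None \<Gamma>) b = Some T" for b T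
    using that nat_cases2[of b] by auto
qed auto

text \<open>The receiver is brought below the pair that the sender extrudes. A bound communication
  then becomes a communication of the value 0 below that pair, and the results on free
  communications apply.\<close>

lemma tr_shift_body:
  assumes "tr (up X) (ext (Some T) \<Gamma>) F W" "dom \<Gamma> \<subseteq> X"
  shows "tr (up (up (up X))) (ext (Some T) (ext None (ext None \<Gamma>))) (sren (lift (Suc \<circ> Suc)) F) (wren (lift (Suc \<circ> Suc)) W)"
proof (rule tr_ren[OF assms(1) srel_lift[OF up2_shift]])
  show "keeps_fresh (lift (Suc \<circ> Suc)) (up X) (up (up (up X)))"
    by (intro keeps_fresh_lift keeps_fresh_comp[OF keeps_fresh_up(1) keeps_fresh_up(1)])
  show "dom (ext (Some T) \<Gamma>) \<subseteq> up X" using assms(2) unfolding ext_dom by (auto simp: up_def)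
qed

lemma wrel_Suc: "wrel A Suc \<Gamma> (ext {} \<Gamma>)"
proof (rule wrelI)
  show "\<exists>a. Suc a = b \<and> V \<in> \<Gamma> a" if "V \<in> ext {} \<Gamma> b" for b V
    using that by (cases b) auto
qed auto

lemma in_lin_typed_shift:
  assumes i: "in_lin_typed g y F \<Delta>" and f: "wfits g X Y \<Delta>" and F: "wgood (up X) F" and y: "y \<in> X"
  shows "in_lin_typed (lift g \<circ> res_map) (Suc (Suc y)) (wren (lift (Suc \<circ> Suc)) F) (ext {} \<Delta>)"
proof -
  from i consider (srv) n V where "VSrv n V \<in> \<Delta> (g y)"
    | (lin) n V\<^sub>1 V\<^sub>2 L where "VIn n V\<^sub>1 V\<^sub>2 \<in> \<Delta> (g y)"
      "wta (ext {V\<^sub>1} (ext {V\<^sub>2} (rem (VIn n V\<^sub>1 V\<^sub>2) (g y) \<Delta>))) (wren (in_ren (Suc \<circ> (Suc \<circ> g)) y 0 1) F) L"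
    unfolding in_lin_typed_def by blast
  then show ?thesis
  proof cases
    case srv
    then show ?thesis unfolding in_lin_typed_def by auto
  next
    case lin
    let ?R = "rem (VIn n V\<^sub>1 V\<^sub>2) (g y) \<Delta>"
    have gd: "wgood (up (up Y)) (wren (in_ren (Suc \<circ> (Suc \<circ> g)) y 0 1) F)"
      using f y by (intro wgood_wren[OF F keeps_fresh_in_ren]) (auto simp: wfits_def)
    have fr: "?R z = {}" if "z \<notin> Y" for z
      using that wfits_fresh[OF f] by (simp add: rem_empty)
    have "wta (ext {V\<^sub>1} (ext {V\<^sub>2} (ext {} ?R))) (wren (lift (lift Suc)) (wren (in_ren (Suc \<circ> (Suc \<circ> g)) y 0 1) F)) L"
    proof (rule wta_ren[OF gd lin(2)])
      show "wrel (wfn (wren (in_ren (Suc \<circ> (Suc \<circ> g)) y 0 1) F)) (lift (lift Suc))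
          (ext {V\<^sub>1} (ext {V\<^sub>2} ?R)) (ext {V\<^sub>1} (ext {V\<^sub>2} (ext {} ?R)))"
        by (intro wrel_lift[OF wrel_lift[OF wrel_Suc]]) (rule UNIV_I)+
      show "keeps_fresh (lift (lift Suc)) (up (up Y)) (up (up (up Y)))"
        by (intro keeps_fresh_lift keeps_fresh_up)
      show "ext {V\<^sub>1} (ext {V\<^sub>2} ?R) z = {}" if "z \<notin> up (up Y)" for z
        using that fr nat_cases2[of z] by auto
      show "ext {V\<^sub>1} (ext {V\<^sub>2} (ext {} ?R)) z = {}" if "z \<notin> up (up (up Y))" for z
        using that fr nat_cases3[of z] by auto
    qed
    moreover have "lift (lift Suc) \<circ> in_ren (Suc \<circ> (Suc \<circ> g)) y 0 1
        = in_ren (Suc \<circ> (Suc \<circ> (lift g \<circ> res_map))) (Suc (Suc y)) 0 1 \<circ> lift (Suc \<circ> Suc)"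
      by (auto simp: fun_eq_iff in_ren_def lift_if res_map_def)
    ultimately have "wta (ext {V\<^sub>1} (ext {V\<^sub>2} (ext {} ?R)))
        (wren (in_ren (Suc \<circ> (Suc \<circ> (lift g \<circ> res_map))) (Suc (Suc y)) 0 1) (wren (lift (Suc \<circ> Suc)) F)) L"
      by (simp only: wren_wren)
    moreover have "(lift g \<circ> res_map) (Suc (Suc y)) = Suc (g y)" by simp
    ultimately show ?thesis using lin(1) unfolding in_lin_typed_def by (simp only: rem_ext ext_simps) blast
  qed
qed

lemma in_srv_typed_shift:
  assumes i: "in_srv_typed g y F \<Delta>" and f: "wfits g X Y \<Delta>" and F: "wgood (up X) F"
  shows "in_srv_typed (lift g \<circ> res_map) (Suc (Suc y)) (wren (lift (Suc \<circ> Suc)) F) (ext {} \<Delta>)"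
proof -
  from i consider (lin) n V\<^sub>1 V\<^sub>2 where "VIn n V\<^sub>1 V\<^sub>2 \<in> \<Delta> (g y)"
    | (srv) n V L where "VSrv n V \<in> \<Delta> (g y)" "wta (ext {V} \<Delta>) (wren (lift g) F) L"
    unfolding in_srv_typed_def by blast
  then show ?thesis
  proof cases
    case lin
    then show ?thesis unfolding in_srv_typed_def by auto
  next
    case srv
    have gd: "wgood (up Y) (wren (lift g) F)"
      using f by (intro wgood_wren[OF F keeps_fresh_lift]) (auto simp: wfits_def)
    have "wta (ext {V} (ext {} \<Delta>)) (wren (lift Suc) (wren (lift g) F)) L"
    proof (rule wta_ren[OF gd srv(2)])
      show "wrel (wfn (wren (lift g) F)) (lift Suc) (ext {V} \<Delta>) (ext {V} (ext {} \<Delta>))"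
        by (intro wrel_lift[OF wrel_Suc]) (rule UNIV_I)
      show "keeps_fresh (lift Suc) (up Y) (up (up Y))"
        by (intro keeps_fresh_lift keeps_fresh_up)
      show "ext {V} \<Delta> z = {}" if "z \<notin> up Y" for z
        using that wfits_fresh[OF f] by (cases z) auto
      show "ext {V} (ext {} \<Delta>) z = {}" if "z \<notin> up (up Y)" for z
        using that wfits_fresh[OF f] nat_cases2[of z] by auto
    qed
    moreover have "lift Suc \<circ> lift g = lift (lift g \<circ> res_map) \<circ> lift (Suc \<circ> Suc)"
      by (auto simp: fun_eq_iff lift_if res_map_def)
    ultimately have "wta (ext {V} (ext {} \<Delta>)) (wren (lift (lift g \<circ> res_map)) (wren (lift (Suc \<circ> Suc)) F)) L"
      by (simp only: wren_wren)
    moreover have "(lift g \<circ> res_map) (Suc (Suc y)) = Suc (g y)" by simp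
    ultimately show ?thesis using srv(1) unfolding in_srv_typed_def by (simp only: ext_simps) blast
  qed
qed

lemma sig_swap: "swap_res \<circ> lift (lift (sig x y)) = sig (Suc (Suc x)) (Suc (Suc y))"
proof
  fix i
  show "(swap_res \<circ> lift (lift (sig x y))) i = sig (Suc (Suc x)) (Suc (Suc y)) i"
    using nat_cases2[of i] by (elim disjE exE) (simp_all add: sig_def)
qed

text \<open>The new pair is bound at the communication, inside the restrictions around it; in the
  quotient it can be moved outside of each of them.\<close>

lemma qres_qren_sig: "qres (qren (sig x y) (qres p)) = qres (qres (qren (sig (Suc (Suc x)) (Suc (Suc y))) p))"
  using qres_swap_res[of "qren (lift (lift (sig x y))) p"] by (simp add: sig_swap del: swap_comps)

text \<open>
  A linear communication on \<open>x\<close> and \<open>y\<close> continues on the extruded pair. The residual up to structural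
  congruence is thus \<open>r\<close> with \<open>x\<close> and \<open>y\<close> renamed to a new pair, bound right here.
\<close>

definition com_lin :: "name set \<Rightarrow> sctx \<Rightarrow> name \<Rightarrow> name \<Rightarrow> sq \<Rightarrow> wproc \<Rightarrow> bool" where
  "com_lin X \<Gamma> x y r W \<longleftrightarrow> (\<exists>R W'. abs_sq R = qres (qren (sig x y) r) \<and> tr X (\<Gamma>(x := None, y := None)) R W'
     \<and> (\<forall>g. g x = g y \<longrightarrow> wlts (wren g W) ATau (wren g W'))
     \<and> (\<forall>g Y \<Delta> L U. wfits g X Y \<Delta> \<longrightarrow> g x = g y \<longrightarrow> \<Delta> (g x) \<subseteq> {U, wdual U} \<longrightarrow> wta \<Delta> (wren g W) L
         \<longrightarrow> (\<exists>V. \<not> wun V \<and> V \<in> \<Delta> (g x) \<and> wdual V \<in> \<Delta> (g x)) \<and> (\<exists>L'. wta (\<Delta>(g x := {})) (wren g W') L')))"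

text \<open>The condition \<open>g x = g y\<close> and the bound on the entry of \<open>g x\<close>
  describe a channel whose binder is still further out. Both are met once \<open>g\<close> contains
  the \<open>res_map\<close> of that binder.\<close>

definition com_cli :: "name set \<Rightarrow> sctx \<Rightarrow> name \<Rightarrow> name \<Rightarrow> sq \<Rightarrow> wproc \<Rightarrow> bool" where
  "com_cli X \<Gamma> x y r W \<longleftrightarrow> (\<exists>R W'. abs_sq R = r \<and> tr X \<Gamma> R W'
     \<and> (\<forall>g. g x = g y \<longrightarrow> wlts (wren g W) ATau (wren g W'))
     \<and> (\<forall>g Y \<Delta> L U. wfits g X Y \<Delta> \<longrightarrow> g x = g y \<longrightarrow> \<Delta> (g x) \<subseteq> {U, wdual U} \<longrightarrow> wta \<Delta> (wren g W) L
         \<longrightarrow> (\<exists>L'. wta \<Delta> (wren g W') L')))"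

lemma com_linI:
  assumes "abs_sq R = qres (qren (sig x y) r)" "tr X (\<Gamma>(x := None, y := None)) R W'"
    and "\<And>g. g x = g y \<Longrightarrow> wlts (wren g W) ATau (wren g W')"
    and "\<And>g Y \<Delta> L U. wfits g X Y \<Delta> \<Longrightarrow> g x = g y \<Longrightarrow> \<Delta> (g x) \<subseteq> {U, wdual U} \<Longrightarrow> wta \<Delta> (wren g W) L
         \<Longrightarrow> (\<exists>V. \<not> wun V \<and> V \<in> \<Delta> (g x) \<and> wdual V \<in> \<Delta> (g x)) \<and> (\<exists>L'. wta (\<Delta>(g x := {})) (wren g W') L')"
  shows "com_lin X \<Gamma> x y r W"
  using assms unfolding com_lin_def by blast

lemma com_cliI:
  assumes "abs_sq R = r" "tr X \<Gamma> R W'"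
    and "\<And>g. g x = g y \<Longrightarrow> wlts (wren g W) ATau (wren g W')"
    and "\<And>g Y \<Delta> L U. wfits g X Y \<Delta> \<Longrightarrow> g x = g y \<Longrightarrow> \<Delta> (g x) \<subseteq> {U, wdual U} \<Longrightarrow> wta \<Delta> (wren g W) L
         \<Longrightarrow> \<exists>L'. wta \<Delta> (wren g W') L'"
  shows "com_cli X \<Gamma> x y r W"
  using assms unfolding com_cli_def by blast

lemma upd_None_ext: "(opened T \<Gamma>)(Suc (Suc x) := None, Suc (Suc y) := None) = opened T (\<Gamma>(x := None, y := None))"
  by (simp add: ext_upd_Suc)

text \<open>The bound case is the free case below the extruded pair, with value 0 and with
  \<open>lift g \<circ> res_map\<close> for \<open>g\<close>; the residual gets one more restriction
  for that pair.\<close>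

lemma meet_lin:
  assumes m: "meet P Q x y r" and s: "ssplit \<Gamma> \<Gamma>\<^sub>1 \<Gamma>\<^sub>2" and t: "tr X \<Gamma>\<^sub>1 P W\<^sub>1" "tr X \<Gamma>\<^sub>2 Q W\<^sub>2"
    and d: "dom \<Gamma> \<subseteq> X" and x: "\<Gamma> x = Some (TLOut T S)" and y: "\<Gamma> y = Some (TLIn T (sdual S))"
  shows "com_lin X \<Gamma> x y r (WPar W\<^sub>1 W\<^sub>2)" "com_lin X \<Gamma> x y r (WPar W\<^sub>2 W\<^sub>1)"
proof -
  note ds = tr_dom_par[OF s d] and j = ssplit_sjoin[OF s]
  from m obtain q where q: "ins Q y q" and pq: "(\<exists>v p. outs P x v p \<and> r = p \<parallel> qren (ext v id) q)
    \<or> (\<exists>p. bouts P x p \<and> r = qres (p \<parallel> qren (ext 0 up2) q))" unfolding meet_def by blast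
  have y2: "\<Gamma>\<^sub>2 y = Some (TLIn T (sdual S))" using ins_type[OF q t(2)] ssplit_sub(2)[OF s] y by fastforce
  have x1: "\<Gamma>\<^sub>1 x = Some (TLOut T S)"
    using pq outs_type[OF _ t(1)] bouts_type[OF _ t(1)] ssplit_sub(1)[OF s] x by fastforce
  have X: "x \<in> X" "y \<in> X" "x \<noteq> y" using x y d by auto
  have nd: "x \<notin> dom \<Gamma>\<^sub>2" "y \<notin> dom \<Gamma>\<^sub>1"
    using sjoin_sub(3)[OF j x1] sjoin_sub(4)[OF j y2] by auto
  from in_lin[OF q t(2) ds(2) y2] obtain F V where F: "abs_sq F = q"
    "tr (up X) (ext (Some T) (\<Gamma>\<^sub>2(y \<mapsto> sdual S))) F V"
    "\<And>g b c. wlts (wren g W\<^sub>2) (AIn (g y) b c) (wren (in_ren g y b c) V)"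
    "\<And>g Y \<Delta> L. wfits g X Y \<Delta> \<Longrightarrow> wta \<Delta> (wren g W\<^sub>2) L \<Longrightarrow> in_lin_typed g y V \<Delta>" by blast
  have dF: "dom (ext (Some T) (\<Gamma>\<^sub>2(y \<mapsto> sdual S))) \<subseteq> up X"
    using ds(2) X unfolding ext_dom by (auto simp: up_def)
  note gF = tr_wgood[OF F(2) dF]
  have "com_lin X \<Gamma> x y r (WPar W\<^sub>1 W\<^sub>2) \<and> com_lin X \<Gamma> x y r (WPar W\<^sub>2 W\<^sub>1)"
    using pq
  proof (elim disjE exE conjE)
    fix v p assume o: "outs P x v p" and r: "r = p \<parallel> qren (ext v id) q"
    from out_lin[OF o t(1) ds(1) x1] obtain P' W' where P: "\<Gamma>\<^sub>1 v = Some T" "v \<noteq> x" "abs_sq P' = p"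
      "tr X ((srem T v \<Gamma>\<^sub>1)(x \<mapsto> S)) P' W'"
      "\<And>g. wlts (wren g W\<^sub>1) (AOut 1 (g x) (Suc (g v)) 0) (wren (out_ren g x) W')"
      "\<And>g Y \<Delta> L. wfits g X Y \<Delta> \<Longrightarrow> wta \<Delta> (wren g W\<^sub>1) L \<Longrightarrow> out_lin_typed g x v W' \<Delta>" by blast
    have vy: "v \<noteq> y" using P(1) nd(2) by auto
    have nd1: "y \<notin> dom (srem T v \<Gamma>\<^sub>1)" using nd(2) by (auto simp: srem_def)
    note gP = tr_wgood[OF P(4) dom_upd_srem(1)[OF ds(1) X(1)]]
    note T = com_lin_tr[OF j d x1 y2 P(1,2,4) F(2)]
    note ren = com_lin_ren[OF nd(1) X(1) nd1 X(2,3) P(2) vy P(4) F(2)]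
    let ?A = "sren (sig x y) P'" and ?B = "sren (sig x y \<circ> ext v id) F"
    let ?WA = "wren (sig x y) W'" and ?WB = "wren (sig x y \<circ> ext v id) V"
    have eq: "wren g (WRes (wren res_map (WPar ?WA ?WB)))
        = WRes (WPar (wren (out_ren g x) W') (wren (in_ren (Suc \<circ> g) y (Suc (g v)) 0) V))"
      "wren g (WRes (wren res_map (WPar ?WB ?WA)))
        = WRes (WPar (wren (in_ren (Suc \<circ> g) y (Suc (g v)) 0) V) (wren (out_ren g x) W'))" for g
      by (simp_all only: wren.simps wren_wren ren)
    have step: "wlts (wren g (WPar W\<^sub>1 W\<^sub>2)) ATau (wren g (WRes (wren res_map (WPar ?WA ?WB))))"
      "wlts (wren g (WPar W\<^sub>2 W\<^sub>1)) ATau (wren g (WRes (wren res_map (WPar ?WB ?WA))))" if xy: "g x = g y" for g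
    proof -
      \<comment> \<open>One name is extruded, so the communication rules shift the receiver by 1 and
        restrict once.\<close>
      have "Suc \<circ> g = (\<lambda>i. i + 1) \<circ> g" by auto
      then have "wlts (wren (\<lambda>i. i + 1) (wren g W\<^sub>2)) (AIn (g x + 1) (Suc (g v)) 0) (wren (in_ren (Suc \<circ> g) y (Suc (g v)) 0) V)"
        using F(3)[of "Suc \<circ> g" "Suc (g v)" 0] xy by (simp add: wren_wren)
      from wl_com1[OF P(5)[of g] this] wl_com2[OF P(5)[of g] this]
      show "wlts (wren g (WPar W\<^sub>1 W\<^sub>2)) ATau (wren g (WRes (wren res_map (WPar ?WA ?WB))))"
        "wlts (wren g (WPar W\<^sub>2 W\<^sub>1)) ATau (wren g (WRes (wren res_map (WPar ?WB ?WA))))"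
        unfolding eq by simp_all
    qed
    have abs: "abs_sq (SRes (SPar ?A ?B)) = qres (qren (sig x y) r)" "abs_sq (SRes (SPar ?B ?A)) = qres (qren (sig x y) r)"
      by (simp_all add: abs_sq_simps P(3) F(1) r qpar.commute)
    have wty: "(\<exists>V. \<not> wun V \<and> V \<in> \<Delta> (g x) \<and> wdual V \<in> \<Delta> (g x))
        \<and> (\<exists>L'. wta (\<Delta>(g x := {})) (wren g (WRes (wren res_map (WPar ?WA ?WB)))) L')
        \<and> (\<exists>L'. wta (\<Delta>(g x := {})) (wren g (WRes (wren res_map (WPar ?WB ?WA)))) L')"
      if f: "wfits g X Y \<Delta>" and xy: "g x = g y" and D: "\<Delta> (g x) \<subseteq> {U, wdual U}"
        and sp: "wsplit \<Delta> \<Delta>\<^sub>1 \<Delta>\<^sub>2" "wta \<Delta>\<^sub>1 (wren g W\<^sub>1) L\<^sub>1" "wta \<Delta>\<^sub>2 (wren g W\<^sub>2) L\<^sub>2" for g Y \<Delta> U \<Delta>\<^sub>1 \<Delta>\<^sub>2 L\<^sub>1 L\<^sub>2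
      using com_lin_typed[OF wsplit_wjoin[OF sp(1)] f X(1,2) xy D
          P(6)[OF wfits_split(1)[OF sp(1) f] sp(2)] F(4)[OF wfits_split(2)[OF sp(1) f] sp(3)] gP gF]
      unfolding eq by blast
    have "com_lin X \<Gamma> x y r (WPar W\<^sub>1 W\<^sub>2)"
    proof (rule com_linI)
      show "abs_sq (SRes (SPar ?A ?B)) = qres (qren (sig x y) r)" by (rule abs)
      show "tr X (\<Gamma>(x := None, y := None)) (SRes (SPar ?A ?B)) (WRes (wren res_map (WPar ?WA ?WB)))"
        by (rule tr.res[OF T(1)])
    next
      fix g Y \<Delta> L U
      assume a: "wfits g X Y \<Delta>" "g x = g y" "\<Delta> (g x) \<subseteq> {U, wdual U}" "wta \<Delta> (wren g (WPar W\<^sub>1 W\<^sub>2)) L"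
      from a(4) obtain \<Delta>\<^sub>1 \<Delta>\<^sub>2 L\<^sub>1 L\<^sub>2 where sp: "wsplit \<Delta> \<Delta>\<^sub>1 \<Delta>\<^sub>2" "wta \<Delta>\<^sub>1 (wren g W\<^sub>1) L\<^sub>1" "wta \<Delta>\<^sub>2 (wren g W\<^sub>2) L\<^sub>2"
        unfolding wren.simps by (rule wta_WParE)
      from wty[OF a(1-3) sp] show "(\<exists>V. \<not> wun V \<and> V \<in> \<Delta> (g x) \<and> wdual V \<in> \<Delta> (g x))
        \<and> (\<exists>L'. wta (\<Delta>(g x := {})) (wren g (WRes (wren res_map (WPar ?WA ?WB)))) L')" by blast
    qed (rule step)
    moreover have "com_lin X \<Gamma> x y r (WPar W\<^sub>2 W\<^sub>1)"
    proof (rule com_linI)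
      show "abs_sq (SRes (SPar ?B ?A)) = qres (qren (sig x y) r)" by (rule abs)
      show "tr X (\<Gamma>(x := None, y := None)) (SRes (SPar ?B ?A)) (WRes (wren res_map (WPar ?WB ?WA)))"
        by (rule tr.res[OF T(2)])
    next
      fix g Y \<Delta> L U
      assume a: "wfits g X Y \<Delta>" "g x = g y" "\<Delta> (g x) \<subseteq> {U, wdual U}" "wta \<Delta> (wren g (WPar W\<^sub>2 W\<^sub>1)) L"
      from a(4) obtain \<Delta>\<^sub>1 \<Delta>\<^sub>2 L\<^sub>1 L\<^sub>2 where sp: "wsplit \<Delta> \<Delta>\<^sub>2 \<Delta>\<^sub>1" "wta \<Delta>\<^sub>1 (wren g W\<^sub>1) L\<^sub>1" "wta \<Delta>\<^sub>2 (wren g W\<^sub>2) L\<^sub>2"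
        unfolding wren.simps by (rule wta_WParE)
      from wty[OF a(1-3) wsplit_sym[OF sp(1)] sp(2,3)] show "(\<exists>V. \<not> wun V \<and> V \<in> \<Delta> (g x) \<and> wdual V \<in> \<Delta> (g x))
        \<and> (\<exists>L'. wta (\<Delta>(g x := {})) (wren g (WRes (wren res_map (WPar ?WB ?WA)))) L')" by blast
    qed (rule step)
    ultimately show ?thesis ..
  next
    fix p assume o: "bouts P x p" and r: "r = qres (p \<parallel> qren (ext 0 up2) q)"
    let ?x = "Suc (Suc x)" and ?y = "Suc (Suc y)" and ?X = "up (up X)"
    from bout_lin[OF o t(1) ds(1) x1] obtain P' W' where P: "abs_sq P' = p"
      "tr ?X ((srem T 0 (opened T \<Gamma>\<^sub>1))(?x \<mapsto> S)) P' W'"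
      "\<And>g. wlts (wren g W\<^sub>1) (AOut 2 (g x) 1 0) (wren (out_ren (lift g \<circ> res_map) ?x) W')"
      "\<And>g Y \<Delta> L. wfits g X Y \<Delta> \<Longrightarrow> wta \<Delta> (wren g W\<^sub>1) L \<Longrightarrow> bout_lin_typed g x W' \<Delta>" by blast
    let ?F = "sren (lift (Suc \<circ> Suc)) F" and ?V = "wren (lift (Suc \<circ> Suc)) V"
    have F': "tr (up ?X) (ext (Some T) ((ext None (ext None \<Gamma>\<^sub>2))(?y \<mapsto> sdual S))) ?F ?V"
      using tr_shift_body[OF F(2)] ds(2) X(2) by (simp add: ext_upd_Suc)
    have j': "sjoin (opened T \<Gamma>) (opened T \<Gamma>\<^sub>1) (ext None (ext None \<Gamma>\<^sub>2))"
      by (intro sjoin_ext j)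
    have x': "opened T \<Gamma>\<^sub>1 ?x = Some (TLOut T S)" "opened T \<Gamma>\<^sub>1 0 = Some T" "0 \<noteq> ?x" "0 \<noteq> ?y" "?x \<noteq> ?y" "?x \<in> ?X" "?y \<in> ?X"
      and y': "ext None (ext None \<Gamma>\<^sub>2) ?y = Some (TLIn T (sdual S))" using x1 y2 X by simp_all
    have nd': "?x \<notin> dom (ext None (ext None \<Gamma>\<^sub>2))" "?y \<notin> dom (srem T 0 (opened T \<Gamma>\<^sub>1))"
      using nd by (auto simp: srem_def domIff)
    note gP = tr_wgood[OF P(2) dom_upd_srem(1)[OF dom_ext2[OF ds(1)] x'(6)]]
    have gF': "wgood (up ?X) ?V"
      by (intro wgood_wren[OF gF] keeps_fresh_lift keeps_fresh_comp[OF keeps_fresh_up(1) keeps_fresh_up(1)])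
    note T = com_lin_tr[OF j' dom_ext2[OF d] x'(1) y' x'(2,3) P(2) F', unfolded upd_None_ext]
    note ren = com_lin_ren[OF nd'(1) x'(6) nd'(2) x'(7,5,3,4) P(2) F']
    let ?A = "sren (sig ?x ?y) P'" and ?B = "sren (sig ?x ?y \<circ> ext 0 id) ?F"
    let ?WA = "wren (sig ?x ?y) W'" and ?WB = "wren (sig ?x ?y \<circ> ext 0 id) ?V"
    let ?g = "\<lambda>g. lift g \<circ> res_map"
    let ?RA = "WRes (wren res_map (WPar ?WA ?WB))" and ?RB = "WRes (wren res_map (WPar ?WB ?WA))"
    have g0: "?g g 0 = 0" "?g g ?x = Suc (g x)" "?g g ?y = Suc (g y)" for g by simp_all
    have eq: "wren (?g g) ?RA
        = WRes (WPar (wren (out_ren (?g g) ?x) W') (wren (in_ren (Suc \<circ> ?g g) ?y (Suc 0) 0) ?V))"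
      "wren (?g g) ?RB
        = WRes (WPar (wren (in_ren (Suc \<circ> ?g g) ?y (Suc 0) 0) ?V) (wren (out_ren (?g g) ?x) W'))" for g
      using ren[of "?g g"] unfolding g0 by (simp_all only: wren.simps wren_wren o_assoc)
    have eq2: "wren g (WRes (wren res_map R)) = WRes (wren (?g g) R)" for g R
      by (simp only: wren.simps wren_wren)
    have inr: "wren (in_ren (Suc \<circ> ?g g) ?y (Suc 0) 0) ?V = wren (in_ren (up2 \<circ> g) y 1 0) V" for g
    proof -
      have "in_ren (Suc \<circ> ?g g) ?y (Suc 0) 0 \<circ> lift (Suc \<circ> Suc) = in_ren (up2 \<circ> g) y 1 0"
        by (auto simp: fun_eq_iff in_ren_def lift_if res_map_def)
      then show ?thesis by (simp only: wren_wren)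
    qed
    have step: "wlts (wren g (WPar W\<^sub>1 W\<^sub>2)) ATau (wren g (WRes (wren res_map ?RA)))"
      "wlts (wren g (WPar W\<^sub>2 W\<^sub>1)) ATau (wren g (WRes (wren res_map ?RB)))" if xy: "g x = g y" for g
    proof -
      \<comment> \<open>Two names are extruded, and the receiver gets index 1 as payload and index 0
        as continuation.\<close>
      have "wlts (wren up2 (wren g W\<^sub>2)) (AIn (g x + 2) 1 0) (wren (in_ren (up2 \<circ> g) y 1 0) V)"
        using F(3)[of "up2 \<circ> g" 1 0] xy by (simp add: wren_wren)
      from wl_com1[OF P(3)[of g] this] wl_com2[OF P(3)[of g] this]
      show "wlts (wren g (WPar W\<^sub>1 W\<^sub>2)) ATau (wren g (WRes (wren res_map ?RA)))"
        "wlts (wren g (WPar W\<^sub>2 W\<^sub>1)) ATau (wren g (WRes (wren res_map ?RB)))"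
        unfolding eq2[of g ?RA] eq2[of g ?RB] eq inr by (simp_all add: numeral_2_eq_2)
    qed
    have "qren (ext 0 id) (qren (lift (Suc \<circ> Suc)) q) = qren (ext 0 up2) q"
    proof -
      have "ext 0 id \<circ> lift (Suc \<circ> Suc) = ext 0 up2" by (auto simp: fun_eq_iff ext_if lift_if)
      then show ?thesis by simp
    qed
    then have "abs_sq (SRes (SPar ?A ?B)) = qres (qren (sig ?x ?y) (p \<parallel> qren (ext 0 up2) q))"
      by (simp only: abs_sq_simps P(1) F(1) qren_qpar qren_qren[symmetric])
    \<comment> \<open>The residual built here binds the new pair inside the extruded one, whereas
      the claim binds it outside.\<close>
    then have abs: "abs_sq (SRes (SRes (SPar ?A ?B))) = qres (qren (sig x y) r)"
      "abs_sq (SRes (SRes (SPar ?B ?A))) = qres (qren (sig x y) r)"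
      unfolding r qres_qren_sig by (simp_all only: abs_sq_simps qpar.commute)
    have wty: "(\<exists>V. \<not> wun V \<and> V \<in> \<Delta> (g x) \<and> wdual V \<in> \<Delta> (g x))
        \<and> (\<exists>L'. wta (\<Delta>(g x := {})) (wren g (WRes (wren res_map ?RA))) L')
        \<and> (\<exists>L'. wta (\<Delta>(g x := {})) (wren g (WRes (wren res_map ?RB))) L')"
      if f: "wfits g X Y \<Delta>" and xy: "g x = g y" and D: "\<Delta> (g x) \<subseteq> {U, wdual U}"
        and sp: "wsplit \<Delta> \<Delta>\<^sub>1 \<Delta>\<^sub>2" "wta \<Delta>\<^sub>1 (wren g W\<^sub>1) L\<^sub>1" "wta \<Delta>\<^sub>2 (wren g W\<^sub>2) L\<^sub>2" for g Y \<Delta> U \<Delta>\<^sub>1 \<Delta>\<^sub>2 L\<^sub>1 L\<^sub>2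
    proof -
      from P(4)[OF wfits_split(1)[OF sp(1) f] sp(2)] obtain Z where Z: "weights_pos Z"
        "out_lin_typed (?g g) ?x 0 W' (ext {Z, wdual Z} \<Delta>\<^sub>1)" unfolding bout_lin_typed_def by blast
      note i = in_lin_typed_shift[OF F(4)[OF wfits_split(2)[OF sp(1) f] sp(3)] wfits_split(2)[OF sp(1) f] gF X(2)]
      have xy': "?g g ?x = ?g g ?y" using xy by simp
      have D': "ext {Z, wdual Z} \<Delta> (?g g ?x) \<subseteq> {U, wdual U}" using D by simp
      note c = com_lin_typed[OF wjoin_ext[OF wsplit_wjoin[OF sp(1)]] wfits_res[OF f] x'(6,7) xy' D' Z(2) i gP gF',
        unfolded g0 eq[symmetric] ext_upd ext_simps(2)]
      show ?thesis using c wta.res[OF Z(1)] unfolding eq2[of g ?RA] eq2[of g ?RB] by blast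
    qed
    have "com_lin X \<Gamma> x y r (WPar W\<^sub>1 W\<^sub>2)"
    proof (rule com_linI)
      show "abs_sq (SRes (SRes (SPar ?A ?B))) = qres (qren (sig x y) r)" by (rule abs)
      show "tr X (\<Gamma>(x := None, y := None)) (SRes (SRes (SPar ?A ?B))) (WRes (wren res_map ?RA))"
        by (rule tr.res[OF tr.res[OF T(1)]])
    next
      fix g Y \<Delta> L U
      assume a: "wfits g X Y \<Delta>" "g x = g y" "\<Delta> (g x) \<subseteq> {U, wdual U}" "wta \<Delta> (wren g (WPar W\<^sub>1 W\<^sub>2)) L"
      from a(4) obtain \<Delta>\<^sub>1 \<Delta>\<^sub>2 L\<^sub>1 L\<^sub>2 where sp: "wsplit \<Delta> \<Delta>\<^sub>1 \<Delta>\<^sub>2" "wta \<Delta>\<^sub>1 (wren g W\<^sub>1) L\<^sub>1" "wta \<Delta>\<^sub>2 (wren g W\<^sub>2) L\<^sub>2"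
        unfolding wren.simps by (rule wta_WParE)
      from wty[OF a(1-3) sp] show "(\<exists>V. \<not> wun V \<and> V \<in> \<Delta> (g x) \<and> wdual V \<in> \<Delta> (g x))
        \<and> (\<exists>L'. wta (\<Delta>(g x := {})) (wren g (WRes (wren res_map ?RA))) L')" by blast
    qed (rule step)
    moreover have "com_lin X \<Gamma> x y r (WPar W\<^sub>2 W\<^sub>1)"
    proof (rule com_linI)
      show "abs_sq (SRes (SRes (SPar ?B ?A))) = qres (qren (sig x y) r)" by (rule abs)
      show "tr X (\<Gamma>(x := None, y := None)) (SRes (SRes (SPar ?B ?A))) (WRes (wren res_map ?RB))"
        by (rule tr.res[OF tr.res[OF T(2)]])
    next
      fix g Y \<Delta> L U
      assume a: "wfits g X Y \<Delta>" "g x = g y" "\<Delta> (g x) \<subseteq> {U, wdual U}" "wta \<Delta> (wren g (WPar W\<^sub>2 W\<^sub>1)) L"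
      from a(4) obtain \<Delta>\<^sub>1 \<Delta>\<^sub>2 L\<^sub>1 L\<^sub>2 where sp: "wsplit \<Delta> \<Delta>\<^sub>2 \<Delta>\<^sub>1" "wta \<Delta>\<^sub>1 (wren g W\<^sub>1) L\<^sub>1" "wta \<Delta>\<^sub>2 (wren g W\<^sub>2) L\<^sub>2"
        unfolding wren.simps by (rule wta_WParE)
      from wty[OF a(1-3) wsplit_sym[OF sp(1)] sp(2,3)] show "(\<exists>V. \<not> wun V \<and> V \<in> \<Delta> (g x) \<and> wdual V \<in> \<Delta> (g x))
        \<and> (\<exists>L'. wta (\<Delta>(g x := {})) (wren g (WRes (wren res_map ?RB))) L')" by blast
    qed (rule step)
    ultimately show ?thesis ..
  qed
  then show "com_lin X \<Gamma> x y r (WPar W\<^sub>1 W\<^sub>2)" "com_lin X \<Gamma> x y r (WPar W\<^sub>2 W\<^sub>1)" by blast+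
qed

lemma meet_cli:
  assumes m: "meet P Q x y r" and s: "ssplit \<Gamma> \<Gamma>\<^sub>1 \<Gamma>\<^sub>2" and t: "tr X \<Gamma>\<^sub>1 P W\<^sub>1" "tr X \<Gamma>\<^sub>2 Q W\<^sub>2"
    and d: "dom \<Gamma> \<subseteq> X" and x: "\<Gamma> x = Some (TCli T)" and y: "\<Gamma> y = Some (TSrv T)"
  shows "com_cli X \<Gamma> x y r (WPar W\<^sub>1 W\<^sub>2)" "com_cli X \<Gamma> x y r (WPar W\<^sub>2 W\<^sub>1)"
proof -
  note ds = tr_dom_par[OF s d] and j = ssplit_sjoin[OF s]
  from m obtain q where q: "ins Q y q" and pq: "(\<exists>v p. outs P x v p \<and> r = p \<parallel> qren (ext v id) q)
    \<or> (\<exists>p. bouts P x p \<and> r = qres (p \<parallel> qren (ext 0 up2) q))" unfolding meet_def by blast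
  \<comment> \<open>Unrestricted entries are on both sides of a split, so it need not be found out
    which component owns the channel.\<close>
  have y2: "\<Gamma>\<^sub>2 y = Some (TSrv T)" using ssplit_sub(4)[OF s y] by simp
  have x1: "\<Gamma>\<^sub>1 x = Some (TCli T)" using ssplit_sub(3)[OF s x] by simp
  from in_srv[OF q t(2) ds(2) y2] obtain F V where F: "abs_sq F = q"
    "tr (up X) (ext (Some T) \<Gamma>\<^sub>2) F V"
    "\<And>g b c. wlts (wren g W\<^sub>2) (AIn (g y) b c) (wren (ext b g) V)"
    "\<And>g Y \<Delta> L. wfits g X Y \<Delta> \<Longrightarrow> wta \<Delta> (wren g W\<^sub>2) L \<Longrightarrow> in_srv_typed g y V \<Delta>" by blast
  have dF: "dom (ext (Some T) \<Gamma>\<^sub>2) \<subseteq> up X"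
    using ds(2) unfolding ext_dom by (auto simp: up_def)
  note gF = tr_wgood[OF F(2) dF]
  have "com_cli X \<Gamma> x y r (WPar W\<^sub>1 W\<^sub>2) \<and> com_cli X \<Gamma> x y r (WPar W\<^sub>2 W\<^sub>1)"
    using pq
  proof (elim disjE exE conjE)
    fix v p assume o: "outs P x v p" and r: "r = p \<parallel> qren (ext v id) q"
    from out_cli[OF o t(1) ds(1) x1] obtain P' W' z where P: "\<Gamma>\<^sub>1 v = Some T" "abs_sq P' = p"
      "tr X (srem T v \<Gamma>\<^sub>1) P' W'"
      "\<And>g. wlts (wren g W\<^sub>1) (AOut 0 (g x) (g v) (g z)) (wren g W')"
      "\<And>g Y \<Delta> L. wfits g X Y \<Delta> \<Longrightarrow> wta \<Delta> (wren g W\<^sub>1) L \<Longrightarrow> out_cli_typed g x v W' \<Delta>" by blast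
    note gP = tr_wgood[OF P(3) dom_upd_srem(2)[OF ds(1)]]
    note T = com_cli_tr[OF j d P(1,3) F(2)]
    let ?B = "sren (ext v id) F" and ?WB = "wren (ext v id) V"
    have eq: "wren g ?WB = wren (ext (g v) g) V" for g
    proof -
      have "g \<circ> ext v id = ext (g v) g" by (auto simp: fun_eq_iff ext_if)
      then show ?thesis by (simp only: wren_wren)
    qed
    have step: "wlts (wren g (WPar W\<^sub>1 W\<^sub>2)) ATau (wren g (WPar W' ?WB))"
      "wlts (wren g (WPar W\<^sub>2 W\<^sub>1)) ATau (wren g (WPar ?WB W'))" if xy: "g x = g y" for g
    proof -
      have "wren (\<lambda>i. i + 0) (wren g W\<^sub>2) = wren g W\<^sub>2"
        using wren_id[of "wren g W\<^sub>2"] by (simp add: id_def)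
      then have "wlts (wren (\<lambda>i. i + 0) (wren g W\<^sub>2)) (AIn (g x + 0) (g v) (g z)) (wren g ?WB)"
        using F(3)[of g "g v" "g z"] xy by (simp add: eq)
      from wl_com1[OF P(4)[of g] this] wl_com2[OF P(4)[of g] this]
      show "wlts (wren g (WPar W\<^sub>1 W\<^sub>2)) ATau (wren g (WPar W' ?WB))"
        "wlts (wren g (WPar W\<^sub>2 W\<^sub>1)) ATau (wren g (WPar ?WB W'))" by simp_all
    qed
    have abs: "abs_sq (SPar P' ?B) = r" "abs_sq (SPar ?B P') = r"
      by (simp_all add: abs_sq_simps P(2) F(1) r qpar.commute)
    have wty: "(\<exists>L'. wta \<Delta> (wren g (WPar W' ?WB)) L') \<and> (\<exists>L'. wta \<Delta> (wren g (WPar ?WB W')) L')"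
      if f: "wfits g X Y \<Delta>" and xy: "g x = g y" and D: "\<Delta> (g x) \<subseteq> {U, wdual U}"
        and sp: "wsplit \<Delta> \<Delta>\<^sub>1 \<Delta>\<^sub>2" "wta \<Delta>\<^sub>1 (wren g W\<^sub>1) L\<^sub>1" "wta \<Delta>\<^sub>2 (wren g W\<^sub>2) L\<^sub>2" for g Y \<Delta> U \<Delta>\<^sub>1 \<Delta>\<^sub>2 L\<^sub>1 L\<^sub>2
      using com_cli_typed[OF wsplit_wjoin[OF sp(1)] f xy D
          P(5)[OF wfits_split(1)[OF sp(1) f] sp(2)] F(4)[OF wfits_split(2)[OF sp(1) f] sp(3)] gP gF]
      unfolding wren.simps eq by blast
    have "com_cli X \<Gamma> x y r (WPar W\<^sub>1 W\<^sub>2)"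
    proof (rule com_cliI)
      show "abs_sq (SPar P' ?B) = r" by (rule abs)
      show "tr X \<Gamma> (SPar P' ?B) (WPar W' ?WB)" by (rule T)
    next
      fix g Y \<Delta> L U
      assume a: "wfits g X Y \<Delta>" "g x = g y" "\<Delta> (g x) \<subseteq> {U, wdual U}" "wta \<Delta> (wren g (WPar W\<^sub>1 W\<^sub>2)) L"
      from a(4) obtain \<Delta>\<^sub>1 \<Delta>\<^sub>2 L\<^sub>1 L\<^sub>2 where sp: "wsplit \<Delta> \<Delta>\<^sub>1 \<Delta>\<^sub>2" "wta \<Delta>\<^sub>1 (wren g W\<^sub>1) L\<^sub>1" "wta \<Delta>\<^sub>2 (wren g W\<^sub>2) L\<^sub>2"
        unfolding wren.simps by (rule wta_WParE)
      from wty[OF a(1-3) sp] show "\<exists>L'. wta \<Delta> (wren g (WPar W' ?WB)) L'" by blast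
    qed (rule step)
    moreover have "com_cli X \<Gamma> x y r (WPar W\<^sub>2 W\<^sub>1)"
    proof (rule com_cliI)
      show "abs_sq (SPar ?B P') = r" by (rule abs)
      show "tr X \<Gamma> (SPar ?B P') (WPar ?WB W')" by (rule T)
    next
      fix g Y \<Delta> L U
      assume a: "wfits g X Y \<Delta>" "g x = g y" "\<Delta> (g x) \<subseteq> {U, wdual U}" "wta \<Delta> (wren g (WPar W\<^sub>2 W\<^sub>1)) L"
      from a(4) obtain \<Delta>\<^sub>1 \<Delta>\<^sub>2 L\<^sub>1 L\<^sub>2 where sp: "wsplit \<Delta> \<Delta>\<^sub>2 \<Delta>\<^sub>1" "wta \<Delta>\<^sub>1 (wren g W\<^sub>1) L\<^sub>1" "wta \<Delta>\<^sub>2 (wren g W\<^sub>2) L\<^sub>2"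
        unfolding wren.simps by (rule wta_WParE)
      from wty[OF a(1-3) wsplit_sym[OF sp(1)] sp(2,3)] show "\<exists>L'. wta \<Delta> (wren g (WPar ?WB W')) L'" by blast
    qed (rule step)
    ultimately show ?thesis ..
  next
    fix p assume o: "bouts P x p" and r: "r = qres (p \<parallel> qren (ext 0 up2) q)"
    let ?x = "Suc (Suc x)" and ?y = "Suc (Suc y)" and ?X = "up (up X)"
    from bout_cli[OF o t(1) ds(1) x1] obtain P' W' z where P: "abs_sq P' = p"
      "tr ?X (srem T 0 (opened T \<Gamma>\<^sub>1)) P' W'"
      "\<And>g. wlts (wren g W\<^sub>1) (AOut 1 (g x) 0 (Suc (g z))) (wren (lift g \<circ> res_map) W')"
      "\<And>g Y \<Delta> L. wfits g X Y \<Delta> \<Longrightarrow> wta \<Delta> (wren g W\<^sub>1) L \<Longrightarrow> bout_cli_typed g x W' \<Delta>" by blast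
    let ?F = "sren (lift (Suc \<circ> Suc)) F" and ?V = "wren (lift (Suc \<circ> Suc)) V"
    have F': "tr (up ?X) (ext (Some T) (ext None (ext None \<Gamma>\<^sub>2))) ?F ?V"
      using tr_shift_body[OF F(2)] ds(2) by simp
    have j': "sjoin (opened T \<Gamma>) (opened T \<Gamma>\<^sub>1) (ext None (ext None \<Gamma>\<^sub>2))"
      by (intro sjoin_ext j)
    have x': "opened T \<Gamma>\<^sub>1 0 = Some T" by simp
    note gP = tr_wgood[OF P(2) dom_upd_srem(2)[OF dom_ext2[OF ds(1)]]]
    have gF': "wgood (up ?X) ?V"
      by (intro wgood_wren[OF gF] keeps_fresh_lift keeps_fresh_comp[OF keeps_fresh_up(1) keeps_fresh_up(1)])
    note T = com_cli_tr[OF j' dom_ext2[OF d] x' P(2) F']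
    let ?B = "sren (ext 0 id) ?F" and ?WB = "wren (ext 0 id) ?V"
    let ?g = "\<lambda>g. lift g \<circ> res_map"
    have eq: "wren (?g g) ?WB = wren (ext 0 (Suc \<circ> g)) V" for g
    proof -
      have "?g g \<circ> (ext 0 id \<circ> lift (Suc \<circ> Suc)) = ext 0 (Suc \<circ> g)"
        by (auto simp: fun_eq_iff ext_if lift_if res_map_def)
      then show ?thesis by (simp only: wren_wren)
    qed
    have eq3: "wren (ext (?g g 0) (?g g)) ?V = wren (ext 0 (Suc \<circ> g)) V" for g
    proof -
      have "ext (?g g 0) (?g g) \<circ> lift (Suc \<circ> Suc) = ext 0 (Suc \<circ> g)"
        by (auto simp: fun_eq_iff ext_if lift_if res_map_def)
      then show ?thesis by (simp only: wren_wren)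
    qed
    have eq2: "wren g (WRes (wren res_map R)) = WRes (wren (?g g) R)" for g R
      by (simp only: wren.simps wren_wren)
    have step: "wlts (wren g (WPar W\<^sub>1 W\<^sub>2)) ATau (wren g (WRes (wren res_map (WPar W' ?WB))))"
      "wlts (wren g (WPar W\<^sub>2 W\<^sub>1)) ATau (wren g (WRes (wren res_map (WPar ?WB W'))))" if xy: "g x = g y" for g
    proof -
      have "Suc \<circ> g = (\<lambda>i. i + 1) \<circ> g" by auto
      then have "wlts (wren (\<lambda>i. i + 1) (wren g W\<^sub>2)) (AIn (g x + 1) 0 (Suc (g z))) (wren (ext 0 (Suc \<circ> g)) V)"
        using F(3)[of "Suc \<circ> g" 0 "Suc (g z)"] xy by (simp add: wren_wren)
      from wl_com1[OF P(3)[of g] this] wl_com2[OF P(3)[of g] this]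
      show "wlts (wren g (WPar W\<^sub>1 W\<^sub>2)) ATau (wren g (WRes (wren res_map (WPar W' ?WB))))"
        "wlts (wren g (WPar W\<^sub>2 W\<^sub>1)) ATau (wren g (WRes (wren res_map (WPar ?WB W'))))"
        unfolding eq2 unfolding wren.simps eq by simp_all
    qed
    have "qren (ext 0 id) (qren (lift (Suc \<circ> Suc)) q) = qren (ext 0 up2) q"
    proof -
      have "ext 0 id \<circ> lift (Suc \<circ> Suc) = ext 0 up2" by (auto simp: fun_eq_iff ext_if lift_if)
      then show ?thesis by simp
    qed
    then have abs: "abs_sq (SRes (SPar P' ?B)) = r" "abs_sq (SRes (SPar ?B P')) = r"
      unfolding r by (simp_all only: abs_sq_simps P(1) F(1) qpar.commute)
    have wty: "(\<exists>L'. wta \<Delta> (wren g (WRes (wren res_map (WPar W' ?WB)))) L')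
        \<and> (\<exists>L'. wta \<Delta> (wren g (WRes (wren res_map (WPar ?WB W')))) L')"
      if f: "wfits g X Y \<Delta>" and xy: "g x = g y" and D: "\<Delta> (g x) \<subseteq> {U, wdual U}"
        and sp: "wsplit \<Delta> \<Delta>\<^sub>1 \<Delta>\<^sub>2" "wta \<Delta>\<^sub>1 (wren g W\<^sub>1) L\<^sub>1" "wta \<Delta>\<^sub>2 (wren g W\<^sub>2) L\<^sub>2" for g Y \<Delta> U \<Delta>\<^sub>1 \<Delta>\<^sub>2 L\<^sub>1 L\<^sub>2
    proof -
      from P(4)[OF wfits_split(1)[OF sp(1) f] sp(2)] obtain Z where Z: "weights_pos Z"
        "out_cli_typed (?g g) ?x 0 W' (ext {Z, wdual Z} \<Delta>\<^sub>1)" unfolding bout_cli_typed_def by blast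
      note i = in_srv_typed_shift[OF F(4)[OF wfits_split(2)[OF sp(1) f] sp(3)] wfits_split(2)[OF sp(1) f] gF]
      have xy': "?g g ?x = ?g g ?y" using xy by simp
      have D': "ext {Z, wdual Z} \<Delta> (?g g ?x) \<subseteq> {U, wdual U}" using D by simp
      note c = com_cli_typed[OF wjoin_ext[OF wsplit_wjoin[OF sp(1)]] wfits_res[OF f] xy' D' Z(2) i gP gF',
        unfolded eq3]
      show ?thesis using c wta.res[OF Z(1)] unfolding eq2 unfolding wren.simps eq by blast
    qed
    have "com_cli X \<Gamma> x y r (WPar W\<^sub>1 W\<^sub>2)"
    proof (rule com_cliI)
      show "abs_sq (SRes (SPar P' ?B)) = r" by (rule abs)
      show "tr X \<Gamma> (SRes (SPar P' ?B)) (WRes (wren res_map (WPar W' ?WB)))" by (rule tr.res[OF T(1)])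
    next
      fix g Y \<Delta> L U
      assume a: "wfits g X Y \<Delta>" "g x = g y" "\<Delta> (g x) \<subseteq> {U, wdual U}" "wta \<Delta> (wren g (WPar W\<^sub>1 W\<^sub>2)) L"
      from a(4) obtain \<Delta>\<^sub>1 \<Delta>\<^sub>2 L\<^sub>1 L\<^sub>2 where sp: "wsplit \<Delta> \<Delta>\<^sub>1 \<Delta>\<^sub>2" "wta \<Delta>\<^sub>1 (wren g W\<^sub>1) L\<^sub>1" "wta \<Delta>\<^sub>2 (wren g W\<^sub>2) L\<^sub>2"
        unfolding wren.simps by (rule wta_WParE)
      from wty[OF a(1-3) sp] show "\<exists>L'. wta \<Delta> (wren g (WRes (wren res_map (WPar W' ?WB)))) L'" by blast
    qed (rule step)
    moreover have "com_cli X \<Gamma> x y r (WPar W\<^sub>2 W\<^sub>1)"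
    proof (rule com_cliI)
      show "abs_sq (SRes (SPar ?B P')) = r" by (rule abs)
      show "tr X \<Gamma> (SRes (SPar ?B P')) (WRes (wren res_map (WPar ?WB W')))" by (rule tr.res[OF T(2)])
    next
      fix g Y \<Delta> L U
      assume a: "wfits g X Y \<Delta>" "g x = g y" "\<Delta> (g x) \<subseteq> {U, wdual U}" "wta \<Delta> (wren g (WPar W\<^sub>2 W\<^sub>1)) L"
      from a(4) obtain \<Delta>\<^sub>1 \<Delta>\<^sub>2 L\<^sub>1 L\<^sub>2 where sp: "wsplit \<Delta> \<Delta>\<^sub>2 \<Delta>\<^sub>1" "wta \<Delta>\<^sub>1 (wren g W\<^sub>1) L\<^sub>1" "wta \<Delta>\<^sub>2 (wren g W\<^sub>2) L\<^sub>2"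
        unfolding wren.simps by (rule wta_WParE)
      from wty[OF a(1-3) wsplit_sym[OF sp(1)] sp(2,3)] show "\<exists>L'. wta \<Delta> (wren g (WRes (wren res_map (WPar ?WB W')))) L'" by blast
    qed (rule step)
    ultimately show ?thesis ..
  qed
  then show "com_cli X \<Gamma> x y r (WPar W\<^sub>1 W\<^sub>2)" "com_cli X \<Gamma> x y r (WPar W\<^sub>2 W\<^sub>1)" by blast+
qed

lemma wun_wdual [simp]: "wun (wdual V) = wun V"
  by (cases V) simp_all

lemma meet_type:
  assumes "meet P Q x y r" "tr X \<Gamma>\<^sub>1 P W\<^sub>1" "tr X \<Gamma>\<^sub>2 Q W\<^sub>2"
  shows "\<exists>T. (\<exists>S. \<Gamma>\<^sub>1 x = Some (TLOut T S)) \<or> \<Gamma>\<^sub>1 x = Some (TCli T)"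
    "\<exists>T. (\<exists>S. \<Gamma>\<^sub>2 y = Some (TLIn T S)) \<or> \<Gamma>\<^sub>2 y = Some (TSrv T)"
  using assms outs_type[OF _ assms(2)] bouts_type[OF _ assms(2)] ins_type[OF _ assms(3)] unfolding meet_def by meson+

lemma coms_type:
  "coms P x y r \<Longrightarrow> tr X \<Gamma> P W \<Longrightarrow> (\<exists>T. (\<exists>S. \<Gamma> x = Some (TLOut T S)) \<or> \<Gamma> x = Some (TCli T))
    \<and> (\<exists>T. (\<exists>S. \<Gamma> y = Some (TLIn T S)) \<or> \<Gamma> y = Some (TSrv T))"
proof (induction P arbitrary: x y r X \<Gamma> W)
  case (SPar P Q)
  from SPar.prems(2) obtain \<Gamma>\<^sub>1 \<Gamma>\<^sub>2 W\<^sub>1 W\<^sub>2 where s: "ssplit \<Gamma> \<Gamma>\<^sub>1 \<Gamma>\<^sub>2" and t: "tr X \<Gamma>\<^sub>1 P W\<^sub>1" "tr X \<Gamma>\<^sub>2 Q W\<^sub>2"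
    by (rule tr_SParE)
  note sub = ssplit_sub(1,2)[OF s]
  from SPar.prems(1) consider p where "coms P x y p" | q where "coms Q x y q"
    | "meet P Q x y r" | "meet Q P x y r" by auto
  then show ?case
  proof cases
    case 1 then show ?thesis using SPar.IH(1)[OF 1 t(1)] sub(1) by meson
  next
    case 2 then show ?thesis using SPar.IH(2)[OF 2 t(2)] sub(2) by meson
  next
    case 3 then show ?thesis using meet_type[OF 3 t] sub by meson
  next
    case 4 then show ?thesis using meet_type[OF 4 t(2,1)] sub by meson
  qed
next
  case (SRes P)
  from SRes.prems(1) obtain p where p: "coms P (Suc (Suc x)) (Suc (Suc y)) p" by auto
  from SRes.prems(2) obtain T V where "tr (up (up X)) (opened T \<Gamma>) P V" by (auto elim!: tr_SResE)
  from SRes.IH[OF p this] show ?case by simp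
qed auto

text \<open>The two dual linear assumptions that \<open>com_lin\<close> exhibits at the channel are
  used here: the communicating component holds the whole entry, so the idle one has none, and the
  contexts still join after the entry is emptied.\<close>

lemma com_lin_par:
  assumes c: "com_lin X \<Gamma>\<^sub>1 x y p W\<^sub>1" and s: "ssplit \<Gamma> \<Gamma>\<^sub>1 \<Gamma>\<^sub>2" and t: "tr X \<Gamma>\<^sub>2 Q W\<^sub>2" and d: "dom \<Gamma> \<subseteq> X"
    and x: "\<Gamma>\<^sub>1 x = Some T" "\<not> sun T" and y: "\<Gamma>\<^sub>1 y = Some S" "\<not> sun S" and xy: "x \<noteq> y"
  shows "com_lin X \<Gamma> x y (p \<parallel> abs_sq Q) (WPar W\<^sub>1 W\<^sub>2)" "com_lin X \<Gamma> x y (p \<parallel> abs_sq Q) (WPar W\<^sub>2 W\<^sub>1)"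
proof -
  let ?n = "\<lambda>\<Gamma> :: sctx. \<Gamma>(x := None, y := None)"
  note ds = tr_dom_par[OF s d] and j = ssplit_sjoin[OF s]
  from c obtain R W' where R: "abs_sq R = qres (qren (sig x y) p)" "tr X (?n \<Gamma>\<^sub>1) R W'"
    "\<And>g. g x = g y \<Longrightarrow> wlts (wren g W\<^sub>1) ATau (wren g W')"
    and ty: "\<And>g Y \<Delta> L U. wfits g X Y \<Delta> \<Longrightarrow> g x = g y \<Longrightarrow> \<Delta> (g x) \<subseteq> {U, wdual U} \<Longrightarrow> wta \<Delta> (wren g W\<^sub>1) L
         \<Longrightarrow> (\<exists>V. \<not> wun V \<and> V \<in> \<Delta> (g x) \<and> wdual V \<in> \<Delta> (g x)) \<and> (\<exists>L'. wta (\<Delta>(g x := {})) (wren g W') L')"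
    unfolding com_lin_def by blast
  have nd: "x \<notin> dom \<Gamma>\<^sub>2" "y \<notin> dom \<Gamma>\<^sub>2" using sjoin_dom[OF j x] sjoin_dom[OF j y] by blast+
  \<comment> \<open>The pair does not occur in the idle component, which is therefore only shifted
    below the new pair and can be moved out of its scope.\<close>
  have "sren (sig x y) Q = sren up2 Q"
    by (rule tr_sren_cong[OF t]) (use nd in \<open>auto simp: sig_def\<close>)
  then have Q: "qren (sig x y) (abs_sq Q) = qren up2 (abs_sq Q)" by (simp only: abs_sq_simps[symmetric])
  have abs: "abs_sq (SPar R Q) = qres (qren (sig x y) (p \<parallel> abs_sq Q))"
    "abs_sq (SPar Q R) = qres (qren (sig x y) (p \<parallel> abs_sq Q))"
    by (simp_all only: abs_sq_simps R(1) qren_qpar Q qres_extrude qpar.commute[of "abs_sq Q"])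
  have "sjoin (?n \<Gamma>) (?n \<Gamma>\<^sub>1) \<Gamma>\<^sub>2"
    using sjoin_upd[OF sjoin_upd[OF j x, of None] _ y(2), of y None] xy y(1) by simp
  then have tr: "tr X (?n \<Gamma>) (SPar R Q) (WPar W' W\<^sub>2)" "tr X (?n \<Gamma>) (SPar Q R) (WPar W\<^sub>2 W')"
    using tr_sjoin[OF R(2) t, of "?n \<Gamma>"] d by auto
  have wty: "(\<exists>V. \<not> wun V \<and> V \<in> \<Delta> (g x) \<and> wdual V \<in> \<Delta> (g x))
      \<and> (\<exists>L'. wta (\<Delta>(g x := {})) (wren g (WPar W' W\<^sub>2)) L') \<and> (\<exists>L'. wta (\<Delta>(g x := {})) (wren g (WPar W\<^sub>2 W')) L')"
    if f: "wfits g X Y \<Delta>" and g: "g x = g y" and D: "\<Delta> (g x) \<subseteq> {U, wdual U}"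
      and sp: "wsplit \<Delta> \<Delta>\<^sub>1 \<Delta>\<^sub>2" "wta \<Delta>\<^sub>1 (wren g W\<^sub>1) L\<^sub>1" "wta \<Delta>\<^sub>2 (wren g W\<^sub>2) L\<^sub>2" for g Y \<Delta> U \<Delta>\<^sub>1 \<Delta>\<^sub>2 L\<^sub>1 L\<^sub>2
  proof -
    note j = wsplit_wjoin[OF sp(1)]
    have "\<Delta>\<^sub>1 (g x) \<subseteq> {U, wdual U}" using D wsplit_sub(1)[OF sp(1)] by blast
    from ty[OF wfits_split(1)[OF sp(1) f] g this sp(2)] obtain V L'
      where V: "\<not> wun V" "V \<in> \<Delta>\<^sub>1 (g x)" "wdual V \<in> \<Delta>\<^sub>1 (g x)" and L': "wta (\<Delta>\<^sub>1(g x := {})) (wren g W') L'" by blast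
    have VD: "V \<in> \<Delta> (g x)" "wdual V \<in> \<Delta> (g x)" using V(2,3) wsplit_sub(1)[OF sp(1)] by blast+
    have "V = U \<or> V = wdual U" using D VD(1) by blast
    then have "\<Delta> (g x) \<subseteq> {V, wdual V}" using D by (elim disjE) (simp_all add: insert_commute wdual_wdual)
    then have "\<Delta>\<^sub>2 (g x) = {}"
      using V wsplit_sub(2,5)[OF sp(1)] wun_wdual by blast
    then have "wjoin (\<Delta>(g x := {})) (\<Delta>\<^sub>1(g x := {})) \<Delta>\<^sub>2" using j unfolding wjoin_def by simp
    moreover have "(\<Delta>(g x := {})) z = {}" if "z \<notin> Y" for z using wfits_fresh[OF f that] by simp
    moreover have "wgood Y (wren g W')" by (rule wfits_wgood[OF f R(2)]) (use ds in auto)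
    moreover have "wgood Y (wren g W\<^sub>2)" by (rule wfits_wgood[OF f t ds(2)])
    ultimately show ?thesis using wta_wjoin[OF L' sp(3)] VD V(1) unfolding wren.simps by blast
  qed
  show "com_lin X \<Gamma> x y (p \<parallel> abs_sq Q) (WPar W\<^sub>1 W\<^sub>2)"
  proof (rule com_linI[OF abs(1) tr(1)])
    show "wlts (wren g (WPar W\<^sub>1 W\<^sub>2)) ATau (wren g (WPar W' W\<^sub>2))" if "g x = g y" for g
      using wl_par_tau1[OF R(3)[OF that]] by simp
    fix g Y \<Delta> L U
    assume a: "wfits g X Y \<Delta>" "g x = g y" "\<Delta> (g x) \<subseteq> {U, wdual U}" "wta \<Delta> (wren g (WPar W\<^sub>1 W\<^sub>2)) L"
    from a(4) obtain \<Delta>\<^sub>1 \<Delta>\<^sub>2 L\<^sub>1 L\<^sub>2 where sp: "wsplit \<Delta> \<Delta>\<^sub>1 \<Delta>\<^sub>2" "wta \<Delta>\<^sub>1 (wren g W\<^sub>1) L\<^sub>1" "wta \<Delta>\<^sub>2 (wren g W\<^sub>2) L\<^sub>2"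
      unfolding wren.simps by (rule wta_WParE)
    from wty[OF a(1-3) sp] show "(\<exists>V. \<not> wun V \<and> V \<in> \<Delta> (g x) \<and> wdual V \<in> \<Delta> (g x))
        \<and> (\<exists>L'. wta (\<Delta>(g x := {})) (wren g (WPar W' W\<^sub>2)) L')" by blast
  qed
  show "com_lin X \<Gamma> x y (p \<parallel> abs_sq Q) (WPar W\<^sub>2 W\<^sub>1)"
  proof (rule com_linI[OF abs(2) tr(2)])
    show "wlts (wren g (WPar W\<^sub>2 W\<^sub>1)) ATau (wren g (WPar W\<^sub>2 W'))" if "g x = g y" for g
      using wl_par_tau2[OF R(3)[OF that]] by simp
    fix g Y \<Delta> L U
    assume a: "wfits g X Y \<Delta>" "g x = g y" "\<Delta> (g x) \<subseteq> {U, wdual U}" "wta \<Delta> (wren g (WPar W\<^sub>2 W\<^sub>1)) L"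
    from a(4) obtain \<Delta>\<^sub>1 \<Delta>\<^sub>2 L\<^sub>1 L\<^sub>2 where sp: "wsplit \<Delta> \<Delta>\<^sub>2 \<Delta>\<^sub>1" "wta \<Delta>\<^sub>1 (wren g W\<^sub>1) L\<^sub>1" "wta \<Delta>\<^sub>2 (wren g W\<^sub>2) L\<^sub>2"
      unfolding wren.simps by (rule wta_WParE)
    from wty[OF a(1-3) wsplit_sym[OF sp(1)] sp(2,3)] show "(\<exists>V. \<not> wun V \<and> V \<in> \<Delta> (g x) \<and> wdual V \<in> \<Delta> (g x))
        \<and> (\<exists>L'. wta (\<Delta>(g x := {})) (wren g (WPar W\<^sub>2 W')) L')" by blast
  qed
qed

lemma wren_WRes: "wren g (WRes (wren res_map W)) = WRes (wren (lift g \<circ> res_map) W)"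
  by (simp only: wren.simps wren_wren)

lemma com_lin_res:
  assumes c: "com_lin (up (up X)) (opened T \<Gamma>) (Suc (Suc x)) (Suc (Suc y)) p W"
  shows "com_lin X \<Gamma> x y (qres p) (WRes (wren res_map W))"
proof -
  let ?x = "Suc (Suc x)" and ?y = "Suc (Suc y)"
  from c obtain R W' where R: "abs_sq R = qres (qren (sig ?x ?y) p)"
    "tr (up (up X)) ((opened T \<Gamma>)(?x := None, ?y := None)) R W'"
    "\<And>g. g ?x = g ?y \<Longrightarrow> wlts (wren g W) ATau (wren g W')"
    and ty: "\<And>g Y \<Delta> L U. wfits g (up (up X)) Y \<Delta> \<Longrightarrow> g ?x = g ?y \<Longrightarrow> \<Delta> (g ?x) \<subseteq> {U, wdual U} \<Longrightarrow> wta \<Delta> (wren g W) L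
         \<Longrightarrow> (\<exists>V. \<not> wun V \<and> V \<in> \<Delta> (g ?x) \<and> wdual V \<in> \<Delta> (g ?x)) \<and> (\<exists>L'. wta (\<Delta>(g ?x := {})) (wren g W') L')"
    unfolding com_lin_def by blast
  have g: "(lift g \<circ> res_map) ?x = Suc (g x)" "(lift g \<circ> res_map) ?y = Suc (g y)" for g by simp_all
  show ?thesis
  proof (rule com_linI)
    show "abs_sq (SRes R) = qres (qren (sig x y) (qres p))" unfolding qres_qren_sig by (simp only: abs_sq_simps R(1))
    show "tr X (\<Gamma>(x := None, y := None)) (SRes R) (WRes (wren res_map W'))"
      by (rule tr.res[OF R(2)[unfolded upd_None_ext]])
    show "wlts (wren g (WRes (wren res_map W))) ATau (wren g (WRes (wren res_map W')))" if "g x = g y" for g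
      unfolding wren_WRes by (rule wl_res_tau[OF R(3)]) (use that in \<open>simp add: g\<close>)
    fix g Y \<Delta> L U
    assume a: "wfits g X Y \<Delta>" "g x = g y" "\<Delta> (g x) \<subseteq> {U, wdual U}" "wta \<Delta> (wren g (WRes (wren res_map W))) L"
    from a(4) obtain V where V: "weights_pos V" "wta (ext {V, wdual V} \<Delta>) (wren (lift g \<circ> res_map) W) L"
      unfolding wren_WRes by (rule wta_WResE)
    note i = ty[OF wfits_res[OF a(1)], of "{V, wdual V}" U L, unfolded g ext_simps(2) ext_upd, OF _ a(3) V(2)]
    show "(\<exists>V. \<not> wun V \<and> V \<in> \<Delta> (g x) \<and> wdual V \<in> \<Delta> (g x))
        \<and> (\<exists>L'. wta (\<Delta>(g x := {})) (wren g (WRes (wren res_map W'))) L')"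
      using i a(2) wta.res[OF V(1)] unfolding wren_WRes by fastforce
  qed
qed

lemma coms_lin:
  "coms P x y r \<Longrightarrow> tr X \<Gamma> P W \<Longrightarrow> dom \<Gamma> \<subseteq> X \<Longrightarrow> \<Gamma> x = Some (TLOut T S) \<Longrightarrow> \<Gamma> y = Some (TLIn T (sdual S))
    \<Longrightarrow> com_lin X \<Gamma> x y r W"
proof (induction P arbitrary: x y r X \<Gamma> W)
  case (SPar P Q)
  note d = SPar.prems(3) and ty = SPar.prems(4,5)
  from SPar.prems(2) obtain \<Gamma>\<^sub>1 \<Gamma>\<^sub>2 W\<^sub>1 W\<^sub>2 where W: "W = WPar W\<^sub>1 W\<^sub>2" and s: "ssplit \<Gamma> \<Gamma>\<^sub>1 \<Gamma>\<^sub>2"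
    and t: "tr X \<Gamma>\<^sub>1 P W\<^sub>1" "tr X \<Gamma>\<^sub>2 Q W\<^sub>2" by (rule tr_SParE)
  note s' = ssplit_sym[OF s]
  have xy: "x \<noteq> y" using ty by auto
  \<comment> \<open>The component that communicates internally owns both linear ends of the
    channel.\<close>
  have sub: "\<Gamma>' x = Some (TLOut T S) \<and> \<Gamma>' y = Some (TLIn T (sdual S))"
    if c: "coms P' x y p" "tr X \<Gamma>' P' W'" "ssplit \<Gamma> \<Gamma>' \<Gamma>''" for P' p \<Gamma>' \<Gamma>'' W'
    using coms_type[OF c(1,2)] ssplit_sub(1)[OF c(3), of x] ssplit_sub(1)[OF c(3), of y] ty by fastforce
  from SPar.prems(1) consider p where "coms P x y p" "r = p \<parallel> abs_sq Q" | q where "coms Q x y q" "r = q \<parallel> abs_sq P"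
    | "meet P Q x y r" | "meet Q P x y r" using qpar.commute by auto
  then show ?case
  proof cases
    case 1
    have *: "\<Gamma>\<^sub>1 x = Some (TLOut T S)" "\<Gamma>\<^sub>1 y = Some (TLIn T (sdual S))" using sub[OF 1(1) t(1) s] by blast+
    show ?thesis unfolding W 1(2)
      by (rule com_lin_par(1)[OF SPar.IH(1)[OF 1(1) t(1) tr_dom_par(1)[OF s d] *] s t(2) d *(1) _ *(2) _ xy]) simp_all
  next
    case 2
    have *: "\<Gamma>\<^sub>2 x = Some (TLOut T S)" "\<Gamma>\<^sub>2 y = Some (TLIn T (sdual S))" using sub[OF 2(1) t(2) s'] by blast+
    show ?thesis unfolding W 2(2)
      by (rule com_lin_par(2)[OF SPar.IH(2)[OF 2(1) t(2) tr_dom_par(2)[OF s d] *] s' t(1) d *(1) _ *(2) _ xy]) simp_all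
  next
    case 3
    show ?thesis unfolding W by (rule meet_lin(1)[OF 3 s t d ty])
  next
    case 4
    show ?thesis unfolding W by (rule meet_lin(2)[OF 4 s' t(2,1) d ty])
  qed
next
  case (SRes P)
  from SRes.prems(1) obtain p where p: "coms P (Suc (Suc x)) (Suc (Suc y)) p" "r = qres p" by auto
  from SRes.prems(2) obtain U V where V: "tr (up (up X)) (opened U \<Gamma>) P V" "W = WRes (wren res_map V)"
    by (auto elim!: tr_SResE)
  show ?case unfolding p(2) V(2)
    by (rule com_lin_res[OF SRes.IH[OF p(1) V(1) dom_ext2[OF SRes.prems(3)]]]) (use SRes.prems(4,5) in simp_all)
qed auto

lemma com_cli_par:
  assumes c: "com_cli X \<Gamma>\<^sub>1 x y p W\<^sub>1" and s: "ssplit \<Gamma> \<Gamma>\<^sub>1 \<Gamma>\<^sub>2" and t: "tr X \<Gamma>\<^sub>2 Q W\<^sub>2"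
  shows "com_cli X \<Gamma> x y (p \<parallel> abs_sq Q) (WPar W\<^sub>1 W\<^sub>2)" "com_cli X \<Gamma> x y (p \<parallel> abs_sq Q) (WPar W\<^sub>2 W\<^sub>1)"
proof -
  from c obtain R W' where R: "abs_sq R = p" "tr X \<Gamma>\<^sub>1 R W'"
    "\<And>g. g x = g y \<Longrightarrow> wlts (wren g W\<^sub>1) ATau (wren g W')"
    and ty: "\<And>g Y \<Delta> L U. wfits g X Y \<Delta> \<Longrightarrow> g x = g y \<Longrightarrow> \<Delta> (g x) \<subseteq> {U, wdual U} \<Longrightarrow> wta \<Delta> (wren g W\<^sub>1) L
         \<Longrightarrow> \<exists>L'. wta \<Delta> (wren g W') L'"
    unfolding com_cli_def by blast
  have wty: "\<exists>L'. wta \<Delta>\<^sub>1 (wren g W') L'"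
    if "wfits g X Y \<Delta>" "g x = g y" "\<Delta> (g x) \<subseteq> {U, wdual U}" "wsplit \<Delta> \<Delta>\<^sub>1 \<Delta>\<^sub>2" "wta \<Delta>\<^sub>1 (wren g W\<^sub>1) L" for g Y \<Delta> U \<Delta>\<^sub>1 \<Delta>\<^sub>2 L
  proof -
    have "\<Delta>\<^sub>1 (g x) \<subseteq> {U, wdual U}" using that(3) wsplit_sub(1)[OF that(4)] by blast
    from ty[OF wfits_split(1)[OF that(4,1)] that(2) this that(5)] show ?thesis .
  qed
  show "com_cli X \<Gamma> x y (p \<parallel> abs_sq Q) (WPar W\<^sub>1 W\<^sub>2)"
  proof (rule com_cliI)
    show "abs_sq (SPar R Q) = p \<parallel> abs_sq Q" by (simp only: abs_sq_simps R(1))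
    show "tr X \<Gamma> (SPar R Q) (WPar W' W\<^sub>2)" by (rule tr.par[OF s R(2) t])
    show "wlts (wren g (WPar W\<^sub>1 W\<^sub>2)) ATau (wren g (WPar W' W\<^sub>2))" if "g x = g y" for g
      using wl_par_tau1[OF R(3)[OF that]] by simp
    show "\<exists>L'. wta \<Delta> (wren g (WPar W' W\<^sub>2)) L'"
      if "wfits g X Y \<Delta>" "g x = g y" "\<Delta> (g x) \<subseteq> {U, wdual U}" "wta \<Delta> (wren g (WPar W\<^sub>1 W\<^sub>2)) L" for g Y \<Delta> L U
      using that(4) unfolding wren.simps by (rule wta_WParE) (use wty[OF that(1-3)] wta.par in blast)
  qed
  show "com_cli X \<Gamma> x y (p \<parallel> abs_sq Q) (WPar W\<^sub>2 W\<^sub>1)"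
  proof (rule com_cliI)
    show "abs_sq (SPar Q R) = p \<parallel> abs_sq Q" by (simp only: abs_sq_simps R(1) qpar.commute)
    show "tr X \<Gamma> (SPar Q R) (WPar W\<^sub>2 W')" by (rule tr.par[OF ssplit_sym[OF s] t R(2)])
    show "wlts (wren g (WPar W\<^sub>2 W\<^sub>1)) ATau (wren g (WPar W\<^sub>2 W'))" if "g x = g y" for g
      using wl_par_tau2[OF R(3)[OF that]] by simp
    show "\<exists>L'. wta \<Delta> (wren g (WPar W\<^sub>2 W')) L'"
      if "wfits g X Y \<Delta>" "g x = g y" "\<Delta> (g x) \<subseteq> {U, wdual U}" "wta \<Delta> (wren g (WPar W\<^sub>2 W\<^sub>1)) L" for g Y \<Delta> L U
      using that(4) unfolding wren.simps by (rule wta_WParE) (use wty[OF that(1-3)] wta.par wsplit_sym in blast)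
  qed
qed

lemma com_cli_res:
  assumes c: "com_cli (up (up X)) (opened T \<Gamma>) (Suc (Suc x)) (Suc (Suc y)) p W"
  shows "com_cli X \<Gamma> x y (qres p) (WRes (wren res_map W))"
proof -
  let ?x = "Suc (Suc x)" and ?y = "Suc (Suc y)"
  from c obtain R W' where R: "abs_sq R = p" "tr (up (up X)) (opened T \<Gamma>) R W'"
    "\<And>g. g ?x = g ?y \<Longrightarrow> wlts (wren g W) ATau (wren g W')"
    and ty: "\<And>g Y \<Delta> L U. wfits g (up (up X)) Y \<Delta> \<Longrightarrow> g ?x = g ?y \<Longrightarrow> \<Delta> (g ?x) \<subseteq> {U, wdual U} \<Longrightarrow> wta \<Delta> (wren g W) L
         \<Longrightarrow> \<exists>L'. wta \<Delta> (wren g W') L'"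
    unfolding com_cli_def by blast
  have g: "(lift g \<circ> res_map) ?x = Suc (g x)" "(lift g \<circ> res_map) ?y = Suc (g y)" for g by simp_all
  show ?thesis
  proof (rule com_cliI)
    show "abs_sq (SRes R) = qres p" by (simp only: abs_sq_simps R(1))
    show "tr X \<Gamma> (SRes R) (WRes (wren res_map W'))" by (rule tr.res[OF R(2)])
    show "wlts (wren g (WRes (wren res_map W))) ATau (wren g (WRes (wren res_map W')))" if "g x = g y" for g
      unfolding wren_WRes by (rule wl_res_tau[OF R(3)]) (use that in \<open>simp add: g\<close>)
    fix g Y \<Delta> L U
    assume a: "wfits g X Y \<Delta>" "g x = g y" "\<Delta> (g x) \<subseteq> {U, wdual U}" "wta \<Delta> (wren g (WRes (wren res_map W))) L"
    from a(4) obtain V where V: "weights_pos V" "wta (ext {V, wdual V} \<Delta>) (wren (lift g \<circ> res_map) W) L"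
      unfolding wren_WRes by (rule wta_WResE)
    note i = ty[OF wfits_res[OF a(1)], of "{V, wdual V}" U L, unfolded g ext_simps(2), OF _ a(3) V(2)]
    show "\<exists>L'. wta \<Delta> (wren g (WRes (wren res_map W'))) L'"
      using i a(2) wta.res[OF V(1)] unfolding wren_WRes by fastforce
  qed
qed

lemma coms_cli:
  "coms P x y r \<Longrightarrow> tr X \<Gamma> P W \<Longrightarrow> dom \<Gamma> \<subseteq> X \<Longrightarrow> \<Gamma> x = Some (TCli T) \<Longrightarrow> \<Gamma> y = Some (TSrv T)
    \<Longrightarrow> com_cli X \<Gamma> x y r W"
proof (induction P arbitrary: x y r X \<Gamma> W)
  case (SPar P Q)
  note d = SPar.prems(3) and ty = SPar.prems(4,5)
  from SPar.prems(2) obtain \<Gamma>\<^sub>1 \<Gamma>\<^sub>2 W\<^sub>1 W\<^sub>2 where W: "W = WPar W\<^sub>1 W\<^sub>2" and s: "ssplit \<Gamma> \<Gamma>\<^sub>1 \<Gamma>\<^sub>2"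
    and t: "tr X \<Gamma>\<^sub>1 P W\<^sub>1" "tr X \<Gamma>\<^sub>2 Q W\<^sub>2" by (rule tr_SParE)
  note s' = ssplit_sym[OF s]
  have sub: "\<Gamma>\<^sub>1 x = Some (TCli T)" "\<Gamma>\<^sub>1 y = Some (TSrv T)" "\<Gamma>\<^sub>2 x = Some (TCli T)" "\<Gamma>\<^sub>2 y = Some (TSrv T)"
    using ssplit_sub(3,4)[OF s ty(1)] ssplit_sub(3,4)[OF s ty(2)] by simp_all
  from SPar.prems(1) consider p where "coms P x y p" "r = p \<parallel> abs_sq Q" | q where "coms Q x y q" "r = q \<parallel> abs_sq P"
    | "meet P Q x y r" | "meet Q P x y r" using qpar.commute by auto
  then show ?case
  proof cases
    case 1
    show ?thesis unfolding W 1(2)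
      by (rule com_cli_par(1)[OF SPar.IH(1)[OF 1(1) t(1) tr_dom_par(1)[OF s d] sub(1,2)] s t(2)])
  next
    case 2
    show ?thesis unfolding W 2(2)
      by (rule com_cli_par(2)[OF SPar.IH(2)[OF 2(1) t(2) tr_dom_par(2)[OF s d] sub(3,4)] s' t(1)])
  next
    case 3
    show ?thesis unfolding W by (rule meet_cli(1)[OF 3 s t d ty])
  next
    case 4
    show ?thesis unfolding W by (rule meet_cli(2)[OF 4 s' t(2,1) d ty])
  qed
next
  case (SRes P)
  from SRes.prems(1) obtain p where p: "coms P (Suc (Suc x)) (Suc (Suc y)) p" "r = qres p" by auto
  from SRes.prems(2) obtain U V where V: "tr (up (up X)) (opened U \<Gamma>) P V" "W = WRes (wren res_map V)"
    by (auto elim!: tr_SResE)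
  show ?case unfolding p(2) V(2)
    by (rule com_cli_res[OF SRes.IH[OF p(1) V(1) dom_ext2[OF SRes.prems(3)]]]) (use SRes.prems(4,5) in simp_all)
qed auto

section \<open>Silent steps of translations\<close>

definition tau_step :: "name set \<Rightarrow> sctx \<Rightarrow> sq \<Rightarrow> wproc \<Rightarrow> bool" where
  "tau_step X \<Gamma> r W \<longleftrightarrow> (\<exists>R W'. abs_sq R = r \<and> tr X \<Gamma> R W'
     \<and> (\<forall>g. wlts (wren g W) ATau (wren g W'))
     \<and> (\<forall>g Y \<Delta> L. wfits g X Y \<Delta> \<longrightarrow> wta \<Delta> (wren g W) L \<longrightarrow> (\<exists>L'. wta \<Delta> (wren g W') L')))"

lemma tau_stepI:
  assumes "abs_sq R = r" "tr X \<Gamma> R W'" "\<And>g. wlts (wren g W) ATau (wren g W')"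
    and "\<And>g Y \<Delta> L. wfits g X Y \<Delta> \<Longrightarrow> wta \<Delta> (wren g W) L \<Longrightarrow> \<exists>L'. wta \<Delta> (wren g W') L'"
  shows "tau_step X \<Gamma> r W"
  using assms unfolding tau_step_def by blast

lemma tau_step_par:
  assumes c: "tau_step X \<Gamma>\<^sub>1 p W\<^sub>1" and s: "ssplit \<Gamma> \<Gamma>\<^sub>1 \<Gamma>\<^sub>2" and t: "tr X \<Gamma>\<^sub>2 Q W\<^sub>2"
  shows "tau_step X \<Gamma> (p \<parallel> abs_sq Q) (WPar W\<^sub>1 W\<^sub>2)" "tau_step X \<Gamma> (p \<parallel> abs_sq Q) (WPar W\<^sub>2 W\<^sub>1)"
proof -
  from c obtain R W' where R: "abs_sq R = p" "tr X \<Gamma>\<^sub>1 R W'" "\<And>g. wlts (wren g W\<^sub>1) ATau (wren g W')"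
    and ty: "\<And>g Y \<Delta> L. wfits g X Y \<Delta> \<Longrightarrow> wta \<Delta> (wren g W\<^sub>1) L \<Longrightarrow> \<exists>L'. wta \<Delta> (wren g W') L'"
    unfolding tau_step_def by blast
  show "tau_step X \<Gamma> (p \<parallel> abs_sq Q) (WPar W\<^sub>1 W\<^sub>2)"
  proof (rule tau_stepI)
    show "abs_sq (SPar R Q) = p \<parallel> abs_sq Q" by (simp only: abs_sq_simps R(1))
    show "tr X \<Gamma> (SPar R Q) (WPar W' W\<^sub>2)" by (rule tr.par[OF s R(2) t])
    show "wlts (wren g (WPar W\<^sub>1 W\<^sub>2)) ATau (wren g (WPar W' W\<^sub>2))" for g
      using wl_par_tau1[OF R(3)] by simp
    show "\<exists>L'. wta \<Delta> (wren g (WPar W' W\<^sub>2)) L'"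
      if "wfits g X Y \<Delta>" "wta \<Delta> (wren g (WPar W\<^sub>1 W\<^sub>2)) L" for g Y \<Delta> L
      using that(2) unfolding wren.simps by (rule wta_WParE) (use ty wfits_split(1)[OF _ that(1)] wta.par in blast)
  qed
  show "tau_step X \<Gamma> (p \<parallel> abs_sq Q) (WPar W\<^sub>2 W\<^sub>1)"
  proof (rule tau_stepI)
    show "abs_sq (SPar Q R) = p \<parallel> abs_sq Q" by (simp only: abs_sq_simps R(1) qpar.commute)
    show "tr X \<Gamma> (SPar Q R) (WPar W\<^sub>2 W')" by (rule tr.par[OF ssplit_sym[OF s] t R(2)])
    show "wlts (wren g (WPar W\<^sub>2 W\<^sub>1)) ATau (wren g (WPar W\<^sub>2 W'))" for g
      using wl_par_tau2[OF R(3)] by simp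
    show "\<exists>L'. wta \<Delta> (wren g (WPar W\<^sub>2 W')) L'"
      if "wfits g X Y \<Delta>" "wta \<Delta> (wren g (WPar W\<^sub>2 W\<^sub>1)) L" for g Y \<Delta> L
      using that(2) unfolding wren.simps by (rule wta_WParE) (use ty wfits_split(2)[OF _ that(1)] wta.par in blast)
  qed
qed

lemma tau_step_res:
  assumes c: "tau_step (up (up X)) (opened T \<Gamma>) p W"
  shows "tau_step X \<Gamma> (qres p) (WRes (wren res_map W))"
proof -
  from c obtain R W' where R: "abs_sq R = p" "tr (up (up X)) (opened T \<Gamma>) R W'"
    "\<And>g. wlts (wren g W) ATau (wren g W')"
    and ty: "\<And>g Y \<Delta> L. wfits g (up (up X)) Y \<Delta> \<Longrightarrow> wta \<Delta> (wren g W) L \<Longrightarrow> \<exists>L'. wta \<Delta> (wren g W') L'"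
    unfolding tau_step_def by blast
  show ?thesis
  proof (rule tau_stepI)
    show "abs_sq (SRes R) = qres p" by (simp only: abs_sq_simps R(1))
    show "tr X \<Gamma> (SRes R) (WRes (wren res_map W'))" by (rule tr.res[OF R(2)])
    show "wlts (wren g (WRes (wren res_map W))) ATau (wren g (WRes (wren res_map W')))" for g
      unfolding wren_WRes by (rule wl_res_tau[OF R(3)])
    show "\<exists>L'. wta \<Delta> (wren g (WRes (wren res_map W'))) L'"
      if "wfits g X Y \<Delta>" "wta \<Delta> (wren g (WRes (wren res_map W))) L" for g Y \<Delta> L
      using that(2) unfolding wren_WRes by (rule wta_WResE) (use ty[OF wfits_res[OF that(1)]] wta.res in blast)
  qed
qed

text \<open>Here the communication meets its binder: \<open>res_map\<close> identifies the
  co-variables, and the restriction supplies the dual pair of weighted types.\<close>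

lemma com_cli_step:
  assumes c: "com_cli (up (up X)) (opened T \<Gamma>) x y p W" and xy: "x < 2" "y < 2"
  shows "tau_step X \<Gamma> (qres p) (WRes (wren res_map W))"
proof -
  from c obtain R W' where R: "abs_sq R = p" "tr (up (up X)) (opened T \<Gamma>) R W'"
    "\<And>g. g x = g y \<Longrightarrow> wlts (wren g W) ATau (wren g W')"
    and ty: "\<And>g Y \<Delta> L U. wfits g (up (up X)) Y \<Delta> \<Longrightarrow> g x = g y \<Longrightarrow> \<Delta> (g x) \<subseteq> {U, wdual U} \<Longrightarrow> wta \<Delta> (wren g W) L
         \<Longrightarrow> \<exists>L'. wta \<Delta> (wren g W') L'"
    unfolding com_cli_def by blast
  have g: "(lift g \<circ> res_map) x = 0" "(lift g \<circ> res_map) y = 0" for g using xy by (simp_all add: res_map_def)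
  show ?thesis
  proof (rule tau_stepI)
    show "abs_sq (SRes R) = qres p" by (simp only: abs_sq_simps R(1))
    show "tr X \<Gamma> (SRes R) (WRes (wren res_map W'))" by (rule tr.res[OF R(2)])
    show "wlts (wren g (WRes (wren res_map W))) ATau (wren g (WRes (wren res_map W')))" for g
      unfolding wren_WRes by (rule wl_res_tau[OF R(3)]) (simp only: g)
    show "\<exists>L'. wta \<Delta> (wren g (WRes (wren res_map W'))) L'"
      if a: "wfits g X Y \<Delta>" "wta \<Delta> (wren g (WRes (wren res_map W))) L" for g Y \<Delta> L
    proof -
      from a(2) obtain V where V: "weights_pos V" "wta (ext {V, wdual V} \<Delta>) (wren (lift g \<circ> res_map) W) L"
        unfolding wren_WRes by (rule wta_WResE)
      have "\<exists>L'. wta (ext {V, wdual V} \<Delta>) (wren (lift g \<circ> res_map) W') L'"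
        by (rule ty[OF wfits_res[OF a(1)] _ _ V(2), of V]) (simp_all only: g ext_simps order_refl)
      then show ?thesis using wta.res[OF V(1)] unfolding wren_WRes by blast
    qed
  qed
qed

text \<open>
  The pair that carried a linear communication is dead afterwards. It stays in the residual with type
  \<open>TEnd\<close>, since the transition of the translation also keeps its restriction.
\<close>

lemma com_lin_step:
  assumes c: "com_lin (up (up X)) (opened T \<Gamma>) x y p W" and xy: "x = 0 \<and> y = 1 \<or> x = 1 \<and> y = 0" and d: "dom \<Gamma> \<subseteq> X"
  shows "tau_step X \<Gamma> (qres p) (WRes (wren res_map W))"
proof -
  from c obtain R W' where R: "abs_sq R = qres (qren (sig x y) p)"
    "tr (up (up X)) ((opened T \<Gamma>)(x := None, y := None)) R W'"
    "\<And>g. g x = g y \<Longrightarrow> wlts (wren g W) ATau (wren g W')"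
    and ty: "\<And>g Y \<Delta> L U. wfits g (up (up X)) Y \<Delta> \<Longrightarrow> g x = g y \<Longrightarrow> \<Delta> (g x) \<subseteq> {U, wdual U} \<Longrightarrow> wta \<Delta> (wren g W) L
         \<Longrightarrow> \<exists>L'. wta (\<Delta>(g x := {})) (wren g W') L'"
    unfolding com_lin_def by blast
  have g: "(lift g \<circ> res_map) x = 0" "(lift g \<circ> res_map) y = 0" for g using xy by (auto simp: res_map_def)
  have "(opened T \<Gamma>)(x := None, y := None) = ext None (ext None \<Gamma>)"
    using xy by (auto simp: fun_eq_iff ext_if)
  note R2 = R(2)[unfolded this]
  have d2: "dom (ext None (ext None \<Gamma>)) \<subseteq> up (up X)"
  proof
    fix i assume "i \<in> dom (ext None (ext None \<Gamma>))"
    then obtain j where "i = Suc (Suc j)" "j \<in> dom \<Gamma>" using nat_cases2[of i] by (auto simp: domIff)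
    then show "i \<in> up (up X)" using d by auto
  qed
  \<comment> \<open>The end type is unrestricted and its own dual, so giving it to both names of the
    absent pair is weakening.\<close>
  have "srel id (ext None (ext None \<Gamma>)) (opened TEnd \<Gamma>)"
  proof (rule srelI)
    show "opened TEnd \<Gamma> (id a) = Some U" if "ext None (ext None \<Gamma>) a = Some U" for a U
      using that nat_cases2[of a] by auto
    show "\<exists>a. id a = b \<and> ext None (ext None \<Gamma>) a = Some U" if "opened TEnd \<Gamma> b = Some U" "\<not> sun U" for b U
      using that nat_cases2[of b] by auto
  qed simp
  from tr_ren[OF R2 this keeps_fresh_id d2] have tr: "tr (up (up X)) (opened TEnd \<Gamma>) R W'" by simp
  \<comment> \<open>After the exchange the new pair is the outer one and takes over the role of
    \<open>x\<close> and \<open>y\<close>, up to their order; the old pair is the inner one and no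
    longer occurs.\<close>
  have "qres (qres (qren (sig x y) p)) = qres (qres (qren (swap_res \<circ> sig x y) p))"
    using qres_swap_res[of "qren (sig x y) p"] by simp
  also have "\<dots> = qres p"
    using xy
  proof
    assume "x = 0 \<and> y = 1"
    then have "swap_res \<circ> sig x y = up2" by (auto simp: fun_eq_iff sig_def swap_res_def)
    then show ?thesis by (simp only: qres_dead)
  next
    assume "x = 1 \<and> y = 0"
    then have "swap_res \<circ> sig x y = up2 \<circ> swap_co" by (auto simp: fun_eq_iff sig_def swap_res_def swap_co_def)
    then show ?thesis by (simp only: qren_qren[symmetric] qres_dead qres_swap_co)
  qed
  finally have abs: "abs_sq (SRes R) = qres p" by (simp only: abs_sq_simps R(1))
  show ?thesis
  proof (rule tau_stepI[OF abs])
    show "tr X \<Gamma> (SRes R) (WRes (wren res_map W'))" by (rule tr.res[OF tr])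
    show "wlts (wren g (WRes (wren res_map W))) ATau (wren g (WRes (wren res_map W')))" for g
      unfolding wren_WRes by (rule wl_res_tau[OF R(3)]) (simp only: g)
    show "\<exists>L'. wta \<Delta> (wren g (WRes (wren res_map W'))) L'"
      if a: "wfits g X Y \<Delta>" "wta \<Delta> (wren g (WRes (wren res_map W))) L" for g Y \<Delta> L
    proof -
      from a(2) obtain V where V: "weights_pos V" "wta (ext {V, wdual V} \<Delta>) (wren (lift g \<circ> res_map) W) L"
        unfolding wren_WRes by (rule wta_WResE)
      have "\<exists>L'. wta ((ext {V, wdual V} \<Delta>)((lift g \<circ> res_map) x := {})) (wren (lift g \<circ> res_map) W') L'"
        by (rule ty[OF wfits_res[OF a(1)] _ _ V(2), of V]) (simp_all only: g ext_simps order_refl)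
      then obtain L' where L': "wta (ext {} \<Delta>) (wren (lift g \<circ> res_map) W') L'" unfolding g ext_upd by blast
      \<comment> \<open>The restriction of the consumed channel is typed anew with the unit type,
        again by weakening.\<close>
      have "wta (ext {VUnit, wdual VUnit} \<Delta>) (wren (lift g \<circ> res_map) W') L'"
      proof (rule wta_weaken[OF wfits_wgood[OF wfits_res[OF a(1), of "{}"] R2 d2] L'])
        show "ext {VUnit, wdual VUnit} \<Delta> z = {}" if "z \<notin> up Y" for z
          using that wfits_fresh[OF a(1)] by (cases z) auto
        show "V \<in> ext {VUnit, wdual VUnit} \<Delta> b" if "V \<in> ext {} \<Delta> b" for b V using that by (cases b) auto
        show "V \<in> ext {} \<Delta> b" if "V \<in> ext {VUnit, wdual VUnit} \<Delta> b" "\<not> wun V" for b V using that by (cases b) auto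
      qed
      then show ?thesis using wta.res[of VUnit] unfolding wren_WRes by auto
    qed
  qed
qed

lemma taus_step:
  "taus P r \<Longrightarrow> tr X \<Gamma> P W \<Longrightarrow> dom \<Gamma> \<subseteq> X \<Longrightarrow> tau_step X \<Gamma> r W"
proof (induction P arbitrary: r X \<Gamma> W)
  case (SPar P Q)
  note d = SPar.prems(3)
  from SPar.prems(2) obtain \<Gamma>\<^sub>1 \<Gamma>\<^sub>2 W\<^sub>1 W\<^sub>2 where W: "W = WPar W\<^sub>1 W\<^sub>2" and s: "ssplit \<Gamma> \<Gamma>\<^sub>1 \<Gamma>\<^sub>2"
    and t: "tr X \<Gamma>\<^sub>1 P W\<^sub>1" "tr X \<Gamma>\<^sub>2 Q W\<^sub>2" by (rule tr_SParE)
  from SPar.prems(1) consider p where "taus P p" "r = p \<parallel> abs_sq Q" | q where "taus Q q" "r = q \<parallel> abs_sq P"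
    using qpar.commute by auto
  then show ?case
  proof cases
    case 1
    show ?thesis unfolding W 1(2)
      by (rule tau_step_par(1)[OF SPar.IH(1)[OF 1(1) t(1) tr_dom_par(1)[OF s d]] s t(2)])
  next
    case 2
    show ?thesis unfolding W 2(2)
      by (rule tau_step_par(2)[OF SPar.IH(2)[OF 2(1) t(2) tr_dom_par(2)[OF s d]] ssplit_sym[OF s] t(1)])
  qed
next
  case (SRes P)
  note d = dom_ext2[OF SRes.prems(3)]
  from SRes.prems(2) obtain T V where V: "tr (up (up X)) (opened T \<Gamma>) P V" and W: "W = WRes (wren res_map V)"
    by (auto elim!: tr_SResE)
  from SRes.prems(1) consider p where "taus P p" "r = qres p" | p where "coms P 0 1 p" "r = qres p"
    | p where "coms P 1 0 p" "r = qres p" by auto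
  then show ?case
  proof cases
    case 1
    show ?thesis unfolding W 1(2) by (rule tau_step_res[OF SRes.IH[OF 1(1) V d]])
  next
    case 2
    from coms_type[OF 2(1) V] consider A S where "T = TLOut A S" | A where "T = TCli A" by auto
    then show ?thesis
    proof cases
      fix A S assume T: "T = TLOut A S"
      show ?thesis unfolding W 2(2)
        by (rule com_lin_step[OF coms_lin[OF 2(1) V d, of A S] _ SRes.prems(3)]) (simp_all add: T)
    next
      fix A assume T: "T = TCli A"
      show ?thesis unfolding W 2(2)
        by (rule com_cli_step[OF coms_cli[OF 2(1) V d, of A]]) (simp_all add: T)
    qed
  next
    case 3
    from coms_type[OF 3(1) V] consider A S where "T = TLIn A S" | A where "T = TSrv A" by auto
    then show ?thesis
    proof cases
      fix A S assume T: "T = TLIn A S"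
      \<comment> \<open>The output is on index 1, whose type is \<open>TLOut A (sdual S)\<close>, so
        the sender's continuation type is \<open>sdual S\<close>, and the receiver's is its dual
        \<open>S\<close>.\<close>
      show ?thesis unfolding W 3(2)
        by (rule com_lin_step[OF coms_lin[OF 3(1) V d, of A "sdual S"] _ SRes.prems(3)]) (simp_all add: T)
    next
      fix A assume T: "T = TSrv A"
      show ?thesis unfolding W 3(2)
        by (rule com_cli_step[OF coms_cli[OF 3(1) V d, of A]]) (simp_all add: T)
    qed
  qed
qed auto

theorem mainTheorem4:
  fixes P :: sproc and \<Gamma> :: sctx and l :: "lname \<Rightarrow> nat" and W :: wproc
  assumes "P \<in> WW"
    and "finite (dom \<Gamma>)" and "level_function l"
    and "\<Gamma> \<turnstile>\<^sub>s P" and "translates \<Gamma> P W" and "ctx_trans l \<Gamma> \<turnstile>\<^sub>w W"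
  shows "\<forall>Q. P \<longrightarrow>\<^sub>s Q \<longrightarrow>
           (\<exists>R \<Gamma>' l' W'. R \<in> WW \<and> in_W_via \<Gamma>' l' R W' \<and> W \<longrightarrow>\<^sub>\<tau> W' \<and> R \<equiv>\<^sub>s Q)"
proof (intro allI impI)
  fix Q assume "P \<longrightarrow>\<^sub>s Q"
  then have "taus P (abs_sq Q)" by (rule sred_taus)
  moreover have "tr (dom \<Gamma>) \<Gamma> P W" using assms(5) strans_imp_tr unfolding translates_def by blast
  ultimately have "tau_step (dom \<Gamma>) \<Gamma> (abs_sq Q) W" by (rule taus_step) simp
  then obtain R W' where R: "abs_sq R = abs_sq Q" "tr (dom \<Gamma>) \<Gamma> R W'" "\<And>g. wlts (wren g W) ATau (wren g W')"
    and ty: "\<And>g Y \<Delta> L. wfits g (dom \<Gamma>) Y \<Delta> \<Longrightarrow> wta \<Delta> (wren g W) L \<Longrightarrow> \<exists>L'. wta \<Delta> (wren g W') L'"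
    unfolding tau_step_def by blast
  \<comment> \<open>The scope is the domain of the context, outside of which the translated context
    is empty, and the general renaming is instantiated with the identity.\<close>
  have "wfits id (dom \<Gamma>) (dom \<Gamma>) (ctx_trans l \<Gamma>)"
    unfolding wfits_def by (auto simp: keeps_fresh_id ctx_trans_def domIff)
  moreover obtain L where "wta (ctx_trans l \<Gamma>) (wren id W) L"
    using assms(6) wtyped_imp_wta unfolding wtyped_proc_def by auto
  ultimately have "ctx_trans l \<Gamma> \<turnstile>\<^sub>w W'"
    using ty[of id] wta_imp_wtyped unfolding wtyped_proc_def by fastforce
  moreover have "strans (dom \<Gamma>) \<Gamma> R W'" by (rule tr_imp_strans[OF R(2)])
  \<comment> \<open>The witnesses \<open>\<Gamma>\<close> and \<open>l\<close> serve for
    \<open>R\<close> as well: both its translation and the weighted typing of \<open>W'\<close> were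
    obtained in the contexts given for \<open>P\<close>.\<close>
  ultimately have "in_W_via \<Gamma> l R W'"
    using assms(2,3) strans_styped unfolding in_W_via_def translates_def by blast
  moreover from this have "R \<in> WW" unfolding WW_def by blast
  moreover have "W \<longrightarrow>\<^sub>\<tau> W'" using R(3)[of id] by simp
  moreover have "R \<equiv>\<^sub>s Q" using R(1) abs_sq_eq_iff by blast
  ultimately show "\<exists>R \<Gamma>' l' W'. R \<in> WW \<and> in_W_via \<Gamma>' l' R W' \<and> W \<longrightarrow>\<^sub>\<tau> W' \<and> R \<equiv>\<^sub>s Q" by blast
qed

end
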